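(* Let $R_3$ be a real rational function of degree three satisfying the standing assumptions listed in the context. If the integral equation $$\lambda\ \mathrm{V.p.}\!\int_{-1}^{1}\frac{u(t)}{t-x}\,dt-\mathrm{V.p.}\!\int_{-1}^{1}\frac{u(t)\,dR_3(t)}{R_3(t)-R_3(x)}=\mathrm{const},\qquad x\in(-1,1),$$ has an antisymmetric eigenfunction for the value $\lambda$ of the spectral parameter, then $\lambda\in[1,2)\cup\{3\}$. (That is, the antisymmetric part of the spectrum is always a subset of $[1,2)\cup\{3\}$.)
   Context: **Standing assumptions on $R_3$.** $\hat{\mathbb R}=\mathbb R\cup\{\infty\}$, $\hat{\mathbb C}=\mathbb C\cup\{\infty\}$. $R_3$ is a real rational function of degree 3 with four distinct critical values $a_1,\dots,a_4\in\hat{\mathbb R}$, all different from $\pm1$. Over $a_s$ lie one double (critical) point $b_s$ and one ordinary point $c_s$, all in $\hat{\mathbb R}$. The $a_s$ are numbered in the natural cyclic order of $\hat{\mathbb R}$ so that every $y$ in $(a_1,a_2)$ or $(a_3,a_4)$ has one real and two complex conjugate preimages, while the other points $y\in\hat{\mathbb R}$, $y\ne a_s$, have three distinct real preimages. $R_3$ is a nondegenerate change of variable on $[-1,1]$: it maps $[-1,1]$ onto itself with $R_3'\neq0$ on $[-1,1]$. Moreover $[-1,1]\subset(b_2,b_3)$, where $(b_2,b_3)$ is the interval of $\hat{\mathbb R}$ between $b_2$ and $b_3$ containing no other critical point. Consequently $[-1,1]$, $[a_1,a_2]$, $[a_3,a_4]$ are disjoint. **The pants.** $\mathcal P(R_3):=\mathrm{Closure}\big(\hat{\mathbb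 C}\setminus([-1,1]\cup[a_1,a_2]\cup[a_3,a_4])\big)$, the closure being taken in the intrinsic metric, so that each slot acquires two sides. It is assumed that $\infty$ lies strictly inside $\mathcal P(R_3)$. **Eigenfunctions.** An eigenfunction is a nonzero real function $u$ on $[-1,1]$ satisfying the integral equation with some constant on the right, of Hölder class, such that the Cauchy-type integral below has Hölder boundary values on $[-1,1]$. For this kind of equation the eigenvalues are positive. Put $\delta=2/(\lambda-1)$, $\varepsilon=e^{2\pi i/3}$, $\mu=\sqrt{(\delta-1)/(\delta+2)}=\sqrt{(3-\lambda)/(2\lambda)}$. For $\lambda\neq1,3$ and an eigenfunction $u$ put $\Phi(x)=\int_{-1}^1\frac{u(t)}{t-x}dt+\mathrm{const}^*$ for $x\in\hat{\mathbb C}\setminus[-1,1]$. The constant $\mathrm{const}^*$ is (uniquely) chosen so that $\Phi(x+i0)+\Phi(x-i0)=\delta(\Phi(x_2(x))+\Phi(x_3(x)))$ for $x\in(-1,1)$, where $x,x_2(x),x_3(x)$ are all solutions $z$ of $R_3(z)=R_3(x)$. The set $R_3^{-1}(\mathcal P(R_3))$ has three components $\mathcal O_1,\mathcal O_2,\mathcal O_3$ whose boundaries contain $[-1,1]$, $[c_4,c_3]$, $[c_2,c_1]$ respectively. For $y\in\mathcal P(R_3)$ let $x_s$ be the unique solution of $R_3(x_s)=y$ in $\mathcal O_s$, and put $W(y)=(\Phi(x_1),\Phi(x_2),\Phi(x_3))^t$. The quadratic form $J(W)=\sum_kW_k^2-\delta\sum_{j<s}W_jW_s$ takes a constant value $J_0$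 on $W(y)$. Let $V=\mathbf K^{-1}W$, where $$\mathbf K=(3\delta+6)^{-1/2}\begin{pmatrix}1&1&1\\1&\varepsilon^2&\varepsilon\\1&\varepsilon&\varepsilon^2\end{pmatrix}\begin{pmatrix}0&\mu^{-1}&0\\0&0&1\\1&0&0\end{pmatrix},$$ so that $J(W)=V_1V_3-V_2^2$. Define $p^\pm(y)=\dfrac{V_2\pm i\sqrt{J_0}}{V_1}=\dfrac{V_3}{V_2\mp i\sqrt{J_0}}$. **Antisymmetric.** For $\lambda\ne1,3$ the eigenfunction $u$ is called antisymmetric if $p^\pm(\bar y)=1/\overline{p^\mp(y)}$ for $y\in\mathcal P(R_3)$. For $\lambda=1,3$ the notion is not defined by these formulas, and these values are simply allowed by the conclusion. *)

theory Defs
  imports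
    "HOL-Analysis.Analysis"
    "HOL-Computational_Algebra.Computational_Algebra"
begin

text \<open>
  The extended complex plane is \<open>complex option\<close>, the extended real line is \<open>real option\<close>;
  in both \<open>None\<close> is the point at infinity.
\<close>

abbreviation sphere_top :: "complex option topology" where
  "sphere_top \<equiv> Alexandroff_compactification euclidean"

abbreviation emb :: "real option \<Rightarrow> complex option" where
  "emb \<equiv> map_option complex_of_real"

text \<open>
  \<open>oarc x y\<close> is the open arc of the extended real line traversed from \<open>x\<close> to \<open>y\<close> in the
  increasing direction (through infinity if necessary).
\<close>

fun oarc :: "real option \<Rightarrow> real option \<Rightarrow> real option set" where
  "oarc (Some x) (Some y) =
     (if x < y then Some ` {x<..<y} else insert None (Some ` ({x<..} \<union> {..<y})))"
| "oarc (Some x) None = Some ` {x<..}"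
| "oarc None (Some y) = Some ` {..<y}"
| "oarc None None = range Some"

definition carc :: "real option \<Rightarrow> real option \<Rightarrow> real option set" where
  "carc x y = {x, y} \<union> oarc x y"

definition cyclically_ordered ::
  "real option \<Rightarrow> real option \<Rightarrow> real option \<Rightarrow> real option \<Rightarrow> bool" where
  "cyclically_ordered w x y z \<longleftrightarrow> x \<in> oarc w y \<and> z \<in> oarc y w"

text \<open>
  Of the two arcs between \<open>x\<close> and \<open>y\<close>, the one that contains no point of \<open>B\<close>
  (meaningful when exactly one of them does).
\<close>

definition oarc_avoiding :: "real option set \<Rightarrow> real option \<Rightarrow> real option \<Rightarrow> real option set" where
  "oarc_avoiding B x y = (if oarc x y \<inter> B = {} then oarc x y else oarc y x)"

definition carc_avoiding :: "real option set \<Rightarrow> real option \<Rightarrow> real option \<Rightarrow> real option set" where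
  "carc_avoiding B x y = {x, y} \<union> oarc_avoiding B x y"

definition sphere_quot :: "complex \<Rightarrow> complex \<Rightarrow> complex option" where
  "sphere_quot z w = (if w = 0 then None else Some (z / w))"

fun inverse_cnj :: "complex option \<Rightarrow> complex option" where
  "inverse_cnj None = Some 0"
| "inverse_cnj (Some z) = sphere_quot 1 (cnj z)"

fun ratmap :: "complex poly \<Rightarrow> complex poly \<Rightarrow> complex option \<Rightarrow> complex option" where
  "ratmap p q (Some z) = sphere_quot (poly p z) (poly q z)"
| "ratmap p q None =
     (if degree q < degree p then None else Some (coeff p (degree q) / lead_coeff q))"

text \<open>
  The preimages of \<open>y\<close> under \<open>p / q\<close>, with multiplicity, are the zeros of \<open>p - y q\<close> (of \<open>q\<close>,
  if \<open>y\<close> is infinite) regarded as a form of degree \<open>max (degree p) (degree q)\<close>.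
\<close>

fun fibre_poly :: "complex poly \<Rightarrow> complex poly \<Rightarrow> complex option \<Rightarrow> complex poly" where
  "fibre_poly p q (Some y) = p - smult y q"
| "fibre_poly p q None = q"

fun local_mult :: "complex poly \<Rightarrow> complex poly \<Rightarrow> complex option \<Rightarrow> nat" where
  "local_mult p q (Some z) = order z (fibre_poly p q (ratmap p q (Some z)))"
| "local_mult p q None =
     max (degree p) (degree q) - degree (fibre_poly p q (ratmap p q None))"

definition holder_on :: "real set \<Rightarrow> (real \<Rightarrow> 'a::real_normed_vector) \<Rightarrow> bool" where
  "holder_on S f \<longleftrightarrow>
     (\<exists>\<alpha> C. 0 < \<alpha> \<and> \<alpha> \<le> 1 \<and> (\<forall>x\<in>S. \<forall>y\<in>S. norm (f x - f y) \<le> C * \<bar>x - y\<bar> powr \<alpha>))"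

definition has_pv_integral :: "(real \<Rightarrow> real) \<Rightarrow> real \<Rightarrow> real \<Rightarrow> bool" where
  "has_pv_integral f x v \<longleftrightarrow>
     ((\<lambda>e. integral {-1..x - e} f + integral {x + e..1} f) \<longlongrightarrow> v) (at_right 0)"

definition cauchy_integral :: "(real \<Rightarrow> real) \<Rightarrow> complex \<Rightarrow> complex" where
  "cauchy_integral u x = integral {-1..1} (\<lambda>t. complex_of_real (u t) / (complex_of_real t - x))"

abbreviation above :: "real \<Rightarrow> complex filter" where
  "above x \<equiv> at (complex_of_real x) within {z. 0 < Im z}"

abbreviation below :: "real \<Rightarrow> complex filter" where
  "below x \<equiv> at (complex_of_real x) within {z. Im z < 0}"

definition cauchy_holder_boundary_values :: "(real \<Rightarrow> real) \<Rightarrow> bool" where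
  "cauchy_holder_boundary_values u \<longleftrightarrow>
     (\<exists>F G :: real \<Rightarrow> complex. holder_on {-1..1} F \<and> holder_on {-1..1} G \<and>
        (\<forall>x\<in>{-1..1}. (cauchy_integral u \<longlongrightarrow> F x) (above x) \<and>
                       (cauchy_integral u \<longlongrightarrow> G x) (below x)))"

definition delta :: "real \<Rightarrow> complex" where
  "delta lam = complex_of_real (2 / (lam - 1))"

definition eps3 :: complex where
  "eps3 = exp (2 * pi * \<i> / 3)"

text \<open>
  The radicands of \<open>mu\<close>, of the scalar factor of \<open>Kmat\<close>, and \<open>J0\<close> below may be negative, so the
  principal complex square root is used. Another choice of sign exchanges
  \<open>p\<^sup>+\<close> and \<open>p\<^sup>-\<close> or replaces them by \<open>- p\<^sup>-\<close> and \<open>- p\<^sup>+\<close>,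
  which does not affect antisymmetry.
\<close>

definition mu :: "real \<Rightarrow> complex" where
  "mu lam = csqrt ((delta lam - 1) / (delta lam + 2))"

definition Kmat :: "real \<Rightarrow> complex^3^3" where
  "Kmat lam = map_matrix (\<lambda>z. z / csqrt (3 * delta lam + 6))
     ((vector [vector [1, 1, 1],
               vector [1, eps3\<^sup>2, eps3],
               vector [1, eps3, eps3\<^sup>2]] :: complex^3^3)
      ** vector [vector [0, inverse (mu lam), 0],
                 vector [0, 0, 1],
                 vector [1, 0, 0]])"

definition Jform :: "real \<Rightarrow> complex^3 \<Rightarrow> complex" where
  "Jform lam W = (\<Sum>k\<in>UNIV. (W $ k)\<^sup>2) - delta lam * (W $ 1 * W $ 2 + W $ 1 * W $ 3 + W $ 2 * W $ 3)"

text \<open>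
  Points of the pants: interior points, and points of the upper and lower banks of the slots
  (which lie on the real line). An end point of a slot is represented twice,
  once on each bank.
\<close>

datatype pants_point = Inner "complex option" | Upper real | Lower real

fun cnj_point :: "pants_point \<Rightarrow> pants_point" where
  "cnj_point (Inner y) = Inner (map_option cnj y)"
| "cnj_point (Upper t) = Lower t"
| "cnj_point (Lower t) = Upper t"

text \<open>
  The rational function is \<open>P / Q\<close>; its critical values are \<open>a s\<close>, and the double and
  the ordinary point over \<open>a s\<close> are \<open>b s\<close> and \<open>c s\<close>, for \<open>s = 1, 2, 3, 4\<close>.
\<close>

locale cubic_change_of_variable =
  fixes P Q :: "real poly" and a b c :: "nat \<Rightarrow> real option"
begin

definition R :: "complex option \<Rightarrow> complex option" where
  "R = ratmap (map_poly of_real P) (map_poly of_real Q)"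

definition mult :: "complex option \<Rightarrow> nat" where
  "mult = local_mult (map_poly of_real P) (map_poly of_real Q)"

definition R_real :: "real \<Rightarrow> real" where
  "R_real t = poly P t / poly Q t"

definition slots :: "real option set" where
  "slots = Some ` {-1..1} \<union> carc (a 1) (a 2) \<union> carc (a 3) (a 4)"

definition pants_interior :: "complex option set" where
  "pants_interior = UNIV - emb ` slots"

definition pants :: "pants_point set" where
  "pants = Inner ` pants_interior \<union> Upper ` {t. Some t \<in> slots} \<union> Lower ` {t. Some t \<in> slots}"

definition standing_assumptions :: bool where
  "standing_assumptions \<longleftrightarrow>
     coprime P Q \<and> max (degree P) (degree Q) = 3 \<and>
     inj_on a {1..4} \<and>
     R ` {x. 2 \<le> mult x} = emb ` a ` {1..4} \<and>
     (\<forall>s\<in>{1..4}. a s \<noteq> Some 1 \<and> a s \<noteq> Some (-1) \<and>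
        R -` {emb (a s)} = {emb (b s), emb (c s)} \<and>
        mult (emb (b s)) = 2 \<and> mult (emb (c s)) = 1) \<and>
     cyclically_ordered (a 1) (a 2) (a 3) (a 4) \<and>
     (\<forall>y \<in> oarc (a 1) (a 2) \<union> oarc (a 3) (a 4).
        \<exists>x z. Im z \<noteq> 0 \<and> R -` {emb y} = {emb x, Some z, Some (cnj z)}) \<and>
     (\<forall>y. y \<notin> oarc (a 1) (a 2) \<union> oarc (a 3) (a 4) \<union> a ` {1..4} \<longrightarrow>
        (\<exists>X. card X = 3 \<and> R -` {emb y} = emb ` X)) \<and>
     R ` emb ` Some ` {-1..1} = emb ` Some ` {-1..1} \<and>
     (\<forall>t\<in>{-1..1}. deriv R_real t \<noteq> 0) \<and>
     oarc_avoiding (b ` {1..4}) (b 2) (b 3) \<inter> b ` {1..4} = {} \<and>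
     Some ` {-1..1} \<subseteq> oarc_avoiding (b ` {1..4}) (b 2) (b 3) \<and>
     None \<in> pants_interior"

definition eigenfunction :: "real \<Rightarrow> (real \<Rightarrow> real) \<Rightarrow> bool" where
  "eigenfunction lam u \<longleftrightarrow>
     (\<exists>t\<in>{-1..1}. u t \<noteq> 0) \<and> holder_on {-1..1} u \<and> cauchy_holder_boundary_values u \<and>
     (\<exists>C. \<forall>x\<in>{-1<..<1}. \<exists>v w.
        has_pv_integral (\<lambda>t. u t / (t - x)) x v \<and>
        has_pv_integral (\<lambda>t. u t * deriv R_real t / (R_real t - R_real x)) x w \<and>
        lam * v - w = C)"

definition Phi_plus_const :: "complex \<Rightarrow> (real \<Rightarrow> real) \<Rightarrow> complex option \<Rightarrow> complex" where
  "Phi_plus_const k u x = (case x of None \<Rightarrow> k | Some z \<Rightarrow> cauchy_integral u z + k)"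

definition Phi_jump_relation :: "real \<Rightarrow> (real \<Rightarrow> real) \<Rightarrow> complex \<Rightarrow> bool" where
  "Phi_jump_relation lam u k \<longleftrightarrow>
     (\<forall>x\<in>{-1<..<1}. let z = Some (complex_of_real x) in
        Lim (above x) (\<lambda>w. Phi_plus_const k u (Some w)) +
        Lim (below x) (\<lambda>w. Phi_plus_const k u (Some w)) =
        delta lam * (\<Sum>x'\<in>R -` {R z} - {z}. Phi_plus_const k u x'))"

definition Phi_const :: "real \<Rightarrow> (real \<Rightarrow> real) \<Rightarrow> complex" where
  "Phi_const lam u = (THE k. Phi_jump_relation lam u k)"

definition Phi :: "real \<Rightarrow> (real \<Rightarrow> real) \<Rightarrow> complex option \<Rightarrow> complex" where
  "Phi lam u = Phi_plus_const (Phi_const lam u) u"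

text \<open>
  The segments with end points \<open>c 4\<close>, \<open>c 3\<close> and \<open>c 2\<close>, \<open>c 1\<close> run, like the interval
  between \<open>b 2\<close> and \<open>b 3\<close>, through no critical point; they are the ones mapped
  onto the slots between \<open>a 3\<close>, \<open>a 4\<close> and \<open>a 1\<close>, \<open>a 2\<close>.
\<close>

definition sheet_segment :: "3 \<Rightarrow> real option set" where
  "sheet_segment s =
     (if s = 1 then Some ` {-1..1}
      else if s = 2 then carc_avoiding (b ` {1..4}) (c 4) (c 3)
      else carc_avoiding (b ` {1..4}) (c 2) (c 1))"

definition sheet :: "3 \<Rightarrow> complex option set" where
  "sheet s = (THE U. U \<in> connected_components_of (subtopology sphere_top (R -` pants_interior)) \<and>
     emb ` sheet_segment s \<subseteq> sphere_top frontier_of U)"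

definition sheet_inv :: "3 \<Rightarrow> complex option \<Rightarrow> complex option" where
  "sheet_inv s y = (THE x. x \<in> sheet s \<and> R x = y)"

text \<open>On the banks of the slots \<open>W\<close> is continued by its boundary values.\<close>

fun W :: "real \<Rightarrow> (real \<Rightarrow> real) \<Rightarrow> pants_point \<Rightarrow> complex^3" where
  "W lam u (Inner y) = (\<chi> s. Phi lam u (sheet_inv s y))"
| "W lam u (Upper t) = (\<chi> s. Lim (above t) (\<lambda>z. Phi lam u (sheet_inv s (Some z))))"
| "W lam u (Lower t) = (\<chi> s. Lim (below t) (\<lambda>z. Phi lam u (sheet_inv s (Some z))))"

definition J0 :: "real \<Rightarrow> (real \<Rightarrow> real) \<Rightarrow> complex" where
  "J0 lam u = (THE j. \<forall>y\<in>pants. Jform lam (W lam u y) = j)"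

definition V :: "real \<Rightarrow> (real \<Rightarrow> real) \<Rightarrow> pants_point \<Rightarrow> complex^3" where
  "V lam u y = matrix_inv (Kmat lam) *v W lam u y"

text \<open>
  \<open>p_value \<sigma> lam u y v\<close>, for \<open>\<sigma> = 1\<close> and \<open>\<sigma> = -1\<close>, says that \<open>v\<close> is the value of \<open>p\<^sup>+\<close>,
  respectively \<open>p\<^sup>-\<close>, at \<open>y\<close>. Either of the two fractions may be of the form \<open>0 / 0\<close>; both are
  only where \<open>V\<close> vanishes (and \<open>J0 = 0\<close>). For \<open>u \<noteq> 0\<close> these points are isolated inside the pants,
  and the values there are determined by continuity, so that
  nothing needs to be required at them.
\<close>

definition p_value ::
  "complex \<Rightarrow> real \<Rightarrow> (real \<Rightarrow> real) \<Rightarrow> pants_point \<Rightarrow> complex option \<Rightarrow> bool" where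
  "p_value \<sigma> lam u y v \<longleftrightarrow>
     (let V1 = V lam u y $ 1; V2 = V lam u y $ 2; V3 = V lam u y $ 3; r = \<sigma> * \<i> * csqrt (J0 lam u) in
        \<not> (V2 + r = 0 \<and> V1 = 0) \<and> v = sphere_quot (V2 + r) V1 \<or>
        \<not> (V3 = 0 \<and> V2 - r = 0) \<and> v = sphere_quot V3 (V2 - r))"

definition antisymmetric :: "real \<Rightarrow> (real \<Rightarrow> real) \<Rightarrow> bool" where
  "antisymmetric lam u \<longleftrightarrow>
     (\<forall>y\<in>pants. \<forall>\<sigma>\<in>{1, -1}. \<forall>v w.
        p_value \<sigma> lam u (cnj_point y) v \<longrightarrow> p_value (- \<sigma>) lam u y w \<longrightarrow> v = inverse_cnj w)"

end

end

theory Submission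
  imports Defs "HOL-Complex_Analysis.Complex_Analysis"
begin

text \<open>
  The values of \<open>\<Phi>\<close> on the three sheets extend continuously to the closed upper half of the
  \<open>y\<close>-sphere. The quadratic form \<open>J\<close> of these three functions is holomorphic inside and real on
  the boundary circle: on the image of \<open>[-1,1]\<close> by the jump relation, elsewhere because fibres of
  \<open>R\<^sub>3\<close> over real points are invariant under conjugation. Hence \<open>J\<close> is a real constant \<open>j\<close>. At real
  points between the slots antisymmetry becomes an equality of moduli, which gives \<open>j \<le> 0\<close> if
  \<open>\<delta> > 1\<close>, \<open>j \<ge> 0\<close> if \<open>\<delta> < -2\<close>, and the equality of the three values if \<open>-2 < \<delta> < 1\<close>.
  In the last case \<open>\<Phi>\<^sup>2\<close> is constant; for \<open>\<delta> < -2\<close> the sign of \<open>j\<close> contradicts the jump relation on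
  \<open>[-1,1]\<close> unless \<open>\<Phi> = 0\<close>; for \<open>\<delta> = -2\<close> one finds that \<open>\<Phi>\<close> is real on the slot. For
  \<open>1 < \<delta> \<le> 2\<close> the Joukowski map carries \<open>\<Phi>\<close> to the unit disc, where an argument with signs on the
  boundary circle and the minimum principle for the real part shows that \<open>\<Phi> = 0\<close>. Only \<open>\<delta> > 2\<close>, that
  is \<open>1 < \<lambda> < 2\<close>, remains.
\<close>

section \<open>A vanishing theorem on the unit disc\<close>

text \<open>With \<open>d = 2 / (lam - 1)\<close> the cases d < -2, d = -2, -2 < d < 1 and 1 < d
  \<le> 2 are 0 < lam < 1, lam = 0, lam outside [0,3], and 2 \<le> lam < 3. The bound 2 comes from
  the form on the slot: with A and B the values on the other two sheets, the jump relation makes it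
  (1 - d^2/4)(A^2 + B^2) - (d + d^2/2) A B minus the squared imaginary part of the boundary value.
  As long as 1 - d^2/4 is nonnegative, J \<le> 0 prevents A and B from having opposite signs where
  the boundary value is real. The Joukowski map opens the slot into a circle. The other two
  preimages of a slot value become two real points of the disc that depend on Re z alone, so the
  boundary relation involves the same function at inner points. The main obstacle is that sheets are
  defined by components and their frontiers, whereas the sections come from lifting over the upper
  half plane, without labels. They are matched by boundary values: one section is real over
  \<open>(a 1, a 2)\<close>, one over \<open>(a 3, a 4)\<close>, and the third traces the arc from
  \<open>b 2\<close> to \<open>b 3\<close>.\<close>

lemma no_zero_if_boundary_misses_negatives:
  assumes holo: "g holomorphic_on ball 0 1" and cont: "continuous_on (cball 0 1) g"
    and neg: "\<And>z. cmod z = 1 \<Longrightarrow> \<not> (Im (g z) = 0 \<and> Re (g z) < 0)"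
    and nz: "\<exists>z\<in>ball 0 1. g z \<noteq> 0"
    and z: "z \<in> ball 0 1"
  shows "g z \<noteq> 0"
proof
  assume g0: "g z = 0"
  have "\<not> g constant_on ball 0 1"
    using nz z g0 unfolding constant_on_def by metis
  then have op: "open (g ` ball 0 1)"
    using open_mapping_thm[OF holo open_ball connected_ball open_ball] by blast
  define K where "K = g ` cball 0 1"
  have K: "compact K" unfolding K_def by (intro compact_continuous_image cont compact_cball)
  obtain e where e: "e > 0" "ball 0 e \<subseteq> g ` ball 0 1"
    using op g0 z by (metis imageI openE)
  \<comment> \<open>Negative values are taken only inside the disc, where the image is open, so a
    least negative value could be decreased further. Cutting at \<open>- e/2\<close> keeps the set
    of negative values compact, and the ball around 0 makes it nonempty.\<close>
  define X where "X = complex_of_real -` K \<inter> {.. - e/2}"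
  have "closed X" unfolding X_def
    by (intro closed_Int continuous_closed_vimage compact_imp_closed[OF K]) auto
  moreover have "bounded X"
  proof -
    obtain B where B: "\<And>x. x \<in> K \<Longrightarrow> cmod x \<le> B"
      using compact_imp_bounded[OF K] by (auto simp: bounded_iff)
    show ?thesis unfolding bounded_iff
      by (intro exI[of _ B]) (auto simp: X_def dest!: B)
  qed
  ultimately have "compact X" by (simp add: compact_eq_bounded_closed)
  moreover have "- e/2 \<in> X"
  proof -
    have "complex_of_real (- e/2) \<in> ball 0 e" using e(1) by (simp add: norm_divide)
    then have "complex_of_real (- e/2) \<in> g ` cball 0 1"
      using e(2) ball_subset_cball[of 0 "1::real"] by (metis (no_types, lifting) image_mono subsetD)
    then show ?thesis by (simp add: X_def K_def)
  qed
  ultimately obtain v where v: "v \<in> X" "\<And>x. x \<in> X \<Longrightarrow> v \<le> x"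
    using compact_attains_inf[of X] by blast
  obtain w where w: "w \<in> cball 0 1" "g w = complex_of_real v"
    using v(1) unfolding X_def K_def by auto
  have "v < 0" using v(1) e(1) by (auto simp: X_def)
  have "w \<in> ball 0 1"
    using w neg[of w] \<open>v < 0\<close> by (cases "cmod w = 1") auto
  then have "complex_of_real v \<in> g ` ball 0 1" using w by force
  then obtain h where h: "h > 0" "ball (complex_of_real v) h \<subseteq> g ` ball 0 1"
    using op openE by metis
  have "complex_of_real (v - h/2) \<in> ball (complex_of_real v) h"
    using h(1) by (simp add: dist_norm norm_divide flip: of_real_diff)
  then have "complex_of_real (v - h/2) \<in> K" using h(2) unfolding K_def by force
  then have "v - h/2 \<in> X" using v(1) h(1) by (auto simp: X_def)
  then show False using v(2) h(1) by fastforce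
qed

text \<open>The local factor at \<open>w\<close> and the quotient by \<open>(z - w) ^ n\<close> away
  from \<open>w\<close> agree where both are defined and glue to a holomorphic function on all of
  \<open>S\<close>.\<close>

lemma factor_out_zero:
  assumes holo: "f holomorphic_on S" and S: "open S" "connected S"
    and nz: "\<exists>z\<in>S. f z \<noteq> 0" and w: "w \<in> S"
  obtains n :: nat and g where "g holomorphic_on S" "g w \<noteq> 0" "\<And>z. z \<in> S \<Longrightarrow> f z = (z - w) ^ n * g z"
proof (cases "f w = 0")
  case False
  then show ?thesis using that[of f 0] holo by auto
next
  case True
  have "\<not> f constant_on S" using nz w True unfolding constant_on_def by metis
  then obtain g r n where *: "0 < n" "0 < r" "ball w r \<subseteq> S" "g holomorphic_on ball w r"
    "\<And>z. z \<in> ball w r \<Longrightarrow> f z = (z - w)^n * g z" "\<And>z. z \<in> ball w r \<Longrightarrow> g z \<noteq> 0"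
    using holomorphic_factor_zero_nonconstant[OF holo S w True] by metis
  define h where "h = (\<lambda>z. if z = w then g w else f z / (z - w) ^ n)"
  have h1: "h z = g z" if "z \<in> ball w r" for z
    using *(5)[OF that] by (auto simp: h_def)
  have "h holomorphic_on ball w r" using *(4) h1 by (metis holomorphic_cong)
  moreover have "h holomorphic_on S - {w}"
  proof -
    have "(\<lambda>z. f z / (z - w) ^ n) holomorphic_on S - {w}"
      by (intro holomorphic_intros holomorphic_on_subset[OF holo]) auto
    then show ?thesis by (rule holomorphic_transform) (auto simp: h_def)
  qed
  ultimately have "h holomorphic_on ball w r \<union> (S - {w})"
    using S by (intro holomorphic_on_Un) auto
  moreover have "ball w r \<union> (S - {w}) = S" using *(2,3) w by auto
  ultimately have "h holomorphic_on S" by simp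
  moreover have "h w \<noteq> 0" using h1[of w] *(2) *(6)[of w] by simp
  moreover have "f z = (z - w) ^ n * h z" if "z \<in> S" for z
    using True *(1) by (auto simp: h_def)
  ultimately show ?thesis using that by blast
qed

lemma factor_out_zeros:
  assumes holo: "f holomorphic_on S" and S: "open S" "connected S"
    and nz: "\<exists>z\<in>S. f z \<noteq> 0" and fin: "finite Z" and Z: "Z \<subseteq> S"
  shows "\<exists>(n :: complex \<Rightarrow> nat) g. g holomorphic_on S \<and> (\<forall>w\<in>Z. g w \<noteq> 0) \<and>
           (\<forall>z\<in>S. f z = (\<Prod>w\<in>Z. (z - w) ^ n w) * g z)"
  using fin Z
proof (induction Z)
  case empty
  then show ?case using holo by auto
next
  case (insert w Z)
  then obtain n :: "complex \<Rightarrow> nat" and g where g: "g holomorphic_on S" "\<forall>w\<in>Z. g w \<noteq> 0"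
    "\<forall>z\<in>S. f z = (\<Prod>w\<in>Z. (z - w) ^ n w) * g z" by auto
  have "\<exists>z\<in>S. g z \<noteq> 0" using nz g(3) by force
  then obtain m :: nat and h where h: "h holomorphic_on S" "h w \<noteq> 0"
    "\<And>z. z \<in> S \<Longrightarrow> g z = (z - w) ^ m * h z"
    using factor_out_zero[OF g(1) S, of w] insert.prems by (metis insert_subset)
  have "f z = (\<Prod>v\<in>insert w Z. (z - v) ^ (n(w := m)) v) * h z" if "z \<in> S" for z
  proof -
    have "(\<Prod>v\<in>Z. (z - v) ^ (n(w := m)) v) = (\<Prod>w\<in>Z. (z - w) ^ n w)"
      using insert.hyps by (intro prod.cong) auto
    then show ?thesis using g(3) h(3)[OF that] that insert.hyps by (simp add: algebra_simps)
  qed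
  moreover have "\<forall>v\<in>insert w Z. h v \<noteq> 0"
    using h(2,3) g(2) insert.prems by force
  ultimately show ?case using h(1) by blast
qed

lemma sign_of_prod_power:
  fixes f :: "'a \<Rightarrow> real" and m :: "'a \<Rightarrow> nat"
  assumes "\<And>t. t \<in> T \<Longrightarrow> s * f t > 0" "s = 1 \<or> s = -1"
  shows "s ^ (sum m T) * (\<Prod>t\<in>T. f t ^ m t) > 0"
proof -
  have "s ^ (sum m T) * (\<Prod>t\<in>T. f t ^ m t) = (\<Prod>t\<in>T. (s * f t) ^ m t)"
    by (simp add: power_sum prod.distrib power_mult_distrib)
  also have "\<dots> > 0" using assms by (intro prod_pos) auto
  finally show ?thesis .
qed

text \<open>On the circle z + cnj z = 2 Re z and z - a = z * cnj (1 - a z), so numerator and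
  denominator are both z times a real number, and z cancels.\<close>

lemma unit_circle_factor:
  fixes z :: complex and t a :: real
  assumes z: "cmod z = 1" and a: "\<bar>a\<bar> < 1"
  shows "(z\<^sup>2 - 2 * t * z + 1) / ((z - a) * (1 - a * z)) = complex_of_real (2 * (Re z - t) / (cmod (1 - a * z))\<^sup>2)"
proof -
  have zz: "z * cnj z = 1" using z by (simp add: complex_norm_square[symmetric])
  have ne: "1 - a * z \<noteq> 0"
  proof
    assume "1 - a * z = 0"
    then have "cmod (a * z) = 1" by (metis eq_iff_diff_eq_0 norm_one)
    then show False using z a by (simp add: norm_mult)
  qed
  have 1: "(z - a) * (1 - a * z) = z * complex_of_real ((cmod (1 - a * z))\<^sup>2)"
  proof -
    have "z - a = z * cnj (1 - a * z)" using zz by (simp add: algebra_simps)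
    then have "(z - a) * (1 - a * z) = z * ((1 - a * z) * cnj (1 - a * z))" by (simp only: mult_ac)
    then show ?thesis by (simp only: complex_norm_square[symmetric] of_real_power)
  qed
  have 2: "z\<^sup>2 - 2 * t * z + 1 = z * complex_of_real (2 * (Re z - t))"
  proof -
    have "z + cnj z = complex_of_real (2 * Re z)" by (rule complex_add_cnj)
    then have "z * complex_of_real (2 * (Re z - t)) = z * (z + cnj z - 2 * t)" by simp
    also have "\<dots> = z\<^sup>2 - 2 * t * z + z * cnj z" by (simp add: power2_eq_square algebra_simps)
    finally show ?thesis by (simp add: zz)
  qed
  have "z \<noteq> 0" using z by auto
  then show ?thesis unfolding 1 2 using ne by simp
qed

text \<open>
  A zero \<open>\<alpha> t\<close> of \<open>f\<close> is replaced by the conjugate pair of boundary points with real part \<open>t\<close>.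
  By \<open>unit_circle_factor\<close> this multiplies \<open>f\<close> on the circle by a real factor whose sign is that of
  \<open>Re z - t\<close>, so the modified function misses the negative half-line there and has no zeros.
\<close>

lemma zeros_in_range:
  fixes f :: "complex \<Rightarrow> complex" and \<alpha> :: "real \<Rightarrow> real"
  assumes holo: "f holomorphic_on ball 0 1" and cont: "continuous_on (cball 0 1) f"
    and real: "\<And>x. \<bar>x\<bar> < 1 \<Longrightarrow> Im (f (complex_of_real x)) = 0"
    and nz: "\<exists>z\<in>ball 0 1. f z \<noteq> 0"
    and \<alpha>: "continuous_on {-1..1} \<alpha>" "inj_on \<alpha> {-1..1}" "\<And>x. x \<in> {-1..1} \<Longrightarrow> \<bar>\<alpha> x\<bar> < 1"
    and neg: "\<And>z. cmod z = 1 \<Longrightarrow> Re (f (\<alpha> (Re z))) \<noteq> 0 \<Longrightarrow>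
                \<not> (Im (f z) = 0 \<and> Re (f z) * Re (f (\<alpha> (Re z))) < 0)"
    and z: "z \<in> ball 0 1" "f z = 0"
  shows "z \<in> complex_of_real ` \<alpha> ` {-1..1}"
proof -
  define I where "I = {-1..1::real}"
  define ca where "ca = (\<lambda>t. complex_of_real (\<alpha> t))"
  have inj: "inj_on ca I" using \<alpha>(2) by (auto simp: inj_on_def ca_def I_def)
  define K where "K = ca ` I"
  have contca: "continuous_on I ca" unfolding ca_def I_def by (intro continuous_intros \<alpha>)
  have K: "compact K" unfolding K_def using contca by (intro compact_continuous_image) (auto simp: I_def)
  have K_sub: "K \<subseteq> ball 0 1" using \<alpha>(3) by (auto simp: K_def ca_def I_def)
  have ncst: "\<not> f constant_on ball 0 1" using nz z unfolding constant_on_def by metis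
  have "finite {z\<in>K. f z = 0}"
    by (rule holomorphic_compact_finite_zeros[OF holo open_ball connected_ball K K_sub ncst])
  \<comment> \<open>The parameters of those zeros that do lie on the curve; only they are divided
    out. A zero off the curve survives in the quotient \<open>g\<close>.\<close>
  moreover define T where "T = {t\<in>I. f (ca t) = 0}"
  moreover have KT: "{z\<in>K. f z = 0} = ca ` T" by (auto simp: K_def T_def)
  ultimately have finT: "finite T"
    by (metis (mono_tags, lifting) finite_imageD inj inj_on_subset mem_Collect_eq subsetI)
  have TI: "T \<subseteq> I" by (auto simp: T_def)
  have injT: "inj_on ca T" using inj TI inj_on_subset by blast
  obtain n g where g: "g holomorphic_on ball 0 1" "\<forall>w\<in>ca ` T. g w \<noteq> 0"
     "\<forall>z\<in>ball 0 1. f z = (\<Prod>w\<in>ca ` T. (z - w) ^ n w) * g z"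
    using factor_out_zeros[OF holo open_ball connected_ball nz, of "ca ` T"] finT K_sub KT by fastforce
  define m where "m = (\<lambda>t. n (ca t))"
  define D where "D = (\<lambda>z. \<Prod>t\<in>T. (z - ca t) ^ m t)"
  have fD: "f z = D z * g z" if "z \<in> ball 0 1" for z
    using g(3) that by (simp add: D_def m_def prod.reindex[OF injT])
  have D_nz: "D z \<noteq> 0" if "z \<notin> ca ` T" for z
    using that finT by (auto simp: D_def)
  \<comment> \<open>The quotient \<open>f / D\<close>, continued over its removable singularities by
    \<open>g\<close>. Unlike \<open>g\<close> it is under control on the circle as well.\<close>
  define h where "h = (\<lambda>z. if z \<in> ball 0 1 then g z else f z / D z)"
  have h1: "h z = f z / D z" if "z \<in> cball 0 1 - ca ` T" for z
    using that fD[of z] D_nz[of z] by (auto simp: h_def)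
  have conth: "continuous_on (cball 0 1) h"
  proof -
    have 1: "continuous_on (ball 0 1) h"
      using holomorphic_on_imp_continuous_on[OF g(1)]
      by (rule continuous_on_eq) (simp add: h_def)
    have "continuous_on (cball 0 1 - ca ` T) (\<lambda>z. f z / D z)"
    proof (intro continuous_on_divide)
      show "continuous_on (cball 0 1 - ca ` T) f" using cont by (rule continuous_on_subset) auto
      show "continuous_on (cball 0 1 - ca ` T) D" unfolding D_def by (intro continuous_intros)
    qed (use D_nz in auto)
    then have 2: "continuous_on (cball 0 1 - ca ` T) h"
      by (rule continuous_on_eq) (simp add: h1)
    have 3: "ball 0 1 \<union> (cball 0 1 - ca ` T) = cball 0 (1::real)"
      using K_sub KT by auto
    show ?thesis
      using continuous_on_Un_local_open[of "ball 0 1" "cball 0 1 - ca ` T" h] 1 2 finT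
      unfolding 3 by (auto simp: finite_imp_closed openin_open)
        (metis (no_types, lifting) Diff_eq finite_imageI finite_imp_closed open_Compl ball_subset_cball inf.absorb_iff2 open_ball)
  qed
  \<comment> \<open>The numerators carry the zeros on the circle, and the denominators have none in
    the closed disc. Divided by \<open>D\<close> this is the product of the real factors of
    \<open>unit_circle_factor\<close>.\<close>
  define E where "E = (\<lambda>z. \<Prod>t\<in>T. ((z\<^sup>2 - 2 * complex_of_real t * z + 1) / (1 - ca t * z)) ^ m t)"
  have den: "1 - ca t * z \<noteq> 0" if "t \<in> T" "z \<in> cball 0 1" for t z
  proof
    assume "1 - ca t * z = 0"
    then have "cmod (ca t * z) = 1" by (metis eq_iff_diff_eq_0 norm_one)
    moreover have "cmod (ca t) < 1" using \<alpha>(3) that TI by (auto simp: ca_def I_def)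
    ultimately show False using that(2)
      by (metis dist_0_norm linorder_not_less mem_cball mult_left_le norm_ge_zero norm_mult)
  qed
  define F where "F = (\<lambda>z. h z * E z)"
  have Eholo: "E holomorphic_on ball 0 1" unfolding E_def
    using den by (intro holomorphic_intros) auto
  have Econt: "continuous_on (cball 0 1) E" unfolding E_def
    using den by (intro continuous_intros) auto
  have "h holomorphic_on ball 0 1" using g(1) by (rule holomorphic_transform) (auto simp: h_def)
  then have Fholo: "F holomorphic_on ball 0 1" unfolding F_def by (intro holomorphic_intros Eholo)
  have Fcont: "continuous_on (cball 0 1) F" unfolding F_def by (intro continuous_intros conth Econt)
  define cc where "cc = (\<lambda>z::complex. \<Prod>t\<in>T. (2 * (Re z - t) / (cmod (1 - complex_of_real (\<alpha> t) * z))\<^sup>2) ^ m t)"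
  have Fc: "F z = f z * complex_of_real (cc z)" if z1: "cmod z = 1" for z :: complex
  proof -
    have "z \<notin> ca ` T" using K_sub KT z1 by fastforce
    then have "h z = f z / D z" using h1[of z] z1 by simp
    then have "F z = f z * (E z / D z)" by (simp add: F_def)
    also have "E z / D z = (\<Prod>t\<in>T. ((z\<^sup>2 - 2 * complex_of_real t * z + 1) / ((z - ca t) * (1 - ca t * z))) ^ m t)"
      unfolding E_def D_def by (simp add: prod_dividef power_divide power_mult_distrib prod.distrib mult.commute)
    also have "\<dots> = complex_of_real (cc z)"
      unfolding cc_def of_real_prod of_real_power
      using unit_circle_factor[OF z1] \<alpha>(3) TI by (intro prod.cong) (auto simp: ca_def I_def)
    finally show ?thesis .
  qed
  \<comment> \<open>\<open>D\<close> and \<open>f\<close> are real on the real axis, and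
    \<open>D\<close> has finitely many zeros; at these the reality of \<open>g\<close> follows by
    continuity.\<close>
  have reg: "Im (g (complex_of_real x)) = 0" if x: "\<bar>x\<bar> < 1" for x :: real
  proof -
    have a1: "isCont (\<lambda>y. Im (g (complex_of_real y))) x"
    proof -
      have "isCont g (complex_of_real x)"
        using continuous_on_interior[OF holomorphic_on_imp_continuous_on[OF g(1)]] x by simp
      then have "isCont (\<lambda>y. g (complex_of_real y)) x"
        by (intro isCont_o2[where f = complex_of_real and g = g]) auto
      then show ?thesis by (rule continuous_Im)
    qed
    have "\<forall>\<^sub>F y in at x. y \<in> {-1<..<1} - (\<alpha> ` T - {x}) - {x}"
      by (rule eventually_at_in_open) (use x finT in \<open>auto intro!: open_Diff finite_imp_closed\<close>)
    then have "\<forall>\<^sub>F y in at x. Im (g (complex_of_real y)) = 0"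
    proof (eventually_elim)
      case (elim y)
      have y: "complex_of_real y \<in> ball 0 1" "complex_of_real y \<notin> ca ` T"
        using elim by (auto simp: ca_def)
      define P where "P = (\<Prod>t\<in>T. (y - \<alpha> t) ^ m t)"
      have "D (complex_of_real y) = complex_of_real P"
        by (simp add: D_def P_def ca_def)
      then have "f (complex_of_real y) = complex_of_real P * g (complex_of_real y)" "P \<noteq> 0"
        using fD[OF y(1)] D_nz[OF y(2)] by auto
      moreover have "Im (f (complex_of_real y)) = 0" using real[of y] elim by auto
      ultimately show ?case by simp
    qed
    then have "((\<lambda>y. Im (g (complex_of_real y))) \<longlongrightarrow> 0) (at x)"
      by (rule tendsto_eventually)
    then show ?thesis using a1 tendsto_unique[of "at x"] by (auto simp: isCont_def)
  qed
  define gr where "gr = (\<lambda>x. Re (g (ca x)))"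
  have gr_nz: "gr x \<noteq> 0" if "x \<in> I" for x
  proof -
    have "g (ca x) \<noteq> 0"
    proof (cases "x \<in> T")
      case False
      then have "f (ca x) \<noteq> 0" using that by (auto simp: T_def)
      then show ?thesis using fD[of "ca x"] K_sub that by (auto simp: K_def)
    qed (use g(2) in auto)
    moreover have "Im (g (ca x)) = 0" using reg[of "\<alpha> x"] \<alpha>(3) that by (auto simp: ca_def I_def)
    ultimately show ?thesis by (auto simp: gr_def complex_eq_iff)
  qed
  have contgr: "continuous_on I gr" unfolding gr_def
    by (intro continuous_intros continuous_on_compose2[OF holomorphic_on_imp_continuous_on[OF g(1)] contca])
       (use K_sub in \<open>auto simp: K_def\<close>)
  have "(\<forall>x\<in>I. gr x > 0) \<or> (\<forall>x\<in>I. gr x < 0)"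
  proof (rule ccontr)
    assume "\<not> ?thesis"
    then obtain x y where "x \<in> I" "y \<in> I" "gr x < 0" "gr y > 0" using gr_nz by (metis linorder_neqE)
    moreover have "connected (gr ` I)"
      using contgr by (intro connected_continuous_image) (auto simp: I_def)
    ultimately have "0 \<in> gr ` I"
      by (meson connected_iff_interval image_eqI less_eq_real_def)
    then show False using gr_nz by auto
  qed
  then obtain e1 :: real where e1: "e1 = 1 \<or> e1 = -1" "\<And>x. x \<in> I \<Longrightarrow> e1 * gr x > 0"
    by (metis minus_mult_minus mult_1 mult_minus_left neg_0_less_iff_less)
  obtain s :: real where s: "s = 1 \<or> s = -1" "\<And>x t. x \<in> I \<Longrightarrow> t \<in> I \<Longrightarrow> x \<noteq> t \<Longrightarrow> s * ((\<alpha> x - \<alpha> t) * (x - t)) > 0"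
  proof -
    have "strict_mono_on I \<alpha> \<or> strict_antimono_on I \<alpha>"
      using injective_eq_monotone_map[of I \<alpha>] \<alpha> by (auto simp: I_def is_interval_cc)
    then show ?thesis
    proof
      assume *: "strict_mono_on I \<alpha>"
      show ?thesis
      proof (rule that[of 1])
        fix x t assume "x \<in> I" "t \<in> I" "x \<noteq> t"
        then show "1 * ((\<alpha> x - \<alpha> t) * (x - t)) > 0"
          using strict_mono_onD[OF *, of x t] strict_mono_onD[OF *, of t x]
          by (cases "x < t") (auto simp: zero_less_mult_iff)
      qed auto
    next
      assume *: "strict_antimono_on I \<alpha>"
      show ?thesis
      proof (rule that[of "-1"])
        fix x t assume "x \<in> I" "t \<in> I" "x \<noteq> t"
        then show "- 1 * ((\<alpha> x - \<alpha> t) * (x - t)) > 0"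
          using monotone_onD[OF *, of x t] monotone_onD[OF *, of t x]
          by (cases "x < t") (auto simp: mult_less_0_iff)
      qed auto
    qed
  qed
  \<comment> \<open>\<open>e1\<close> is the sign of \<open>g\<close> along the curve and
    \<open>s\<close> that of (\<alpha> x - \<alpha> t)(x - t), which is constant because \<alpha> is
    monotone. With the sign \<open>e\<close>, the value of \<open>f\<close> at \<alpha> x and the
    real factor on the circle above x have the same sign.\<close>
  define e where "e = e1 * s ^ sum m T"
  have e: "e = 1 \<or> e = -1"
    unfolding e_def using e1(1) s(1) by (metis minus_one_power_iff mult_1 mult_minus_left power_one minus_minus)
  have sgn: "e * (Re (f (ca x)) * (\<Prod>t\<in>T. (x - t) ^ m t)) > 0" if x: "x \<in> I" "x \<notin> T" for x
  proof -
    have "f (ca x) = complex_of_real (\<Prod>t\<in>T. (\<alpha> x - \<alpha> t) ^ m t) * g (ca x)"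
      using fD[of "ca x"] K_sub x by (auto simp: K_def D_def ca_def)
    then have "Re (f (ca x)) = (\<Prod>t\<in>T. (\<alpha> x - \<alpha> t) ^ m t) * gr x"
      by (simp only: Re_complex_of_real Im_complex_of_real times_complex.sel gr_def)
    then have "e * (Re (f (ca x)) * (\<Prod>t\<in>T. (x - t) ^ m t))
      = (e1 * gr x) * (s ^ sum m T * (\<Prod>t\<in>T. ((\<alpha> x - \<alpha> t) * (x - t)) ^ m t))"
      by (simp add: e_def prod.distrib power_mult_distrib mult_ac)
    also have "\<dots> > 0"
    proof (rule mult_pos_pos)
      have "\<And>t. t \<in> T \<Longrightarrow> s * ((\<alpha> x - \<alpha> t) * (x - t)) > 0" using s(2) x TI by blast
      then show "s ^ sum m T * (\<Prod>t\<in>T. ((\<alpha> x - \<alpha> t) * (x - t)) ^ m t) > 0"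
        using s(1) by (rule sign_of_prod_power)
    qed (rule e1(2)[OF x(1)])
    finally show ?thesis .
  qed
  have Fneg: "\<not> (Im (e * F w) = 0 \<and> Re (e * F w) < 0)" if w: "cmod w = 1" for w
  proof
    assume *: "Im (e * F w) = 0 \<and> Re (e * F w) < 0"
    define x where "x = Re w"
    have xI: "x \<in> I" using abs_Re_le_cmod[of w] w by (auto simp: I_def x_def abs_le_iff)
    have eF: "complex_of_real e * F w = complex_of_real (e * cc w) * f w"
      by (simp add: Fc[OF w] mult_ac)
    have 1: "(e * cc w) * Im (f w) = 0" "(e * cc w) * Re (f w) < 0"
      using * unfolding eF by auto
    have den1: "(cmod (1 - complex_of_real (\<alpha> t) * w))\<^sup>2 > 0" if "t \<in> T" for t
      using den[OF that, of w] w by (auto simp: ca_def)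
    define k where "k = (\<Prod>t\<in>T. (2 / (cmod (1 - complex_of_real (\<alpha> t) * w))\<^sup>2) ^ m t)"
    have "k > 0" unfolding k_def using den1 by (intro prod_pos) auto
    have cck: "cc w = k * (\<Prod>t\<in>T. (x - t) ^ m t)"
      unfolding cc_def k_def x_def prod.distrib[symmetric] power_mult_distrib[symmetric] by (intro prod.cong) auto
    show False
    proof (cases "x \<in> T")
      case True
      then have "f (ca x) = 0" by (auto simp: T_def)
      \<comment> \<open>The zero with parameter \<open>x\<close> has positive order, so the real
        factor vanishes at \<open>w\<close>, and \<open>F w\<close> is 0 rather than
        negative.\<close>
      have "m x \<noteq> 0"
      proof
        assume "m x = 0"
        have "D (ca x) \<noteq> 0" using finT \<open>m x = 0\<close> injT True by (auto simp: D_def inj_on_def)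
        then have "f (ca x) \<noteq> 0" using fD[of "ca x"] g(2) True K_sub xI by (auto simp: K_def)
        then show False using \<open>f (ca x) = 0\<close> by simp
      qed
      then have "cc w = 0" unfolding cck using True finT by auto
      then show False using 1 by simp
    next
      case False
      define A where "A = Re (f (ca x))"
      have "e * (A * cc w) > 0" using mult_pos_pos[OF \<open>k > 0\<close> sgn[OF xI False]]
        by (simp add: cck A_def mult_ac)
      then have "A \<noteq> 0" "(e * cc w) * A > 0" by (auto simp: mult_ac)
      then have "Im (f w) = 0" "Re (f w) * A < 0"
        using 1 by (auto simp: zero_less_mult_iff mult_less_0_iff)
      then show False using neg[OF w] \<open>A \<noteq> 0\<close> by (auto simp: A_def ca_def x_def)
    qed
  qed
  show ?thesis
  proof (rule ccontr)
    assume nin: "z \<notin> complex_of_real ` \<alpha> ` {-1..1}"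
    have "\<exists>z\<in>ball 0 1. e * F z \<noteq> 0"
    proof -
      have "\<exists>w\<in>ball 0 1. \<forall>t\<in>T. w\<^sup>2 - 2 * t * w + 1 \<noteq> 0 \<and> f w \<noteq> 0"
      proof -
        obtain w0 where w0: "w0 \<in> ball 0 1" "f w0 \<noteq> 0" using nz by auto
        \<comment> \<open>Both roots, t plus or minus i sqrt (1 - t^2), have modulus 1, so
          \<open>E\<close> has no zero in the open disc.\<close>
        have q: "w\<^sup>2 - 2 * complex_of_real t * w + 1 \<noteq> 0" if "t \<in> T" "w \<in> ball 0 1" for t w
        proof
          assume eq: "w\<^sup>2 - 2 * complex_of_real t * w + 1 = 0"
          have tI: "\<bar>t\<bar> \<le> 1" using that(1) TI by (auto simp: I_def abs_le_iff)
          define rt where "rt = complex_of_real (sqrt (1 - t\<^sup>2))"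
          have rt: "rt\<^sup>2 = 1 - (complex_of_real t)\<^sup>2"
          proof -
            have "1 - t\<^sup>2 \<ge> 0" using tI by (simp add: abs_square_le_1)
            then have "(sqrt (1 - t\<^sup>2))\<^sup>2 = 1 - t\<^sup>2" by simp
            then show ?thesis unfolding rt_def
              by (metis of_real_1 of_real_diff of_real_power)
          qed
          have "(w - t - \<i> * rt) * (w - t + \<i> * rt) = w\<^sup>2 - 2 * t * w + ((complex_of_real t)\<^sup>2 + rt\<^sup>2)"
            by (simp add: algebra_simps power2_eq_square)
          then have "(w - t - \<i> * rt) * (w - t + \<i> * rt) = 0" using eq by (simp add: rt)
          then have "w - t - \<i> * rt = 0 \<or> w - t + \<i> * rt = 0" by (simp only: mult_eq_0_iff)
          then have "w = Complex t (sqrt (1 - t\<^sup>2)) \<or> w = Complex t (- sqrt (1 - t\<^sup>2))"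
            unfolding rt_def complex_eq_iff by auto
          then have "cmod w = 1" using tI by (auto simp: cmod_def abs_square_le_1)
          then show False using that by simp
        qed
        then show ?thesis using w0 by auto
      qed
      then obtain w where w: "w \<in> ball 0 1" "\<forall>t\<in>T. w\<^sup>2 - 2 * complex_of_real t * w + 1 \<noteq> 0" "T = {} \<or> f w \<noteq> 0" by blast
      show ?thesis
      proof (cases "T = {}")
        case True
        then show ?thesis using nz e fD by (auto simp: F_def E_def D_def h_def)
      next
        case False
        then have "g w \<noteq> 0" using w fD[of w] by auto
        then have "e * F w \<noteq> 0" using e w den finT by (auto simp: F_def E_def h_def)
        then show ?thesis using w by blast
      qed
    qed
    then have "e * F z \<noteq> 0"
      using no_zero_if_boundary_misses_negatives[of "\<lambda>z. e * F z" z] Fneg z(1)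
      by (force intro!: holomorphic_intros continuous_intros Fholo Fcont)
    moreover have "z \<notin> ca ` T" using nin TI by (auto simp: ca_def I_def)
    then have "g z = 0" using fD[OF z(1)] z(2) D_nz[of z] by auto
    ultimately show False using z(1) by (simp add: F_def h_def)
  qed
qed

text \<open>Eliminating \<open>w\<close> turns the form into (1 - d^2/4)(A^2 + B^2) - (d + d^2/2) A
  B. If w A < 0, then A B < -A^2 < 0 and the form is positive; the first term is harmless because d
  \<le> 2.\<close>

lemma opposite_signs_excluded:
  fixes A B w d :: real
  assumes "1 < d" "d \<le> 2" "2 * w = d * (A + B)" "A\<^sup>2 + B\<^sup>2 - d * A * B - w\<^sup>2 \<le> 0" "A \<noteq> 0"
  shows "\<not> w * A < 0"
proof
  assume *: "w * A < 0"
  have w: "w = d * (A + B) / 2" using assms(3) by simp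
  have "A\<^sup>2 + B\<^sup>2 - d * A * B - w\<^sup>2 = (1 - d\<^sup>2/4) * (A\<^sup>2 + B\<^sup>2) - (d + d\<^sup>2/2) * (A * B)"
    unfolding w by (simp add: power2_eq_square field_simps)
  moreover have "d\<^sup>2 \<le> 2\<^sup>2" using assms by (intro power_mono) auto
  then have "(1 - d\<^sup>2/4) * (A\<^sup>2 + B\<^sup>2) \<ge> 0" by (intro mult_nonneg_nonneg) auto
  moreover have "(d + d\<^sup>2/2) * (A * B) < 0"
  proof -
    have "d * (A * A + A * B) < 0" using * unfolding w by (simp add: algebra_simps)
    then have "A * A + A * B < 0" using assms(1) by (simp add: mult_less_0_iff)
    moreover have "A * A > 0" using assms(5) by (auto simp: zero_less_mult_iff linorder_neq_iff)
    ultimately have "A * B < 0" by linarith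
    moreover have "d + d\<^sup>2/2 > 0" using assms(1) by (intro add_pos_pos) auto
    ultimately show ?thesis by (metis mult_pos_neg)
  qed
  ultimately show False using assms(4) by linarith
qed

text \<open>Every zero in the disc would lie on both of two disjoint curves, so there is none, and
  \<open>f\<close> has one sign \<open>e\<close> on the real diameter. Let m be the minimum of
  \<open>e * Re f\<close> on the circle. The relation expresses 2 m as d times the sum of two inner
  values, which are positive and at least m; thus m > 0 and 2 m \<ge> 2 d m, which d > 1
  excludes.\<close>

proposition disc_vanishing:
  fixes f :: "complex \<Rightarrow> complex" and \<alpha> \<beta> :: "real \<Rightarrow> real" and d :: real
  assumes holo: "f holomorphic_on ball 0 1" and cont: "continuous_on (cball 0 1) f"
    and real: "\<And>x. \<bar>x\<bar> < 1 \<Longrightarrow> Im (f (complex_of_real x)) = 0"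
    and \<alpha>: "continuous_on {-1..1} \<alpha>" "inj_on \<alpha> {-1..1}" "\<And>x. x \<in> {-1..1} \<Longrightarrow> \<bar>\<alpha> x\<bar> < 1"
    and \<beta>: "continuous_on {-1..1} \<beta>" "inj_on \<beta> {-1..1}" "\<And>x. x \<in> {-1..1} \<Longrightarrow> \<bar>\<beta> x\<bar> < 1"
    and disj: "\<alpha> ` {-1..1} \<inter> \<beta> ` {-1..1} = {}"
    and rel: "\<And>z. cmod z = 1 \<Longrightarrow> 2 * Re (f z) = d * (Re (f (\<alpha> (Re z))) + Re (f (\<beta> (Re z))))"
    and quad: "\<And>z. cmod z = 1 \<Longrightarrow> (Re (f (\<alpha> (Re z))))\<^sup>2 + (Re (f (\<beta> (Re z))))\<^sup>2
                 - d * Re (f (\<alpha> (Re z))) * Re (f (\<beta> (Re z))) - (cmod (f z))\<^sup>2 \<le> 0"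
    and d: "1 < d" "d \<le> 2"
    and z: "z \<in> ball 0 1"
  shows "f z = 0"
proof (rule ccontr)
  assume "f z \<noteq> 0"
  then have nz: "\<exists>z\<in>ball 0 1. f z \<noteq> 0" using z by blast
  have za: "w \<in> complex_of_real ` \<alpha> ` {-1..1}" if "w \<in> ball 0 1" "f w = 0" for w
  proof (rule zeros_in_range[OF holo cont real nz \<alpha> _ that])
    fix v assume v: "cmod v = 1" and A: "Re (f (\<alpha> (Re v))) \<noteq> 0"
    show "\<not> (Im (f v) = 0 \<and> Re (f v) * Re (f (\<alpha> (Re v))) < 0)"
      using opposite_signs_excluded[OF d rel[OF v] _ A] quad[OF v] by (auto simp: cmod_power2)
  qed auto
  have zb: "w \<in> complex_of_real ` \<beta> ` {-1..1}" if "w \<in> ball 0 1" "f w = 0" for w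
  proof (rule zeros_in_range[OF holo cont real nz \<beta> _ that])
    fix v assume v: "cmod v = 1" and A: "Re (f (\<beta> (Re v))) \<noteq> 0"
    show "\<not> (Im (f v) = 0 \<and> Re (f v) * Re (f (\<beta> (Re v))) < 0)"
      using opposite_signs_excluded[OF d _ _ A, of "Re (f v)" "Re (f (\<alpha> (Re v)))"] quad[OF v] rel[OF v]
      by (auto simp: cmod_power2 algebra_simps)
  qed auto
  have nozero: "f w \<noteq> 0" if "w \<in> ball 0 1" for w
    using za[OF that] zb[OF that] disj by fastforce
  define h where "h = (\<lambda>x. Re (f (complex_of_real x)))"
  have contf: "continuous_on (ball 0 1) f" using holo holomorphic_on_imp_continuous_on by blast
  have "continuous_on {-1<..<1} h" unfolding h_def
    by (intro continuous_intros continuous_on_compose2[OF contf]) auto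
  moreover have hnz: "h x \<noteq> 0" if "x \<in> {-1<..<1}" for x
    using nozero[of "complex_of_real x"] real[of x] that by (auto simp: h_def complex_eq_iff abs_less_iff)
  ultimately have "(\<forall>x\<in>{-1<..<1}. h x > 0) \<or> (\<forall>x\<in>{-1<..<1}. h x < 0)"
  proof -
    assume c: "continuous_on {-1<..<1} h"
    show ?thesis
    proof (rule ccontr)
      assume "\<not> ?thesis"
      then obtain x y where "x \<in> {-1<..<1}" "y \<in> {-1<..<1}" "h x < 0" "h y > 0"
        using hnz by (metis linorder_neqE)
      moreover have "connected (h ` {-1<..<1})"
        using c by (intro connected_continuous_image) auto
      ultimately have "0 \<in> h ` {-1<..<1}"
        by (meson connected_iff_interval image_eqI less_eq_real_def)
      then show False using hnz by auto
    qed
  qed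
  then obtain e :: real where e: "e = 1 \<or> e = -1" "\<And>x. x \<in> {-1<..<1} \<Longrightarrow> e * h x > 0"
    by (metis minus_mult_minus mult_1 mult_minus_left neg_0_less_iff_less)
  define S where "S = (\<lambda>v. e * Re (f v))"
  have "continuous_on (sphere 0 1) S" unfolding S_def
    by (intro continuous_intros continuous_on_subset[OF cont]) auto
  then obtain v where v: "v \<in> sphere 0 1" "\<And>w. w \<in> sphere 0 1 \<Longrightarrow> S v \<le> S w"
    using continuous_attains_inf[of "sphere (0::complex) 1" S] by auto
  have abs_Re: "Re w \<in> {-1..1}" if "cmod w = 1" for w
    using abs_Re_le_cmod[of w] that by (auto simp: abs_le_iff)
  have a: "\<alpha> (Re v) \<in> {-1<..<1}" "\<beta> (Re v) \<in> {-1<..<1}"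
    using \<alpha>(3)[OF abs_Re, of v] \<beta>(3)[OF abs_Re, of v] v by auto
  have S_rel: "2 * S v = d * (e * h (\<alpha> (Re v)) + e * h (\<beta> (Re v)))"
    using arg_cong[OF rel[of v], of "\<lambda>y. e * y"] v(1) by (simp add: S_def h_def algebra_simps)
  have Sm: "S v \<le> S w" if w: "w \<in> ball 0 1" for w
  proof -
    have "Re (- e * f w) \<le> - S v"
    proof (rule maximum_real_frontier[of "\<lambda>w. - e * f w" "ball 0 1"])
      show "(\<lambda>w. - e * f w) holomorphic_on interior (ball 0 1)"
        by (auto intro!: holomorphic_intros holo)
      show "continuous_on (closure (ball 0 1)) (\<lambda>w. - e * f w)"
        using cont by (auto intro!: continuous_intros)
    qed (use v(2) w in \<open>auto simp: S_def\<close>)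
    then show ?thesis by (simp add: S_def)
  qed
  have "S v > 0" using S_rel e(2)[OF a(1)] e(2)[OF a(2)] d
    by (metis add_pos_pos less_trans mult_pos_pos zero_less_mult_iff zero_less_one zero_less_numeral not_less_iff_gr_or_eq)
  moreover have "S v \<le> e * h (\<alpha> (Re v))" "S v \<le> e * h (\<beta> (Re v))"
    using Sm[of "complex_of_real (\<alpha> (Re v))"] Sm[of "complex_of_real (\<beta> (Re v))"] a
    by (auto simp: S_def h_def)
  then have "d * (2 * S v) \<le> d * (e * h (\<alpha> (Re v)) + e * h (\<beta> (Re v)))"
    using d by (intro mult_left_mono) linarith+
  then have "d * (2 * S v) \<le> 2 * S v" unfolding S_rel .
  ultimately show False using d by simp
qed

section \<open>The Riemann sphere\<close>

abbreviation upper :: "complex set" where "upper \<equiv> {z. 0 < Im z}"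

lemma insert_None_range_Some [simp]: "insert None (range Some) = UNIV"
  by (simp add: UNIV_option_conv)

lemma topspace_sphere: "topspace sphere_top = UNIV"
  by simp

lemma closedin_sphere: "closedin sphere_top K \<longleftrightarrow> openin sphere_top (- K)"
  by (simp add: closedin_def Compl_eq_Diff_UNIV)

lemma Hausdorff_sphere: "Hausdorff_space sphere_top"
  unfolding Hausdorff_space_Alexandroff_compactification
  by (auto simp: locally_compact_space_euclidean)

lemma regular_sphere: "regular_space sphere_top"
  by (simp add: Hausdorff_sphere compact_Hausdorff_imp_regular_space)

lemma closedin_finite_sphere: "finite S \<Longrightarrow> closedin sphere_top S"
  using Hausdorff_imp_t1_space[OF Hausdorff_sphere] by (simp add: t1_space_closedin_finite)

lemma limitin_sphere_Some:
  "limitin sphere_top (\<lambda>x. Some (h x)) (Some z) F \<longleftrightarrow> (h \<longlongrightarrow> z) F"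
proof
  assume L: "limitin sphere_top (\<lambda>x. Some (h x)) (Some z) F"
  show "(h \<longlongrightarrow> z) F"
    unfolding tendsto_def
  proof safe
    fix S :: "complex set" assume "open S" "z \<in> S"
    then have "eventually (\<lambda>x. Some (h x) \<in> Some ` S) F"
      by (intro limitinD[OF L]) auto
    then show "eventually (\<lambda>x. h x \<in> S) F" by (rule eventually_mono) auto
  qed
next
  assume "(h \<longlongrightarrow> z) F"
  then show "limitin sphere_top (\<lambda>x. Some (h x)) (Some z) F"
    using continuous_map_limit[OF continuous_map_Some, of euclidean h z F] by (simp add: o_def)
qed

lemma openin_sphere_NoneD:
  assumes "openin sphere_top U" "None \<in> U"
  obtains B where "\<And>z. cmod z > B \<Longrightarrow> Some z \<in> U"
proof -
  obtain C :: "complex set" where C: "compact C" "U = insert None (Some ` (- C))"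
    using assms by (auto simp: openin_Alexandroff_compactification Compl_eq_Diff_UNIV)
  then obtain B where "\<And>z. z \<in> C \<Longrightarrow> cmod z \<le> B"
    using compact_imp_bounded bounded_iff by metis
  then show ?thesis using C(2) by (intro that[of B]) force
qed

lemma limitin_sphere_NoneI:
  assumes "\<And>B. eventually (\<lambda>x. case f x of None \<Rightarrow> True | Some z \<Rightarrow> cmod z > B) F"
  shows "limitin sphere_top f None F"
  unfolding limitin_def
proof safe
  fix U assume "openin sphere_top U" "None \<in> U"
  then obtain B where "\<And>z. cmod z > B \<Longrightarrow> Some z \<in> U" using openin_sphere_NoneD by blast
  with \<open>None \<in> U\<close> show "eventually (\<lambda>x. f x \<in> U) F"
    using assms[of B]
      by (auto elim!: eventually_mono split: option.splits) (metis not_None_eq)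
qed simp

lemma openin_sphere_outside: "openin sphere_top (insert None (Some ` {z. cmod z > B}))"
proof -
  have "{z. cmod z > B} = UNIV - cball 0 B" by auto
  then show ?thesis unfolding openin_Alexandroff_compactification
    by (intro disjI2 exI[of _ "cball 0 B"]) auto
qed

lemma limitin_sphere_None:
  "limitin sphere_top (\<lambda>x. Some (h x)) None F \<longleftrightarrow> filterlim h at_infinity F"
proof
  assume L: "limitin sphere_top (\<lambda>x. Some (h x)) None F"
  show "filterlim h at_infinity F"
    unfolding filterlim_at_infinity[OF order.refl]
  proof safe
    fix r :: real
    have "eventually (\<lambda>x. Some (h x) \<in> insert None (Some ` {z. cmod z > r})) F"
      by (intro limitinD[OF L] openin_sphere_outside) auto
    then show "eventually (\<lambda>x. r \<le> cmod (h x)) F" by (rule eventually_mono) auto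
  qed
next
  assume *: "filterlim h at_infinity F"
  show "limitin sphere_top (\<lambda>x. Some (h x)) None F"
  proof (rule limitin_sphere_NoneI)
    fix B
    have "eventually (\<lambda>x. \<bar>B\<bar> + 1 \<le> cmod (h x)) F"
      using * filterlim_at_infinity[of 0 h F] by simp
    then show "eventually (\<lambda>x. case Some (h x) of None \<Rightarrow> True | Some z \<Rightarrow> B < cmod z) F"
      by (rule eventually_mono) auto
  qed
qed

lemma limitin_sphere_quot:
  assumes a: "(a \<longlongrightarrow> a0) F" and b: "(b \<longlongrightarrow> b0) F" and ne: "a0 \<noteq> 0 \<or> b0 \<noteq> 0"
  shows "limitin sphere_top (\<lambda>x. sphere_quot (a x) (b x)) (sphere_quot a0 b0) F"
proof (cases "b0 = 0")
  case False
  have "eventually (\<lambda>x. b x \<noteq> 0) F" using tendsto_imp_eventually_ne[OF b False] .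
  then have "eventually (\<lambda>x. Some (a x / b x) = sphere_quot (a x) (b x)) F"
    by (rule eventually_mono) (simp add: sphere_quot_def)
  moreover have "limitin sphere_top (\<lambda>x. Some (a x / b x)) (sphere_quot a0 b0) F"
    using False by (auto simp: sphere_quot_def limitin_sphere_Some intro!: tendsto_intros a b)
  ultimately show ?thesis by (rule limitin_transform_eventually)
next
  case True
  then have "a0 \<noteq> 0" using ne by simp
  show ?thesis unfolding sphere_quot_def[of a0 b0] using True
  proof (simp, intro limitin_sphere_NoneI)
    fix B :: real
    \<comment> \<open>The quotient may be infinite. The inequality |a| > K |b| with K > B replaces
      |a / b| > B; it holds near the limit because \<open>b\<close> tends to 0 and \<open>a\<close>
      does not.\<close>
    define K where "K = \<bar>B\<bar> + 1"
    have "((\<lambda>x. K * cmod (b x)) \<longlongrightarrow> K * cmod 0) F"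
      using b True by (intro tendsto_intros) auto
    moreover have "((\<lambda>x. cmod (a x)) \<longlongrightarrow> cmod a0) F" by (intro tendsto_intros a)
    ultimately have "((\<lambda>x. cmod (a x) - K * cmod (b x)) \<longlongrightarrow> cmod a0 - K * cmod 0) F"
      by (intro tendsto_diff)
    then have "eventually (\<lambda>x. cmod (a x) - K * cmod (b x) > 0) F"
      using \<open>a0 \<noteq> 0\<close> by (intro order_tendstoD(1)) auto
    then show "eventually (\<lambda>x. case sphere_quot (a x) (b x) of None \<Rightarrow> True | Some z \<Rightarrow> B < cmod z) F"
    proof (rule eventually_mono)
      fix x assume *: "cmod (a x) - K * cmod (b x) > 0"
      show "case sphere_quot (a x) (b x) of None \<Rightarrow> True | Some z \<Rightarrow> B < cmod z"
      proof (cases "b x = 0")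
        case False
        then have "K < cmod (a x / b x)" using * by (simp add: norm_divide field_simps)
        then show ?thesis using False by (simp add: sphere_quot_def K_def)
      qed (simp add: sphere_quot_def)
    qed
  qed
qed

lemma atin_sphere_Some:
  "atin_within sphere_top (Some z) (Some ` S) = filtermap Some (at z within S)"
proof (rule filter_eqI)
  fix P
  show "eventually P (atin_within sphere_top (Some z) (Some ` S)) \<longleftrightarrow> eventually P (filtermap Some (at z within S))"
  proof
    assume "eventually P (atin_within sphere_top (Some z) (Some ` S))"
    then obtain T where T: "openin sphere_top T" "Some z \<in> T" "\<forall>x\<in>T. x \<in> Some ` S \<and> x \<noteq> Some z \<longrightarrow> P x"
      by (auto simp: eventually_atin_within)
    have "open (Some -` T)"
      using openin_continuous_map_preimage[OF continuous_map_Some T(1)] by (simp add: vimage_def)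
    then show "eventually P (filtermap Some (at z within S))"
      unfolding eventually_filtermap eventually_at_topological
      using T by (intro exI[of _ "Some -` T"]) auto
  next
    assume "eventually P (filtermap Some (at z within S))"
    then obtain T where T: "open T" "z \<in> T" "\<forall>x\<in>T. x \<noteq> z \<longrightarrow> x \<in> S \<longrightarrow> P (Some x)"
      by (auto simp: eventually_filtermap eventually_at_topological)
    then show "eventually P (atin_within sphere_top (Some z) (Some ` S))"
      unfolding eventually_atin_within by (intro disjI2 exI[of _ "Some ` T"]) auto
  qed
qed

lemma atin_sphere_None:
  "atin_within sphere_top None (Some ` S) = filtermap Some (inf at_infinity (principal S))"
proof (rule filter_eqI)
  fix P
  show "eventually P (atin_within sphere_top None (Some ` S)) \<longleftrightarrow>
        eventually P (filtermap Some (inf at_infinity (principal S)))"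
  proof
    assume "eventually P (atin_within sphere_top None (Some ` S))"
    then obtain T where T: "openin sphere_top T" "None \<in> T" "\<forall>x\<in>T. x \<in> Some ` S \<and> x \<noteq> None \<longrightarrow> P x"
      by (auto simp: eventually_atin_within)
    then obtain B where "\<And>z. cmod z > B \<Longrightarrow> Some z \<in> T" using openin_sphere_NoneD by blast
    then show "eventually P (filtermap Some (inf at_infinity (principal S)))"
      unfolding eventually_filtermap eventually_inf_principal eventually_at_infinity
      using T(3) by (intro exI[of _ "B + 1"]) auto
  next
    assume "eventually P (filtermap Some (inf at_infinity (principal S)))"
    then obtain B where "\<forall>z. B \<le> cmod z \<longrightarrow> z \<in> S \<longrightarrow> P (Some z)"
      by (auto simp: eventually_filtermap eventually_inf_principal eventually_at_infinity)
    then show "eventually P (atin_within sphere_top None (Some ` S))"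
      unfolding eventually_atin_within
      by (intro disjI2 exI[of _ "insert None (Some ` {z. cmod z > B})"]) (auto intro: openin_sphere_outside)
  qed
qed

lemma limitin_filtermap: "limitin X f l (filtermap g F) \<longleftrightarrow> limitin X (\<lambda>x. f (g x)) l F"
  by (simp add: limitin_def eventually_filtermap)

text \<open>If \<open>x\<close> is infinity, it is excluded as the centre anyway; otherwise infinity
  can be removed from a neighbourhood, since points are closed.\<close>

lemma atin_within_sphere_delete:
  "atin_within sphere_top x (S - {None}) = atin_within sphere_top x S"
proof (intro filter_eqI iffI)
  fix P assume "eventually P (atin_within sphere_top x (S - {None}))"
  then obtain T where T: "openin sphere_top T" "x \<in> T" "\<forall>y\<in>T. y \<in> S - {None} \<and> y \<noteq> x \<longrightarrow> P y"
    by (auto simp: eventually_atin_within)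
  have "openin sphere_top (T - ({None} - {x}))"
    by (intro openin_diff T closedin_finite_sphere) auto
  then show "eventually P (atin_within sphere_top x S)"
    unfolding eventually_atin_within using T(2,3) by (intro disjI2 exI[of _ "T - ({None} - {x})"]) auto
next
  fix P assume "eventually P (atin_within sphere_top x S)"
  then show "eventually P (atin_within sphere_top x (S - {None}))"
    by (auto simp: eventually_atin_within)
qed

lemma atin_sphere:
  "atin sphere_top (Some z) = filtermap Some (at z)" "atin sphere_top None = filtermap Some at_infinity"
proof -
  have eq: "range Some = UNIV - {None}"
    using notin_range_Some by blast
  have *: "atin_within sphere_top x (range Some) = atin sphere_top x" for x
    by (simp only: eq atin_within_sphere_delete)
  show "atin sphere_top (Some z) = filtermap Some (at z)"
    using atin_sphere_Some[of z UNIV] * by simp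
  show "atin sphere_top None = filtermap Some at_infinity"
    using atin_sphere_None[of UNIV] * by simp
qed

lemma continuous_map_sphere:
  "continuous_map sphere_top Y f \<longleftrightarrow>
     (\<forall>z. limitin Y (\<lambda>w. f (Some w)) (f (Some z)) (at z)) \<and> limitin Y (\<lambda>w. f (Some w)) (f None) at_infinity"
  unfolding continuous_map_atin
  by (simp add: split_option_all atin_sphere limitin_filtermap conj_commute)

section \<open>Rational functions as continuous maps of the sphere\<close>

lemma tendsto_poly_div_power_at_infinity:
  fixes p :: "complex poly"
  assumes "degree p \<le> m"
  shows "((\<lambda>z. poly p z / z ^ m) \<longlongrightarrow> coeff p m) at_infinity"
proof -
  have "poly p z = (\<Sum>i\<le>m. coeff p i * z ^ i)" for z
    unfolding poly_altdef using assms
    by (intro sum.mono_neutral_left) (auto simp: coeff_eq_0)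
  then have "(\<lambda>z. poly p z / z ^ m) = (\<lambda>z. \<Sum>i\<le>m. coeff p i * (z ^ i / z ^ m))"
    by (simp add: sum_divide_distrib)
  moreover have "((\<lambda>z. \<Sum>i\<le>m. coeff p i * (z ^ i / z ^ m)) \<longlongrightarrow> (\<Sum>i\<le>m. if i = m then coeff p m else 0)) at_infinity"
  proof (intro tendsto_sum)
    fix i assume i: "i \<in> {..m}"
    have ev: "eventually (\<lambda>z::complex. z \<noteq> 0) at_infinity"
      unfolding eventually_at_infinity by (intro exI[of _ 1]) auto
    have "((\<lambda>z::complex. z ^ i / z ^ m) \<longlongrightarrow> (if i = m then 1 else 0)) at_infinity"
    proof (cases "i = m")
      case True
      then show ?thesis using ev
        by (auto intro!: tendsto_eventually elim!: eventually_mono)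
    next
      case False
      then have im: "i < m" using i by simp
      have "((\<lambda>z::complex. inverse z ^ (m - i)) \<longlongrightarrow> 0 ^ (m - i)) at_infinity"
        by (intro tendsto_intros tendsto_inverse_0)
      moreover have "eventually (\<lambda>z::complex. inverse z ^ (m - i) = z ^ i / z ^ m) at_infinity"
        using ev by (rule eventually_mono) (use im in \<open>auto simp: power_diff power_inverse field_simps\<close>)
      ultimately show ?thesis using im
        by (auto simp: tendsto_cong zero_power)
    qed
    from tendsto_mult_left[OF this, of "coeff p i"]
    show "((\<lambda>z. coeff p i * (z ^ i / z ^ m)) \<longlongrightarrow> (if i = m then coeff p m else 0)) at_infinity"
      by (auto split: if_splits)
  qed
  ultimately show ?thesis by simp
qed

text \<open>The homogeneous form of the value at infinity: both coefficients of the top degree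
  appear, so finite and infinite values are treated alike and \<open>limitin_sphere_quot\<close>
  applies.\<close>

lemma ratmap_None_eq:
  assumes "1 \<le> max (degree p) (degree q)"
  shows "ratmap p q None = sphere_quot (coeff p (max (degree p) (degree q))) (coeff q (max (degree p) (degree q)))"
proof (cases "degree q < degree p")
  case True
  then show ?thesis by (simp add: sphere_quot_def coeff_eq_0)
next
  case False
  then have "max (degree p) (degree q) = degree q" by simp
  moreover from this have "lead_coeff q \<noteq> 0" using assms by auto
  ultimately show ?thesis using False by (simp add: sphere_quot_def)
qed

lemma continuous_map_ratmap:
  assumes deg: "1 \<le> max (degree p) (degree q)" and ncr: "\<And>z. poly p z \<noteq> 0 \<or> poly q z \<noteq> 0"
  shows "continuous_map sphere_top sphere_top (ratmap p q)"
  unfolding continuous_map_sphere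
proof safe
  fix z
  have "(poly r \<longlongrightarrow> poly r z) (at z)" for r :: "complex poly"
    using isCont_def poly_isCont by blast
  then show "limitin sphere_top (\<lambda>w. ratmap p q (Some w)) (ratmap p q (Some z)) (at z)"
    using ncr[of z] by (auto intro!: limitin_sphere_quot)
next
  define m where "m = max (degree p) (degree q)"
  have lim: "limitin sphere_top (\<lambda>w. sphere_quot (poly p w / w ^ m) (poly q w / w ^ m))
          (sphere_quot (coeff p m) (coeff q m)) at_infinity"
  proof (rule limitin_sphere_quot)
    have "lead_coeff p \<noteq> 0 \<or> lead_coeff q \<noteq> 0" using deg by (auto simp: max_def split: if_splits)
    then show "coeff p m \<noteq> 0 \<or> coeff q m \<noteq> 0"
      using deg by (cases "degree p \<le> degree q") (auto simp: m_def max_def split: if_splits)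
  qed (auto intro!: tendsto_poly_div_power_at_infinity simp: m_def)
  have "eventually (\<lambda>w. sphere_quot (poly p w / w ^ m) (poly q w / w ^ m) = ratmap p q (Some w)) at_infinity"
    unfolding eventually_at_infinity
    by (intro exI[of _ 1]) (auto simp: sphere_quot_def)
  from limitin_transform_eventually[OF this lim] show "limitin sphere_top (\<lambda>w. ratmap p q (Some w)) (ratmap p q None) at_infinity"
    unfolding ratmap_None_eq[OF deg] m_def[symmetric] .
qed

lemma continuous_map_sphere_cnj: "continuous_map sphere_top sphere_top (map_option cnj)"
  unfolding continuous_map_sphere
proof safe
  fix z show "limitin sphere_top (\<lambda>w. map_option cnj (Some w)) (map_option cnj (Some z)) (at z)"
    by (auto simp: limitin_sphere_Some intro!: tendsto_intros)
next
  show "limitin sphere_top (\<lambda>w. map_option cnj (Some w)) (map_option cnj None) at_infinity"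
    by (auto simp: limitin_sphere_None filterlim_at_infinity[of 0] eventually_at_infinity)
qed

text \<open>Near a point of a finite fibre a section cannot cross the boundary of a small
  neighbourhood of that point, which contains no other point of the fibre.\<close>

lemma section_limit_exists:
  assumes R: "continuous_map sphere_top sphere_top R" and fin: "finite (R -` {t})"
    and r: "continuous_on H r" "\<And>y. y \<in> H \<Longrightarrow> R (Some (r y)) = Some y"
    and F: "F \<noteq> bot" "limitin sphere_top Some t F"
    and conn: "\<And>P. eventually P F \<Longrightarrow> \<exists>C. connected C \<and> C \<subseteq> H \<and> eventually (\<lambda>y. y \<in> C) F \<and> (\<forall>y\<in>C. P y)"
  obtains x where "limitin sphere_top (\<lambda>y. Some (r y)) x F" "R x = t"
proof -
  have cm: "closed_map sphere_top sphere_top R"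
    by (intro continuous_imp_closed_map) (auto simp: R Hausdorff_sphere)
  have evH: "eventually (\<lambda>y. y \<in> H) F"
    using conn[of "\<lambda>_. True"] by (auto elim: eventually_mono)
  \<comment> \<open>The image of \<open>K\<close> is closed and misses \<open>t\<close>, so near
    \<open>t\<close> no section value lies in \<open>K\<close>.\<close>
  have away: "eventually (\<lambda>y. Some (r y) \<notin> K) F" if K: "closedin sphere_top K" "K \<inter> R -` {t} = {}" for K
  proof -
    have "closedin sphere_top (R ` K)" using cm K(1) by (auto simp: closed_map_def)
    then have "openin sphere_top (UNIV - R ` K)" by (simp add: closedin_sphere Compl_eq_Diff_UNIV)
    moreover have "t \<in> UNIV - R ` K" using K(2) by auto
    ultimately have "eventually (\<lambda>y. Some y \<in> UNIV - R ` K) F" by (rule limitinD[OF F(2)])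
    then show ?thesis using evH
      by eventually_elim (metis DiffD2 imageI r(2))
  qed
  \<comment> \<open>A cluster point exists among the finitely many preimages: otherwise the section
    would avoid neighbourhoods of all of them as well as the complement of their union.\<close>
  have "\<exists>x\<in>R -` {t}. \<forall>U. openin sphere_top U \<and> x \<in> U \<longrightarrow> \<not> eventually (\<lambda>y. Some (r y) \<notin> U) F"
  proof (rule ccontr)
    assume "\<not> ?thesis"
    then have "\<forall>x\<in>R -` {t}. \<exists>U. openin sphere_top U \<and> x \<in> U \<and> eventually (\<lambda>y. Some (r y) \<notin> U) F" by blast
    then obtain U where U: "\<And>x. x \<in> R -` {t} \<Longrightarrow> openin sphere_top (U x)" "\<And>x. x \<in> R -` {t} \<Longrightarrow> x \<in> U x"
      "\<And>x. x \<in> R -` {t} \<Longrightarrow> eventually (\<lambda>y. Some (r y) \<notin> U x) F" by metis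
    have "eventually (\<lambda>y. \<forall>x\<in>R -` {t}. Some (r y) \<notin> U x) F"
      using fin U(3) by (intro eventually_ball_finite) auto
    moreover have "eventually (\<lambda>y. Some (r y) \<notin> UNIV - \<Union>(U ` (R -` {t}))) F"
      using U by (intro away closedin_diff openin_Union) (auto intro: closedin_topspace[of sphere_top, simplified])
    ultimately have "eventually (\<lambda>y. False) F" by eventually_elim auto
    then show False using F(1) by (simp add: trivial_limit_def)
  qed
  then obtain x where x: "R x = t" "\<And>U. openin sphere_top U \<Longrightarrow> x \<in> U \<Longrightarrow> \<not> eventually (\<lambda>y. Some (r y) \<notin> U) F"
    by auto
  have "eventually (\<lambda>y. Some (r y) \<in> U) F" if U: "openin sphere_top U" "x \<in> U" for U
  proof -
    define U' where "U' = U - (R -` {t} - {x})"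
    have "openin sphere_top U'" unfolding U'_def
      using U(1) fin by (intro openin_diff closedin_finite_sphere) auto
    moreover have "x \<in> U'" using U(2) by (simp add: U'_def)
    ultimately obtain V where V: "openin sphere_top V" "x \<in> V" "sphere_top closure_of V \<subseteq> U'"
    proof -
      have "closedin sphere_top (UNIV - U')" "x \<in> topspace sphere_top - (UNIV - U')"
        using \<open>openin sphere_top U'\<close> \<open>x \<in> U'\<close> by (auto simp: closedin_sphere Compl_eq_Diff_UNIV double_diff)
      then have "\<exists>V. openin sphere_top V \<and> x \<in> V \<and> disjnt (UNIV - U') (sphere_top closure_of V)"
        using regular_sphere unfolding regular_space by blast
      then show ?thesis using that by (auto simp: disjnt_def)
    qed
    \<comment> \<open>The frontier of \<open>V\<close> contains no point of the fibre. The image of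
      a connected set close to \<open>t\<close> misses this frontier and meets \<open>V\<close>,
      because \<open>x\<close> is a cluster point; hence it stays in \<open>V\<close>.\<close>
    define K where "K = sphere_top closure_of V - V"
    have "closedin sphere_top K" unfolding K_def using V by (intro closedin_diff) auto
    moreover have "K \<inter> R -` {t} = {}" using V by (auto simp: K_def U'_def)
    ultimately have "eventually (\<lambda>y. Some (r y) \<notin> K) F" by (rule away)
    from conn[OF this] obtain C where C: "connected C" "C \<subseteq> H" "eventually (\<lambda>y. y \<in> C) F" "\<forall>y\<in>C. Some (r y) \<notin> K"
      by blast
    have "connectedin sphere_top (Some ` r ` C)"
    proof (rule connectedin_continuous_map_image[OF continuous_map_Some])
      show "connectedin euclidean (r ` C)"
        using C(1,2) r(1) continuous_on_subset by (auto intro!: connected_continuous_image)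
    qed
    moreover have "\<exists>y\<in>C. Some (r y) \<in> V"
    proof (rule ccontr)
      assume "\<not> ?thesis"
      then have "eventually (\<lambda>y. Some (r y) \<notin> V) F" using C(3) by (auto elim: eventually_mono)
      then show False using x(2)[OF V(1,2)] by simp
    qed
    moreover have "openin sphere_top (UNIV - sphere_top closure_of V)"
      by (metis closedin_closure_of closedin_def topspace_sphere)
    ultimately have "Some ` r ` C \<inter> (UNIV - sphere_top closure_of V) = {}"
      using connectedinD[of sphere_top "Some ` r ` C" V "UNIV - sphere_top closure_of V"] V(1) C(4)
        closure_of_subset[of V sphere_top] unfolding K_def by fastforce
    then have "\<forall>y\<in>C. Some (r y) \<in> U" using V(3) by (auto simp: U'_def)
    then show ?thesis using C(3) by (auto elim: eventually_mono)
  qed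
  then have "limitin sphere_top (\<lambda>y. Some (r y)) x F" by (simp add: limitin_def)
  then show ?thesis using that x(1) by blast
qed

section \<open>Connected neighbourhoods in the upper half plane\<close>

lemma convex_upper: "convex upper"
  by (simp add: convex_halfspace_Im_gt)

lemma Im_minus_inverse: "Im (- inverse z) = Im z / (cmod z)\<^sup>2"
  by (simp add: cmod_power2)

text \<open>The map v to -1/v carries a half disc at 0, which is convex, onto the part of the half
  plane outside a circle.\<close>

lemma connected_upper_outside: "connected {y \<in> upper. cmod y > B}"
proof -
  define B' where "B' = \<bar>B\<bar> + 1"
  have 1: "connected {y \<in> upper. cmod y > C}" if "C > 0" for C
  proof -
    have "{y \<in> upper. cmod y > C} = (\<lambda>v. - inverse v) ` (ball 0 (inverse C) \<inter> upper)"
    proof safe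
      fix y assume y: "C < cmod y" "0 < Im y"
      then have "y \<noteq> 0" using that by auto
      show "y \<in> (\<lambda>v. - inverse v) ` (ball 0 (inverse C) \<inter> upper)"
      proof (rule image_eqI[of _ _ "- inverse y"])
        have "cmod (- inverse y) < inverse C"
          unfolding norm_minus_cancel norm_inverse using y that by (intro less_imp_inverse_less)
        moreover have "Im (- inverse y) > 0" unfolding Im_minus_inverse using y \<open>y \<noteq> 0\<close> by simp
        ultimately show "- inverse y \<in> ball 0 (inverse C) \<inter> upper" by simp
      qed simp
    next
      fix v :: complex assume v: "v \<in> ball 0 (inverse C)" "0 < Im v"
      have "v \<noteq> 0" using v by auto
      have "inverse (inverse C) < cmod (- inverse v)"
        unfolding norm_minus_cancel norm_inverse using v \<open>v \<noteq> 0\<close> by (intro less_imp_inverse_less) auto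
      then show "C < cmod (- inverse v)" using that by simp
      show "0 < Im (- inverse v)" unfolding Im_minus_inverse using v \<open>v \<noteq> 0\<close> by simp
    qed
    moreover have "connected ((\<lambda>v. - inverse v) ` (ball 0 (inverse C) \<inter> upper))"
    proof (rule connected_continuous_image)
      show "connected (ball 0 (inverse C) \<inter> upper)"
        by (intro convex_connected convex_Int convex_upper convex_ball)
    qed (auto intro!: continuous_intros)
    ultimately show ?thesis by simp
  qed
  show ?thesis
  proof (cases "B > 0")
    case False
    then have "{y \<in> upper. cmod y > B} = upper"
    proof safe
      fix x assume "0 < Im x"
      then have "x \<noteq> 0" by auto
      then have "0 < cmod x" by simp
      then show "B < cmod x" using False by linarith
    qed
    then show ?thesis using convex_connected[OF convex_upper] by simp
  qed (use 1 in auto)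
qed

lemma connected_basis_upper:
  assumes "eventually P (at t within upper)"
  shows "\<exists>C. connected C \<and> C \<subseteq> upper \<and> eventually (\<lambda>y. y \<in> C) (at t within upper) \<and> (\<forall>y\<in>C - {t}. P y)"
proof -
  obtain e where e: "e > 0" "\<forall>y\<in>upper. y \<noteq> t \<and> dist y t < e \<longrightarrow> P y"
    using assms by (auto simp: eventually_at)
  show ?thesis
    using e by (intro exI[of _ "ball t e \<inter> upper"])
      (auto simp: eventually_at dist_commute intro!: convex_connected convex_Int convex_upper)
qed

lemma connected_basis_upper_infinity:
  assumes "eventually P (inf at_infinity (principal upper))"
  shows "\<exists>C. connected C \<and> C \<subseteq> upper \<and> eventually (\<lambda>y. y \<in> C) (inf at_infinity (principal upper)) \<and> (\<forall>y\<in>C. P y)"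
proof -
  obtain b where b: "\<forall>y. b \<le> cmod y \<longrightarrow> y \<in> upper \<longrightarrow> P y"
    using assms by (auto simp: eventually_inf_principal eventually_at_infinity)
  show ?thesis
    using b connected_upper_outside[of b]
    by (intro exI[of _ "{y \<in> upper. cmod y > b}"])
      (auto simp: eventually_inf_principal eventually_at_infinity intro!: exI[of _ "b + 1"])
qed

section \<open>Circles orthogonal to the real line\<close>

fun side :: "real option \<Rightarrow> real option \<Rightarrow> complex \<Rightarrow> real" where
  "side (Some p) (Some q) z = Re ((z - of_real p) * cnj (z - of_real q))"
| "side (Some p) None z = Re z - p"
| "side None (Some q) z = Re z - q"
| "side None None z = 0"

text \<open>For finite \<open>p\<close> and \<open>q\<close>, \<open>side p q z\<close> is |z - m|^2
  - ((p - q)/2)^2 with m the midpoint, so it is negative inside the circle with diameter from p to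
  q. If one of them is infinite, the circle becomes the vertical line through the other. Infinity
  lies outside the circle, hence the value 1, and on the line, hence the value 0.\<close>

fun side_opt :: "real option \<Rightarrow> real option \<Rightarrow> complex option \<Rightarrow> real" where
  "side_opt p q (Some z) = side p q z"
| "side_opt (Some p) (Some q) None = 1"
| "side_opt p q None = 0"

lemma side_real: "side (Some p) (Some q) (complex_of_real t) = (t - p) * (t - q)"
  by simp

lemma side_nonzero:
  assumes "p \<noteq> q" "t \<noteq> p" "t \<noteq> q"
  shows "side_opt p q (emb t) \<noteq> 0"
proof (cases p; cases q; cases t)
  fix a b d assume *: "p = Some a" "q = Some b" "t = Some d"
  then show ?thesis using assms by (simp add: side_real del: side.simps)
qed (use assms in auto)

text \<open>One point is taken on each arc between \<open>x\<close> and \<open>y\<close>, so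
  \<open>p\<close> and \<open>q\<close> in turn separate \<open>x\<close> from \<open>y\<close>, and
  exactly one of \<open>x\<close>, \<open>y\<close> lies on the negative side. The finite and
  infinite positions are checked one by one.\<close>

lemma side_separates:
  assumes "x \<noteq> y" "p \<in> oarc x y" "q \<in> oarc y x"
  shows "side_opt p q (emb x) * side_opt p q (emb y) < 0"
proof (cases x; cases y)
  assume "x = None" "y = None" then show ?thesis using assms by simp
next
  fix a assume *: "x = None" "y = Some a"
  then obtain s t where st: "p = Some s" "q = Some t" "s < a" "a < t" using assms by auto
  then have "(a - s) * (a - t) < 0" by (intro mult_pos_neg) auto
  then show ?thesis using * st by (simp add: side_real del: side.simps)
next
  fix a assume *: "x = Some a" "y = None"
  then obtain s t where st: "p = Some s" "q = Some t" "a < s" "t < a" using assms by auto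
  then have "(a - s) * (a - t) < 0" by (intro mult_neg_pos) auto
  then show ?thesis using * st by (simp add: side_real del: side.simps)
next
  fix a b assume *: "x = Some a" "y = Some b"
  show ?thesis
  proof (cases "a < b")
    case True
    then obtain s where s: "p = Some s" "a < s" "s < b" using assms * by auto
    show ?thesis
    proof (cases q)
      case None
      have "(a - s) * (b - s) < 0" using s by (intro mult_neg_pos) auto
      then show ?thesis using * s None by simp
    next
      case (Some t)
      then have "t < a \<or> t > b" using assms * True by auto
      then have "((a - s) * (a - t)) * ((b - s) * (b - t)) < 0"
      proof
        assume "t < a"
        then have "(a - s) * (a - t) < 0" "(b - s) * (b - t) > 0"
          using s by (auto intro!: mult_neg_pos mult_pos_pos)
        then show ?thesis by (rule mult_neg_pos)
      next
        assume "t > b"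
        then have "(a - s) * (a - t) > 0" "(b - s) * (b - t) < 0"
          using s by (auto intro!: mult_neg_neg mult_pos_neg)
        then show ?thesis by (rule mult_pos_neg)
      qed
      then show ?thesis using * s Some by (simp add: side_real del: side.simps)
    qed
  next
    case False
    then have ba: "b < a" using assms * by auto
    then obtain t where t: "q = Some t" "b < t" "t < a" using assms * by auto
    show ?thesis
    proof (cases p)
      case None
      have "(a - t) * (b - t) < 0" using t by (intro mult_pos_neg) auto
      then show ?thesis using * t None by simp
    next
      case (Some s)
      then have "s < b \<or> s > a" using assms * ba by auto
      then have "((a - s) * (a - t)) * ((b - s) * (b - t)) < 0"
      proof
        assume "s < b"
        then have "(a - s) * (a - t) > 0" "(b - s) * (b - t) < 0"
          using t by (auto intro!: mult_pos_neg mult_pos_pos)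
        then show ?thesis by (rule mult_pos_neg)
      next
        assume "s > a"
        then have "(a - s) * (a - t) < 0" "(b - s) * (b - t) > 0"
          using t ba by (auto intro!: mult_neg_neg mult_neg_pos)
        then show ?thesis by (rule mult_neg_pos)
      qed
      then show ?thesis using * t Some by (simp add: side_real del: side.simps)
    qed
  qed
qed

lemma bounded_side: "bounded {z. side (Some a) (Some b) z \<le> 0}"
proof -
  define m where "m = complex_of_real ((a + b) / 2)"
  have "dist m z \<le> \<bar>a - b\<bar>" if "side (Some a) (Some b) z \<le> 0" for z
  proof -
    have "side (Some a) (Some b) z = (cmod (z - m))\<^sup>2 - ((a - b)/2)\<^sup>2"
      unfolding cmod_power2 by (simp add: m_def power2_eq_square field_simps)
    then have "(cmod (z - m))\<^sup>2 \<le> (\<bar>a - b\<bar>/2)\<^sup>2" using that by (simp add: power_divide)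
    then have "cmod (z - m) \<le> \<bar>a - b\<bar>/2" by (rule power2_le_imp_le) auto
    then show ?thesis by (simp add: dist_norm norm_minus_commute)
  qed
  then show ?thesis unfolding bounded_def by blast
qed

lemma continuous_side: "continuous_on UNIV (side p q)"
proof (cases p; cases q)
  fix a b assume "p = Some a" "q = Some b"
  moreover have "side (Some a) (Some b) = (\<lambda>z. Re ((z - of_real a) * cnj (z - of_real b)))"
    by (rule ext) (rule side.simps)
  ultimately show ?thesis by (simp only:) (intro continuous_intros)
qed (auto intro!: continuous_intros)

lemma openin_side_neg: "openin sphere_top {x. side_opt p q x < 0}"
proof -
  have "{x. side_opt p q x < 0} = Some ` {z. side p q z < 0}"
  proof safe
    fix x assume *: "side_opt p q x < 0"
    then have "x \<noteq> None" by (cases x; cases p; cases q) auto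
    then show "x \<in> Some ` {z. side p q z < 0}" using * by (auto simp del: side.simps)
  qed auto
  moreover have "open {z. side p q z < 0}"
    by (intro open_Collect_less continuous_side continuous_intros)
  ultimately show ?thesis by simp
qed

text \<open>Infinity belongs to the set only for finite \<open>p\<close> and \<open>q\<close>, and
  then the complement is a closed disc, hence compact.\<close>

lemma openin_side_pos: "openin sphere_top {x. side_opt p q x > 0}"
proof (cases "\<exists>a b. p = Some a \<and> q = Some b")
  case True
  then obtain a b where ab: "p = Some a" "q = Some b" by auto
  have cl: "closed {z. side p q z \<le> 0}"
    by (intro closed_Collect_le continuous_side continuous_intros)
  moreover have "compact {z. side p q z \<le> 0}"
    using bounded_side[of a b] cl unfolding ab compact_eq_bounded_closed by blast
  moreover have "{x. side_opt p q x > 0} = insert None (Some ` (topspace euclidean - {z. side p q z \<le> 0}))"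
  proof safe
    fix x assume "side_opt p q x > 0" "x \<notin> Some ` (topspace euclidean - {z. side p q z \<le> 0})"
    then show "x = None" by (cases x) (auto simp del: side.simps)
  qed (auto simp: ab simp del: side.simps)
  ultimately show ?thesis unfolding openin_Alexandroff_compactification
    by (intro disjI2 exI[of _ "{z. side p q z \<le> 0}"]) auto
next
  case False
  have "{x. side_opt p q x > 0} = Some ` {z. side p q z > 0}"
  proof safe
    fix x assume *: "side_opt p q x > 0"
    then have "x \<noteq> None" using False by (cases x; cases p; cases q) auto
    then show "x \<in> Some ` {z. side p q z > 0}" using * by (auto simp del: side.simps)
  qed auto
  moreover have "open {z. side p q z > 0}"
    by (intro open_Collect_less continuous_side continuous_intros)
  ultimately show ?thesis by simp
qed

text \<open>The circle through \<open>p\<close> and \<open>q\<close> orthogonal to the real line separates the two arcs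
  between \<open>p\<close> and \<open>q\<close>.\<close>

lemma connected_contains_arc:
  assumes C: "connectedin sphere_top C" "C \<subseteq> range emb" and xy: "emb x \<in> C" "emb y \<in> C" "x \<noteq> y"
  shows "emb ` oarc x y \<subseteq> C \<or> emb ` oarc y x \<subseteq> C"
proof (rule ccontr)
  assume "\<not> ?thesis"
  then obtain p q where pq: "p \<in> oarc x y" "emb p \<notin> C" "q \<in> oarc y x" "emb q \<notin> C" by blast
  have sep: "side_opt p q (emb x) * side_opt p q (emb y) < 0"
    by (rule side_separates[OF xy(3) pq(1,3)])
  have "p \<noteq> q"
  proof
    assume "p = q"
    then show False using pq(1,3) xy(3) by (cases x; cases y; cases q) (auto split: if_splits)
  qed
  then have "C \<subseteq> {x. side_opt p q x < 0} \<union> {x. side_opt p q x > 0}"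
    using side_nonzero[of p q] C(2) pq by (fastforce simp: linorder_neq_iff)
  moreover have "{x. side_opt p q x < 0} \<inter> {x. side_opt p q x > 0} \<inter> C = {}" by auto
  moreover have "{x. side_opt p q x < 0} \<inter> C \<noteq> {}" "{x. side_opt p q x > 0} \<inter> C \<noteq> {}"
    using sep xy(1,2) by (auto simp: mult_less_0_iff)
  ultimately show False
    using connectedinD[OF C(1) openin_side_neg[of p q] openin_side_pos[of p q]] by simp
qed

section \<open>Sections of the rational function over the upper half plane\<close>

abbreviation cnjo :: "complex option \<Rightarrow> complex option" where "cnjo \<equiv> map_option cnj"

definition closed_upper :: "complex option set" where
  "closed_upper = insert None (Some ` {z. 0 \<le> Im z})"

text \<open>The punctured neighbourhoods of \<open>t\<close> on the sphere, cut down to the open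
  upper half plane and written as a filter of finite points; see
  \<open>atin_within_upper\<close>.\<close>

definition upper_filter :: "complex option \<Rightarrow> complex filter" where
  "upper_filter t = (case t of None \<Rightarrow> inf at_infinity (principal upper) | Some t \<Rightarrow> at t within upper)"

lemma closedin_closed_upper: "closedin sphere_top closed_upper"
proof -
  have "- closed_upper = Some ` {z. Im z < 0}"
    unfolding closed_upper_def by (auto simp: image_iff) (metis linorder_not_less option.exhaust)
  then show ?thesis by (simp add: closedin_sphere open_halfspace_Im_lt)
qed

lemma upper_filter_nontrivial:
  assumes "t \<in> closed_upper"
  shows "upper_filter t \<noteq> bot"
proof (cases t)
  case None
  have "\<not> eventually (\<lambda>_. False) (inf at_infinity (principal upper))"
  proof
    assume "eventually (\<lambda>_. False) (inf at_infinity (principal upper))"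
    then obtain b where b: "\<forall>z. b \<le> cmod z \<longrightarrow> z \<notin> upper"
      by (auto simp: eventually_inf_principal eventually_at_infinity)
    have "cmod (Complex 0 (\<bar>b\<bar> + 1)) = \<bar>b\<bar> + 1" by (simp add: cmod_def)
    moreover have "0 < \<bar>b\<bar> + 1" "b \<le> \<bar>b\<bar> + 1" by linarith+
    ultimately show False using b[rule_format, of "Complex 0 (\<bar>b\<bar> + 1)"] by auto
  qed
  then show ?thesis using None by (auto simp: upper_filter_def trivial_limit_def)
next
  case (Some z)
  then have z: "Im z \<ge> 0" using assms by (auto simp: closed_upper_def)
  have "z \<in> closure upper"
    unfolding closure_approachable
  proof safe
    fix e :: real assume "e > 0"
    then show "\<exists>y\<in>upper. dist y z < e"
      using z by (intro bexI[of _ "z + \<i> * (e/2)"]) (auto simp: dist_norm norm_mult)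
  qed
  moreover have "z islimpt upper" if "z \<in> upper"
    using that by (intro interior_limit_point) (simp add: interior_open open_halfspace_Im_gt)
  ultimately have "z islimpt upper" by (auto simp: closure_def)
  then show ?thesis by (simp add: Some upper_filter_def trivial_limit_within)
qed

lemma atin_within_upper: "atin_within sphere_top t (Some ` upper) = filtermap Some (upper_filter t)"
  by (cases t) (simp_all add: upper_filter_def atin_sphere_None atin_sphere_Some)

lemma limitin_Some_upper_filter: "limitin sphere_top Some t (upper_filter t)"
proof (cases t)
  case None
  have "filterlim (\<lambda>x. x) at_infinity (inf at_infinity (principal upper))"
    by (simp add: filterlim_inf filterlim_def)
  then show ?thesis using None limitin_sphere_None[of "\<lambda>x. x"] by (simp add: upper_filter_def)
next
  case (Some z)
  then show ?thesis using limitin_sphere_Some[of "\<lambda>x. x"] by (simp add: upper_filter_def)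
qed

lemma closed_upper_subset_closure: "closed_upper \<subseteq> sphere_top closure_of (Some ` upper)"
proof
  fix t assume t: "t \<in> closed_upper"
  show "t \<in> sphere_top closure_of (Some ` upper)"
    unfolding in_closure_of
  proof safe
    fix T assume T: "t \<in> T" "openin sphere_top T"
    have "eventually (\<lambda>y. Some y \<in> T) (upper_filter t)" by (rule limitinD[OF limitin_Some_upper_filter T(2,1)])
    moreover have "eventually (\<lambda>y. y \<in> upper) (upper_filter t)"
      by (cases t) (auto simp: upper_filter_def eventually_inf_principal eventually_at_filter)
    ultimately have "eventually (\<lambda>y. Some y \<in> T \<and> y \<in> upper) (upper_filter t)" by eventually_elim simp
    then obtain y where "Some y \<in> T" "y \<in> upper"
      using upper_filter_nontrivial[OF t] eventually_happens by blast
    then show "\<exists>y. y \<in> Some ` upper \<and> y \<in> T" by blast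
  qed simp
qed

lemma eventually_upper_filter: "eventually (\<lambda>y. y \<in> upper) (upper_filter t)"
  by (cases t) (auto simp: upper_filter_def eventually_inf_principal eventually_at_filter)

section \<open>Fibres as zero sets of polynomials\<close>

lemma ratmap_eq_Some_iff:
  assumes "\<And>z. poly p z \<noteq> 0 \<or> poly q z \<noteq> 0"
  shows "ratmap p q (Some z) = Some y \<longleftrightarrow> poly (p - smult y q) z = 0"
  using assms[of z] by (auto simp: sphere_quot_def field_simps)

lemma ratmap_eq_iff:
  assumes "\<And>z. poly p z \<noteq> 0 \<or> poly q z \<noteq> 0"
  shows "ratmap p q (Some z) = t \<longleftrightarrow> poly (fibre_poly p q t) z = 0"
  using ratmap_eq_Some_iff[OF assms] by (cases t) (auto simp: sphere_quot_def)

lemma map_poly_of_real_add: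
  "map_poly of_real (A + B) = map_poly of_real A + (map_poly of_real B :: complex poly)"
  by (rule poly_eqI) (simp add: coeff_map_poly)

lemma map_poly_of_real_mult:
  "map_poly of_real (A * B) = map_poly of_real A * (map_poly of_real B :: complex poly)"
  by (rule poly_eqI) (simp add: coeff_map_poly coeff_mult)

lemma Some_in_range_emb: "Some z \<in> range emb \<longleftrightarrow> Im z = 0"
proof
  assume "Im z = 0"
  then have "Some z = emb (Some (Re z))" by (simp add: complex_eq_iff)
  then show "Some z \<in> range emb" by blast
qed (auto simp: image_iff split_option_ex)

lemma range_emb_iff: "x \<in> range emb \<longleftrightarrow> cnjo x = x"
proof (cases x)
  case None
  then have "x = emb None" by simp
  then have "x \<in> range emb" by blast
  then show ?thesis using None by simp
next
  case (Some z)
  then show ?thesis by (simp add: Some_in_range_emb complex_eq_iff)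
qed

text \<open>A nonzero combination of least degree divides every combination, because the remainder
  would be a combination of smaller degree. It therefore divides both polynomials and is a
  unit.\<close>

lemma coprime_poly_bezout:
  fixes P Q :: "'a::field poly"
  assumes "coprime P Q"
  shows "\<exists>s t. s * P + t * Q = 1"
proof -
  define S where "S = (\<lambda>d. d \<noteq> 0 \<and> (\<exists>s t. d = s * P + t * Q))"
  have "P \<noteq> 0 \<or> Q \<noteq> 0" using assms by auto
  moreover have "P = 1 * P + 0 * Q" "Q = 0 * P + 1 * Q" by simp_all
  ultimately obtain d0 where "S d0" unfolding S_def by blast
  then obtain d where d: "S d" "\<And>x. S x \<Longrightarrow> degree d \<le> degree x"
    using ex_has_least_nat[of S d0 degree] by blast
  then obtain s t where st: "d = s * P + t * Q" and d0: "d \<noteq> 0" by (auto simp: S_def)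
  have dvd: "d dvd p * P + q * Q" for p q
  proof -
    let ?X = "p * P + q * Q"
    define m where "m = ?X div d"
    have "?X mod d = ?X - m * d" unfolding m_def by (rule minus_div_mult_eq_mod[symmetric])
    also have "\<dots> = ?X - m * (s * P + t * Q)" by (simp only: st)
    also have "\<dots> = (p - m * s) * P + (q - m * t) * Q" by (simp add: algebra_simps)
    finally have "?X mod d = 0 \<or> S (?X mod d)" unfolding S_def by blast
    moreover have "\<not> S (?X mod d)"
    proof
      assume *: "S (?X mod d)"
      then have "?X mod d \<noteq> 0" unfolding S_def by (rule conjunct1)
      then have "degree (?X mod d) < degree d" using degree_mod_less[OF d0, of ?X] by blast
      then show False using d(2)[OF *] by simp
    qed
    ultimately show ?thesis by (simp add: mod_eq_0_iff_dvd)
  qed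
  have "d dvd P" "d dvd Q" using dvd[of 1 0] dvd[of 0 1] by simp_all
  then have "is_unit d" by (rule coprime_common_divisor[OF assms])
  then obtain e where "1 = d * e" by (rule dvdE)
  then have "(e * s) * P + (e * t) * Q = 1" unfolding st by (simp add: algebra_simps)
  then show ?thesis by blast
qed

locale cubic_setting = cubic_change_of_variable +
  assumes standing: standing_assumptions
begin

definition cP :: "complex poly" where "cP = map_poly of_real P"
definition cQ :: "complex poly" where "cQ = map_poly of_real Q"

lemma R_eq: "R = ratmap cP cQ" by (simp add: R_def cP_def cQ_def)
lemma mult_eq: "mult = local_mult cP cQ" by (simp add: mult_def cP_def cQ_def)

lemma degree_cP: "degree cP = degree P" and degree_cQ: "degree cQ = degree Q"
  by (simp_all add: cP_def cQ_def degree_map_poly)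

lemma max_degree: "max (degree cP) (degree cQ) = 3"
  using standing by (simp add: standing_assumptions_def degree_cP degree_cQ)

text \<open>A Bezout identity over the reals remains valid over the complex numbers and rules out
  common complex roots.\<close>

lemma no_common_root: "poly cP z \<noteq> 0 \<or> poly cQ z \<noteq> 0"
proof -
  have "coprime P Q" using standing by (simp add: standing_assumptions_def)
  then obtain s t where "s * P + t * Q = 1" using coprime_poly_bezout by blast
  then have "map_poly of_real (s * P + t * Q) = (1 :: complex poly)" by simp
  then have "map_poly of_real s * cP + map_poly of_real t * cQ = 1"
    by (simp add: cP_def cQ_def map_poly_of_real_add map_poly_of_real_mult)
  then have "poly (map_poly of_real s * cP + map_poly of_real t * cQ) z = 1" by simp
  then show ?thesis by auto
qed

lemma continuous_R: "continuous_map sphere_top sphere_top R"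
  unfolding R_eq using max_degree by (intro continuous_map_ratmap no_common_root) auto

lemma R_Some_iff: "R (Some z) = t \<longleftrightarrow> poly (fibre_poly cP cQ t) z = 0"
  unfolding R_eq by (rule ratmap_eq_iff[OF no_common_root])

lemma R_None: "R None = sphere_quot (coeff cP 3) (coeff cQ 3)"
  unfolding R_eq using ratmap_None_eq[of cP cQ] max_degree by simp

lemma coeff3: "coeff cP 3 \<noteq> 0 \<or> coeff cQ 3 \<noteq> 0"
proof -
  have nz: "coeff A 3 \<noteq> 0" if "degree A = 3" for A :: "complex poly"
    using that by (metis degree_0 leading_coeff_neq_0 zero_neq_numeral)
  have "degree cP = 3 \<or> degree cQ = 3" using max_degree by (auto simp: max_def split: if_splits)
  then show ?thesis using nz by auto
qed

lemma degree_fibre_poly: "degree (fibre_poly cP cQ t) \<le> 3"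
proof (cases t)
  case (Some y)
  have "degree (cP - smult y cQ) \<le> max (degree cP) (degree (smult y cQ))" by (rule degree_diff_le_max)
  also have "\<dots> \<le> max (degree cP) (degree cQ)" by (intro max.mono) (auto simp: degree_smult_le)
  finally show ?thesis using Some max_degree by simp
qed (use max_degree in \<open>auto simp: max_def split: if_splits\<close>)

lemma R_None_iff: "R None = t \<longleftrightarrow> coeff (fibre_poly cP cQ t) 3 = 0"
  using coeff3 by (cases t) (auto simp: R_None sphere_quot_def field_simps)

text \<open>Otherwise \<open>cQ\<close> would vanish or \<open>cP\<close> would be a multiple of it,
  and a root of the nonconstant polynomial would be common to both.\<close>

lemma fibre_poly_nonzero: "fibre_poly cP cQ t \<noteq> 0"
proof
  assume *: "fibre_poly cP cQ t = 0"
  show False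
  proof (cases t)
    case None
    then have q0: "cQ = 0" using * by simp
    then have "degree cP > 0" using max_degree by auto
    then obtain w where "poly cP w = 0" using alg_closed_imp_poly_has_root by blast
    then show False using no_common_root[of w] by (simp add: q0)
  next
    case (Some y)
    then have eq: "cP = smult y cQ" using * by simp
    have "degree cQ > 0"
      using max_degree degree_smult_le[of y cQ] unfolding eq by (auto simp: max_def split: if_splits)
    then obtain w where "poly cQ w = 0" using alg_closed_imp_poly_has_root by blast
    then show False using no_common_root[of w] by (simp add: eq)
  qed
qed

lemma finite_fibre: "finite (R -` {t})"
proof -
  have "R -` {t} \<subseteq> insert None (Some ` {z. poly (fibre_poly cP cQ t) z = 0})"
  proof
    fix x assume "x \<in> R -` {t}"
    then show "x \<in> insert None (Some ` {z. poly (fibre_poly cP cQ t) z = 0})"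
      by (cases x) (auto simp: R_Some_iff)
  qed
  moreover have "finite {z. poly (fibre_poly cP cQ t) z = 0}"
    using poly_roots_finite[OF fibre_poly_nonzero] .
  ultimately show ?thesis by (meson finite.insertI finite_imageI finite_subset)
qed

lemma cnj_poly: "cnj (poly (map_poly of_real A) z) = poly (map_poly of_real A) (cnj z)"
  for A :: "real poly"
  by (induction A) (auto simp: map_poly_pCons)

lemma R_cnjo: "R (cnjo x) = cnjo (R x)"
proof (cases x)
  case None
  have "cnj (coeff cP 3) = coeff cP 3" "cnj (coeff cQ 3) = coeff cQ 3"
    by (simp_all add: cP_def cQ_def coeff_map_poly)
  then show ?thesis unfolding None R_None
    by (simp add: R_None sphere_quot_def)
next
  case (Some z)
  have "poly cP (cnj z) = cnj (poly cP z)" "poly cQ (cnj z) = cnj (poly cQ z)"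
    by (simp_all add: cP_def cQ_def cnj_poly)
  then show ?thesis unfolding Some R_eq by (simp add: sphere_quot_def)
qed

lemma R_real: "R (emb x) \<in> range emb"
proof -
  have "cnjo (emb x) = emb x" by (cases x) auto
  then show ?thesis unfolding range_emb_iff by (metis R_cnjo)
qed

lemma critical_value_real:
  assumes "2 \<le> mult x"
  shows "R x \<in> emb ` a ` {1..4}"
proof -
  have "R ` {x. 2 \<le> mult x} = emb ` a ` {1..4}"
    using standing by (simp only: standing_assumptions_def)
  then show ?thesis using assms by auto
qed

text \<open>Infinity and all critical points have real images, so over a nonreal \<open>y\<close>
  there are three finite simple preimages.\<close>

lemma fibre_upper:
  assumes "Im y > 0"
  shows "rsquarefree (cP - smult y cQ)" "degree (cP - smult y cQ) = 3" "card {z. poly (cP - smult y cQ) z = 0} = 3"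
proof -
  have "R None \<noteq> Some y"
  proof
    assume "R None = Some y"
    then have "Some y \<in> range emb" using R_real[of None] by simp
    then show False using assms by (simp add: Some_in_range_emb)
  qed
  then have c3: "coeff (cP - smult y cQ) 3 \<noteq> 0" using R_None_iff[of "Some y"] by simp
  then show deg: "degree (cP - smult y cQ) = 3"
    using degree_fibre_poly[of "Some y"] le_degree[of "cP - smult y cQ" 3] by simp
  show rs: "rsquarefree (cP - smult y cQ)"
    unfolding rsquarefree_def
  proof (intro conjI allI)
    show "cP - smult y cQ \<noteq> 0" using c3 by auto
    fix z
    show "order z (cP - smult y cQ) = 0 \<or> order z (cP - smult y cQ) = 1"
    proof (rule ccontr)
      assume *: "\<not> ?thesis"
      then have "poly (cP - smult y cQ) z = 0" using order_root[of "cP - smult y cQ" z] by metis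
      then have Rz: "R (Some z) = Some y" by (simp add: R_Some_iff)
      then have "mult (Some z) \<ge> 2" using * unfolding mult_eq by (simp flip: R_eq)
      then have "Some y \<in> range emb" proof -
        have "Some y \<in> emb ` a ` {1..4}" using critical_value_real[OF \<open>mult (Some z) \<ge> 2\<close>] Rz by simp
        then show ?thesis by blast
      qed
      then show False using assms by (simp add: Some_in_range_emb)
    qed
  qed
  show "card {z. poly (cP - smult y cQ) z = 0} = 3"
  proof -
    define F where "F = cP - smult y cQ"
    have "F \<noteq> 0" using c3 by (auto simp: F_def)
    then have fin: "finite {z. poly F z = 0}" by (rule poly_roots_finite)
    have "degree F = degree (smult (lead_coeff F) (\<Prod>z|poly F z = 0. [:-z, 1:]))"
      using complex_poly_decompose_rsquarefree[of F] rs by (simp add: F_def)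
    also have "\<dots> = (\<Sum>z|poly F z = 0. degree [:-z, 1:])"
      using \<open>F \<noteq> 0\<close> by (simp only: degree_smult_eq leading_coeff_0_iff if_False)
        (rule degree_prod_eq_sum_degree, simp)
    also have "\<dots> = card {z. poly F z = 0}" by simp
    finally show ?thesis using deg by (simp add: F_def)
  qed
qed

section \<open>The covering of the upper half plane\<close>

definition Rc :: "complex \<Rightarrow> complex" where "Rc z = poly cP z / poly cQ z"

definition Hpre :: "complex set" where "Hpre = {z. poly cQ z \<noteq> 0 \<and> Im (Rc z) > 0}"

lemma R_Some_eq_Some: "R (Some z) = Some y \<longleftrightarrow> poly cQ z \<noteq> 0 \<and> Rc z = y"
  by (auto simp: R_eq Rc_def sphere_quot_def)

lemma Rc_root_iff: "z \<in> Hpre \<and> Rc z = y \<longleftrightarrow> Im y > 0 \<and> poly (cP - smult y cQ) z = 0"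
  using R_Some_iff[of z "Some y"] R_Some_eq_Some[of z y] by (auto simp: Hpre_def)

lemma open_Qnz: "open {z. poly cQ z \<noteq> 0}"
  by (intro open_Collect_neq continuous_intros)

lemma holomorphic_Rc: "Rc holomorphic_on {z. poly cQ z \<noteq> 0}"
  unfolding Rc_def by (intro holomorphic_intros) auto

lemma open_Hpre: "open Hpre"
proof -
  have "continuous_on {z. poly cQ z \<noteq> 0} (\<lambda>z. Im (Rc z))"
    using holomorphic_on_imp_continuous_on[OF holomorphic_Rc] by (intro continuous_intros)
  then have "open ((\<lambda>z. Im (Rc z)) -` {0<..} \<inter> {z. poly cQ z \<noteq> 0})"
    using open_Qnz by (simp add: Int_commute continuous_open_preimage)
  then show ?thesis by (simp add: Hpre_def vimage_def Int_def conj_commute)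
qed

text \<open>At a zero of F = P - y Q the derivative of P/Q equals F'/Q, and the zeros of F over the
  upper half plane are simple.\<close>

lemma deriv_Rc_nonzero:
  assumes "z \<in> Hpre"
  shows "deriv Rc z \<noteq> 0"
proof -
  define y where "y = Rc z"
  define F where "F = cP - smult y cQ"
  have y: "Im y > 0" and root: "poly F z = 0" using Rc_root_iff[of z y] assms by (auto simp: y_def F_def)
  have q: "poly cQ z \<noteq> 0" using assms by (simp add: Hpre_def)
  have dF: "poly (pderiv F) z \<noteq> 0"
    using fibre_upper(1)[OF y] root by (auto simp: rsquarefree_roots F_def)
  have "(Rc has_field_derivative (poly (pderiv cP) z * poly cQ z - poly cP z * poly (pderiv cQ) z) / (poly cQ z * poly cQ z)) (at z)"
    unfolding Rc_def using q by (auto intro!: derivative_eq_intros poly_DERIV)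
  then have "deriv Rc z = (poly (pderiv cP) z * poly cQ z - poly cP z * poly (pderiv cQ) z) / (poly cQ z * poly cQ z)"
    by (rule DERIV_imp_deriv)
  also have "poly cP z = y * poly cQ z" using root by (simp add: F_def)
  also have "(poly (pderiv cP) z * poly cQ z - y * poly cQ z * poly (pderiv cQ) z) / (poly cQ z * poly cQ z)
     = poly (pderiv F) z / poly cQ z"
    using q by (simp add: F_def pderiv_diff pderiv_smult field_simps)
  finally show ?thesis using dF q by simp
qed

text \<open>The three preimages of \<open>y\<close> have disjoint discs on which \<open>Rc\<close>
  is injective. Over the intersection \<open>T\<close> of the images of these discs each disc
  supplies one preimage. Since fibres have three points there are no others, so the discs, cut down
  to the preimage of \<open>T\<close>, are the sheets over \<open>T\<close>.\<close>

lemma covering_Rc: "covering_space Hpre Rc upper"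
proof (rule covering_spaceI)
  show "continuous_on Hpre Rc"
    using holomorphic_on_imp_continuous_on[OF holomorphic_Rc] by (rule continuous_on_subset) (auto simp: Hpre_def)
  show "Rc ` Hpre = upper"
  proof safe
    fix y :: complex assume y: "0 < Im y"
    have "{z. poly (cP - smult y cQ) z = 0} \<noteq> {}"
      using fibre_upper(3)[OF y] by (intro notI) simp
    then obtain z where "poly (cP - smult y cQ) z = 0" by blast
    then show "y \<in> Rc ` Hpre" using Rc_root_iff[of z y] y by blast
  qed (auto simp: Hpre_def)
next
  fix y assume "y \<in> upper"
  then have y: "Im y > 0" by simp
  define Z where "Z = {z. poly (cP - smult y cQ) z = 0}"
  have cardZ: "card Z = 3" using fibre_upper(3)[OF y] by (simp only: Z_def)
  then have finZ: "finite Z" by (intro card_ge_0_finite) simp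
  have ZH: "z \<in> Hpre" "Rc z = y" if "z \<in> Z" for z using Rc_root_iff[of z y] y that by (auto simp: Z_def)
  have holo: "Rc holomorphic_on Hpre" using holomorphic_Rc by (rule holomorphic_on_subset) (auto simp: Hpre_def)
  have "\<exists>e>0. ball z e \<subseteq> Hpre \<and> inj_on Rc (ball z e)" if "z \<in> Z" for z
    using has_complex_derivative_locally_injective[OF holo ZH(1)[OF that] open_Hpre deriv_Rc_nonzero[OF ZH(1)[OF that]]]
    by metis
  then obtain e where e: "\<And>z. z \<in> Z \<Longrightarrow> e z > 0" "\<And>z. z \<in> Z \<Longrightarrow> ball z (e z) \<subseteq> Hpre"
     "\<And>z. z \<in> Z \<Longrightarrow> inj_on Rc (ball z (e z))" by metis
  \<comment> \<open>Half distances, so that discs of radius \<open>\<rho>\<close> about different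
    preimages are disjoint.\<close>
  define D where "D = {dist z w / 2 | z w. z \<in> Z \<and> w \<in> Z \<and> z \<noteq> w}"
  have "D \<subseteq> (\<lambda>u. dist (fst u) (snd u) / 2) ` (Z \<times> Z)" by (force simp: D_def)
  then have finD: "finite D" using finZ by (meson finite_SigmaI finite_imageI finite_subset)
  define \<rho> where "\<rho> = Min (e ` Z \<union> D)"
  have "Z \<noteq> {}" using cardZ by auto
  have \<rho>_in: "\<rho> \<in> e ` Z \<union> D" unfolding \<rho>_def using finZ finD \<open>Z \<noteq> {}\<close> by (intro Min_in) auto
  have "x > 0" if "x \<in> e ` Z \<union> D" for x
    using that
  proof
    assume "x \<in> D"
    then obtain z w :: complex where "x = dist z w / 2" "z \<noteq> w" by (auto simp: D_def)
    then show ?thesis using zero_less_dist_iff[of z w] by linarith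
  qed (use e(1) in auto)
  then have \<rho>: "\<rho> > 0" using \<rho>_in by simp
  have \<rho>e: "\<rho> \<le> e z" if "z \<in> Z" for z unfolding \<rho>_def using finZ finD that by (intro Min_le) auto
  have disj: "ball z \<rho> \<inter> ball w \<rho> = {}" if "z \<in> Z" "w \<in> Z" "z \<noteq> w" for z w
  proof -
    have "\<rho> \<le> dist z w / 2" unfolding \<rho>_def using finZ finD that by (intro Min_le) (auto simp: D_def)
    then show ?thesis by (intro disjoint_ballI) simp
  qed
  have sub: "ball z \<rho> \<subseteq> Hpre" and inj: "inj_on Rc (ball z \<rho>)" if "z \<in> Z" for z
    using e(2,3)[OF that] \<rho>e[OF that] subset_ball[OF \<rho>e[OF that], of z] inj_on_subset by blast+
  have cont: "continuous_on (ball z \<rho>) Rc" if "z \<in> Z" for z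
    using holomorphic_on_imp_continuous_on[OF holo] sub[OF that] continuous_on_subset by blast
  define T where "T = (\<Inter>z\<in>Z. Rc ` ball z \<rho>)"
  have "open (Rc ` ball z \<rho>)" if "z \<in> Z" for z
    using invariance_of_domain[OF cont[OF that] open_ball inj[OF that]] .
  then have openT: "open T" unfolding T_def using finZ by auto
  have yT: "y \<in> T" unfolding T_def using ZH(2) \<rho> by (auto intro!: image_eqI)
  have T_upper: "T \<subseteq> upper"
  proof -
    obtain z where "z \<in> Z" using \<open>Z \<noteq> {}\<close> by auto
    then show ?thesis using sub[OF \<open>z \<in> Z\<close>] by (force simp: T_def Hpre_def)
  qed
  define v where "v = (\<lambda>z. ball z \<rho> \<inter> Rc -` T) ` Z"
  \<comment> \<open>One preimage in each disc together with \<open>x\<close> outside all of them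
    would give four points in a fibre of three.\<close>
  have preim: "\<exists>z\<in>Z. x \<in> ball z \<rho>" if x: "x \<in> Hpre" "Rc x \<in> T" for x
  proof (rule ccontr)
    assume no: "\<not> ?thesis"
    have "\<forall>z\<in>Z. \<exists>x'\<in>ball z \<rho>. Rc x' = Rc x" using x(2) by (force simp: T_def)
    then obtain h where h: "\<And>z. z \<in> Z \<Longrightarrow> h z \<in> ball z \<rho>" "\<And>z. z \<in> Z \<Longrightarrow> Rc (h z) = Rc x" by metis
    have injh: "inj_on h Z" using h(1) disj by (fastforce simp: inj_on_def)
    have "x \<notin> h ` Z" using no h(1) by auto
    then have "card (insert x (h ` Z)) = 4" using finZ cardZ card_image[OF injh] by simp
    moreover have "insert x (h ` Z) \<subseteq> {z. poly (cP - smult (Rc x) cQ) z = 0}"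
      using Rc_root_iff[of _ "Rc x"] x(1) h sub by blast
    moreover have c3: "card {z. poly (cP - smult (Rc x) cQ) z = 0} = 3"
      using fibre_upper(3)[of "Rc x"] x(1) by (simp add: Hpre_def)
    moreover have "finite {z. poly (cP - smult (Rc x) cQ) z = 0}"
      by (rule card_ge_0_finite) (simp only: c3)
    ultimately have "4 \<le> (3::nat)" by (metis card_mono)
    then show False by simp
  qed
  show "\<exists>T. y \<in> T \<and> openin (top_of_set upper) T \<and>
           (\<exists>v. \<Union>v = Hpre \<inter> Rc -` T \<and> (\<forall>u\<in>v. openin (top_of_set Hpre) u) \<and> pairwise disjnt v \<and>
                (\<forall>u\<in>v. \<exists>q. homeomorphism u T Rc q))"
  proof (intro exI[of _ T] conjI exI[of _ v])
    show "openin (top_of_set upper) T" using openT T_upper by (simp add: open_halfspace_Im_gt openin_open_eq)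
    show "\<Union>v = Hpre \<inter> Rc -` T" unfolding v_def using sub preim by auto
    show "\<forall>u\<in>v. openin (top_of_set Hpre) u"
    proof
      fix u assume "u \<in> v"
      then obtain z where z: "z \<in> Z" "u = ball z \<rho> \<inter> Rc -` T" by (auto simp: v_def)
      have "open u" unfolding z(2) using cont[OF z(1)] openT by (simp add: continuous_open_preimage)
      moreover have "u \<subseteq> Hpre" using z sub by auto
      ultimately show "openin (top_of_set Hpre) u" by (simp add: open_Hpre openin_open_eq)
    qed
    show "pairwise disjnt v" unfolding v_def pairwise_def disjnt_def using disj by blast
    show "\<forall>u\<in>v. \<exists>q. homeomorphism u T Rc q"
    proof
      fix u assume "u \<in> v"
      then obtain z where z: "z \<in> Z" "u = ball z \<rho> \<inter> Rc -` T" by (auto simp: v_def)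
      obtain q where q: "homeomorphism (ball z \<rho>) (Rc ` ball z \<rho>) Rc q"
        using invariance_of_domain_homeomorphism[OF open_ball cont[OF z(1)] _ inj[OF z(1)]] by auto
      have Tsub: "T \<subseteq> Rc ` ball z \<rho>" unfolding T_def using z(1) by (rule INF_lower)
      have "Rc ` u = Rc ` ball z \<rho> \<inter> T" using z(2) by blast
      then have "Rc ` u = T" using Tsub by blast
      moreover have "u \<subseteq> ball z \<rho>" using z(2) by blast
      ultimately have "homeomorphism u T Rc q"
        using homeomorphism_of_subsets[OF q _ Tsub] by blast
      then show "\<exists>q. homeomorphism u T Rc q" by blast
    qed
  qed (use yT in auto)
qed

definition is_sections :: "(3 \<Rightarrow> complex \<Rightarrow> complex) \<Rightarrow> bool" where
  "is_sections r \<longleftrightarrow> (\<forall>s. r s holomorphic_on upper) \<and>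
     (\<forall>y\<in>upper. inj (\<lambda>s. r s y) \<and> {z. poly (cP - smult y cQ) z = 0} = range (\<lambda>s. r s y))"

text \<open>The half plane is simply connected, so the identity lifts through the covering from each
  of the three preimages of the base point \<open>\<i>\<close>. Lifts that agree at one point agree
  everywhere; hence the three never meet and exhaust each fibre. They are holomorphic as local
  inverses of \<open>Rc\<close>.\<close>

lemma ex_sections: "\<exists>r. is_sections r"
proof -
  have *: "card {z. poly (cP - smult \<i> cQ) z = 0} = 3"
    by (rule fibre_upper(3)) simp
  have "finite {z. poly (cP - smult \<i> cQ) z = 0}" by (rule card_ge_0_finite) (simp only: *)
  then obtain e where e: "bij_betw e (UNIV :: 3 set) {z. poly (cP - smult \<i> cQ) z = 0}"
    using * finite_same_card_bij[of "UNIV :: 3 set" "{z. poly (cP - smult \<i> cQ) z = 0}"] by auto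
  have eH: "e s \<in> Hpre" "Rc (e s) = \<i>" for s
    using Rc_root_iff[of "e s" \<i>] bij_betwE[OF e] by auto
  have "\<exists>g. continuous_on upper g \<and> g \<in> upper \<rightarrow> Hpre \<and> g \<i> = e s \<and> (\<forall>y\<in>upper. Rc (g y) = y)" for s
  proof -
    have "simply_connected upper" by (intro convex_imp_simply_connected convex_upper)
    moreover have "locally path_connected upper" by (intro convex_imp_locally_path_connected convex_upper)
    ultimately show ?thesis
      using covering_space_lift_strong[OF covering_Rc eH(1)[of s], of \<i> upper "\<lambda>y. y"] eH(2)[of s]
      by (smt (verit) Pi_I complex_i_not_zero continuous_on_id imaginary_unit.sel(2) mem_Collect_eq zero_less_one)
  qed
  then obtain r where r: "\<And>s. continuous_on upper (r s)" "\<And>s. r s \<in> upper \<rightarrow> Hpre" "\<And>s. r s \<i> = e s"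
     "\<And>s y. y \<in> upper \<Longrightarrow> Rc (r s y) = y" by metis
  have inj: "inj (\<lambda>s. r s y)" if y: "y \<in> upper" for y
  proof (rule injI)
    fix s s' assume "r s y = r s' y"
    then have "r s \<i> = r s' \<i>"
      using covering_space_lift_unique[OF covering_Rc, of "r s" y "r s'" upper "\<lambda>y. y" \<i>] r y
        convex_connected[OF convex_upper] by auto
    then show "s = s'" using e r(3) by (simp add: bij_betw_def inj_on_def)
  qed
  have sub: "range (\<lambda>s. r s y) \<subseteq> {z. poly (cP - smult y cQ) z = 0}" if y: "y \<in> upper" for y
    using Rc_root_iff[of _ y] r(2,4) y by blast
  have "{z. poly (cP - smult y cQ) z = 0} = range (\<lambda>s. r s y)" if y: "y \<in> upper" for y
  proof -
    have "card {z. poly (cP - smult y cQ) z = 0} = 3" using fibre_upper(3) y by simp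
    moreover have "card (range (\<lambda>s. r s y)) = 3" using card_image[OF inj[OF y]] by simp
    moreover have "finite {z. poly (cP - smult y cQ) z = 0}"
      by (rule card_ge_0_finite) (simp only: calculation(1))
    ultimately show ?thesis using card_subset_eq[OF _ sub[OF y]] by (metis (no_types))
  qed
  moreover have "r s holomorphic_on upper" for s
    unfolding holomorphic_on_def
  proof
    fix y :: complex assume y: "y \<in> upper"
    have Hy: "r s y \<in> Hpre" using r(2) y by blast
    have "(Rc has_field_derivative deriv Rc (r s y)) (at (r s y))"
      using holomorphic_derivI[OF holomorphic_Rc open_Qnz] Hy by (simp add: Hpre_def)
    moreover have "isCont (r s) y" using r(1) y by (simp add: continuous_on_eq_continuous_at open_halfspace_Im_gt)
    ultimately have "(r s has_field_derivative inverse (deriv Rc (r s y))) (at y)"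
      using deriv_Rc_nonzero[OF Hy] y r(4)
      by (intro has_field_derivative_inverse_basic[where t = upper]) (auto simp: open_halfspace_Im_gt)
    then show "r s field_differentiable at y within upper"
      using field_differentiable_at_within field_differentiable_def by blast
  qed
  ultimately show ?thesis using inj unfolding is_sections_def by blast
qed

end

section \<open>Multiplicities counted by sections\<close>

definition lin :: "complex option \<Rightarrow> complex poly" where
  "lin x = (case x of None \<Rightarrow> 1 | Some z \<Rightarrow> [:- z, 1:])"

lemma lin_nonzero: "lin x \<noteq> 0"
  by (cases x) (auto simp: lin_def)

lemma order_lin: "order z (lin x) = (if x = Some z then 1 else 0)"
proof (cases x)
  case None
  then show ?thesis by (simp add: lin_def order_0I)
next
  case (Some w)
  show ?thesis
  proof (cases "w = z")
    case True
    then show ?thesis using order_power_n_n[of z 1] Some by (simp add: lin_def)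
  next
    case False
    then show ?thesis using Some by (simp add: lin_def order_0I)
  qed
qed

lemma degree_lin: "degree (lin x) = (if x = None then 0 else 1)"
  by (cases x) (auto simp: lin_def)

lemma order_prod_lin:
  assumes "finite S"
  shows "order z (\<Prod>s\<in>S. lin (f s)) = card {s\<in>S. f s = Some z}"
  using assms
proof (induction S)
  case (insert s S)
  have nz: "(\<Prod>s\<in>S. lin (f s)) \<noteq> 0" using insert.hyps lin_nonzero by auto
  have eq: "{t \<in> insert s S. f t = Some z} = (if f s = Some z then insert s {t\<in>S. f t = Some z} else {t\<in>S. f t = Some z})"
    by auto
  show ?case using insert nz lin_nonzero[of "f s"] unfolding eq
    by (simp add: order_mult order_lin)
qed (simp add: order_0I)

text \<open>A preimage at infinity contributes the factor 1 instead of a linear one, so the missing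
  degree is the number of infinite preimages.\<close>

lemma degree_prod_lin:
  assumes "finite S"
  shows "degree (\<Prod>s\<in>S. lin (f s)) + card {s\<in>S. f s = None} = card S"
  using assms
proof (induction S)
  case (insert s S)
  have nz: "(\<Prod>s\<in>S. lin (f s)) \<noteq> 0" using insert.hyps lin_nonzero by auto
  have eq: "{t \<in> insert s S. f t = None} = (if f s = None then insert s {t\<in>S. f t = None} else {t\<in>S. f t = None})"
    by auto
  show ?case using insert nz lin_nonzero[of "f s"] unfolding eq
    by (simp add: degree_mult_eq degree_lin)
qed simp

text \<open>\<open>g\<close> extends the sections continuously to the closed half plane with
  infinity. Its values on the real line are the boundary values by which the sheets will be
  recognised.\<close>

locale cubic_ext = cubic_setting +
  fixes r :: "3 \<Rightarrow> complex \<Rightarrow> complex" and g :: "3 \<Rightarrow> complex option \<Rightarrow> complex option"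
  assumes sections: "is_sections r"
    and cont_g: "\<And>s. continuous_map (subtopology sphere_top closed_upper) sphere_top (g s)"
    and g_Some: "\<And>s y. y \<in> upper \<Longrightarrow> g s (Some y) = Some (r s y)"
begin

lemma holo_r: "r s holomorphic_on upper"
  and inj_r: "y \<in> upper \<Longrightarrow> inj (\<lambda>s. r s y)"
  and roots_r: "y \<in> upper \<Longrightarrow> {z. poly (cP - smult y cQ) z = 0} = range (\<lambda>s. r s y)"
  using sections by (auto simp: is_sections_def)

lemma R_r: "y \<in> upper \<Longrightarrow> R (Some (r s y)) = Some y"
  using roots_r[of y] by (auto simp: R_Some_iff)

lemma limit_g:
  assumes "t \<in> closed_upper"
  shows "limitin sphere_top (\<lambda>y. Some (r s y)) (g s t) (upper_filter t)"
proof -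
  have "limitin sphere_top (g s) (g s t) (atin (subtopology sphere_top closed_upper) t)"
    using cont_g assms by (auto simp: continuous_map_atin)
  then have "limitin sphere_top (g s) (g s t) (atin_within sphere_top t closed_upper)"
    using assms by (simp add: atin_subtopology_within)
  then have "limitin sphere_top (g s) (g s t) (atin_within sphere_top t (Some ` upper))"
    by (rule limit_within_subset) (auto simp: closed_upper_def)
  then have "limitin sphere_top (\<lambda>y. g s (Some y)) (g s t) (upper_filter t)"
    by (simp add: atin_within_upper limitin_filtermap)
  moreover have "eventually (\<lambda>y. g s (Some y) = Some (r s y)) (upper_filter t)"
    using eventually_upper_filter by (rule eventually_mono) (rule g_Some)
  ultimately show ?thesis by (rule limitin_transform_eventually[rotated])
qed

lemma R_g:
  assumes t: "t \<in> closed_upper"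
  shows "R (g s t) = t"
proof -
  have "limitin sphere_top (\<lambda>y. R (Some (r s y))) (R (g s t)) (upper_filter t)"
    using continuous_map_limit[OF continuous_R limit_g[OF t]] by (simp add: o_def)
  moreover have "eventually (\<lambda>y. R (Some (r s y)) = Some y) (upper_filter t)"
    using eventually_upper_filter by (rule eventually_mono) (rule R_r)
  ultimately have "limitin sphere_top Some (R (g s t)) (upper_filter t)"
    by (rule limitin_transform_eventually[rotated])
  then show ?thesis
    using limitin_Some_upper_filter upper_filter_nontrivial[OF t] Hausdorff_sphere
    by (metis limitin_Hausdorff_unique)
qed

lemma poly_factor_upper:
  assumes y: "y \<in> upper"
  shows "poly cP X - y * poly cQ X = coeff (cP - smult y cQ) 3 * (\<Prod>s\<in>UNIV. X - r s y)"
proof -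
  have Im: "Im y > 0" using y by simp
  define C where "C = coeff (cP - smult y cQ) 3"
  have "cP - smult y cQ = smult C (\<Prod>z\<in>range (\<lambda>s. r s y). [:-z, 1:])"
    using complex_poly_decompose_rsquarefree[OF fibre_upper(1)[OF Im]] fibre_upper(2)[OF Im] roots_r[OF y]
    by (simp add: C_def)
  also have "(\<Prod>z\<in>range (\<lambda>s. r s y). [:-z, 1:]) = (\<Prod>s\<in>UNIV. [:- r s y, 1:])"
    using inj_r[OF y] by (simp add: prod.reindex)
  finally have "poly (cP - smult y cQ) X = poly (smult C (\<Prod>s\<in>UNIV. [:- r s y, 1:])) X"
    by (rule arg_cong)
  then show ?thesis by (simp add: poly_prod C_def)
qed

text \<open>The factorisation of P - y Q passes to the limit as y tends to \<open>t\<close>, once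
  the factors that tend to infinity are normalised. The remaining constant converges because it is
  determined by evaluation at one point \<open>X0\<close> where the limit product is
  nonzero.\<close>

lemma fibre_poly_factor:
  assumes t: "t \<in> closed_upper"
  obtains \<kappa> where "\<kappa> \<noteq> 0" "fibre_poly cP cQ t = smult \<kappa> (\<Prod>s\<in>UNIV. lin (g s t))"
proof -
  define F where "F = upper_filter t"
  have Fnt: "F \<noteq> bot" using upper_filter_nontrivial[OF t] by (simp add: F_def)
  have evU: "eventually (\<lambda>y. y \<in> upper) F" unfolding F_def by (rule eventually_upper_filter)
  \<comment> \<open>At infinity P - y Q is divided by -y and then tends to Q. A factor X - r with r
    tending to infinity is divided by -r and tends to 1. \<open>\<kappa>\<close> collects these
    constants and the leading coefficient.\<close>
  define m where "m = (\<lambda>y::complex. if t = None then - inverse y else 1)"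
  define \<phi> where "\<phi> = (\<lambda>X s y. if g s t = None then 1 - X * inverse (r s y) else X - r s y)"
  define \<kappa> where "\<kappa> = (\<lambda>y. m y * coeff (cP - smult y cQ) 3 * (\<Prod>s\<in>{s. g s t = None}. - r s y))"
  define L where "L = fibre_poly cP cQ t"
  define Lf where "Lf = (\<Prod>s\<in>UNIV. lin (g s t))"
  have lim_L: "((\<lambda>y. m y * (poly cP X - y * poly cQ X)) \<longlongrightarrow> poly L X) F" for X
  proof (cases t)
    case None
    have inf: "filterlim (\<lambda>y. y) at_infinity F"
      using limitin_Some_upper_filter[of t] None limitin_sphere_None[of "\<lambda>y. y"] by (simp add: F_def)
    have "((\<lambda>y. - inverse y * poly cP X + poly cQ X) \<longlongrightarrow> - 0 * poly cP X + poly cQ X) F"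
      using filterlim_compose[OF tendsto_inverse_0 inf] by (intro tendsto_intros)
    moreover have "eventually (\<lambda>y. - inverse y * poly cP X + poly cQ X = m y * (poly cP X - y * poly cQ X)) F"
      using evU
    proof (rule eventually_mono)
      fix y assume "y \<in> upper"
      then have "y \<noteq> 0" by auto
      then show "- inverse y * poly cP X + poly cQ X = m y * (poly cP X - y * poly cQ X)"
        using None by (simp add: m_def field_simps)
    qed
    ultimately show ?thesis using None by (auto simp: L_def elim: Lim_transform_eventually)
  next
    case (Some y0)
    have "((\<lambda>y. y) \<longlongrightarrow> y0) F"
      using limitin_Some_upper_filter[of t] Some limitin_sphere_Some[of "\<lambda>y. y"] by (simp add: F_def)
    then show ?thesis using Some by (auto simp: m_def L_def intro!: tendsto_eq_intros)
  qed
  have lim_\<phi>: "(\<phi> X s \<longlongrightarrow> poly (lin (g s t)) X) F" for X s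
  proof (cases "g s t")
    case None
    have "filterlim (r s) at_infinity F"
      using limit_g[OF t, of s] None by (simp add: F_def limitin_sphere_None)
    have "((\<lambda>y. 1 - X * inverse (r s y)) \<longlongrightarrow> 1 - X * 0) F"
      by (intro tendsto_intros filterlim_compose[OF tendsto_inverse_0 \<open>filterlim (r s) at_infinity F\<close>])
    then show ?thesis using None by (simp add: \<phi>_def lin_def)
  next
    case (Some z)
    have "(r s \<longlongrightarrow> z) F"
      using limit_g[OF t, of s] Some by (simp add: F_def limitin_sphere_Some)
    then have "((\<lambda>y. X - r s y) \<longlongrightarrow> X - z) F" by (intro tendsto_intros)
    then show ?thesis using Some by (simp add: \<phi>_def lin_def)
  qed
  have "eventually (\<lambda>y. r s y \<noteq> 0 \<or> g s t \<noteq> None) F" for s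
  proof (cases "g s t = None")
    case True
    then have "filterlim (r s) at_infinity F"
      using limit_g[OF t, of s] by (simp add: F_def limitin_sphere_None)
    then have "eventually (\<lambda>y. 1 \<le> cmod (r s y)) F" using filterlim_at_infinity[of 0 "r s" F] by auto
    then show ?thesis by (rule eventually_mono) auto
  qed auto
  then have "eventually (\<lambda>y. \<forall>s. r s y \<noteq> 0 \<or> g s t \<noteq> None) F" by (rule eventually_all_finite)
  then have eq: "eventually (\<lambda>y. \<forall>X. m y * (poly cP X - y * poly cQ X) = \<kappa> y * (\<Prod>s\<in>UNIV. \<phi> X s y)) F"
    using evU
  proof eventually_elim
    case (elim y)
    show ?case
    proof
      fix X
      have "(\<Prod>s\<in>{s. g s t = None}. - r s y) * (\<Prod>s\<in>UNIV. \<phi> X s y)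
        = (\<Prod>s\<in>UNIV. (if g s t = None then - r s y else 1) * \<phi> X s y)"
        by (simp add: prod.distrib prod.If_cases)
      also have "\<dots> = (\<Prod>s\<in>UNIV. X - r s y)"
        using elim(1) by (intro prod.cong refl) (auto simp: \<phi>_def field_simps)
      finally have "\<kappa> y * (\<Prod>s\<in>UNIV. \<phi> X s y) = m y * coeff (cP - smult y cQ) 3 * (\<Prod>s\<in>UNIV. X - r s y)"
        by (simp only: \<kappa>_def mult.assoc)
      then show "m y * (poly cP X - y * poly cQ X) = \<kappa> y * (\<Prod>s\<in>UNIV. \<phi> X s y)"
        by (simp only: poly_factor_upper[OF elim(2)] mult.assoc)
    qed
  qed
  have lim_Lf: "((\<lambda>y. \<Prod>s\<in>UNIV. \<phi> X s y) \<longlongrightarrow> poly Lf X) F" for X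
    unfolding Lf_def poly_prod by (intro tendsto_prod lim_\<phi>)
  have "Lf \<noteq> 0" unfolding Lf_def using lin_nonzero by simp
  then obtain X0 where X0: "poly Lf X0 \<noteq> 0" using poly_all_0_iff_0 by blast
  define \<kappa>0 where "\<kappa>0 = poly L X0 / poly Lf X0"
  have lim_\<kappa>: "(\<kappa> \<longlongrightarrow> \<kappa>0) F"
  proof -
    have "((\<lambda>y. m y * (poly cP X0 - y * poly cQ X0) / (\<Prod>s\<in>UNIV. \<phi> X0 s y)) \<longlongrightarrow> \<kappa>0) F"
      unfolding \<kappa>0_def by (intro tendsto_divide lim_L lim_Lf X0)
    moreover have "eventually (\<lambda>y. (\<Prod>s\<in>UNIV. \<phi> X0 s y) \<noteq> 0) F"
      by (rule tendsto_imp_eventually_ne[OF lim_Lf X0])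
    with eq have "eventually (\<lambda>y. m y * (poly cP X0 - y * poly cQ X0) / (\<Prod>s\<in>UNIV. \<phi> X0 s y) = \<kappa> y) F"
      by eventually_elim simp
    ultimately show ?thesis by (rule Lim_transform_eventually)
  qed
  have "poly L X = \<kappa>0 * poly Lf X" for X
  proof (rule tendsto_unique[OF Fnt lim_L])
    have "((\<lambda>y. \<kappa> y * (\<Prod>s\<in>UNIV. \<phi> X s y)) \<longlongrightarrow> \<kappa>0 * poly Lf X) F"
      by (intro tendsto_mult lim_\<kappa> lim_Lf)
    then show "((\<lambda>y. m y * (poly cP X - y * poly cQ X)) \<longlongrightarrow> \<kappa>0 * poly Lf X) F"
      by (rule Lim_transform_eventually) (use eq in \<open>auto elim: eventually_mono\<close>)
  qed
  then have "poly L = poly (smult \<kappa>0 Lf)" by auto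
  then have "L = smult \<kappa>0 Lf" by (simp only: poly_eq_poly_eq_iff)
  moreover from this have "\<kappa>0 \<noteq> 0" using fibre_poly_nonzero[of t] by (auto simp: L_def)
  ultimately show ?thesis using that by (simp add: L_def Lf_def)
qed

text \<open>The order of a root counts equal linear factors, and the degree defect counts the
  factors lost at infinity. Assumptions on multiplicities thus become statements about how many
  sections meet.\<close>

lemma mult_count:
  assumes t: "t \<in> closed_upper" and x: "R x = t"
  shows "mult x = card {s. g s t = x}"
proof -
  obtain \<kappa> where \<kappa>: "\<kappa> \<noteq> 0" "fibre_poly cP cQ t = smult \<kappa> (\<Prod>s\<in>UNIV. lin (g s t))"
    using fibre_poly_factor[OF t] by blast
  show ?thesis
  proof (cases x)
    case (Some z)
    have "mult x = order z (fibre_poly cP cQ t)"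
      using x unfolding Some mult_eq by (simp flip: R_eq)
    then show ?thesis using \<kappa>(1) Some unfolding \<kappa>(2) by (simp add: order_smult order_prod_lin)
  next
    case None
    have "mult x = 3 - degree (fibre_poly cP cQ t)"
      using x max_degree unfolding None mult_eq by (simp flip: R_eq)
    then show ?thesis using \<kappa>(1) None degree_prod_lin[of "UNIV :: 3 set" "\<lambda>s. g s t"] unfolding \<kappa>(2) by simp
  qed
qed

lemma mult_pos: "mult x \<ge> 1"
proof (cases x)
  case (Some z)
  define t where "t = R x"
  have "poly (fibre_poly cP cQ t) z = 0" using Some R_Some_iff[of z t] by (simp add: t_def)
  then have "order z (fibre_poly cP cQ t) \<noteq> 0"
    using order_root[of "fibre_poly cP cQ t" z] fibre_poly_nonzero[of t] by simp
  then show ?thesis using Some unfolding mult_eq t_def by (simp flip: R_eq)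
next
  case None
  define t where "t = R x"
  have "coeff (fibre_poly cP cQ t) 3 = 0" using None R_None_iff[of t] by (simp add: t_def)
  then have "degree (fibre_poly cP cQ t) \<noteq> 3"
    using fibre_poly_nonzero[of t] by (metis leading_coeff_0_iff)
  then have "degree (fibre_poly cP cQ t) < 3" using degree_fibre_poly[of t] by simp
  then show ?thesis using None max_degree unfolding mult_eq t_def by (simp flip: R_eq)
qed

lemma fibre_eq:
  assumes t: "t \<in> closed_upper"
  shows "R -` {t} = range (\<lambda>s. g s t)"
proof
  show "range (\<lambda>s. g s t) \<subseteq> R -` {t}" using R_g[OF t] by auto
  show "R -` {t} \<subseteq> range (\<lambda>s. g s t)"
  proof
    fix x assume "x \<in> R -` {t}"
    then have "card {s. g s t = x} \<ge> 1" using mult_count[OF t, of x] mult_pos[of x] by simp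
    then have "{s. g s t = x} \<noteq> {}" by (metis card.empty not_one_le_zero)
    then show "x \<in> range (\<lambda>s. g s t)" by auto
  qed
qed

lemma inj_g:
  assumes "t \<in> closed_upper" "card (R -` {t}) = 3"
  shows "inj (\<lambda>s. g s t)"
  using assms fibre_eq[OF assms(1)] by (simp add: eq_card_imp_inj_on)

text \<open>The point \<open>\<i>\<close> is merely a base point: by \<open>Im_r_sign\<close> the
  sign is the same on the whole half plane, so \<open>pos s\<close> tells on which side of the real
  line the section \<open>s\<close> runs.\<close>

definition pos :: "3 \<Rightarrow> bool" where "pos s \<longleftrightarrow> Im (r s \<i>) > 0"

lemma r_nonreal: "y \<in> upper \<Longrightarrow> Im (r s y) \<noteq> 0"
proof
  assume y: "y \<in> upper" and "Im (r s y) = 0"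
  then obtain x where "Some (r s y) = emb x" using Some_in_range_emb by blast
  then have "Some y \<in> range emb" using R_real[of x] R_r[OF y, of s] by simp
  then show False using y by (simp add: Some_in_range_emb)
qed

text \<open>A real value of a section would lie over a real point, because \<open>R\<close>
  preserves the real line; connectedness then fixes the sign.\<close>

lemma Im_r_sign:
  assumes y: "y \<in> upper"
  shows "Im (r s y) > 0 \<longleftrightarrow> pos s"
proof -
  have "connected ((\<lambda>y. Im (r s y)) ` upper)"
    by (intro connected_continuous_image continuous_intros holomorphic_on_imp_continuous_on holo_r
        convex_connected convex_upper)
  then have iv: "x \<le> 0 \<Longrightarrow> 0 \<le> x' \<Longrightarrow> 0 \<in> (\<lambda>y. Im (r s y)) ` upper"
    if "x \<in> (\<lambda>y. Im (r s y)) ` upper" "x' \<in> (\<lambda>y. Im (r s y)) ` upper" for x x'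
    using that unfolding connected_iff_interval by blast
  have no: "0 \<notin> (\<lambda>y. Im (r s y)) ` upper" using r_nonreal by fastforce
  have "Im (r s y) \<in> (\<lambda>y. Im (r s y)) ` upper" "Im (r s \<i>) \<in> (\<lambda>y. Im (r s y)) ` upper"
    using y by auto
  then have "\<not> (Im (r s y) \<le> 0 \<and> 0 \<le> Im (r s \<i>))" "\<not> (Im (r s \<i>) \<le> 0 \<and> 0 \<le> Im (r s y))"
    using iv no by blast+
  then show ?thesis unfolding pos_def by linarith
qed

lemma cnjo_cnjo [simp]: "cnjo (cnjo x) = x"
  by (cases x) auto

lemma g_pos:
  assumes t: "t \<in> closed_upper" and s: "pos s"
  shows "g s t \<in> closed_upper"
proof (rule limitin_closedin[OF limit_g[OF t, of s] closedin_closed_upper])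
  show "eventually (\<lambda>y. Some (r s y) \<in> closed_upper) (upper_filter t)"
    using eventually_upper_filter
  proof (rule eventually_mono)
    fix y assume "y \<in> upper"
    then show "Some (r s y) \<in> closed_upper" using Im_r_sign[of y s] s by (auto simp: closed_upper_def)
  qed
qed (rule upper_filter_nontrivial[OF t])

lemma g_neg:
  assumes t: "t \<in> closed_upper" and s: "\<not> pos s"
  shows "cnjo (g s t) \<in> closed_upper"
proof -
  have "limitin sphere_top (\<lambda>y. cnjo (Some (r s y))) (cnjo (g s t)) (upper_filter t)"
    using continuous_map_limit[OF continuous_map_sphere_cnj limit_g[OF t, of s]] by (simp add: o_def)
  then show ?thesis
  proof (rule limitin_closedin[OF _ closedin_closed_upper])
    show "eventually (\<lambda>y. cnjo (Some (r s y)) \<in> closed_upper) (upper_filter t)"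
      using eventually_upper_filter
    proof (rule eventually_mono)
      fix y assume "y \<in> upper"
      then show "cnjo (Some (r s y)) \<in> closed_upper"
        using Im_r_sign[of y s] s by (auto simp: closed_upper_def)
    qed
  qed (rule upper_filter_nontrivial[OF t])
qed

end

section \<open>Extension of the sections to the closed half plane\<close>

context cubic_setting
begin

text \<open>\<open>section_limit_exists\<close> provides a limit at each boundary point; as the
  sphere is regular, the extension by these pointwise limits is continuous.\<close>

lemma ex_ext: "\<exists>r g. cubic_ext P Q a b c r g"
proof -
  obtain r where r: "is_sections r" using ex_sections by blast
  have Rr: "R (Some (r s y)) = Some y" if "y \<in> upper" for s y
  proof -
    have "r s y \<in> {z. poly (cP - smult y cQ) z = 0}" using r that unfolding is_sections_def by blast
    then show ?thesis by (simp add: R_Some_iff)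
  qed
  have cont: "continuous_on upper (r s)" for s
    using r holomorphic_on_imp_continuous_on by (auto simp: is_sections_def)
  have lim: "\<exists>l. limitin sphere_top (\<lambda>y. Some (r s y)) l (upper_filter t)" if t: "t \<in> closed_upper - Some ` upper" for s t
  proof -
    have "\<exists>C. connected C \<and> C \<subseteq> upper \<and> eventually (\<lambda>y. y \<in> C) (upper_filter t) \<and> (\<forall>y\<in>C. Pr y)"
      if ev: "eventually Pr (upper_filter t)" for Pr
    proof (cases t)
      case None
      then show ?thesis using connected_basis_upper_infinity[of Pr] ev by (simp add: upper_filter_def)
    next
      case (Some z)
      then have "z \<notin> upper" using t by auto
      then show ?thesis using connected_basis_upper[of Pr z] ev Some
        by (force simp: upper_filter_def)
    qed
    then show ?thesis
      using section_limit_exists[OF continuous_R finite_fibre[of t] cont[of s] Rr[of _ s] _ limitin_Some_upper_filter]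
        upper_filter_nontrivial[of t] t by (metis DiffD1)
  qed
  have "\<exists>h. continuous_map (subtopology sphere_top closed_upper) sphere_top h \<and> (\<forall>y\<in>upper. h (Some y) = Some (r s y))" for s
  proof -
    define f where "f = (\<lambda>x. Some (r s (the x)) :: complex option)"
    have cf: "continuous_map (subtopology sphere_top (Some ` upper)) sphere_top f"
    proof -
      have "limitin sphere_top f (f x) (atin_within sphere_top x (Some ` upper))" if x: "x \<in> Some ` upper" for x
      proof -
        obtain y where y: "y \<in> upper" "x = Some y" using x by auto
        have "(r s \<longlongrightarrow> r s y) (at y within upper)" using cont y by (auto simp: continuous_on_def)
        then show ?thesis unfolding y(2) atin_sphere_Some limitin_filtermap
          by (simp add: f_def limitin_sphere_Some)
      qed
      then show ?thesis by (auto simp: continuous_map_atin atin_subtopology_within)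
    qed
    have sub: "Some ` upper \<subseteq> closed_upper" by (auto simp: closed_upper_def)
    have ex: "\<exists>l. limitin sphere_top f l (atin_within sphere_top t (Some ` upper))" if "t \<in> closed_upper - Some ` upper" for t
      using lim[OF that, of s] unfolding atin_within_upper limitin_filtermap by (simp add: f_def)
    obtain h where "continuous_map (subtopology sphere_top closed_upper) sphere_top h"
        "\<And>x. x \<in> Some ` upper \<Longrightarrow> h x = f x"
      using continuous_map_extension_pointwise_alt[OF regular_sphere sub closed_upper_subset_closure cf ex]
      by blast
    then show ?thesis by (intro exI[of _ h]) (auto simp: f_def)
  qed
  then obtain g where "\<And>s. continuous_map (subtopology sphere_top closed_upper) sphere_top (g s)"
     "\<And>s y. y \<in> upper \<Longrightarrow> g s (Some y) = Some (r s y)" by metis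
  then have "cubic_ext P Q a b c r g"
    using r cubic_setting_axioms by (simp add: cubic_ext_def cubic_ext_axioms_def)
  then show ?thesis by blast
qed

end

text \<open>The points \<open>a\<close>, \<open>b\<close>, \<open>c\<close> are indexed by natural
  numbers, and terms such as \<open>a 1\<close> are to keep that form under simplification.\<close>

declare One_nat_def [simp del]

section \<open>Labelling the sections\<close>

lemma other_two:
  fixes i :: 3
  obtains j k where "j \<noteq> i" "k \<noteq> i" "j \<noteq> k" "\<And>s. s = i \<or> s = j \<or> s = k"
proof -
  have d: "(1::3) \<noteq> 2" "(1::3) \<noteq> 3" "(2::3) \<noteq> 3" by auto
  consider "i = 1" | "i = 2" | "i = 3" using exhaust_3 by blast
  then show ?thesis
  proof cases
    case 1 then show ?thesis using that[of 2 3] d exhaust_3 by metis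
  next
    case 2 then show ?thesis using that[of 1 3] d exhaust_3 by metis
  next
    case 3 then show ?thesis using that[of 1 2] d exhaust_3 by metis
  qed
qed

lemma oarc_endpoints: "x \<noteq> y \<Longrightarrow> x \<notin> oarc x y" "x \<noteq> y \<Longrightarrow> y \<notin> oarc x y"
  by (cases x; cases y; auto)+

lemma oarc_cover: "x \<noteq> y \<Longrightarrow> z \<in> {x, y} \<union> oarc x y \<union> oarc y x"
  by (cases x; cases y; cases z) (auto simp: image_iff)

lemma oarc_nonempty: "x \<noteq> y \<Longrightarrow> oarc x y \<noteq> {}"
  by (cases x; cases y) auto

text \<open>A connected set of real points through \<open>x\<close> and \<open>y\<close> contains
  one of the two arcs, and that arc avoids \<open>B\<close>. The point \<open>z\<close> ensures that
  only one arc does, so the choice made in \<open>oarc_avoiding\<close> is this one.\<close>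

lemma oarc_avoiding_subset:
  assumes C: "connectedin sphere_top C" "C \<subseteq> range emb" and xy: "emb x \<in> C" "emb y \<in> C" "x \<noteq> y"
    and B: "C \<inter> emb ` B \<subseteq> {emb x, emb y}" "z \<in> B" "z \<noteq> x" "z \<noteq> y"
  shows "emb ` oarc_avoiding B x y \<subseteq> C"
proof -
  have inj: "inj emb" by (intro option.inj_map) (simp add: inj_def)
  have avoid: "D \<inter> B = {}" if "emb ` D \<subseteq> C" "x \<notin> D" "y \<notin> D" for D
  proof (rule ccontr)
    assume "D \<inter> B \<noteq> {}"
    then obtain w where w: "w \<in> D" "w \<in> B" by blast
    then have "emb w \<in> {emb x, emb y}" using B(1) that(1) by blast
    then have "w = x \<or> w = y" using inj by (auto dest: injD)
    then show False using w that by blast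
  qed
  from connected_contains_arc[OF C xy] show ?thesis
  proof
    assume s: "emb ` oarc x y \<subseteq> C"
    then have "oarc x y \<inter> B = {}" using avoid oarc_endpoints[OF xy(3)] by blast
    then show ?thesis using s by (simp add: oarc_avoiding_def)
  next
    assume s: "emb ` oarc y x \<subseteq> C"
    then have "oarc y x \<inter> B = {}" using avoid oarc_endpoints[of y x] xy(3) by blast
    then have "oarc x y \<inter> B \<noteq> {}" using oarc_cover[OF xy(3), of z] B(2-4) by blast
    then show ?thesis using s by (simp add: oarc_avoiding_def)
  qed
qed

lemma emb_in_closed_upper: "emb x \<in> closed_upper"
  by (cases x) (auto simp: closed_upper_def)

lemma emb_inject [simp]: "emb x = emb y \<longleftrightarrow> x = y"
  by (cases x; cases y) auto

lemma emb_in_image [simp]: "emb x \<in> emb ` A \<longleftrightarrow> x \<in> A"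
  by (auto simp: image_iff)

text \<open>The extended real line is the fixed point set of conjugation, a continuous map on a
  Hausdorff space.\<close>

lemma closedin_range_emb: "closedin sphere_top (range emb)"
proof -
  have "closedin sphere_top {x \<in> topspace sphere_top. cnjo x = id x}"
    by (intro closedin_continuous_maps_eq[OF Hausdorff_sphere] continuous_map_sphere_cnj continuous_map_id)
  moreover have "{x \<in> topspace sphere_top. cnjo x = id x} = range emb"
    by (rule set_eqI) (simp only: mem_Collect_eq topspace_sphere UNIV_I range_emb_iff id_apply simp_thms)
  ultimately show ?thesis by simp
qed

lemma continuous_map_real_line:
  "continuous_map euclideanreal (subtopology sphere_top closed_upper) (\<lambda>t. Some (complex_of_real t))"
proof -
  have "continuous_map euclideanreal euclidean complex_of_real" by (auto intro!: continuous_intros)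
  then have "continuous_map euclideanreal sphere_top (Some \<circ> complex_of_real)"
    using continuous_map_Some by (rule continuous_map_compose)
  then show ?thesis by (auto simp: continuous_map_in_subtopology closed_upper_def o_def)
qed

section \<open>Fibres over the extended real line\<close>

context cubic_setting
begin

lemma inj_a: "inj_on a {1..4}"
  and cyclic_a: "cyclically_ordered (a 1) (a 2) (a 3) (a 4)"
  and None_pants: "None \<in> pants_interior"
  and over_a: "s \<in> {1..4} \<Longrightarrow> R -` {emb (a s)} = {emb (b s), emb (c s)}"
    "s \<in> {1..4} \<Longrightarrow> mult (emb (b s)) = 2" "s \<in> {1..4} \<Longrightarrow> mult (emb (c s)) = 1"
  and over_arcs: "y \<in> oarc (a 1) (a 2) \<union> oarc (a 3) (a 4) \<Longrightarrow>
      \<exists>x z. Im z \<noteq> 0 \<and> R -` {emb y} = {emb x, Some z, Some (cnj z)}"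
  and over_gaps: "y \<notin> oarc (a 1) (a 2) \<union> oarc (a 3) (a 4) \<union> a ` {1..4} \<Longrightarrow>
      \<exists>X. card X = 3 \<and> R -` {emb y} = emb ` X"
  and R_interval: "R ` emb ` Some ` {-1..1} = emb ` Some ` {-1..1}"
  and interval_arc: "Some ` {-1..1} \<subseteq> oarc_avoiding (b ` {1..4}) (b 2) (b 3)"
  using standing unfolding standing_assumptions_def by (elim conjE, (assumption | simp))+

text \<open>Infinity lies in the interior of the pants, so neither slot arc reaches it. The final
  alternative records which of the two gaps between these arcs contains infinity.\<close>

lemma real_critical_values:
  obtains A where "\<And>s. s \<in> {1..4} \<Longrightarrow> a s = Some (A s)" "A 1 < A 2" "A 3 < A 4"
    "A 2 < A 3 \<or> A 4 < A 1"
proof -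
  have no: "None \<notin> slots" using None_pants unfolding pants_interior_def by force
  have "a s \<noteq> None" if "s \<in> {1..4}" for s
  proof -
    have "s = 1 \<or> s = 2 \<or> s = 3 \<or> s = 4" using that by auto
    moreover have "a 1 \<in> slots" "a 2 \<in> slots" "a 3 \<in> slots" "a 4 \<in> slots"
      by (auto simp: slots_def carc_def)
    ultimately show ?thesis using no by metis
  qed
  moreover define A where "A = (\<lambda>s. the (a s))"
  ultimately have A: "a s = Some (A s)" if "s \<in> {1..4}" for s using that by simp
  have a: "a 1 = Some (A 1)" "a 2 = Some (A 2)" "a 3 = Some (A 3)" "a 4 = Some (A 4)" by (simp_all add: A)
  have n1: "None \<notin> oarc (Some (A 1)) (Some (A 2))" "None \<notin> oarc (Some (A 3)) (Some (A 4))"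
    using no by (auto simp: slots_def carc_def a)
  have None_iff: "None \<in> oarc (Some x) (Some y) \<longleftrightarrow> \<not> x < y" for x y by auto
  have 1: "A 1 < A 2" "A 3 < A 4" using n1 unfolding None_iff by simp_all
  have "a 1 \<noteq> a 3" using inj_a by (auto dest!: inj_onD[of a "{1..4}" 1 3])
  then have "A 1 \<noteq> A 3" by (simp add: a)
  then have "A 2 < A 3 \<or> A 4 < A 1"
    using cyclic_a 1 by (auto simp: cyclically_ordered_def a split: if_splits)
  then show ?thesis using that A 1 by blast
qed

lemma inj_b: "s \<in> {1..4} \<Longrightarrow> s' \<in> {1..4} \<Longrightarrow> b s = b s' \<Longrightarrow> s = s'"
proof -
  assume s: "s \<in> {1..4}" "s' \<in> {1..4}" "b s = b s'"
  then have "R (emb (b s)) = emb (a s)" "R (emb (b s')) = emb (a s')" using over_a(1) by blast+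
  then have "a s = a s'" using s(3) by simp
  then show ?thesis using inj_a s by (auto dest: inj_onD)
qed

lemma R_b: "s \<in> {1..4} \<Longrightarrow> R (emb (b s)) = emb (a s)"
  and R_c: "s \<in> {1..4} \<Longrightarrow> R (emb (c s)) = emb (a s)"
  using over_a(1) by blast+

lemma b_neq_c: "s \<in> {1..4} \<Longrightarrow> s' \<in> {1..4} \<Longrightarrow> b s \<noteq> c s'"
  using over_a(2,3) by (metis one_eq_numeral_iff semiring_norm(85))

lemma fibre_real:
  assumes "y \<notin> oarc (a 1) (a 2) \<union> oarc (a 3) (a 4)"
  shows "R -` {emb y} \<subseteq> range emb"
proof (cases "y \<in> a ` {1..4}")
  case True
  then obtain s where s: "s \<in> {1..4}" "y = a s" by blast
  show ?thesis unfolding s(2) over_a(1)[OF s(1)] by blast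
next
  case False
  then show ?thesis using over_gaps assms by blast
qed

lemma card_fibre_gap:
  assumes "y \<notin> oarc (a 1) (a 2) \<union> oarc (a 3) (a 4) \<union> a ` {1..4}"
  shows "card (R -` {emb y}) = 3"
proof -
  obtain X where "card X = 3" "R -` {emb y} = emb ` X" using over_gaps[OF assms] by blast
  then show ?thesis by (simp add: card_image inj_on_def)
qed

lemma card_fibre_arc:
  assumes "y \<in> oarc (a 1) (a 2) \<union> oarc (a 3) (a 4)"
  shows "card (R -` {emb y}) = 3"
proof -
  obtain x z where xz: "Im z \<noteq> 0" "R -` {emb y} = {emb x, Some z, Some (cnj z)}" using over_arcs[OF assms] by blast
  have "emb x \<noteq> Some z" "emb x \<noteq> Some (cnj z)" using xz(1) by (cases x; auto simp: complex_eq_iff)+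
  moreover have "z \<noteq> cnj z" using xz(1) by (auto simp: complex_eq_iff)
  ultimately show ?thesis using xz(2) by simp
qed

end

context cubic_ext
begin

abbreviation gr :: "3 \<Rightarrow> real \<Rightarrow> complex option" where "gr s t \<equiv> g s (Some (complex_of_real t))"

lemma cont_gr: "continuous_map euclideanreal sphere_top (gr s)"
  using continuous_map_compose[OF continuous_map_real_line cont_g[of s]] by (simp add: o_def)

lemma R_gr: "R (gr s t) = Some (complex_of_real t)"
  using R_g[OF emb_in_closed_upper[of "Some t"], of s] by simp

text \<open>Each section stays in one closed half plane, so two sections that end at conjugate
  nonreal points come from opposite sides.\<close>

lemma arc_pair:
  assumes y: "y \<in> oarc (a 1) (a 2) \<union> oarc (a 3) (a 4)"
  shows "\<exists>i. g i (emb y) \<in> range emb \<and> (\<forall>j k. j \<noteq> i \<longrightarrow> k \<noteq> i \<longrightarrow> j \<noteq> k \<longrightarrow>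
      g j (emb y) \<notin> range emb \<and> g k (emb y) = cnjo (g j (emb y)) \<and> pos j \<noteq> pos k)"
proof -
  obtain x z where xz: "Im z \<noteq> 0" "R -` {emb y} = {emb x, Some z, Some (cnj z)}" using over_arcs[OF y] by blast
  have inj: "inj (\<lambda>s. g s (emb y))" by (intro inj_g emb_in_closed_upper card_fibre_arc y)
  have ran: "range (\<lambda>s. g s (emb y)) = {emb x, Some z, Some (cnj z)}"
    using fibre_eq[OF emb_in_closed_upper, of y] xz(2) by simp
  then obtain i where i: "g i (emb y) = emb x" by (metis insertI1 rangeE)
  have "g j (emb y) \<notin> range emb \<and> g k (emb y) = cnjo (g j (emb y)) \<and> pos j \<noteq> pos k"
    if jk: "j \<noteq> i" "k \<noteq> i" "j \<noteq> k" for j k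
  proof -
    have j: "g j (emb y) \<in> {Some z, Some (cnj z)}" and k: "g k (emb y) \<in> {Some z, Some (cnj z)}"
      and ne: "g j (emb y) \<noteq> g k (emb y)"
      using ran inj jk i by (metis injD insertE rangeI)+
    have kj: "g k (emb y) = cnjo (g j (emb y))" using j k ne by auto
    moreover have "Some z \<notin> range emb" "Some (cnj z) \<notin> range emb"
      using xz(1) by (simp_all add: Some_in_range_emb)
    then have nr: "g j (emb y) \<notin> range emb" using j by (elim insertE emptyE) (simp_all only: not_False_eq_True)
    moreover have "pos j \<noteq> pos k"
    proof
      assume *: "pos j = pos k"
      obtain w where w: "g j (emb y) = Some w" "Im w \<noteq> 0" using j xz(1) by auto
      have gk: "g k (emb y) = Some (cnj w)" using kj w by simp
      show False
      proof (cases "pos j")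
        case True
        then have "Some w \<in> closed_upper" "Some (cnj w) \<in> closed_upper"
          using g_pos[OF emb_in_closed_upper, of _ y] * w gk by metis+
        then show False using w(2) by (auto simp: closed_upper_def)
      next
        case False
        then have "cnjo (Some w) \<in> closed_upper" "cnjo (Some (cnj w)) \<in> closed_upper"
          using g_neg[OF emb_in_closed_upper, of _ y] * w gk by metis+
        then show False using w(2) by (auto simp: closed_upper_def)
      qed
    qed
    ultimately show ?thesis using nr by blast
  qed
  note pr = this
  have gi: "g i (emb y) \<in> range emb" unfolding i by (rule rangeI)
  show ?thesis by (rule exI[of _ i], rule conjI[OF gi]) (intro allI impI, rule pr)
qed

text \<open>The set where a given section is real is closed. Since exactly one section is real at
  each point, it is also the complement of the two other such sets, hence open, and an interval is
  connected. The relations extend to the ends by continuity.\<close>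

lemma real_index_on_arc:
  assumes AB: "A < B" "Some ` {A<..<B} \<subseteq> oarc (a 1) (a 2) \<union> oarc (a 3) (a 4)"
  obtains i where "\<And>t. t \<in> {A<..<B} \<Longrightarrow> gr i t \<in> range emb"
    "\<And>t j k. t \<in> {A<..<B} \<Longrightarrow> j \<noteq> i \<Longrightarrow> k \<noteq> i \<Longrightarrow> j \<noteq> k \<Longrightarrow>
        gr j t \<notin> range emb \<and> gr k t = cnjo (gr j t) \<and> pos j \<noteq> pos k"
    "\<And>j k. j \<noteq> i \<Longrightarrow> k \<noteq> i \<Longrightarrow> j \<noteq> k \<Longrightarrow> gr k A = cnjo (gr j A) \<and> gr k B = cnjo (gr j B)"
    "gr i A \<in> range emb" "gr i B \<in> range emb"
proof -
  define S where "S = {A<..<B}"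
  have ex: "\<exists>i. gr i t \<in> range emb \<and> (\<forall>j k. j \<noteq> i \<longrightarrow> k \<noteq> i \<longrightarrow> j \<noteq> k \<longrightarrow>
      gr j t \<notin> range emb \<and> gr k t = cnjo (gr j t) \<and> pos j \<noteq> pos k)" if "t \<in> S" for t
  proof -
    have "Some t \<in> oarc (a 1) (a 2) \<union> oarc (a 3) (a 4)" using AB(2) that unfolding S_def by blast
    from arc_pair[OF this] show ?thesis by (simp only: option.map)
  qed
  have uniq: "j = i" if h: "t \<in> S" "gr i t \<in> range emb" "gr j t \<in> range emb" for i j t
  proof -
    obtain l where l: "gr l t \<in> range emb \<and> (\<forall>j k. j \<noteq> l \<longrightarrow> k \<noteq> l \<longrightarrow> j \<noteq> k \<longrightarrow>
      gr j t \<notin> range emb \<and> gr k t = cnjo (gr j t) \<and> pos j \<noteq> pos k)"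
      using ex[OF h(1)] by (rule exE)
    have nl: "gr j t \<notin> range emb" if j: "j \<noteq> l" for j
    proof -
      obtain k where "k \<noteq> l" "k \<noteq> j" using other_two[of l] by metis
      then show ?thesis using l j by blast
    qed
    have "i = l" using nl h(2) by blast
    moreover have "j = l" using nl h(3) by blast
    ultimately show ?thesis by simp
  qed
  define Z where "Z = (\<lambda>s. {t \<in> S. gr s t \<in> range emb})"
  have clZ: "closedin (top_of_set S) (Z s)" for s
  proof -
    have "closedin euclideanreal {t \<in> topspace euclideanreal. gr s t \<in> range emb}"
      by (rule closedin_continuous_map_preimage[OF cont_gr closedin_range_emb])
    then have "closed {t. gr s t \<in> range emb}" by simp
    moreover have "Z s = S \<inter> {t. gr s t \<in> range emb}" by (auto simp: Z_def)
    ultimately show ?thesis using closedin_closed_Int by metis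
  qed
  have opZ: "openin (top_of_set S) (Z s)" for s
  proof -
    obtain j k where jk: "j \<noteq> s" "k \<noteq> s" "j \<noteq> k" "\<And>s'. s' = s \<or> s' = j \<or> s' = k" using other_two[of s] by blast
    have "Z s = S - (Z j \<union> Z k)"
    proof (intro equalityI subsetI)
      fix t assume "t \<in> Z s" then show "t \<in> S - (Z j \<union> Z k)" using uniq jk by (auto simp: Z_def)
    next
      fix t assume t: "t \<in> S - (Z j \<union> Z k)"
      obtain i where "gr i t \<in> range emb" using ex t by blast
      then have "i = s" using t jk(4)[of i] by (auto simp: Z_def)
      then show "t \<in> Z s" using t \<open>gr i t \<in> range emb\<close> by (simp add: Z_def)
    qed
    moreover have "closedin (top_of_set S) (Z j \<union> Z k)" using clZ by (intro closedin_Un)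
    ultimately show ?thesis using openin_diff[of "top_of_set S" S "Z j \<union> Z k"] by simp
  qed
  have "(A + B) / 2 \<in> S" using AB(1) by (simp add: S_def)
  then obtain i where "(A + B) / 2 \<in> Z i" using ex by (force simp: Z_def)
  moreover have "connected S" by (simp add: S_def)
  ultimately have Zi: "Z i = S" using clZ[of i] opZ[of i] unfolding connected_clopen by blast
  then have i: "gr i t \<in> range emb" if "t \<in> S" for t using that by (auto simp: Z_def)
  have pair: "gr j t \<notin> range emb \<and> gr k t = cnjo (gr j t) \<and> pos j \<noteq> pos k"
    if t: "t \<in> S" and jk: "j \<noteq> i" "k \<noteq> i" "j \<noteq> k" for t j k
  proof -
    obtain l where l: "gr l t \<in> range emb" "\<forall>j k. j \<noteq> l \<longrightarrow> k \<noteq> l \<longrightarrow> j \<noteq> k \<longrightarrow>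
      gr j t \<notin> range emb \<and> gr k t = cnjo (gr j t) \<and> pos j \<noteq> pos k" using ex[OF t] by (elim exE conjE) (rule that)
    have "l = i" using uniq[OF t i[OF t] l(1)] .
    then show ?thesis using l(2) jk by blast
  qed
  have cl: "x \<in> euclidean closure_of S" if "x \<in> {A, B}" for x
    using that AB(1) by (auto simp: S_def)
  have ends: "gr k x = cnjo (gr j x)" if "x \<in> {A, B}" and jk: "j \<noteq> i" "k \<noteq> i" "j \<noteq> k" for x j k
  proof -
    have "continuous_map euclideanreal sphere_top (\<lambda>t. cnjo (gr j t))"
      using continuous_map_compose[OF cont_gr continuous_map_sphere_cnj] by (simp add: o_def)
    then show ?thesis
      by (rule forall_in_closure_of_eq[OF cl[OF that(1)] Hausdorff_sphere cont_gr]) (use pair jk in blast)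
  qed
  have endr: "gr i x \<in> range emb" if "x \<in> {A, B}" for x
    by (rule forall_in_closure_of[OF cl[OF that] i
          closedin_continuous_map_preimage[OF cont_gr closedin_range_emb]])
  show ?thesis
  proof (rule that[of i])
    show "gr i t \<in> range emb" if "t \<in> {A<..<B}" for t using that unfolding S_def[symmetric] by (rule i)
    show "gr j t \<notin> range emb \<and> gr k t = cnjo (gr j t) \<and> pos j \<noteq> pos k"
      if "t \<in> {A<..<B}" "j \<noteq> i" "k \<noteq> i" "j \<noteq> k" for t j k
      using that unfolding S_def[symmetric] by (rule pair)
    show "gr k A = cnjo (gr j A) \<and> gr k B = cnjo (gr j B)"
      if "j \<noteq> i" "k \<noteq> i" "j \<noteq> k" for j k
      by (rule conjI; rule ends[OF _ that]) simp_all
    show "gr i A \<in> range emb" "gr i B \<in> range emb" by (rule endr, simp)+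
  qed
qed

end

text \<open>Infinity lies in the closure of an unbounded set, and a connected set stays connected
  when points of its closure are added.\<close>

lemma connectedin_ray:
  fixes S :: "real set"
  assumes S: "connected S" "\<And>B. \<exists>x\<in>S. \<bar>x\<bar> > B"
  shows "connectedin sphere_top (insert None ((\<lambda>t. Some (complex_of_real t)) ` S))"
proof -
  have "continuous_map euclideanreal sphere_top (\<lambda>t. Some (complex_of_real t))"
    using continuous_map_real_line by (simp add: continuous_map_in_subtopology)
  then have c: "connectedin sphere_top ((\<lambda>t. Some (complex_of_real t)) ` S)"
    by (rule connectedin_continuous_map_image) (simp add: S)
  have "None \<in> sphere_top closure_of ((\<lambda>t. Some (complex_of_real t)) ` S)"
    unfolding in_closure_of
  proof (intro conjI allI impI)
    fix T assume "None \<in> T \<and> openin sphere_top T"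
    then obtain B where B: "\<And>z. cmod z > B \<Longrightarrow> Some z \<in> T" using openin_sphere_NoneD by blast
    obtain x where x: "x \<in> S" "\<bar>x\<bar> > B" using S(2) by blast
    have "Some (complex_of_real x) \<in> T" by (rule B) (simp add: x(2))
    then show "\<exists>y. y \<in> (\<lambda>t. Some (complex_of_real t)) ` S \<and> y \<in> T" using x(1) by blast
  qed simp
  then show ?thesis
    by (intro connectedin_intermediate_closure_of[OF c]) (auto intro: closure_of_subset[THEN subsetD])
qed

context cubic_change_of_variable
begin

abbreviation crit :: "real option set" where "crit \<equiv> b ` {1..4}"

text \<open>The data by which \<open>sheet\<close> recognises a component: \<open>i1\<close> takes
  the values of the interval \<open>[-1,1]\<close>, while \<open>i2\<close> and \<open>i3\<close>
  cover the segments with ends \<open>c 4\<close>, \<open>c 3\<close> and \<open>c 2\<close>,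
  \<open>c 1\<close>. The second clause keeps the image of the interval away from the two slot
  arcs.\<close>

definition good_labelling :: "3 \<Rightarrow> 3 \<Rightarrow> 3 \<Rightarrow> (3 \<Rightarrow> complex option \<Rightarrow> complex option) \<Rightarrow> bool" where
  "good_labelling i1 i2 i3 g \<longleftrightarrow>
     (\<forall>x\<in>{-1..1}. g i1 (R (emb (Some x))) = emb (Some x)) \<and>
     (\<forall>x\<in>{-1..1}. R (emb (Some x)) \<notin> emb ` (carc (a 1) (a 2) \<union> carc (a 3) (a 4))) \<and>
     g i2 (emb (a 3)) = emb (c 3) \<and> g i2 (emb (a 4)) = emb (c 4) \<and>
     emb ` carc_avoiding crit (c 4) (c 3) \<subseteq> (\<lambda>t. g i2 (emb t)) ` carc (a 3) (a 4) \<and>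
     g i3 (emb (a 1)) = emb (c 1) \<and> g i3 (emb (a 2)) = emb (c 2) \<and>
     emb ` carc_avoiding crit (c 2) (c 1) \<subseteq> (\<lambda>t. g i3 (emb t)) ` carc (a 1) (a 2)"

end

context cubic_ext
begin

lemma real_fibre_value: "y \<notin> oarc (a 1) (a 2) \<union> oarc (a 3) (a 4) \<Longrightarrow> g s (emb y) \<in> range emb"
  using fibre_real[of y] fibre_eq[OF emb_in_closed_upper[of y]] by blast

lemma None_not_in_arcs: "None \<notin> oarc (a 1) (a 2) \<union> oarc (a 3) (a 4)"
proof
  assume "None \<in> oarc (a 1) (a 2) \<union> oarc (a 3) (a 4)"
  then have "None \<in> slots" by (auto simp: slots_def carc_def)
  then have "emb None \<in> emb ` slots" by (rule imageI)
  then show False using None_pants by (simp add: pants_interior_def)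
qed

lemma compactin_closed_upper: "compactin sphere_top closed_upper"
  by (rule closedin_compact_space) (auto simp: closedin_closed_upper)

text \<open>A section that is real on the whole real line has an image that is open and closed in
  its half plane, hence all of it. A second section on the same side would share its values, which
  injectivity forbids.\<close>

lemma not_all_real:
  assumes real: "\<And>t. gr i t \<in> range emb" and k: "k \<noteq> i" "pos k = pos i"
  shows False
proof -
  define U where "U = (if pos i then upper else {x. Im x < 0})"
  have inU: "r s y \<in> U" if "s \<in> {i, k}" "y \<in> upper" for s y
    using Im_r_sign[OF that(2), of s] r_nonreal[OF that(2), of s] that(1) k(2)
    by (auto simp: U_def)
  have nr: "Im x \<noteq> 0" if "x \<in> U" for x using that by (auto simp: U_def split: if_splits)
  have "connected upper" "connected {x. Im x < 0}"
    by (rule convex_connected, rule convex_upper) (rule convex_connected, rule convex_halfspace_Im_lt)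
  then have conU: "connected U" unfolding U_def by (split if_split) blast
  have inj: "inj_on (r i) upper"
  proof (rule inj_onI)
    fix y y' assume *: "y \<in> upper" "y' \<in> upper" "r i y = r i y'"
    have "Some y = R (Some (r i y))" by (rule R_r[OF *(1), symmetric])
    also have "\<dots> = Some y'" unfolding *(3) by (rule R_r[OF *(2)])
    finally show "y = y'" by simp
  qed
  have op: "open (r i ` upper)"
    by (rule open_mapping_thm3[OF holo_r _ inj]) (rule open_halfspace_Im_gt)
  define K where "K = {x. Some x \<in> g i ` closed_upper}"
  have "compactin (subtopology sphere_top closed_upper) closed_upper"
    by (simp add: compactin_subtopology compactin_closed_upper)
  then have "compactin sphere_top (g i ` closed_upper)" by (rule image_compactin[OF _ cont_g])
  then have "closedin sphere_top (g i ` closed_upper)" by (rule compactin_imp_closedin[OF Hausdorff_sphere])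
  then have "closed K"
    using closedin_continuous_map_preimage[OF continuous_map_Some] by (fastforce simp: K_def)
  have gi_real: "g i (emb y) \<in> range emb" for y
  proof (cases y)
    case None
    then show ?thesis using real_fibre_value[OF None_not_in_arcs] by simp
  qed (use real in simp)
  have eq: "r i ` upper = U \<inter> K"
  proof (intro equalityI subsetI)
    fix x assume "x \<in> r i ` upper"
    then obtain y where y: "y \<in> upper" "x = r i y" by blast
    then have "Some x = g i (Some y)" by (simp add: g_Some)
    moreover have "Some y \<in> closed_upper" using y(1) by (auto simp: closed_upper_def)
    ultimately have "x \<in> K" unfolding K_def by blast
    then show "x \<in> U \<inter> K" using inU y by simp
  next
    fix x assume x: "x \<in> U \<inter> K"
    then obtain t where t: "t \<in> closed_upper" "Some x = g i t" by (auto simp: K_def)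
    have "t \<notin> range emb"
    proof
      assume "t \<in> range emb"
      then have "Some x \<in> range emb" using gi_real t(2) by auto
      then show False using nr x by (simp add: Some_in_range_emb)
    qed
    then obtain y where y: "t = Some y" "Im y \<ge> 0" "Im y \<noteq> 0"
      using t(1) Some_in_range_emb by (auto simp: closed_upper_def)
    then have "y \<in> upper" by simp
    moreover have "x = r i y" using t(2) y(1) g_Some[OF \<open>y \<in> upper\<close>, of i] by simp
    ultimately show "x \<in> r i ` upper" by blast
  qed
  have "openin (top_of_set U) (r i ` upper)"
    using op eq by (metis Int_lower1 open_openin_trans openin_subtopology_Int2 openin_open_Int inf.absorb_iff2)
  moreover have "closedin (top_of_set U) (r i ` upper)"
    unfolding eq using \<open>closed K\<close> by (rule closedin_closed_Int)
  moreover have "r i ` upper \<noteq> {}"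
  proof -
    have "\<i> \<in> upper" by simp
    then show ?thesis by blast
  qed
  ultimately have "r i ` upper = U" using conU unfolding connected_clopen by blast
  moreover have "r k \<i> \<in> U" by (rule inU) auto
  ultimately obtain y where y: "y \<in> upper" "r k \<i> = r i y" by blast
  have "\<i> \<in> upper" by simp
  have "Some \<i> = R (Some (r k \<i>))" by (rule R_r[OF \<open>\<i> \<in> upper\<close>, symmetric])
  also have "\<dots> = Some y" unfolding y(2) by (rule R_r[OF y(1)])
  finally have "\<i> = y" by simp
  then have "r k \<i> = r i \<i>" using y(2) by simp
  then show False using inj_r[OF \<open>\<i> \<in> upper\<close>] k(1) by (auto dest: injD)
qed

text \<open>At the end of an arc the conjugate pair becomes real and merges. Two sections meet
  there, so their common value cannot be the simple point \<open>c s\<close> and is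
  \<open>b s\<close>; the simple point is left for the real section.\<close>

lemma end_values:
  assumes s: "s \<in> {1..4}" "a s = Some \<tau>" and ijk: "j \<noteq> i" "k \<noteq> i" "j \<noteq> k" "gr k \<tau> = cnjo (gr j \<tau>)"
  shows "gr i \<tau> = emb (c s)" "gr j \<tau> = emb (b s)"
proof -
  have t: "emb (a s) = Some (complex_of_real \<tau>)" using s(2) by simp
  have ran: "range (\<lambda>s. gr s \<tau>) = {emb (b s), emb (c s)}"
    using fibre_eq[OF emb_in_closed_upper[of "a s"]] over_a(1)[OF s(1)] by (simp only: t)
  then have ex: "gr l \<tau> \<in> {emb (b s), emb (c s)}" for l by blast
  have "cnjo (gr j \<tau>) = gr j \<tau>" using ex[of j] range_emb_iff by blast
  then have kj: "gr k \<tau> = gr j \<tau>" using ijk(4) by simp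
  have card1: "card {l. gr l \<tau> = emb (c s)} = 1"
    using mult_count[OF emb_in_closed_upper[of "a s"] R_c[OF s(1)]] over_a(3)[OF s(1)] by (simp only: t)
  have "gr j \<tau> \<noteq> emb (c s)"
  proof
    assume "gr j \<tau> = emb (c s)"
    then have "{j, k} \<subseteq> {l. gr l \<tau> = emb (c s)}" using kj by simp
    then have "card {j, k} \<le> 1" using card1 card_mono[of "{l. gr l \<tau> = emb (c s)}" "{j, k}"] by simp
    then show False using ijk(3) by simp
  qed
  then show j: "gr j \<tau> = emb (b s)" using ex[of j] by blast
  obtain l where l: "gr l \<tau> = emb (c s)"
    using card1 by (metis (mono_tags, lifting) card_1_singletonE mem_Collect_eq singletonI)
  have "emb (b s) \<noteq> emb (c s)" using b_neq_c[OF s(1) s(1)] by simp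
  then have "l \<noteq> j" "l \<noteq> k" using l j kj by auto
  then have "l = i" using ijk other_two[of i] by metis
  then show "gr i \<tau> = emb (c s)" using l by simp
qed

text \<open>The sections that are real over the two slot arcs are \<open>i3\<close> and
  \<open>i2\<close>. The third one, \<open>m\<close>, is real over the gap from \<open>a 2\<close>
  to \<open>a 3\<close> and joins \<open>b 2\<close> to \<open>b 3\<close> there; its values cover
  the arc between these points that is free of critical points, and this arc contains the interval
  \<open>[-1,1]\<close>.\<close>

lemma ex_good_labelling:
  "\<exists>i1 i2 i3. i1 \<noteq> i2 \<and> i1 \<noteq> i3 \<and> i2 \<noteq> i3 \<and> good_labelling i1 i2 i3 g"
proof -
  obtain A where A: "\<And>s. s \<in> {1..4} \<Longrightarrow> a s = Some (A s)" "A 1 < A 2" "A 3 < A 4" "A 2 < A 3 \<or> A 4 < A 1"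
    using real_critical_values by blast
  have aA: "a 1 = Some (A 1)" "a 2 = Some (A 2)" "a 3 = Some (A 3)" "a 4 = Some (A 4)" by (simp_all add: A(1))
  have o12: "oarc (a 1) (a 2) = Some ` {A 1<..<A 2}" and o34: "oarc (a 3) (a 4) = Some ` {A 3<..<A 4}"
    using A(2,3) by (simp_all add: aA)
  have c12: "carc (a 1) (a 2) = Some ` {A 1..A 2}"
    unfolding carc_def o12 aA using A(2) by (auto simp: image_iff less_eq_real_def)
  have c34: "carc (a 3) (a 4) = Some ` {A 3..A 4}"
    unfolding carc_def o34 aA using A(3) by (auto simp: image_iff less_eq_real_def)
  have s4: "s = 1 \<or> s = 2 \<or> s = 3 \<or> s = 4" if "s \<in> {1..4}" for s :: nat using that by auto
  have sub12: "Some ` {A 1<..<A 2} \<subseteq> oarc (a 1) (a 2) \<union> oarc (a 3) (a 4)"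
    and sub34: "Some ` {A 3<..<A 4} \<subseteq> oarc (a 1) (a 2) \<union> oarc (a 3) (a 4)"
    unfolding o12 o34 by simp_all
  obtain i3 where i3: "\<And>t. t \<in> {A 1<..<A 2} \<Longrightarrow> gr i3 t \<in> range emb"
    "\<And>t j k. t \<in> {A 1<..<A 2} \<Longrightarrow> j \<noteq> i3 \<Longrightarrow> k \<noteq> i3 \<Longrightarrow> j \<noteq> k \<Longrightarrow>
        gr j t \<notin> range emb \<and> gr k t = cnjo (gr j t) \<and> pos j \<noteq> pos k"
    "\<And>j k. j \<noteq> i3 \<Longrightarrow> k \<noteq> i3 \<Longrightarrow> j \<noteq> k \<Longrightarrow> gr k (A 1) = cnjo (gr j (A 1)) \<and> gr k (A 2) = cnjo (gr j (A 2))"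
    "gr i3 (A 1) \<in> range emb" "gr i3 (A 2) \<in> range emb"
    by (rule real_index_on_arc[OF A(2) sub12]) (rule that; assumption)
  obtain i2 where i2: "\<And>t. t \<in> {A 3<..<A 4} \<Longrightarrow> gr i2 t \<in> range emb"
    "\<And>t j k. t \<in> {A 3<..<A 4} \<Longrightarrow> j \<noteq> i2 \<Longrightarrow> k \<noteq> i2 \<Longrightarrow> j \<noteq> k \<Longrightarrow>
        gr j t \<notin> range emb \<and> gr k t = cnjo (gr j t) \<and> pos j \<noteq> pos k"
    "\<And>j k. j \<noteq> i2 \<Longrightarrow> k \<noteq> i2 \<Longrightarrow> j \<noteq> k \<Longrightarrow> gr k (A 3) = cnjo (gr j (A 3)) \<and> gr k (A 4) = cnjo (gr j (A 4))"
    "gr i2 (A 3) \<in> range emb" "gr i2 (A 4) \<in> range emb"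
    by (rule real_index_on_arc[OF A(3) sub34]) (rule that; assumption)
  \<comment> \<open>A section real over both arcs would be real over the whole line, because all
    other real points have real fibres. Of the remaining two sections, which run on opposite sides,
    one would share its half plane.\<close>
  have ne23: "i2 \<noteq> i3"
  proof
    assume eq: "i2 = i3"
    obtain j k where jk: "j \<noteq> i3" "k \<noteq> i3" "j \<noteq> k" using other_two[of i3] by metis
    have "(A 1 + A 2) / 2 \<in> {A 1<..<A 2}" using A(2) by simp
    then have "pos j \<noteq> pos k" using i3(2) jk by blast
    then obtain l where l: "l \<noteq> i3" "pos l = pos i3" using jk by metis
    have "gr i3 t \<in> range emb" for t
    proof (cases "Some t \<in> oarc (a 1) (a 2) \<union> oarc (a 3) (a 4)")
      case True
      then have "t \<in> {A 1<..<A 2} \<or> t \<in> {A 3<..<A 4}" unfolding o12 o34 by blast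
      then show ?thesis using i3(1) i2(1) eq by metis
    next
      case False
      then show ?thesis using real_fibre_value[OF False, of i3] by simp
    qed
    then show False using not_all_real[of i3 l] l by blast
  qed
  obtain m where m: "m \<noteq> i3" "m \<noteq> i2" using other_two[of i3] ne23 by metis
  have v1: "gr i3 (A 1) = emb (c 1)" "gr m (A 1) = emb (b 1)"
    using end_values[of 1 "A 1" m i3 i2] aA m ne23 i3(3)[of m i2] by simp_all
  have v2: "gr i3 (A 2) = emb (c 2)" "gr m (A 2) = emb (b 2)"
    using end_values[of 2 "A 2" m i3 i2] aA m ne23 i3(3)[of m i2] by simp_all
  have v3: "gr i2 (A 3) = emb (c 3)" "gr m (A 3) = emb (b 3)"
    using end_values[of 3 "A 3" m i2 i3] aA m ne23 i2(3)[of m i3] by simp_all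
  have v4: "gr i2 (A 4) = emb (c 4)" "gr m (A 4) = emb (b 4)"
    using end_values[of 4 "A 4" m i2 i3] aA m ne23 i2(3)[of m i3] by simp_all
  have Rb: "A s = t" if "emb (b s) = gr l t" "s \<in> {1..4}" for s l t
    using R_b[OF that(2)] R_gr[of l t] A(1)[OF that(2)] that(1) by simp
  \<comment> \<open>Common to both slots: the real section maps the slot onto a connected set of
    real points joining \<open>c s\<close> to \<open>c s'\<close>. It contains no critical point,
    because critical values occur only at the ends, where the section takes the simple
    point.\<close>
  have slot: "emb ` carc_avoiding crit (c s') (c s) \<subseteq> gr i ` {A s..A s'}"
    if s: "s \<in> {1..4}" "s' \<in> {1..4}" "A s < A s'"
      and re: "\<And>t. t \<in> {A s<..<A s'} \<Longrightarrow> gr i t \<in> range emb"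
      and ends: "gr i (A s) = emb (c s)" "gr i (A s') = emb (c s')"
      and only: "\<And>l. l \<in> {1..4} \<Longrightarrow> A l \<in> {A s..A s'} \<Longrightarrow> l = s \<or> l = s'" for s s' i
  proof -
    define C where "C = gr i ` {A s..A s'}"
    have C: "connectedin sphere_top C" unfolding C_def
      by (rule connectedin_continuous_map_image[OF cont_gr]) simp
    have Cr: "C \<subseteq> range emb"
    proof
      fix x assume "x \<in> C"
      then obtain t where t: "x = gr i t" "A s \<le> t" "t \<le> A s'" by (auto simp: C_def)
      then consider "t = A s" | "t = A s'" | "t \<in> {A s<..<A s'}" by fastforce
      then show "x \<in> range emb" using re ends t(1) by cases auto
    qed
    have in_C: "emb (c s') \<in> C" "emb (c s) \<in> C"
      unfolding C_def ends[symmetric] using s(3) by auto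
    have "a s \<noteq> a s'" using A(1) s by auto
    then have "emb (a s) \<noteq> emb (a s')" by simp
    then have "c s' \<noteq> c s" using R_c[OF s(1)] R_c[OF s(2)] by metis
    have "C \<inter> emb ` crit = {}"
    proof (rule ccontr)
      assume "C \<inter> emb ` crit \<noteq> {}"
      then obtain x where x: "x \<in> C" "x \<in> emb ` crit" by blast
      obtain t where t: "x = gr i t" "t \<in> {A s..A s'}" using x(1) unfolding C_def by blast
      obtain l where l: "l \<in> {1..4}" "emb (b l) = gr i t" "t \<in> {A s..A s'}" using x(2) t by blast
      then have "A l = t" using Rb by blast
      then have "l = s \<or> l = s'" using only l by blast
      then have "gr i t = emb (c l)" using ends \<open>A l = t\<close> by auto
      then have "b l = c l" using l(2) by simp
      then show False using b_neq_c l(1) by blast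
    qed
    then have "emb ` oarc_avoiding crit (c s') (c s) \<subseteq> C"
      using oarc_avoiding_subset[OF C Cr in_C \<open>c s' \<noteq> c s\<close>, of crit "b 1"] b_neq_c[of 1] s by auto
    then show ?thesis using in_C unfolding carc_avoiding_def C_def by auto
  qed
  have seg3: "emb ` carc_avoiding crit (c 2) (c 1) \<subseteq> gr i3 ` {A 1..A 2}"
  proof (rule slot)
    fix l assume "l \<in> {1..4::nat}" "A l \<in> {A 1..A 2}"
    then show "l = 1 \<or> l = 2" using s4[of l] A(2,3,4) by auto
  qed (use A(2) i3(1) v1 v2 in auto)
  have seg2: "emb ` carc_avoiding crit (c 4) (c 3) \<subseteq> gr i2 ` {A 3..A 4}"
  proof (rule slot)
    fix l assume "l \<in> {1..4::nat}" "A l \<in> {A 3..A 4}"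
    then show "l = 3 \<or> l = 4" using s4[of l] A(2,3,4) by auto
  qed (use A(3) i2(1) v3 v4 in auto)
  \<comment> \<open>The closed gap. If \<open>A 3 < A 2\<close>, it passes through infinity and is
    the union of two rays with this point in common.\<close>
  define D where "D = carc (a 2) (a 3)"
  have D_Some: "Some t \<in> D \<longleftrightarrow> (if A 2 < A 3 then A 2 \<le> t \<and> t \<le> A 3 else A 2 \<le> t \<or> t \<le> A 3)" for t
    unfolding D_def carc_def aA by (auto simp: image_iff)
  have emb_None_Some: "emb ` insert None (Some ` S) = insert None ((\<lambda>t. Some (complex_of_real t)) ` S)" for S
    by (auto simp: image_iff)
  have conD: "connectedin sphere_top (emb ` D)"
  proof (cases "A 2 < A 3")
    case True
    have "D = Some ` {A 2..A 3}"
      using True unfolding D_def carc_def aA by (auto simp: image_iff less_eq_real_def)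
    then have eq: "emb ` D = (\<lambda>t. Some (complex_of_real t)) ` {A 2..A 3}" by (simp add: image_image)
    have "continuous_map euclideanreal sphere_top (\<lambda>t. Some (complex_of_real t))"
      using continuous_map_real_line by (simp add: continuous_map_in_subtopology)
    then show ?thesis unfolding eq by (rule connectedin_continuous_map_image) simp
  next
    case False
    have "D = insert None (Some ` {A 2..}) \<union> insert None (Some ` {..A 3})"
      using False unfolding D_def carc_def aA by (auto simp: image_iff less_eq_real_def)
    then have eq: "emb ` D = insert None ((\<lambda>t. Some (complex_of_real t)) ` {A 2..}) \<union> insert None ((\<lambda>t. Some (complex_of_real t)) ` {..A 3})"
      by (simp only: image_Un emb_None_Some)
    show ?thesis unfolding eq
    proof (rule connectedin_Un)
      have "\<exists>x\<in>{A 2..}. \<bar>x\<bar> > B" for B by (rule bexI[of _ "\<bar>A 2\<bar> + \<bar>B\<bar> + 1"]) auto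
      then show "connectedin sphere_top (insert None ((\<lambda>t. Some (complex_of_real t)) ` {A 2..}))"
        by (intro connectedin_ray) auto
      have "\<exists>x\<in>{..A 3}. \<bar>x\<bar> > B" for B by (rule bexI[of _ "- (\<bar>A 3\<bar> + \<bar>B\<bar> + 1)"]) auto
      then show "connectedin sphere_top (insert None ((\<lambda>t. Some (complex_of_real t)) ` {..A 3}))"
        by (intro connectedin_ray) auto
    qed auto
  qed
  have D_arcs: "t \<notin> oarc (a 1) (a 2) \<union> oarc (a 3) (a 4)" if "t \<in> D" for t
  proof (cases t)
    case None
    then show ?thesis using None_not_in_arcs by simp
  next
    case (Some \<tau>)
    then show ?thesis using that A(2,3,4) D_Some[of \<tau>] unfolding o12 o34 by (auto split: if_splits)
  qed
  define C where "C = (\<lambda>t. g m (emb t)) ` D"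
  have C: "connectedin sphere_top C"
  proof -
    have "emb ` D \<subseteq> closed_upper" using emb_in_closed_upper by blast
    then have "connectedin (subtopology sphere_top closed_upper) (emb ` D)"
      using conD by (simp add: connectedin_subtopology)
    from connectedin_continuous_map_image[OF cont_g this, of m] show ?thesis by (simp add: C_def image_image)
  qed
  have Cr: "C \<subseteq> range emb" unfolding C_def using D_arcs real_fibre_value by blast
  have a_D: "a 2 \<in> D" "a 3 \<in> D" by (simp_all add: D_def carc_def)
  have gm: "g m (emb (a 2)) = emb (b 2)" "g m (emb (a 3)) = emb (b 3)" using v2(2) v3(2) by (simp_all add: aA)
  have in_C: "emb (b 2) \<in> C" "emb (b 3) \<in> C" unfolding C_def gm[symmetric] using a_D by blast+
  have b23: "b 2 \<noteq> b 3" "b 1 \<noteq> b 2" "b 1 \<noteq> b 3" using inj_b[of 2 3] inj_b[of 1 2] inj_b[of 1 3] by auto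
  have "C \<inter> emb ` crit \<subseteq> {emb (b 2), emb (b 3)}"
  proof
    fix x assume "x \<in> C \<inter> emb ` crit"
    then have x: "x \<in> C" "x \<in> emb ` crit" by simp_all
    obtain t where t: "x = g m (emb t)" "t \<in> D" using x(1) unfolding C_def by blast
    obtain l where l: "l \<in> {1..4}" "x = emb (b l)" "emb (b l) = g m (emb t)" "t \<in> D" using x(2) t by blast
    have "emb (a l) = emb t" using R_b[OF l(1)] l(3) R_g[OF emb_in_closed_upper] by simp
    then have t: "t = Some (A l)" using A(1)[OF l(1)] by (simp only: emb_inject)
    then have "l = 2 \<or> l = 3" using l(4) s4[OF l(1)] A(2,3,4) D_Some[of "A l"] by (auto split: if_splits)
    then show "x \<in> {emb (b 2), emb (b 3)}" using l(2) by auto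
  qed
  then have arc: "emb ` oarc_avoiding crit (b 2) (b 3) \<subseteq> C"
    by (rule oarc_avoiding_subset[OF C Cr in_C b23(1), where z = "b 1"]) (use b23 in auto)
  have interval: "\<exists>t\<in>D. R (emb (Some x)) = emb t \<and> g m (emb t) = emb (Some x) \<and> t \<noteq> a 2 \<and> t \<noteq> a 3"
    if x: "x \<in> {-1..1}" for x
  proof -
    have xo: "Some x \<in> oarc_avoiding crit (b 2) (b 3)" using interval_arc x by blast
    then have "emb (Some x) \<in> C" using arc by blast
    then obtain t where t: "t \<in> D" "emb (Some x) = g m (emb t)" unfolding C_def by blast
    have "b 2 \<notin> oarc_avoiding crit (b 2) (b 3)" "b 3 \<notin> oarc_avoiding crit (b 2) (b 3)"
      using oarc_endpoints[of "b 2" "b 3"] oarc_endpoints[of "b 3" "b 2"] b23(1)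
      by (auto simp: oarc_avoiding_def)
    then have "b 2 \<noteq> Some x" "b 3 \<noteq> Some x" using xo by auto
    then have "t \<noteq> a 2" "t \<noteq> a 3" using t(2) gm by (metis emb_inject)+
    moreover have "R (emb (Some x)) = emb t" unfolding t(2) by (rule R_g[OF emb_in_closed_upper])
    ultimately show ?thesis using t by metis
  qed
  have "good_labelling m i2 i3 g"
    unfolding good_labelling_def
  proof (intro conjI ballI)
    fix x :: real assume x: "x \<in> {-1..1}"
    then obtain t where t: "t \<in> D" "R (emb (Some x)) = emb t" "g m (emb t) = emb (Some x)" "t \<noteq> a 2" "t \<noteq> a 3"
      using interval by blast
    show "g m (R (emb (Some x))) = emb (Some x)" using t by simp
    show "R (emb (Some x)) \<notin> emb ` (carc (a 1) (a 2) \<union> carc (a 3) (a 4))"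
    proof
      assume "R (emb (Some x)) \<in> emb ` (carc (a 1) (a 2) \<union> carc (a 3) (a 4))"
      then have "t \<in> Some ` {A 1..A 2} \<union> Some ` {A 3..A 4}" using t(2) unfolding c12 c34 by simp
      then obtain \<tau> where \<tau>: "t = Some \<tau>" "\<tau> \<in> {A 1..A 2} \<or> \<tau> \<in> {A 3..A 4}" by blast
      moreover have "\<tau> \<noteq> A 2" "\<tau> \<noteq> A 3" using t(4,5) \<tau>(1) by (auto simp: aA)
      ultimately show False using t(1) D_Some[of \<tau>] A(2,3,4) by (auto split: if_splits)
    qed
  next
    show "emb ` carc_avoiding crit (c 4) (c 3) \<subseteq> (\<lambda>t. g i2 (emb t)) ` carc (a 3) (a 4)"
      using seg2 unfolding c34 by (simp add: image_image)
    show "emb ` carc_avoiding crit (c 2) (c 1) \<subseteq> (\<lambda>t. g i3 (emb t)) ` carc (a 1) (a 2)"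
      using seg3 unfolding c12 by (simp add: image_image)
  qed (use v1 v2 v3 v4 in \<open>simp_all add: aA\<close>)
  then show ?thesis using m ne23 by metis
qed

end

lemma (in cubic_setting) ex_labelled: "\<exists>r g. cubic_ext P Q a b c r g \<and> good_labelling 1 2 3 g"
proof -
  obtain r g where "cubic_ext P Q a b c r g" using ex_ext by blast
  then interpret E: cubic_ext P Q a b c r g .
  obtain i1 i2 i3 where i: "i1 \<noteq> i2" "i1 \<noteq> i3" "i2 \<noteq> i3" "good_labelling i1 i2 i3 g"
    using E.ex_good_labelling by blast
  define \<pi> :: "3 \<Rightarrow> 3" where "\<pi> = (\<lambda>s. if s = 1 then i1 else if s = 2 then i2 else i3)"
  have \<pi>: "\<pi> 1 = i1" "\<pi> 2 = i2" "\<pi> 3 = i3" by (auto simp: \<pi>_def)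
  have inj: "inj \<pi>"
  proof (rule injI)
    fix s t assume "\<pi> s = \<pi> t"
    then show "s = t" using exhaust_3[of s] exhaust_3[of t] \<pi> i by metis
  qed
  then have surj: "surj \<pi>" by (simp add: finite_UNIV_inj_surj)
  have "cubic_ext P Q a b c (\<lambda>s. r (\<pi> s)) (\<lambda>s. g (\<pi> s))"
  proof (intro cubic_ext.intro cubic_setting_axioms cubic_ext_axioms.intro)
    show "is_sections (\<lambda>s. r (\<pi> s))"
      unfolding is_sections_def
    proof (intro conjI allI ballI)
      fix y assume y: "y \<in> upper"
      show "inj (\<lambda>s. r (\<pi> s) y)" using inj_compose[OF E.inj_r[OF y] inj] by (simp add: o_def)
      have "range (\<lambda>s. r (\<pi> s) y) = (\<lambda>s. r s y) ` range \<pi>" by (simp add: image_image)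
      then show "{z. poly (cP - smult y cQ) z = 0} = range (\<lambda>s. r (\<pi> s) y)" using E.roots_r[OF y] surj by simp
    qed (rule E.holo_r)
  qed (auto intro: E.cont_g E.g_Some)
  moreover have "good_labelling 1 2 3 (\<lambda>s. g (\<pi> s))" using i(4) by (simp add: good_labelling_def \<pi>)
  ultimately show ?thesis by blast
qed

section \<open>Cauchy integrals over the slot\<close>

lemma holder_continuous:
  assumes "holder_on S f"
  shows "continuous_on S f"
  unfolding continuous_on_def
proof
  fix x assume x: "x \<in> S"
  obtain \<alpha> C where h: "0 < \<alpha>" "\<And>x y. x \<in> S \<Longrightarrow> y \<in> S \<Longrightarrow> norm (f x - f y) \<le> C * \<bar>x - y\<bar> powr \<alpha>"
    using assms unfolding holder_on_def by blast
  have "((\<lambda>y. \<bar>y - x\<bar>) \<longlongrightarrow> \<bar>x - x\<bar>) (at x within S)" by (intro tendsto_intros)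
  then have "((\<lambda>y. \<bar>y - x\<bar> powr \<alpha>) \<longlongrightarrow> 0) (at x within S)"
    using h(1) by (intro tendsto_zero_powrI[where b = \<alpha>]) auto
  from tendsto_mult_left[OF this, of C] have "((\<lambda>y. C * \<bar>y - x\<bar> powr \<alpha>) \<longlongrightarrow> 0) (at x within S)" by simp
  moreover have "eventually (\<lambda>y. norm (f y - f x) \<le> C * \<bar>y - x\<bar> powr \<alpha>) (at x within S)"
    unfolding eventually_at_filter by (intro always_eventually allI impI h(2) x)
  ultimately have "((\<lambda>y. f y - f x) \<longlongrightarrow> 0) (at x within S)"
    by (rule Lim_null_comparison[rotated])
  then show "(f \<longlongrightarrow> f x) (at x within S)" by (simp add: LIM_zero_iff)
qed

abbreviation slot :: "complex set" where "slot \<equiv> complex_of_real ` {-1..1}"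

lemma closed_slot: "closed slot" and compact_slot: "compact slot"
proof -
  show "compact slot" by (intro compact_continuous_image continuous_intros) auto
  then show "closed slot" by (rule compact_imp_closed)
qed

lemma slot_iff: "z \<in> slot \<longleftrightarrow> Im z = 0 \<and> \<bar>Re z\<bar> \<le> 1"
proof
  assume "Im z = 0 \<and> \<bar>Re z\<bar> \<le> 1"
  then have "z = complex_of_real (Re z)" "Re z \<in> {-1..1}" by (auto simp: complex_eq_iff)
  then show "z \<in> slot" by blast
qed auto

lemma continuous_cauchy_integrand:
  assumes "continuous_on {-1..1} u" "z \<notin> slot"
  shows "continuous_on {-1..1} (\<lambda>t. complex_of_real (u t) / (complex_of_real t - z))"
  using assms by (intro continuous_intros) auto

lemma integrable_cauchy_integrand:
  assumes "continuous_on {-1..1} u" "z \<notin> slot"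
  shows "(\<lambda>t. complex_of_real (u t) / (complex_of_real t - z)) integrable_on {-1..1}"
  by (intro integrable_continuous_interval continuous_cauchy_integrand assms)

lemma holomorphic_cauchy_integral:
  assumes u: "continuous_on {-1..1} u"
  shows "cauchy_integral u holomorphic_on - slot"
  unfolding holomorphic_on_def
proof
  fix z assume z: "z \<in> - slot"
  then obtain e where e: "e > 0" "ball z e \<subseteq> - slot"
    using closed_slot openE[of "- slot" z] by (auto simp: open_Compl)
  have ne: "complex_of_real t - w \<noteq> 0" if "t \<in> {-1..1}" "w \<in> ball z e" for t w
    using e(2) that by auto
  have "(\<lambda>w. integral (cbox (-1) 1) (\<lambda>t. complex_of_real (u t) / (complex_of_real t - w))) holomorphic_on ball z e"
  proof (rule leibniz_rule_holomorphic[where fx = "\<lambda>w t. complex_of_real (u t) / (complex_of_real t - w)\<^sup>2"])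
    fix w t assume "w \<in> ball z e" "t \<in> cbox (-1) (1::real)"
    then have "complex_of_real t - w \<noteq> 0" using ne[of t w] by simp
    then show "((\<lambda>w. complex_of_real (u t) / (complex_of_real t - w)) has_field_derivative
        complex_of_real (u t) / (complex_of_real t - w)\<^sup>2) (at w within ball z e)"
      by (auto intro!: derivative_eq_intros simp: power2_eq_square)
  next
    fix w assume "w \<in> ball z e"
    then show "(\<lambda>t. complex_of_real (u t) / (complex_of_real t - w)) integrable_on cbox (-1) 1"
      using integrable_cauchy_integrand[OF u, of w] e(2) by auto
  next
    have cu: "continuous_on (ball z e \<times> cbox (-1) 1) (\<lambda>x. u (snd x))"
      using u by (intro continuous_on_compose2[OF u] continuous_intros) auto
    have "continuous_on (ball z e \<times> cbox (-1) 1) (\<lambda>x. complex_of_real (u (snd x)) / (complex_of_real (snd x) - fst x)\<^sup>2)"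
      using ne by (intro continuous_intros cu) force
    then show "continuous_on (ball z e \<times> cbox (-1) 1) (\<lambda>(w, t). complex_of_real (u t) / (complex_of_real t - w)\<^sup>2)"
      by (simp add: case_prod_unfold)
  qed auto
  then have "cauchy_integral u holomorphic_on ball z e"
    by (simp add: cauchy_integral_def[abs_def])
  then show "cauchy_integral u field_differentiable at z within - slot"
    using e(1) by (meson centre_in_ball field_differentiable_at_within holomorphic_on_imp_differentiable_at open_ball)
qed

lemma density_bounded:
  fixes u :: "real \<Rightarrow> real"
  assumes "continuous_on {-1..1} u"
  obtains M where "\<And>t. t \<in> {-1..1} \<Longrightarrow> \<bar>u t\<bar> \<le> M" "M > 0"
proof -
  have "bounded (u ` {-1..1})"
    by (intro compact_imp_bounded compact_continuous_image assms) simp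
  then obtain B where "\<forall>x\<in>u ` {-1..1}. norm x \<le> B" unfolding bounded_iff by blast
  have "\<bar>u t\<bar> \<le> \<bar>B\<bar> + 1" if t: "t \<in> {-1..1}" for t
  proof -
    have "norm (u t) \<le> B" using \<open>\<forall>x\<in>u ` {-1..1}. norm x \<le> B\<close> t by blast
    then show ?thesis by simp
  qed
  then show ?thesis using that[of "\<bar>B\<bar> + 1"] by simp
qed

lemma cauchy_integral_at_infinity:
  assumes u: "continuous_on {-1..1} u"
  shows "(cauchy_integral u \<longlongrightarrow> 0) at_infinity"
proof -
  obtain M where M: "\<And>t. t \<in> {-1..1} \<Longrightarrow> \<bar>u t\<bar> \<le> M" "M > 0"
    using density_bounded[OF u] by metis
  have bound: "cmod (cauchy_integral u z) \<le> 4 * M * cmod (inverse z)" if z: "cmod z \<ge> 2" for z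
  proof -
    have ns: "z \<notin> slot" using z by auto
    have "cmod (complex_of_real (u t) / (complex_of_real t - z)) \<le> M / (cmod z / 2)" if t: "t \<in> {-1..1}" for t
    proof -
      have "\<bar>t\<bar> \<le> 1" using t by auto
      then have "cmod z / 2 \<le> cmod (complex_of_real t - z)"
        using norm_triangle_ineq2[of z "complex_of_real t"] z by (simp add: norm_minus_commute)
      then show ?thesis unfolding norm_divide using M(1)[OF t] M(2) z by (intro frac_le) auto
    qed
    then have "cmod (cauchy_integral u z) \<le> M / (cmod z / 2) * (1 - (-1))"
      unfolding cauchy_integral_def using continuous_cauchy_integrand[OF u ns]
      by (intro integral_bound) auto
    moreover have "cmod (inverse z) = 1 / cmod z" unfolding norm_inverse by (rule inverse_eq_divide)
    ultimately show ?thesis by simp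
  qed
  have "((\<lambda>z::complex. cmod (inverse z)) \<longlongrightarrow> 0) at_infinity"
    by (rule tendsto_norm_zero[OF tendsto_inverse_0])
  from tendsto_mult_left[OF this, of "4 * M"]
  have "((\<lambda>z::complex. 4 * M * cmod (inverse z)) \<longlongrightarrow> 0) at_infinity" by simp
  then show ?thesis
    by (rule Lim_null_comparison[rotated]) (use bound in \<open>auto simp: eventually_at_infinity\<close>)
qed

lemma cauchy_integral_cnj: "cauchy_integral u (cnj z) = cnj (cauchy_integral u z)"
  unfolding cauchy_integral_def integral_cnj by simp

text \<open>Up to constant factors the kernels are the conjugate Poisson kernel and the Poisson
  kernel of the half plane.\<close>

lemma cauchy_parts:
  assumes u: "continuous_on {-1..1} u" and e: "e > 0"
  shows "Re (cauchy_integral u (Complex x e)) = integral {-1..1} (\<lambda>t. u t * ((t - x) / ((t - x)\<^sup>2 + e\<^sup>2)))"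
    "Im (cauchy_integral u (Complex x e)) = integral {-1..1} (\<lambda>t. u t * (e / ((t - x)\<^sup>2 + e\<^sup>2)))"
proof -
  have ns: "Complex x e \<notin> slot" using e by (simp add: slot_iff)
  note int = integrable_cauchy_integrand[OF u ns]
  have "complex_of_real (u t) / (complex_of_real t - Complex x e)
     = Complex (u t * ((t - x) / ((t - x)\<^sup>2 + e\<^sup>2))) (u t * (e / ((t - x)\<^sup>2 + e\<^sup>2)))" for t
    by (simp add: complex_eq_iff Re_divide Im_divide)
  then have eq: "(\<lambda>t. complex_of_real (u t) / (complex_of_real t - Complex x e))
     = (\<lambda>t. Complex (u t * ((t - x) / ((t - x)\<^sup>2 + e\<^sup>2))) (u t * (e / ((t - x)\<^sup>2 + e\<^sup>2))))" by blast
  show "Re (cauchy_integral u (Complex x e)) = integral {-1..1} (\<lambda>t. u t * ((t - x) / ((t - x)\<^sup>2 + e\<^sup>2)))"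
    using integral_linear[OF int bounded_linear_Re] unfolding eq cauchy_integral_def by (simp add: o_def)
  show "Im (cauchy_integral u (Complex x e)) = integral {-1..1} (\<lambda>t. u t * (e / ((t - x)\<^sup>2 + e\<^sup>2)))"
    using integral_linear[OF int bounded_linear_Im] unfolding eq cauchy_integral_def by (simp add: o_def)
qed

text \<open>If \<open>u x\<close> is nonzero at an inner point, the Poisson integral at small height
  above \<open>x\<close> is nonzero, but it is the imaginary part of a vanishing Cauchy integral.
  The ends follow by continuity.\<close>

lemma cauchy_integral_eq_0_imp:
  assumes u: "continuous_on {-1..1} u" and zero: "\<And>z. z \<notin> slot \<Longrightarrow> cauchy_integral u z = 0"
    and t: "t \<in> {-1..1}"
  shows "u t = 0"
proof -
  have inner: "u x = 0" if x: "x \<in> {-1<..<1}" for x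
  proof (rule ccontr)
    assume ux: "u x \<noteq> 0"
    define s where "s = sgn (u x)"
    define c where "c = \<bar>u x\<bar> / 2"
    have c0: "c > 0" using ux by (simp add: c_def)
    have s: "s * u x = 2 * c" "\<bar>s\<bar> = 1"
      using ux by (cases "u x > 0"; simp add: s_def c_def sgn_if)+
    obtain M where M: "\<And>t. t \<in> {-1..1} \<Longrightarrow> \<bar>u t\<bar> \<le> M" "M > 0"
    proof -
      show ?thesis using density_bounded[OF u] that by metis
    qed
    have "isCont (\<lambda>t. s * u t) x"
      using continuous_on_interior[OF u] x by (auto intro!: continuous_intros)
    moreover have "s * u x > c" using s c0 by simp
    ultimately have "eventually (\<lambda>t. s * u t > c) (at x)"
      by (auto simp: isCont_def intro: order_tendstoD)
    moreover have "eventually (\<lambda>t. t \<in> {-1<..<1}) (at x)"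
      using x by (intro eventually_at_in_open') auto
    ultimately have "eventually (\<lambda>t. s * u t > c \<and> t \<in> {-1<..<1}) (at x)" by eventually_elim simp
    then obtain h0 where h0: "h0 > 0" "\<And>t. t \<noteq> x \<Longrightarrow> dist t x < h0 \<Longrightarrow> s * u t > c \<and> t \<in> {-1<..<1}"
      unfolding eventually_at by auto
    define h where "h = h0 / 2"
    have h: "h > 0" "\<And>t. \<bar>t - x\<bar> \<le> h \<Longrightarrow> s * u t \<ge> c \<and> t \<in> {-1<..<1}"
    proof -
      show "h > 0" using h0(1) by (simp add: h_def)
      fix t assume "\<bar>t - x\<bar> \<le> h"
      moreover have "h < h0" using h0(1) by (simp add: h_def)
      ultimately have "dist t x < h0" by (simp add: dist_real_def)
      then show "s * u t \<ge> c \<and> t \<in> {-1<..<1}"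
        using h0(2)[of t] x \<open>s * u x > c\<close> by (cases "t = x") auto
    qed
    \<comment> \<open>For |t - x| \<le> e the kernel is at least 1/(2 e), so this part contributes
      at least \<open>c\<close>. For |t - x| > h the integrand is at least -M e/h^2, and the choice
      of \<open>e\<close> limits this loss to c/2 in total; in between the integrand is
      nonnegative.\<close>
    define e where "e = min h (c * h\<^sup>2 / (4 * M))"
    have e: "e > 0" "e \<le> h" "2 * M * e / h\<^sup>2 \<le> c / 2"
    proof -
      show "e > 0" "e \<le> h" using h(1) c0 M(2) by (auto simp: e_def)
      have "e \<le> c * h\<^sup>2 / (4 * M)" by (simp add: e_def)
      then have "2 * M * e \<le> 2 * M * (c * h\<^sup>2 / (4 * M))" using M(2) by (intro mult_left_mono) auto
      also have "\<dots> = c / 2 * h\<^sup>2" using M(2) by (simp add: field_simps)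
      finally show "2 * M * e / h\<^sup>2 \<le> c / 2" using h(1) by (simp add: divide_le_eq)
    qed
    define k where "k = (\<lambda>t. s * u t * (e / ((t - x)\<^sup>2 + e\<^sup>2)))"
    have den: "(t - x)\<^sup>2 + e\<^sup>2 > 0" for t using e(1) by (intro add_nonneg_pos) auto
    have contk: "continuous_on {-1..1} k" unfolding k_def
      using den by (intro continuous_intros u) (metis less_irrefl)
    have sub: "x - e \<ge> -1" "x + e \<le> 1" using h(2)[of "x - e"] h(2)[of "x + e"] e(1,2) by auto
    define q where "q = M * e / h\<^sup>2"
    have low: "k t \<ge> - q" if t: "t \<in> {-1..1}" for t
    proof (cases "\<bar>t - x\<bar> \<le> h")
      case True
      then have "s * u t \<ge> 0" using h(2)[of t] c0 by linarith
      moreover have "e / ((t - x)\<^sup>2 + e\<^sup>2) \<ge> 0" using e(1) den[of t] by simp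
      ultimately have "k t \<ge> 0" unfolding k_def by (rule mult_nonneg_nonneg)
      moreover have "q \<ge> 0" using M(2) e(1) by (simp add: q_def)
      ultimately show ?thesis by linarith
    next
      case False
      then have "h\<^sup>2 \<le> (t - x)\<^sup>2" using h(1) abs_le_square_iff[of h "t - x"] by simp
      then have "h\<^sup>2 \<le> (t - x)\<^sup>2 + e\<^sup>2" by (rule order.trans) simp
      then have "e / ((t - x)\<^sup>2 + e\<^sup>2) \<le> e / h\<^sup>2" using e(1) h(1) by (intro frac_le) auto
      moreover have "\<bar>s * u t\<bar> \<le> M" using M(1)[OF t] s(2) by (simp add: abs_mult)
      moreover have "e / ((t - x)\<^sup>2 + e\<^sup>2) \<ge> 0" using e(1) den[of t] by simp
      ultimately have "\<bar>k t\<bar> \<le> M * (e / h\<^sup>2)" unfolding k_def abs_mult[of "s * u t"]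
        using M(2) by (intro mult_mono) auto
      then show ?thesis by (simp add: q_def)
    qed
    have mid: "k t \<ge> c / (2 * e)" if t: "t \<in> {x - e..x + e}" for t
    proof -
      have te: "\<bar>t - x\<bar> \<le> e" using t by auto
      then have "(t - x)\<^sup>2 \<le> e\<^sup>2" using e(1) abs_le_square_iff[of "t - x" e] by simp
      then have "e / (2 * e\<^sup>2) \<le> e / ((t - x)\<^sup>2 + e\<^sup>2)" using e(1) den[of t] by (intro divide_left_mono) auto
      moreover have "s * u t \<ge> c" using h(2)[of t] te e(2) by linarith
      ultimately have "c * (e / (2 * e\<^sup>2)) \<le> k t" unfolding k_def using c0 e(1) by (intro mult_mono) auto
      then show ?thesis using e(1) by (simp add: power2_eq_square)
    qed
    have ik: "k integrable_on {-1..1}" using contk by (rule integrable_continuous_interval)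
    have i1: "k integrable_on {-1..x - e}" and i2: "k integrable_on {x - e..x + e}" and i3: "k integrable_on {x + e..1}"
      and i4: "k integrable_on {x - e..1}"
      by (rule integrable_subinterval_real[OF ik]; use sub e(1) in auto)+
    have "integral {-1..1} k = integral {-1..x - e} k + (integral {x - e..x + e} k + integral {x + e..1} k)"
      using Henstock_Kurzweil_Integration.integral_combine[of "-1" "x - e" 1 k] Henstock_Kurzweil_Integration.integral_combine[of "x - e" "x + e" 1 k] ik i4 sub e(1) by simp
    moreover have "integral {-1..x - e} (\<lambda>_. - q) \<le> integral {-1..x - e} k"
      using low sub e(1) by (intro integral_le i1) auto
    moreover have "integral {x + e..1} (\<lambda>_. - q) \<le> integral {x + e..1} k"
      using low sub e(1) by (intro integral_le i3) auto
    moreover have "integral {x - e..x + e} (\<lambda>_. c / (2 * e)) \<le> integral {x - e..x + e} k"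
      using mid by (intro integral_le i2) auto
    moreover have "integral {x - e..x + e} (\<lambda>_. c / (2 * e)) = c" using e(1) by (simp add: field_simps)
    moreover have "integral {-1..x - e} (\<lambda>_. - q) = - q * (x - e + 1)" using sub(1) by simp
    moreover have "integral {x + e..1} (\<lambda>_. - q) = - q * (1 - (x + e))" using sub(2) by simp
    ultimately have "integral {-1..1} k \<ge> - q * (x - e + 1) + (c + - q * (1 - (x + e)))" by linarith
    also have "- q * (x - e + 1) + (c + - q * (1 - (x + e))) = c - 2 * q + 2 * (q * e)" by (simp add: algebra_simps)
    finally have "integral {-1..1} k \<ge> c - 2 * q + 2 * (q * e)" .
    moreover have "q * e \<ge> 0" using M(2) e(1) by (simp add: q_def)
    moreover have "2 * q \<le> c / 2" using e(3) by (simp add: q_def)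
    ultimately have "integral {-1..1} k > 0" using c0 by linarith
    moreover have "integral {-1..1} k = s * Im (cauchy_integral u (Complex x e))"
      unfolding cauchy_parts(2)[OF u e(1)] k_def by (simp only: mult.assoc integral_mult_right)
    moreover have "Complex x e \<notin> slot" using e(1) by (simp add: slot_iff)
    ultimately show False using zero by simp
  qed
  have "u t = 0" if "t \<in> closure {-1<..<1}" for t
    by (rule continuous_constant_on_closure[of "{-1<..<1}" u 0]) (use u inner that in auto)
  then show ?thesis using t by simp
qed

section \<open>The real part of the boundary values as a principal value\<close>

lemma powr_integrable:
  assumes "\<alpha> > 0" and x: "x \<in> {-1<..<1::real}"
  shows "(\<lambda>t. \<bar>t - x\<bar> powr (\<alpha> - 1)) integrable_on {-1..1}"
proof -
  have 1: "((\<lambda>t. (t - x) powr (\<alpha> - 1)) has_integral ((1 - x) powr \<alpha> / \<alpha> - (x - x) powr \<alpha> / \<alpha>)) {x..1}"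
  proof (rule fundamental_theorem_of_calculus_interior)
    show "continuous_on {x..1} (\<lambda>t. (t - x) powr \<alpha> / \<alpha>)"
      using assms(1) by (intro continuous_intros continuous_on_powr') auto
    fix t assume "t \<in> {x<..<1}"
    then have "((\<lambda>t. (t - x) powr \<alpha> / \<alpha>) has_real_derivative (t - x) powr (\<alpha> - 1)) (at t)"
      using assms(1) by (auto intro!: derivative_eq_intros)
    then show "((\<lambda>t. (t - x) powr \<alpha> / \<alpha>) has_vector_derivative (t - x) powr (\<alpha> - 1)) (at t)"
      by (simp add: has_real_derivative_iff_has_vector_derivative)
  qed (use x in auto)
  have 2: "((\<lambda>t. (x - t) powr (\<alpha> - 1)) has_integral (- ((x - x) powr \<alpha> / \<alpha>) - - ((x - -1) powr \<alpha> / \<alpha>))) {-1..x}"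
  proof (rule fundamental_theorem_of_calculus_interior)
    show "continuous_on {-1..x} (\<lambda>t. - ((x - t) powr \<alpha> / \<alpha>))"
      using assms(1) by (intro continuous_intros continuous_on_powr') auto
    fix t assume "t \<in> {-1<..<x}"
    then have "((\<lambda>t. - ((x - t) powr \<alpha> / \<alpha>)) has_real_derivative (x - t) powr (\<alpha> - 1)) (at t)"
      using assms(1) by (auto intro!: derivative_eq_intros)
    then show "((\<lambda>t. - ((x - t) powr \<alpha> / \<alpha>)) has_vector_derivative (x - t) powr (\<alpha> - 1)) (at t)"
      by (simp add: has_real_derivative_iff_has_vector_derivative)
  qed (use x in auto)
  have r: "(\<lambda>t. \<bar>t - x\<bar> powr (\<alpha> - 1)) integrable_on {x..1}"
    using has_integral_integrable[OF 1] by (rule integrable_eq) auto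
  have l: "(\<lambda>t. \<bar>t - x\<bar> powr (\<alpha> - 1)) integrable_on {-1..x}"
    using has_integral_integrable[OF 2] by (rule integrable_eq) auto
  show ?thesis
    by (rule Henstock_Kurzweil_Integration.integrable_combine[OF _ _ l r]) (use x in auto)
qed

text \<open>Subtracting \<open>u x\<close> splits both sides into the integral of (u t - u x)/(t -
  x), which converges absolutely by the Hoelder condition, and \<open>u x\<close> times an explicit
  logarithmic integral. The latter has the same limit \<open>L\<close> whether the kernel is
  smoothed or symmetrically truncated.\<close>

lemma plemelj_real_part:
  assumes u: "holder_on {-1..1} u" and x: "x \<in> {-1<..<1}"
    and pv: "has_pv_integral (\<lambda>t. u t / (t - x)) x v"
    and lim: "(cauchy_integral u \<longlongrightarrow> F) (above x)"
  shows "Re F = v"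
proof -
  have cu: "continuous_on {-1..1} u" by (rule holder_continuous[OF u])
  obtain \<alpha> C where h: "0 < \<alpha>" "\<And>s t. s \<in> {-1..1} \<Longrightarrow> t \<in> {-1..1} \<Longrightarrow> \<bar>u s - u t\<bar> \<le> C * \<bar>s - t\<bar> powr \<alpha>"
    using u unfolding holder_on_def real_norm_def by blast
  define e where "e = (\<lambda>n. inverse (real (Suc n)))"
  have e0: "e n > 0" for n by (simp add: e_def)
  have e_lim: "e \<longlonglongrightarrow> 0" unfolding e_def by (rule LIMSEQ_inverse_real_of_nat)
  have e_at: "filterlim e (at_right 0) sequentially"
  proof -
    have "e n \<in> {0<..} \<and> e n \<noteq> 0" for n by (simp add: e_def)
    then show ?thesis unfolding filterlim_at using e_lim by simp
  qed
  define w where "w = (\<lambda>t. u t - u x)"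
  define g where "g = (\<lambda>t. w t / (t - x))"
  define K where "K = (\<lambda>n t. (t - x) / ((t - x)\<^sup>2 + (e n)\<^sup>2))"
  have den: "(t - x)\<^sup>2 + (e n)\<^sup>2 > 0" for t n using e0[of n] by (intro add_nonneg_pos) auto
  have contK: "continuous_on S (K n)" for S n unfolding K_def
    using den by (intro continuous_intros) (metis less_irrefl)
  have contw: "continuous_on {-1..1} w" unfolding w_def by (intro continuous_intros cu)
  \<comment> \<open>A majorant independent of \<open>n\<close> and integrable because \<alpha> > 0,
    for dominated convergence.\<close>
  have bnd: "\<bar>w t * K n t\<bar> \<le> C * \<bar>t - x\<bar> powr (\<alpha> - 1)" if t: "t \<in> {-1..1}" for t n
  proof (cases "t = x")
    case True then show ?thesis by (simp add: w_def)
  next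
    case False
    have "\<bar>K n t\<bar> \<le> 1 / \<bar>t - x\<bar>"
    proof -
      have "\<bar>K n t\<bar> = \<bar>t - x\<bar> / ((t - x)\<^sup>2 + (e n)\<^sup>2)" using den[of t n] by (simp add: K_def abs_divide)
      also have "\<dots> \<le> \<bar>t - x\<bar> / (t - x)\<^sup>2" using False by (intro divide_left_mono) (auto intro!: mult_pos_pos den)
      also have "\<dots> = 1 / \<bar>t - x\<bar>"
      proof (cases "x < t")
        case True
        then show ?thesis by (simp add: power2_eq_square)
      next
        case False
        then have "\<bar>t - x\<bar> = x - t" by simp
        then show ?thesis using \<open>t \<noteq> x\<close> unfolding power2_commute[of t x] by (simp add: power2_eq_square)
      qed
      finally show ?thesis .
    qed
    then have "\<bar>w t * K n t\<bar> \<le> (C * \<bar>t - x\<bar> powr \<alpha>) * (1 / \<bar>t - x\<bar>)"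
      unfolding abs_mult w_def using h(2)[OF t, of x] x by (intro mult_mono) auto
    also have "\<dots> = C * \<bar>t - x\<bar> powr (\<alpha> - 1)" using False by (simp add: powr_diff)
    finally show ?thesis .
  qed
  have conv: "(\<lambda>n. w t * K n t) \<longlonglongrightarrow> g t" for t
  proof (cases "t = x")
    case True then show ?thesis by (simp add: g_def w_def)
  next
    case False
    have "(\<lambda>n. w t * ((t - x) / ((t - x)\<^sup>2 + (e n)\<^sup>2))) \<longlonglongrightarrow> w t * ((t - x) / ((t - x)\<^sup>2 + 0\<^sup>2))"
      using False by (intro tendsto_intros e_lim) auto
    then show ?thesis using False by (simp add: K_def g_def power2_eq_square)
  qed
  have iw: "(\<lambda>t. w t * K n t) integrable_on {-1..1}" for n
    by (intro integrable_continuous_interval continuous_intros contw contK)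
  have ih: "(\<lambda>t. C * \<bar>t - x\<bar> powr (\<alpha> - 1)) integrable_on {-1..1}"
    using integrable_cmul[OF powr_integrable[OF h(1) x], of C] by simp
  have ig: "g integrable_on {-1..1}" and lim1: "(\<lambda>n. integral {-1..1} (\<lambda>t. w t * K n t)) \<longlonglongrightarrow> integral {-1..1} g"
    using dominated_convergence[of "\<lambda>n t. w t * K n t" "{-1..1}" "\<lambda>t. C * \<bar>t - x\<bar> powr (\<alpha> - 1)" g] iw ih bnd conv
    by auto
  define L where "L = ln (1 - x) - ln (1 + x)"
  have intK: "integral {-1..1} (K n) = ln ((1 - x)\<^sup>2 + (e n)\<^sup>2) / 2 - ln ((-1 - x)\<^sup>2 + (e n)\<^sup>2) / 2" for n
  proof (rule integral_unique, rule fundamental_theorem_of_calculus)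
    fix t :: real assume "t \<in> {-1..1}"
    have "((\<lambda>t. ln ((t - x)\<^sup>2 + (e n)\<^sup>2) / 2) has_real_derivative K n t) (at t)"
    proof -
      have dd: "((\<lambda>t. (t - x)\<^sup>2 + (e n)\<^sup>2) has_real_derivative 2 * (t - x)) (at t)"
        by (auto intro!: derivative_eq_intros)
      have "1 / D * (2 * y) / 2 = y / D" for D y :: real by simp
      then show ?thesis unfolding K_def
        using DERIV_cdivide[OF DERIV_chain2[OF DERIV_ln_divide[OF den[of t n]] dd], of 2] by (simp only:)
    qed
    then show "((\<lambda>t. ln ((t - x)\<^sup>2 + (e n)\<^sup>2) / 2) has_vector_derivative K n t) (at t within {-1..1})"
      by (simp add: has_real_derivative_iff_has_vector_derivative has_vector_derivative_at_within)
  qed simp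
  have limK: "(\<lambda>n. integral {-1..1} (K n)) \<longlonglongrightarrow> L"
  proof -
    have "(\<lambda>n. ln ((1 - x)\<^sup>2 + (e n)\<^sup>2) / 2 - ln ((-1 - x)\<^sup>2 + (e n)\<^sup>2) / 2)
        \<longlonglongrightarrow> ln ((1 - x)\<^sup>2 + 0\<^sup>2) / 2 - ln ((-1 - x)\<^sup>2 + 0\<^sup>2) / 2"
      using x by (intro tendsto_intros e_lim) auto
    moreover have "(-1 - x)\<^sup>2 = (1 + x)\<^sup>2" by (simp add: power2_eq_square algebra_simps)
    ultimately show ?thesis unfolding intK L_def using x by (simp add: ln_realpow)
  qed
  have total: "Re (cauchy_integral u (Complex x (e n)))
      = integral {-1..1} (\<lambda>t. w t * K n t) + u x * integral {-1..1} (K n)" for n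
  proof -
    have "Re (cauchy_integral u (Complex x (e n))) = integral {-1..1} (\<lambda>t. w t * K n t + u x * K n t)"
    proof -
      have "w t * K n t + u x * K n t = u t * K n t" for t by (simp add: w_def left_diff_distrib)
      then show ?thesis unfolding cauchy_parts(1)[OF cu e0] by (simp add: K_def)
    qed
    also have "\<dots> = integral {-1..1} (\<lambda>t. w t * K n t) + integral {-1..1} (\<lambda>t. u x * K n t)"
      by (intro integral_add iw integrable_continuous_interval continuous_intros contK)
    finally show ?thesis by simp
  qed
  have "filterlim (\<lambda>n. Complex x (e n)) (above x) sequentially"
    unfolding filterlim_at
  proof
    have "(\<lambda>n. complex_of_real x + \<i> * complex_of_real (e n)) \<longlonglongrightarrow> complex_of_real x + \<i> * complex_of_real 0"
      by (intro tendsto_intros e_lim)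
    then show "(\<lambda>n. Complex x (e n)) \<longlonglongrightarrow> complex_of_real x" by (simp add: Complex_eq)
    show "\<forall>\<^sub>F n in sequentially. Complex x (e n) \<in> {z. 0 < Im z} \<and> Complex x (e n) \<noteq> complex_of_real x"
      using e0 by (auto simp: complex_eq_iff intro!: always_eventually) (metis less_irrefl)
  qed
  then have "(\<lambda>n. cauchy_integral u (Complex x (e n))) \<longlonglongrightarrow> F" by (rule filterlim_compose[OF lim])
  then have "(\<lambda>n. Re (cauchy_integral u (Complex x (e n)))) \<longlonglongrightarrow> Re F" by (intro tendsto_intros)
  moreover have "(\<lambda>n. Re (cauchy_integral u (Complex x (e n)))) \<longlonglongrightarrow> integral {-1..1} g + u x * L"
    unfolding total by (intro tendsto_intros lim1 limK)
  ultimately have ReF: "Re F = integral {-1..1} g + u x * L" by (rule LIMSEQ_unique)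
  define PV where "PV = (\<lambda>n. integral {-1..x - e n} (\<lambda>t. u t / (t - x)) + integral {x + e n..1} (\<lambda>t. u t / (t - x)))"
  have "PV \<longlonglongrightarrow> v" unfolding PV_def
    using filterlim_compose[OF pv[unfolded has_pv_integral_def] e_at] .
  define d where "d = min (1 - x) (1 + x)"
  have d0: "d > 0" using x by (simp add: d_def)
  have small: "eventually (\<lambda>n. e n < d) sequentially" using e_lim d0 by (rule order_tendstoD)
  have PV_eq: "PV n = (integral {-1..x - e n} g + integral {x + e n..1} g) + u x * L" if n: "e n < d" for n
  proof -
    have le: "-1 \<le> x - e n" "x + e n \<le> 1" using n by (auto simp: d_def)
    have left: "integral {-1..x - e n} (\<lambda>t. u t / (t - x)) = integral {-1..x - e n} g + u x * (ln (e n) - ln (1 + x))"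
    proof -
      have i1: "g integrable_on {-1..x - e n}" by (rule integrable_subinterval_real[OF ig]) (use x e0[of n] in auto)
      have i2: "((\<lambda>t. 1 / (t - x)) has_integral (ln (x - (x - e n)) - ln (x - -1))) {-1..x - e n}"
      proof (rule fundamental_theorem_of_calculus[OF le(1)])
        fix t assume "t \<in> {-1..x - e n}"
        then have "t < x" using e0[of n] by auto
        then have "((\<lambda>t. ln (x - t)) has_real_derivative 1 / (t - x)) (at t)"
          by (auto intro!: derivative_eq_intros simp: field_simps)
        then show "((\<lambda>t. ln (x - t)) has_vector_derivative 1 / (t - x)) (at t within {-1..x - e n})"
          by (simp add: has_real_derivative_iff_has_vector_derivative has_vector_derivative_at_within)
      qed
      have "integral {-1..x - e n} (\<lambda>t. u t / (t - x)) = integral {-1..x - e n} (\<lambda>t. g t + u x * (1 / (t - x)))"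
        by (simp add: g_def w_def diff_divide_distrib)
      also have "\<dots> = integral {-1..x - e n} g + integral {-1..x - e n} (\<lambda>t. u x * (1 / (t - x)))"
        using i1 has_integral_integrable[OF has_integral_mult_right[OF i2, of "u x"]] by (intro integral_add) auto
      also have "integral {-1..x - e n} (\<lambda>t. u x * (1 / (t - x))) = u x * (ln (e n) - ln (1 + x))"
        using integral_unique[OF has_integral_mult_right[OF i2, of "u x"]] by (simp add: add.commute)
      finally show ?thesis .
    qed
    have right: "integral {x + e n..1} (\<lambda>t. u t / (t - x)) = integral {x + e n..1} g + u x * (ln (1 - x) - ln (e n))"
    proof -
      have i1: "g integrable_on {x + e n..1}" by (rule integrable_subinterval_real[OF ig]) (use x e0[of n] in auto)
      have i2: "((\<lambda>t. 1 / (t - x)) has_integral (ln (1 - x) - ln (x + e n - x))) {x + e n..1}"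
      proof (rule fundamental_theorem_of_calculus[OF le(2)])
        fix t assume "t \<in> {x + e n..1}"
        then have "t > x" using e0[of n] by auto
        then have "((\<lambda>t. ln (t - x)) has_real_derivative 1 / (t - x)) (at t)"
          by (auto intro!: derivative_eq_intros simp: field_simps)
        then show "((\<lambda>t. ln (t - x)) has_vector_derivative 1 / (t - x)) (at t within {x + e n..1})"
          by (simp add: has_real_derivative_iff_has_vector_derivative has_vector_derivative_at_within)
      qed
      have "integral {x + e n..1} (\<lambda>t. u t / (t - x)) = integral {x + e n..1} (\<lambda>t. g t + u x * (1 / (t - x)))"
        by (simp add: g_def w_def diff_divide_distrib)
      also have "\<dots> = integral {x + e n..1} g + integral {x + e n..1} (\<lambda>t. u x * (1 / (t - x)))"
        using i1 has_integral_integrable[OF has_integral_mult_right[OF i2, of "u x"]] by (intro integral_add) auto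
      also have "integral {x + e n..1} (\<lambda>t. u x * (1 / (t - x))) = u x * (ln (1 - x) - ln (e n))"
        using integral_unique[OF has_integral_mult_right[OF i2, of "u x"]] by simp
      finally show ?thesis .
    qed
    show ?thesis unfolding PV_def left right L_def by (simp add: algebra_simps)
  qed
  have "(\<lambda>n. integral {-1..x - e n} g + integral {x + e n..1} g) \<longlonglongrightarrow> integral {-1..x} g + integral {x..1} g"
  proof (rule tendsto_add)
    have "continuous_on {-1..1} (\<lambda>s. integral {-1..s} g)" by (rule indefinite_integral_continuous_1[OF ig])
    then have "isCont (\<lambda>s. integral {-1..s} g) x" using continuous_on_interior x by fastforce
    moreover have "(\<lambda>n. x - e n) \<longlonglongrightarrow> x - 0" by (intro tendsto_intros e_lim)
    ultimately show "(\<lambda>n. integral {-1..x - e n} g) \<longlonglongrightarrow> integral {-1..x} g"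
      using isCont_tendsto_compose by fastforce
    have "continuous_on {-1..1} (\<lambda>s. integral {s..1} g)" by (rule indefinite_integral_continuous_1'[OF ig])
    then have "isCont (\<lambda>s. integral {s..1} g) x" using continuous_on_interior x by fastforce
    moreover have "(\<lambda>n. x + e n) \<longlonglongrightarrow> x + 0" by (intro tendsto_intros e_lim)
    ultimately show "(\<lambda>n. integral {x + e n..1} g) \<longlonglongrightarrow> integral {x..1} g"
      using isCont_tendsto_compose by fastforce
  qed
  moreover have "integral {-1..x} g + integral {x..1} g = integral {-1..1} g"
    using x by (intro Henstock_Kurzweil_Integration.integral_combine ig) auto
  ultimately have "(\<lambda>n. (integral {-1..x - e n} g + integral {x + e n..1} g) + u x * L) \<longlonglongrightarrow> integral {-1..1} g + u x * L"
    by (intro tendsto_intros) simp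
  moreover have "eventually (\<lambda>n. (integral {-1..x - e n} g + integral {x + e n..1} g) + u x * L = PV n) sequentially"
    using small by eventually_elim (simp add: PV_eq)
  ultimately have "PV \<longlonglongrightarrow> integral {-1..1} g + u x * L" by (rule Lim_transform_eventually)
  then have "v = integral {-1..1} g + u x * L" using LIMSEQ_unique[OF \<open>PV \<longlonglongrightarrow> v\<close>] by blast
  then show ?thesis using ReF by simp
qed

section \<open>The sheets\<close>

locale cubic_labelled = cubic_ext +
  assumes good: "good_labelling 1 2 3 g"
begin

lemma g1: "x \<in> {-1..1} \<Longrightarrow> g 1 (R (emb (Some x))) = emb (Some x)"
  and interval_off_slots: "x \<in> {-1..1} \<Longrightarrow> R (emb (Some x)) \<notin> emb ` (carc (a 1) (a 2) \<union> carc (a 3) (a 4))"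
  and g2_ends: "g 2 (emb (a 3)) = emb (c 3)" "g 2 (emb (a 4)) = emb (c 4)"
  and seg2: "emb ` carc_avoiding crit (c 4) (c 3) \<subseteq> (\<lambda>t. g 2 (emb t)) ` carc (a 3) (a 4)"
  and g3_ends: "g 3 (emb (a 1)) = emb (c 1)" "g 3 (emb (a 2)) = emb (c 2)"
  and seg3: "emb ` carc_avoiding crit (c 2) (c 1) \<subseteq> (\<lambda>t. g 3 (emb t)) ` carc (a 1) (a 2)"
  using good unfolding good_labelling_def by blast+

lemma interval_image:
  assumes "t \<in> {-1..1}"
  obtains x where "x \<in> {-1..1}" "R (emb (Some x)) = emb (Some t)" "g 1 (emb (Some t)) = emb (Some x)"
proof -
  have "emb (Some t) \<in> R ` emb ` Some ` {-1..1}" unfolding R_interval using assms by blast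
  then obtain x where x: "x \<in> {-1..1}" "R (emb (Some x)) = emb (Some t)" by force
  then show ?thesis using that g1[OF x(1)] by simp
qed

lemma R_interval_value:
  assumes "x \<in> {-1..1}"
  obtains t where "t \<in> {-1..1}" "R (emb (Some x)) = emb (Some t)"
proof -
  have "R (emb (Some x)) \<in> R ` emb ` Some ` {-1..1}" using assms by blast
  then show ?thesis using that unfolding R_interval by blast
qed

lemma carc_eq: "carc x y = {x, y} \<union> oarc x y" by (simp add: carc_def)

lemma interval_disjoint_arcs: "t \<in> {-1..1} \<Longrightarrow> Some t \<notin> carc (a 1) (a 2) \<union> carc (a 3) (a 4)"
proof
  assume t: "t \<in> {-1..1}" and *: "Some t \<in> carc (a 1) (a 2) \<union> carc (a 3) (a 4)"
  obtain x where x: "x \<in> {-1..1}" "R (emb (Some x)) = emb (Some t)" using interval_image[OF t] by blast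
  have "emb (Some t) \<notin> emb ` (carc (a 1) (a 2) \<union> carc (a 3) (a 4))"
    using interval_off_slots[OF x(1)] unfolding x(2) .
  then show False using imageI[OF *, of emb] by (rule notE)
qed

lemma a_cases: "a ` {1..4} = {a 1, a 2, a 3, a 4}"
proof -
  have "{1..4::nat} = {1, 2, 3, 4}" by auto
  then show ?thesis by simp
qed

lemma off_arcs_generic:
  assumes "y \<notin> carc (a 1) (a 2) \<union> carc (a 3) (a 4)"
  shows "y \<notin> oarc (a 1) (a 2) \<union> oarc (a 3) (a 4) \<union> a ` {1..4}"
  using assms unfolding carc_eq a_cases by blast

lemma real_off_arcs:
  assumes "y \<notin> carc (a 1) (a 2) \<union> carc (a 3) (a 4)"
  shows "g s (emb y) \<in> range emb" "inj (\<lambda>s. g s (emb y))"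
proof -
  note y = off_arcs_generic[OF assms]
  show "g s (emb y) \<in> range emb" by (rule real_fibre_value) (use y in blast)
  show "inj (\<lambda>s. g s (emb y))" by (intro inj_g emb_in_closed_upper card_fibre_gap y)
qed

lemma inj_on_arc:
  assumes "y \<in> oarc (a 1) (a 2) \<union> oarc (a 3) (a 4)"
  shows "inj (\<lambda>s. g s (emb y))"
  by (intro inj_g emb_in_closed_upper card_fibre_arc assms)

lemma pants_real: "emb y \<in> pants_interior \<longleftrightarrow> y \<notin> slots"
  by (simp add: pants_interior_def)

lemma pants_upper: "Some ` upper \<subseteq> pants_interior"
proof
  fix x assume "x \<in> Some ` upper"
  then obtain y where y: "x = Some y" "Im y > 0" by auto
  have "x \<notin> range emb" using y by (simp add: Some_in_range_emb)
  then show "x \<in> pants_interior" unfolding pants_interior_def by blast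
qed

lemma pants_cnjo: "x \<in> pants_interior \<Longrightarrow> cnjo x \<in> pants_interior"
proof -
  assume x: "x \<in> pants_interior"
  show "cnjo x \<in> pants_interior"
  proof (cases "x \<in> range emb")
    case True then show ?thesis using x range_emb_iff by metis
  next
    case False
    then have "cnjo x \<noteq> x" using range_emb_iff by blast
    then have "cnjo x \<notin> range emb" using range_emb_iff[of "cnjo x"] cnjo_cnjo by metis
    then show ?thesis unfolding pants_interior_def by blast
  qed
qed

lemma closed_upper_cases: "x \<in> closed_upper \<or> cnjo x \<in> closed_upper"
proof (cases x)
  case (Some z)
  then show ?thesis by (cases "Im z \<ge> 0") (auto simp: closed_upper_def)
qed (simp add: closed_upper_def)

lemma closed_upper_both: "x \<in> closed_upper \<Longrightarrow> cnjo x \<in> closed_upper \<Longrightarrow> x \<in> range emb"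
proof -
  assume x: "x \<in> closed_upper" "cnjo x \<in> closed_upper"
  have "cnjo x = x"
  proof (cases x)
    case (Some z)
    then have "Im z = 0" using x by (auto simp: closed_upper_def)
    then show ?thesis using Some by (simp add: complex_eq_iff)
  qed simp
  then show ?thesis by (simp add: range_emb_iff)
qed

lemma slots_off: "y \<notin> slots \<Longrightarrow> y \<notin> carc (a 1) (a 2) \<union> carc (a 3) (a 4)"
  by (auto simp: slots_def)

lemma pants_value:
  assumes "y \<in> pants_interior" "y \<in> closed_upper"
  shows "inj (\<lambda>s. g s y)" "y \<in> range emb \<Longrightarrow> g s y \<in> range emb"
proof -
  have real: "x \<notin> carc (a 1) (a 2) \<union> carc (a 3) (a 4)" if "y = emb x" for x
    using assms(1) that pants_real slots_off by blast
  show "y \<in> range emb \<Longrightarrow> g s y \<in> range emb" using real real_off_arcs(1) by blast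
  show "inj (\<lambda>s. g s y)"
  proof (cases "y \<in> range emb")
    case True
    then show ?thesis using real real_off_arcs(2) by blast
  next
    case False
    then obtain z where z: "y = Some z" "z \<in> upper"
      using assms(2) Some_in_range_emb rangeI[of emb None]
      by (cases y) (auto simp: closed_upper_def less_eq_real_def)
    then show ?thesis using inj_r[OF z(2)] unfolding z(1) by (simp add: g_Some inj_def)
  qed
qed

definition gf :: "3 \<Rightarrow> complex option \<Rightarrow> complex option" where
  "gf s y = (if y \<in> closed_upper then g s y else cnjo (g s (cnjo y)))"

lemma R_gf: "R (gf s y) = y"
proof (cases "y \<in> closed_upper")
  case False
  then have "cnjo y \<in> closed_upper" using closed_upper_cases by blast
  then have "R (gf s y) = cnjo (cnjo y)" using False by (simp add: gf_def R_cnjo R_g del: cnjo_cnjo)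
  then show ?thesis by (simp only: cnjo_cnjo)
qed (simp add: gf_def R_g)

lemma gf_fibre:
  assumes "y \<in> pants_interior"
  shows "R -` {y} = range (\<lambda>s. gf s y)" "inj (\<lambda>s. gf s y)"
proof -
  have "R -` {y} = range (\<lambda>s. gf s y) \<and> inj (\<lambda>s. gf s y)"
  proof (cases "y \<in> closed_upper")
    case True
    then have "(\<lambda>s. gf s y) = (\<lambda>s. g s y)" by (simp add: gf_def)
    show ?thesis unfolding \<open>(\<lambda>s. gf s y) = (\<lambda>s. g s y)\<close>
      using fibre_eq[OF True] pants_value(1)[OF assms True] by (rule conjI)
  next
    case False
    then have cu: "cnjo y \<in> closed_upper" using closed_upper_cases by blast
    have eq: "(\<lambda>s. gf s y) = (\<lambda>s. cnjo (g s (cnjo y)))" using False by (simp add: gf_def)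
    have "inj (\<lambda>s. cnjo (g s (cnjo y)))"
    proof (rule injI)
      fix s t assume "cnjo (g s (cnjo y)) = cnjo (g t (cnjo y))"
      then have "g s (cnjo y) = g t (cnjo y)" by (metis cnjo_cnjo)
      then show "s = t" using pants_value(1)[OF pants_cnjo[OF assms] cu] by (auto dest: injD)
    qed
    moreover have "R -` {y} = range (\<lambda>s. cnjo (g s (cnjo y)))"
    proof (intro equalityI subsetI)
      fix x assume "x \<in> R -` {y}"
      then have "R (cnjo x) = cnjo y" by (simp add: R_cnjo)
      then have "cnjo x \<in> range (\<lambda>s. g s (cnjo y))" using fibre_eq[OF cu] by blast
      then obtain s where "cnjo x = g s (cnjo y)" by blast
      then have "x = cnjo (g s (cnjo y))" by (metis cnjo_cnjo)
      then show "x \<in> range (\<lambda>s. cnjo (g s (cnjo y)))" by blast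
    next
      fix x assume "x \<in> range (\<lambda>s. cnjo (g s (cnjo y)))"
      then obtain s where "x = cnjo (g s (cnjo y))" by blast
      then have "R x = cnjo (cnjo y)" by (simp only: R_cnjo R_g[OF cu])
      then show "x \<in> R -` {y}" by (simp only: cnjo_cnjo vimage_singleton_eq)
    qed
    ultimately show ?thesis unfolding eq by blast
  qed
  then show "R -` {y} = range (\<lambda>s. gf s y)" "inj (\<lambda>s. gf s y)" by blast+
qed

text \<open>On the gaps the section is real, so its reflection continues it to the lower half plane.\<close>

lemma continuous_gf: "continuous_map (subtopology sphere_top pants_interior) sphere_top (gf s)"
proof -
  define low where "low = {x. cnjo x \<in> closed_upper}"
  have cl_low: "closedin sphere_top low"
    using closedin_continuous_map_preimage[OF continuous_map_sphere_cnj closedin_closed_upper]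
    by (simp add: low_def)
  have c1: "continuous_map (subtopology sphere_top closed_upper) sphere_top (gf s)"
    by (rule continuous_map_eq[OF cont_g[of s]]) (simp add: gf_def)
  have c2: "continuous_map (subtopology sphere_top (pants_interior \<inter> low)) sphere_top (gf s)"
  proof -
    have "continuous_map (subtopology sphere_top low) (subtopology sphere_top closed_upper) cnjo"
      by (auto simp: continuous_map_in_subtopology low_def intro: continuous_map_from_subtopology continuous_map_sphere_cnj)
    from continuous_map_compose[OF continuous_map_compose[OF this cont_g[of s]] continuous_map_sphere_cnj]
    have "continuous_map (subtopology sphere_top low) sphere_top (\<lambda>y. cnjo (g s (cnjo y)))" by (simp add: o_def)
    then have "continuous_map (subtopology sphere_top (pants_interior \<inter> low)) sphere_top (\<lambda>y. cnjo (g s (cnjo y)))"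
      by (rule continuous_map_from_subtopology_mono) blast
    then show ?thesis
    proof (rule continuous_map_eq)
      fix y assume "y \<in> topspace (subtopology sphere_top (pants_interior \<inter> low))"
      then have y: "y \<in> pants_interior" "cnjo y \<in> closed_upper" by (simp_all add: low_def)
      show "cnjo (g s (cnjo y)) = gf s y"
      proof (cases "y \<in> closed_upper")
        case True
        then have yr: "y \<in> range emb" using closed_upper_both y(2) by blast
        then have "cnjo y = y" "g s y \<in> range emb" using range_emb_iff pants_value(2)[OF y(1) True] by blast+
        then show ?thesis using True range_emb_iff[of "g s y"] by (simp add: gf_def)
      qed (simp add: gf_def)
    qed
  qed
  define X where "X = subtopology sphere_top pants_interior"
  have "continuous_map X sphere_top (gf s)"
  \<comment> \<open>The index \<open>True\<close> stands for the part in the closed upper half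
    plane, \<open>False\<close> for the part in the closed lower one.\<close>
  proof (rule pasting_lemma_locally_finite[where I = "UNIV :: bool set" and T = "\<lambda>b. pants_interior \<inter> (if b then closed_upper else low)" and f = "\<lambda>_. gf s"])
    fix x assume "x \<in> topspace X"
    then show "\<exists>V. openin X V \<and> x \<in> V \<and> finite {i \<in> UNIV. (pants_interior \<inter> (if i then closed_upper else low)) \<inter> V \<noteq> {}}"
      by (intro exI[of _ "topspace X"]) auto
  next
    fix i :: bool
    show "closedin X (pants_interior \<inter> (if i then closed_upper else low))"
      using closedin_closed_upper cl_low unfolding X_def closedin_subtopology by (auto simp: Int_commute)
    show "continuous_map (subtopology X (pants_interior \<inter> (if i then closed_upper else low))) sphere_top (gf s)"
    proof (cases i)
      case True
      have "continuous_map (subtopology sphere_top (pants_interior \<inter> closed_upper)) sphere_top (gf s)"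
        using c1 by (rule continuous_map_from_subtopology_mono) blast
      then show ?thesis using True by (simp add: X_def subtopology_subtopology Int_absorb1 inf.absorb2)
    next
      case False
      then show ?thesis using c2 by (simp add: X_def subtopology_subtopology Int_absorb1 inf.absorb2)
    qed
  next
    fix x assume "x \<in> topspace X"
    then show "\<exists>j. j \<in> UNIV \<and> x \<in> pants_interior \<inter> (if j then closed_upper else low) \<and> gf s x = gf s x"
      using closed_upper_cases[of x] by (auto simp: X_def low_def intro: exI[of _ True] exI[of _ False])
  qed auto
  then show ?thesis by (simp add: X_def)
qed

text \<open>The part in the closed upper half plane lies between the open half plane and its
  closure. It shares infinity, an interior point of the pants, with its mirror image.\<close>

lemma connected_pants: "connectedin sphere_top pants_interior"
proof -
  have "connectedin euclidean upper" using convex_connected[OF convex_upper] by simp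
  then have c: "connectedin sphere_top (Some ` upper)"
    by (rule connectedin_continuous_map_image[OF continuous_map_Some])
  define A where "A = pants_interior \<inter> closed_upper"
  have A: "connectedin sphere_top A"
    by (rule connectedin_intermediate_closure_of[OF c])
      (use pants_upper closed_upper_subset_closure in \<open>auto simp: A_def closed_upper_def\<close>)
  have A': "connectedin sphere_top (cnjo ` A)"
    by (rule connectedin_continuous_map_image[OF continuous_map_sphere_cnj A])
  have "None \<in> A" using None_pants by (simp add: A_def closed_upper_def)
  then have "None \<in> A \<inter> cnjo ` A" by force
  then have "connectedin sphere_top (A \<union> cnjo ` A)" using connectedin_Un[OF A A'] by blast
  moreover have "A \<union> cnjo ` A = pants_interior"
  proof (intro equalityI subsetI)
    fix x assume x: "x \<in> pants_interior"
    show "x \<in> A \<union> cnjo ` A"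
    proof (cases "x \<in> closed_upper")
      case False
      then have "cnjo x \<in> A" using closed_upper_cases[of x] pants_cnjo[OF x] by (auto simp: A_def)
      then have "cnjo (cnjo x) \<in> cnjo ` A" by (rule imageI)
      then show ?thesis by (simp only: cnjo_cnjo) blast
    qed (use x in \<open>simp add: A_def\<close>)
  next
    fix x assume "x \<in> A \<union> cnjo ` A"
    then show "x \<in> pants_interior" using pants_cnjo by (auto simp: A_def)
  qed
  ultimately show ?thesis by simp
qed

section \<open>Components of the preimage of the pants\<close>

abbreviation preim :: "complex option topology" where
  "preim \<equiv> subtopology sphere_top (R -` pants_interior)"

definition sheet_component :: "3 \<Rightarrow> complex option set" where "sheet_component s = gf s ` pants_interior"

lemma sheet_component_connected: "connectedin preim (sheet_component s)"
proof -
  have "connectedin (subtopology sphere_top pants_interior) pants_interior"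
    using connected_pants by (simp add: connectedin_subtopology)
  then have "connectedin sphere_top (sheet_component s)"
    unfolding sheet_component_def by (rule connectedin_continuous_map_image[OF continuous_gf])
  moreover have "sheet_component s \<subseteq> R -` pants_interior" by (auto simp: sheet_component_def R_gf)
  ultimately show ?thesis by (simp add: connectedin_subtopology)
qed

lemma sheet_component_eq: "sheet_component s = {x \<in> R -` pants_interior. gf s (R x) = x}"
  by (auto simp: sheet_component_def R_gf image_iff) (metis)

lemma sheet_component_cover: "x \<in> R -` pants_interior \<Longrightarrow> \<exists>s. x \<in> sheet_component s"
proof -
  assume x: "x \<in> R -` pants_interior"
  then have "x \<in> range (\<lambda>s. gf s (R x))" using gf_fibre(1)[of "R x"] by auto
  then obtain s where "gf s (R x) = x" by (metis rangeE)
  then show "\<exists>s. x \<in> sheet_component s" using x by (auto simp: sheet_component_eq)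
qed

lemma sheet_component_disjoint: "x \<in> sheet_component s \<Longrightarrow> x \<in> sheet_component s' \<Longrightarrow> s = s'"
proof -
  assume "x \<in> sheet_component s" "x \<in> sheet_component s'"
  then have x: "R x \<in> pants_interior" "gf s (R x) = gf s' (R x)" by (simp_all add: sheet_component_eq)
  show "s = s'" by (rule injD[OF gf_fibre(2)[OF x(1)] x(2)])
qed

lemma sheet_component_closed: "closedin preim (sheet_component s)"
proof -
  have "continuous_map preim (subtopology sphere_top pants_interior) R"
    by (auto simp: continuous_map_in_subtopology intro: continuous_map_from_subtopology continuous_R)
  from continuous_map_compose[OF this continuous_gf[of s]]
  have 1: "continuous_map preim sphere_top (\<lambda>x. gf s (R x))" by (simp add: o_def)
  have 2: "continuous_map preim sphere_top (\<lambda>x. x)"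
    by (rule continuous_map_from_subtopology) (rule continuous_map_id[unfolded id_def])
  have "closedin preim {x \<in> topspace preim. gf s (R x) = x}"
    by (rule closedin_continuous_maps_eq[OF Hausdorff_sphere 1 2])
  then show ?thesis by (simp add: sheet_component_eq Int_def vimage_def)
qed

lemma sheet_component_open: "openin preim (sheet_component s)"
proof -
  obtain j k where jk: "j \<noteq> s" "k \<noteq> s" "j \<noteq> k" "\<And>s'. s' = s \<or> s' = j \<or> s' = k" using other_two[of s] by metis
  have "sheet_component s = topspace preim - (sheet_component j \<union> sheet_component k)"
  proof (intro equalityI subsetI)
    fix x assume "x \<in> sheet_component s"
    then show "x \<in> topspace preim - (sheet_component j \<union> sheet_component k)" using sheet_component_disjoint jk by (auto simp: sheet_component_eq)
  next
    fix x assume x: "x \<in> topspace preim - (sheet_component j \<union> sheet_component k)"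
    then obtain s' where "x \<in> sheet_component s'" using sheet_component_cover by auto
    then show "x \<in> sheet_component s" using x jk(4)[of s'] by auto
  qed
  then show ?thesis using openin_diff[OF openin_topspace closedin_Un[OF sheet_component_closed sheet_component_closed]] by simp
qed

lemma sheet_component_nonempty: "sheet_component s \<noteq> {}"
  using None_pants by (auto simp: sheet_component_def)

text \<open>The three images are connected, disjoint and cover the preimage. Each is closed as a
  coincidence set of continuous maps and open as the complement of the other two.\<close>

lemma components: "connected_components_of preim = range sheet_component"
proof (intro equalityI subsetI)
  fix K assume K: "K \<in> connected_components_of preim"
  then have "K \<noteq> {}" "K \<subseteq> topspace preim"
    using nonempty_connected_components_of connected_components_of_subset by blast+
  then obtain x s where x: "x \<in> K" "x \<in> sheet_component s" using sheet_component_cover by force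
  have "K \<subseteq> sheet_component s"
    using connectedin_clopen_cases[OF connectedin_connected_components_of[OF K] sheet_component_closed sheet_component_open, of s] x
    by (auto simp: disjnt_def)
  moreover have "sheet_component s \<subseteq> K"
    using connected_components_of_maximal[OF K sheet_component_connected[of s]] x by (auto simp: disjnt_def)
  ultimately show "K \<in> range sheet_component" by blast
next
  fix K assume "K \<in> range sheet_component"
  then obtain s where s: "K = sheet_component s" by blast
  obtain x where x: "x \<in> sheet_component s" using sheet_component_nonempty by blast
  then have "x \<in> topspace preim" by (auto simp: sheet_component_eq)
  then have C: "connected_component_of_set preim x \<in> connected_components_of preim"
    by (auto simp: connected_components_of_def)
  have xC: "x \<in> connected_component_of_set preim x"
    using \<open>x \<in> topspace preim\<close> by (simp add: connected_component_of_refl)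
  have "connected_component_of_set preim x \<subseteq> sheet_component s"
    using connectedin_clopen_cases[OF connectedin_connected_components_of[OF C] sheet_component_closed sheet_component_open, of s] x xC
    by (auto simp: disjnt_def)
  moreover have "sheet_component s \<subseteq> connected_component_of_set preim x"
    using connected_components_of_maximal[OF C sheet_component_connected[of s]] x xC by (auto simp: disjnt_def)
  ultimately show "K \<in> connected_components_of preim" using C s by simp
qed

lemma slot_in_frontier:
  assumes t: "t \<in> slots"
  shows "g s (emb t) \<in> sphere_top frontier_of (sheet_component s)"
proof -
  have "g s (emb t) \<in> sphere_top closure_of (sheet_component s)"
    unfolding in_closure_of
  proof (intro conjI allI impI)
    fix T assume T: "g s (emb t) \<in> T \<and> openin sphere_top T"
    have "eventually (\<lambda>y. Some (r s y) \<in> T) (upper_filter (emb t))"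
      using limitinD[OF limit_g[OF emb_in_closed_upper]] T by blast
    then have "eventually (\<lambda>y. Some (r s y) \<in> T \<and> y \<in> upper) (upper_filter (emb t))"
      using eventually_upper_filter by eventually_elim simp
    then obtain y where y: "Some (r s y) \<in> T" "y \<in> upper"
      using upper_filter_nontrivial[OF emb_in_closed_upper[of t]] eventually_happens by blast
    have "Some y \<in> pants_interior" "Some y \<in> closed_upper" using y(2) pants_upper by (auto simp: closed_upper_def)
    then have "gf s (Some y) \<in> sheet_component s" unfolding sheet_component_def by blast
    moreover have "gf s (Some y) = Some (r s y)" using \<open>Some y \<in> closed_upper\<close> g_Some[OF y(2)] by (simp add: gf_def)
    ultimately show "\<exists>y. y \<in> sheet_component s \<and> y \<in> T" using y(1) by metis
  qed simp
  moreover have "g s (emb t) \<notin> sheet_component s"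
  proof
    assume "g s (emb t) \<in> sheet_component s"
    then have "R (g s (emb t)) \<in> pants_interior" by (simp add: sheet_component_eq)
    then have "emb t \<in> pants_interior" using R_g[OF emb_in_closed_upper] by simp
    then show False using t by (simp add: pants_real)
  qed
  ultimately show ?thesis using interior_of_subset[of sphere_top "sheet_component s"] by (auto simp: frontier_of_def)
qed

text \<open>A point of the component close to \<open>x\<close> lies over a point close to
  \<open>t\<close>, and the point or its conjugate is a value of \<open>g s\<close> close to
  \<open>g s (emb t)\<close>. As \<open>x\<close> is real, both are close to \<open>x\<close>, so
  \<open>x\<close> and \<open>g s (emb t)\<close> cannot be separated.\<close>

lemma frontier_slot:
  assumes x: "x \<in> range emb" "x \<in> sphere_top frontier_of (sheet_component s)" and t: "R x = emb t"
  shows "g s (emb t) = x"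
proof (rule ccontr)
  assume ne: "g s (emb t) \<noteq> x"
  obtain O1 O2 where O: "openin sphere_top O1" "openin sphere_top O2" "x \<in> O1" "g s (emb t) \<in> O2" "O1 \<inter> O2 = {}"
  proof -
    have "\<exists>U V. openin sphere_top U \<and> openin sphere_top V \<and> x \<in> U \<and> g s (emb t) \<in> V \<and> disjnt U V"
      using Hausdorff_sphere ne unfolding Hausdorff_space_def by (metis UNIV_I topspace_sphere)
    then show ?thesis using that by (auto simp: disjnt_def)
  qed
  have opc: "openin sphere_top {y. cnjo y \<in> U}" if "openin sphere_top U" for U
    using openin_continuous_map_preimage[OF continuous_map_sphere_cnj that] by simp
  have "openin (subtopology sphere_top closed_upper) {y \<in> topspace (subtopology sphere_top closed_upper). g s y \<in> O2}"
    by (rule openin_continuous_map_preimage[OF cont_g O(2)])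
  then obtain N where N: "openin sphere_top N" "{y \<in> closed_upper. g s y \<in> O2} = N \<inter> closed_upper"
    by (auto simp: openin_subtopology)
  have tN: "emb t \<in> N" using N(2) O(4) emb_in_closed_upper[of t] by blast
  define N' where "N' = N \<inter> {y. cnjo y \<in> N}"
  have "openin sphere_top N'" unfolding N'_def by (intro openin_Int N opc)
  then have "openin sphere_top {z. R z \<in> N'}"
    using openin_continuous_map_preimage[OF continuous_R] by simp
  then have op: "openin sphere_top ({z. R z \<in> N'} \<inter> (O1 \<inter> {y. cnjo y \<in> O1}))" by (intro openin_Int O opc)
  have cx: "cnjo x = x" "cnjo (emb t) = emb t" using x(1) range_emb_iff by blast+
  then have "x \<in> {z. R z \<in> N'} \<inter> (O1 \<inter> {y. cnjo y \<in> O1})" using tN O(3) by (simp add: t N'_def)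
  moreover have "x \<in> sphere_top closure_of (sheet_component s)" using x(2) by (simp add: frontier_of_def)
  ultimately have "\<exists>z. z \<in> sheet_component s \<and> z \<in> {z. R z \<in> N'} \<inter> (O1 \<inter> {y. cnjo y \<in> O1})"
    using op unfolding in_closure_of by (elim conjE allE[of _ "{z. R z \<in> N'} \<inter> (O1 \<inter> {y. cnjo y \<in> O1})"]) (rule mp, assumption, rule conjI)
  then obtain z where z: "z \<in> sheet_component s" "R z \<in> N'" "z \<in> O1" "cnjo z \<in> O1" by (auto simp del: cnjo_cnjo)
  have zg: "z = gf s (R z)" using z(1) by (simp add: sheet_component_eq)
  show False
  proof (cases "R z \<in> closed_upper")
    case True
    then have "g s (R z) \<in> O2" using N(2) z(2) by (auto simp: N'_def)
    then show False using zg True O(5) z(3) by (auto simp: gf_def)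
  next
    case False
    then have "cnjo (R z) \<in> closed_upper" using closed_upper_cases by blast
    then have "g s (cnjo (R z)) \<in> O2" using N(2) z(2) by (auto simp: N'_def)
    moreover have "cnjo z = g s (cnjo (R z))" using zg False by (metis cnjo_cnjo gf_def)
    ultimately show False using O(5) z(4) by auto
  qed
qed

text \<open>On the second and third segments an inner point is taken: over the ends of the slot arcs
  the other two sections coincide, whereas elsewhere the three values are distinct. This is what
  makes the point identify the sheet.\<close>

lemma sheet_witness:
  obtains x t where "x \<in> emb ` sheet_segment s" "t \<in> slots" "x = g s (emb t)" "inj (\<lambda>s. g s (emb t))"
proof -
  have c_ne: "c 4 \<noteq> c 3" "c 2 \<noteq> c 1"
  proof -
    have "a 4 \<noteq> a 3" "a 2 \<noteq> a 1" using inj_a by (auto dest: inj_onD)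
    moreover have "R (emb (c 1)) = emb (a 1)" "R (emb (c 2)) = emb (a 2)" "R (emb (c 3)) = emb (a 3)" "R (emb (c 4)) = emb (a 4)"
      using R_c[of 1] R_c[of 2] R_c[of 3] R_c[of 4] by auto
    ultimately show "c 4 \<noteq> c 3" "c 2 \<noteq> c 1" by auto
  qed
  have pick: "\<exists>x. x \<in> oarc_avoiding crit p q \<and> x \<noteq> p \<and> x \<noteq> q" if "p \<noteq> q" for p q
    using oarc_nonempty[OF that] oarc_nonempty[of q p] oarc_endpoints[of p q] oarc_endpoints[of q p] that
    unfolding oarc_avoiding_def by (auto simp: ex_in_conv[symmetric])
  consider "s = 1" | "s = 2" | "s = 3" using exhaust_3 by blast
  then show ?thesis
  proof cases
    case 1
    have 0: "(0::real) \<in> {-1..1}" by simp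
    then obtain t where t: "t \<in> {-1..1}" "R (emb (Some 0)) = emb (Some t)" using R_interval_value by blast
    show ?thesis
    proof (rule that[of "emb (Some 0)" "Some t"])
      show "emb (Some 0) \<in> emb ` sheet_segment s"
        by (rule imageI) (use 0 1 in \<open>simp add: sheet_segment_def\<close>)
      show "Some t \<in> slots" using t(1) by (auto simp: slots_def)
      show "emb (Some 0) = g s (emb (Some t))" using g1[OF 0] unfolding t(2) 1 by (rule sym)
      show "inj (\<lambda>s. g s (emb (Some t)))" by (rule real_off_arcs(2)[OF interval_disjoint_arcs[OF t(1)]])
    qed
  next
    case 2
    obtain x where x: "x \<in> oarc_avoiding crit (c 4) (c 3)" "x \<noteq> c 4" "x \<noteq> c 3" using pick[OF c_ne(1)] by blast
    have "emb x \<in> emb ` carc_avoiding crit (c 4) (c 3)" by (rule imageI) (simp add: carc_avoiding_def x(1))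
    then have xs: "emb x \<in> emb ` sheet_segment s" and "emb x \<in> (\<lambda>t. g 2 (emb t)) ` carc (a 3) (a 4)"
      using seg2 by (simp add: 2 sheet_segment_def, blast)
    then obtain t where t: "t \<in> carc (a 3) (a 4)" "emb x = g 2 (emb t)" by blast
    have "t \<noteq> a 3" "t \<noteq> a 4" using t(2) x(2,3) g2_ends by auto
    then have ta: "t \<in> oarc (a 3) (a 4)" using t(1) by (simp add: carc_eq)
    show ?thesis
    proof (rule that[of "emb x" t])
      show "t \<in> slots" using t(1) by (simp add: slots_def)
      show "emb x = g s (emb t)" unfolding 2 by (rule t(2))
      show "inj (\<lambda>s. g s (emb t))" by (rule inj_on_arc) (use ta in blast)
    qed (rule xs)
  next
    case 3
    obtain x where x: "x \<in> oarc_avoiding crit (c 2) (c 1)" "x \<noteq> c 2" "x \<noteq> c 1" using pick[OF c_ne(2)] by blast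
    have "emb x \<in> emb ` carc_avoiding crit (c 2) (c 1)" by (rule imageI) (simp add: carc_avoiding_def x(1))
    then have xs: "emb x \<in> emb ` sheet_segment s" and "emb x \<in> (\<lambda>t. g 3 (emb t)) ` carc (a 1) (a 2)"
      using seg3 by (simp add: 3 sheet_segment_def, blast)
    then obtain t where t: "t \<in> carc (a 1) (a 2)" "emb x = g 3 (emb t)" by blast
    have "t \<noteq> a 1" "t \<noteq> a 2" using t(2) x(2,3) g3_ends by auto
    then have ta: "t \<in> oarc (a 1) (a 2)" using t(1) by (simp add: carc_eq)
    show ?thesis
    proof (rule that[of "emb x" t])
      show "t \<in> slots" using t(1) by (simp add: slots_def)
      show "emb x = g s (emb t)" unfolding 3 by (rule t(2))
      show "inj (\<lambda>s. g s (emb t))" by (rule inj_on_arc) (use ta in blast)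
    qed (rule xs)
  qed
qed

lemma segment_in_frontier: "emb ` sheet_segment s \<subseteq> sphere_top frontier_of (sheet_component s)"
proof -
  have image: ?thesis if "emb ` sheet_segment s \<subseteq> (\<lambda>t. g s (emb t)) ` T" "\<And>t. t \<in> T \<Longrightarrow> t \<in> slots" for T
  proof
    fix y assume "y \<in> emb ` sheet_segment s"
    from subsetD[OF that(1) this] obtain t where "t \<in> T" "y = g s (emb t)" by blast
    then show "y \<in> sphere_top frontier_of (sheet_component s)" using slot_in_frontier[OF that(2)] by simp
  qed
  consider "s = 1" | "s = 2" | "s = 3" using exhaust_3 by blast
  then show ?thesis
  proof cases
    case 1
    show ?thesis
    proof
      fix y assume "y \<in> emb ` sheet_segment s"
      then obtain x where x: "x \<in> {-1..1}" "y = emb (Some x)" using 1 by (auto simp: sheet_segment_def)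
      obtain t where t: "t \<in> {-1..1}" "R (emb (Some x)) = emb (Some t)" using R_interval_value[OF x(1)] by blast
      have "y = g s (emb (Some t))" using g1[OF x(1)] t(2) x(2) 1 by simp
      moreover have "Some t \<in> slots" using t(1) by (auto simp: slots_def)
      ultimately show "y \<in> sphere_top frontier_of (sheet_component s)" using slot_in_frontier by blast
    qed
  next
    case 2
    have "emb ` sheet_segment s \<subseteq> (\<lambda>t. g s (emb t)) ` carc (a 3) (a 4)" using seg2 2 by (simp add: sheet_segment_def)
    then show ?thesis by (rule image) (simp add: slots_def)
  next
    case 3
    have "emb ` sheet_segment s \<subseteq> (\<lambda>t. g s (emb t)) ` carc (a 1) (a 2)" using seg3 3 by (simp add: sheet_segment_def)
    then show ?thesis by (rule image) (simp add: slots_def)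
  qed
qed

text \<open>The components are known, and by \<open>frontier_slot\<close> the point of
  \<open>sheet_witness\<close> lies on the frontier of only one of them.\<close>

lemma sheet_eq: "sheet s = sheet_component s"
  unfolding sheet_def
proof (rule the_equality)
  show "sheet_component s \<in> connected_components_of preim \<and> emb ` sheet_segment s \<subseteq> sphere_top frontier_of (sheet_component s)"
    using components segment_in_frontier by blast
next
  fix U assume U: "U \<in> connected_components_of preim \<and> emb ` sheet_segment s \<subseteq> sphere_top frontier_of U"
  then obtain s' where s': "U = sheet_component s'" using conjunct1[OF U] unfolding components by blast
  obtain x t where xt: "x \<in> emb ` sheet_segment s" "t \<in> slots" "x = g s (emb t)" "inj (\<lambda>s. g s (emb t))"
    by (rule sheet_witness[of s])
  have "R x = emb t" unfolding xt(3) by (rule R_g[OF emb_in_closed_upper])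
  moreover have "x \<in> range emb" using xt(1) by blast
  moreover have "x \<in> sphere_top frontier_of (sheet_component s')" using subsetD[OF conjunct2[OF U] xt(1)] s' by simp
  ultimately have "g s' (emb t) = x" by (intro frontier_slot)
  then have "g s' (emb t) = g s (emb t)" using xt(3) by simp
  then have "s' = s" by (rule injD[OF xt(4)])
  then show "U = sheet_component s" using s' by simp
qed

lemma sheet_inv_eq: "y \<in> pants_interior \<Longrightarrow> sheet_inv s y = gf s y"
  unfolding sheet_inv_def sheet_eq
  by (rule the_equality) (auto simp: sheet_component_eq R_gf)

end

section \<open>The jump relation\<close>

lemma has_pv_integral_add_continuous:
  assumes x: "x \<in> {-1<..<1}" and h: "continuous_on {-1..1} h"
    and f: "\<And>e. 0 < e \<Longrightarrow> f integrable_on {-1..x - e}" "\<And>e. 0 < e \<Longrightarrow> f integrable_on {x + e..1}"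
    and eq: "\<And>t. t \<in> {-1..1} \<Longrightarrow> t \<noteq> x \<Longrightarrow> f' t = f t + h t"
    and pv: "has_pv_integral f x v" "has_pv_integral f' x w"
  shows "w = v + integral {-1..1} h"
proof -
  have ih: "h integrable_on {-1..1}" by (rule integrable_continuous_interval[OF h])
  define H where "H = (\<lambda>s. integral {-1..s} h)"
  have cH: "isCont H x"
  proof -
    have "continuous_on {-1..1} H" unfolding H_def by (rule indefinite_integral_continuous_1[OF ih])
    then show ?thesis using continuous_on_interior[of "{-1..1}" H x] x by simp
  qed
  have lim: "((\<lambda>e. (integral {-1..x - e} f + integral {x + e..1} f) + (H (x - e) + (H 1 - H (x + e)))) \<longlongrightarrow> v + (H (x - 0) + (H 1 - H (x + 0)))) (at_right 0)"
  proof (intro tendsto_intros pv(1)[unfolded has_pv_integral_def])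
    show "((\<lambda>e. H (x - e)) \<longlongrightarrow> H (x - 0)) (at_right 0)"
      by (rule isCont_tendsto_compose) (use cH in simp, intro tendsto_intros tendsto_ident_at)
    show "((\<lambda>e. H (x + e)) \<longlongrightarrow> H (x + 0)) (at_right 0)"
      by (rule isCont_tendsto_compose) (use cH in simp, intro tendsto_intros tendsto_ident_at)
  qed
  define d where "d = min (1 - x) (1 + x)"
  have d: "d > 0" using x by (simp add: d_def)
  have "eventually (\<lambda>e. e \<in> {0<..<d}) (at_right (0::real))" by (rule eventually_at_right_real[OF d])
  then have "eventually (\<lambda>e. (integral {-1..x - e} f + integral {x + e..1} f) + (H (x - e) + (H 1 - H (x + e)))
      = integral {-1..x - e} f' + integral {x + e..1} f') (at_right 0)"
  proof (rule eventually_mono)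
    fix e assume e: "e \<in> {0<..<d}"
    then have e': "0 < e" "-1 \<le> x - e" "x + e \<le> 1" "x - e \<le> 1" "-1 \<le> x + e" using x by (auto simp: d_def)
    have i: "h integrable_on {-1..x - e}" "h integrable_on {x + e..1}"
      by (rule integrable_subinterval_real[OF ih]; use e' in auto)+
    have 1: "integral {-1..x - e} f' = integral {-1..x - e} f + integral {-1..x - e} h"
      unfolding integral_add[OF f(1)[OF e'(1)] i(1), symmetric]
      by (rule integral_cong) (use e' eq in auto)
    have 2: "integral {x + e..1} f' = integral {x + e..1} f + integral {x + e..1} h"
      unfolding integral_add[OF f(2)[OF e'(1)] i(2), symmetric]
      by (rule integral_cong) (use e' eq in auto)
    have "H (x + e) + integral {x + e..1} h = H 1"
      unfolding H_def by (rule Henstock_Kurzweil_Integration.integral_combine[OF e'(5,3) ih])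
    then show "(integral {-1..x - e} f + integral {x + e..1} f) + (H (x - e) + (H 1 - H (x + e)))
      = integral {-1..x - e} f' + integral {x + e..1} f'"
      unfolding 1 2 by (simp add: H_def)
  qed
  then have "((\<lambda>e. integral {-1..x - e} f' + integral {x + e..1} f') \<longlongrightarrow> v + (H (x - 0) + (H 1 - H (x + 0)))) (at_right 0)"
    by (rule Lim_transform_eventually[OF lim])
  then have "w = v + (H (x - 0) + (H 1 - H (x + 0)))"
    using pv(2)[unfolded has_pv_integral_def] by (intro tendsto_unique[OF trivial_limit_at_right_real])
  then show ?thesis by (simp add: H_def)
qed

section \<open>The kernel as a logarithmic derivative\<close>

lemma poly_map_of_real: "poly (map_poly complex_of_real A) (complex_of_real x) = complex_of_real (poly A x)"
  by (induction A) (simp_all add: map_poly_pCons)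

lemma pderiv_map_of_real: "pderiv (map_poly complex_of_real A) = map_poly complex_of_real (pderiv A)"
  by (rule poly_eqI) (simp add: coeff_pderiv coeff_map_poly)

text \<open>The logarithmic derivative of the factor that belongs to the preimage \<open>p\<close>:
  the Cauchy kernel for a finite point, 0 for infinity.\<close>

definition pterm :: "complex option \<Rightarrow> complex \<Rightarrow> complex" where
  "pterm p t = poly (pderiv (lin p)) t / poly (lin p) t"

lemma pterm_None [simp]: "pterm None t = 0" and pterm_Some [simp]: "pterm (Some z) t = 1 / (t - z)"
  by (simp_all add: pterm_def lin_def pderiv_pCons)

text \<open>The left side is the logarithmic derivative of p/q - y = (p - y q)/q, where p - y q is a
  constant times three factors, the first of which has derivative 1.\<close>

lemma log_derivative_quotient:
  fixes p q p' q' y \<kappa> A a2 a3 b2 b3 :: complex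
  assumes ev: "p - y * q = \<kappa> * (A * a2 * a3)" and dv: "p' - y * q' = \<kappa> * (a2 * a3 + A * (b2 * a3 + a2 * b3))"
    and nz: "q \<noteq> 0" "\<kappa> \<noteq> 0" "A \<noteq> 0" "a2 \<noteq> 0" "a3 \<noteq> 0"
  shows "((p' * q - p * q') / (q * q)) / (p / q - y) = 1 / A + b2 / a2 + b3 / a3 - q' / q"
proof -
  define D D' where "D = p - y * q" and "D' = p' - y * q'"
  have D0: "D \<noteq> 0" using nz unfolding D_def ev by simp
  have "p / q - y = D / q" using nz(1) by (simp add: D_def field_simps)
  moreover have "p' * q - p * q' = D' * q - D * q'" by (simp add: D_def D'_def algebra_simps)
  ultimately have "((p' * q - p * q') / (q * q)) / (p / q - y) = ((D' * q - D * q') / (q * q)) / (D / q)" by (simp only:)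
  also have "\<dots> = (D' * q - D * q') / (q * D)" using nz(1) by simp
  also have "\<dots> = (q * D') / (q * D) - (D * q') / (D * q)"
    unfolding diff_divide_distrib by (simp only: mult.commute)
  also have "\<dots> = D' / D - q' / q" using nz(1) D0 by simp
  also have "D' / D = (a2 * a3 + A * (b2 * a3 + a2 * b3)) / (A * a2 * a3)"
    unfolding D_def D'_def ev dv using nz(2) by (rule mult_divide_mult_cancel_left)
  also have "a2 * a3 + A * (b2 * a3 + a2 * b3) = (a2 * a3) * 1 + (A * a3) * b2 + (A * a2) * b3"
    by (simp add: algebra_simps)
  also have "\<dots> / (A * a2 * a3) = ((a2 * a3) * 1) / ((a2 * a3) * A) + ((A * a3) * b2) / ((A * a3) * a2) + ((A * a2) * b3) / ((A * a2) * a3)"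
    unfolding add_divide_distrib by (simp only: mult.commute mult.left_commute mult.assoc)
  also have "\<dots> = 1 / A + b2 / a2 + b3 / a3"
    using nz by (simp only: mult_divide_mult_cancel_left mult_eq_0_iff simp_thms)
  finally show ?thesis .
qed

lemma prod_3: "prod f (UNIV :: 3 set) = f 1 * f 2 * f 3" for f :: "3 \<Rightarrow> 'a::comm_monoid_mult"
  unfolding UNIV_3 by (simp add: ac_simps)

context cubic_labelled
begin

abbreviation sec :: "3 \<Rightarrow> real \<Rightarrow> complex option" where
  "sec s x \<equiv> g s (R (Some (complex_of_real x)))"

lemma sec1: "x \<in> {-1..1} \<Longrightarrow> sec 1 x = Some (complex_of_real x)"
  using g1[of x] by simp

lemma interval_value:
  assumes "x \<in> {-1..1}"
  shows "R (Some (complex_of_real x)) = Some (complex_of_real (R_real x))" "R_real x \<in> {-1..1}" "poly Q x \<noteq> 0"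
proof -
  obtain t where t: "t \<in> {-1..1}" "R (emb (Some x)) = emb (Some t)" by (rule R_interval_value[OF assms])
  then have *: "poly cQ (complex_of_real x) \<noteq> 0" "Rc (complex_of_real x) = complex_of_real t"
    using R_Some_eq_Some[of "complex_of_real x" "complex_of_real t"] by simp_all
  then show "poly Q x \<noteq> 0" by (simp add: cQ_def poly_map_of_real)
  have "Rc (complex_of_real x) = complex_of_real (R_real x)"
    by (simp add: Rc_def R_real_def cP_def cQ_def poly_map_of_real)
  then have "R_real x = t" using *(2) by simp
  then show "R_real x \<in> {-1..1}" "R (Some (complex_of_real x)) = Some (complex_of_real (R_real x))" using t by simp_all
qed

lemma R_in_closed_upper: "x \<in> {-1..1} \<Longrightarrow> R (Some (complex_of_real x)) \<in> closed_upper"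
  using interval_value(1,2)[of x] emb_in_closed_upper[of "Some (R_real x)"] by simp

lemma sec_real: "x \<in> {-1..1} \<Longrightarrow> sec s x \<in> range emb"
  and inj_sec: "x \<in> {-1..1} \<Longrightarrow> inj (\<lambda>s. sec s x)"
  using real_off_arcs[OF interval_disjoint_arcs[OF interval_value(2)[of x]]] interval_value(1)[of x] by simp_all

lemma off_slot:
  assumes y: "y \<in> closed_upper" "y \<notin> emb ` Some ` {-1..1}" and z: "g s y = Some z"
  shows "z \<notin> slot"
proof
  assume "z \<in> slot"
  then obtain t where t: "t \<in> {-1..1}" "z = complex_of_real t" by blast
  have "y = R (emb (Some t))" using R_g[OF y(1), of s] z t by simp
  then have "y \<in> R ` emb ` Some ` {-1..1}" using t(1) by blast
  then show False using y(2) unfolding R_interval by blast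
qed

text \<open>Sheet 1 already takes every slot value, and the three values over a point of the
  interval are distinct.\<close>

lemma sec_off_slot:
  assumes x: "x \<in> {-1..1}" and s: "s \<noteq> 1" and z: "sec s x = Some z"
  shows "z \<notin> slot"
proof
  assume "z \<in> slot"
  then obtain t where t: "t \<in> {-1..1}" "z = complex_of_real t" by blast
  have "R (Some z) = R (Some (complex_of_real x))"
    using R_g[OF R_in_closed_upper[OF x], of s] z by simp
  then have "sec 1 x = Some z" using sec1[OF t(1)] t(2) by simp
  then have "sec 1 x = sec s x" using z by simp
  then have "1 = s" by (rule injD[OF inj_sec[OF x]])
  then show False using s by simp
qed

lemma lin_nonzero_on_interval:
  assumes x: "x \<in> {-1..1}" and s: "s \<noteq> 1" and t: "t \<in> {-1..1}"
  shows "poly (lin (sec s x)) (complex_of_real t) \<noteq> 0"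
proof (cases "sec s x")
  case (Some z)
  then have "z \<notin> slot" by (rule sec_off_slot[OF x s])
  then show ?thesis using t Some by (auto simp: lin_def)
qed (simp add: lin_def)

text \<open>The fibre over R x consists of x and the values of the sections 2 and 3, so R'/(R - R x)
  splits into Cauchy kernels at these points. The remaining term does not depend on x and ends up in
  the constant.\<close>

lemma kernel_split:
  assumes x: "x \<in> {-1..1}" and t: "t \<in> {-1..1}" "t \<noteq> x"
  shows "complex_of_real (deriv R_real t / (R_real t - R_real x))
    = 1 / (complex_of_real t - complex_of_real x) + pterm (sec 2 x) (complex_of_real t)
      + pterm (sec 3 x) (complex_of_real t) - complex_of_real (poly (pderiv Q) t / poly Q t)"
proof -
  define y where "y = R_real x"
  have Rx: "R (Some (complex_of_real x)) = Some (complex_of_real y)"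
    using interval_value(1)[OF x] by (simp add: y_def)
  have Qt: "poly Q t \<noteq> 0" by (rule interval_value(3)[OF t(1)])
  obtain \<kappa> where \<kappa>: "\<kappa> \<noteq> 0" "fibre_poly cP cQ (Some (complex_of_real y)) = smult \<kappa> (\<Prod>s\<in>UNIV. lin (g s (Some (complex_of_real y))))"
    using fibre_poly_factor[OF R_in_closed_upper[OF x, unfolded Rx]] by blast
  define l2 l3 where "l2 = lin (sec 2 x)" and "l3 = lin (sec 3 x)"
  have "lin (g 1 (Some (complex_of_real y))) = [:- complex_of_real x, 1:]"
    using sec1[OF x] by (simp add: Rx lin_def)
  then have N: "cP - smult (complex_of_real y) cQ = smult \<kappa> ([:- complex_of_real x, 1:] * l2 * l3)"
    using \<kappa>(2) unfolding l2_def l3_def Rx prod_3 fibre_poly.simps by (simp only:)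
  define T where "T = complex_of_real t"
  have ev: "complex_of_real (poly P t) - complex_of_real y * complex_of_real (poly Q t)
      = \<kappa> * ((T - complex_of_real x) * poly l2 T * poly l3 T)"
    using arg_cong[OF N, of "\<lambda>p. poly p T"] by (simp add: cP_def cQ_def poly_map_of_real T_def algebra_simps)
  have dv: "complex_of_real (poly (pderiv P) t) - complex_of_real y * complex_of_real (poly (pderiv Q) t)
      = \<kappa> * (poly l2 T * poly l3 T + (T - complex_of_real x) * (poly (pderiv l2) T * poly l3 T + poly l2 T * poly (pderiv l3) T))"
    using arg_cong[OF N, of "\<lambda>p. poly (pderiv p) T"]
    by (simp add: pderiv_diff pderiv_smult pderiv_mult pderiv_pCons cP_def cQ_def pderiv_map_of_real poly_map_of_real T_def algebra_simps)
  have nz: "poly l2 T \<noteq> 0" "poly l3 T \<noteq> 0"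
    unfolding l2_def l3_def T_def by (rule lin_nonzero_on_interval[OF x _ t(1)], simp)+
  have tx: "T - complex_of_real x \<noteq> 0" using t(2) by (simp add: T_def)
  have fn: "R_real = (\<lambda>t. poly P t / poly Q t)" by (simp add: fun_eq_iff R_real_def)
  have "(R_real has_real_derivative (poly (pderiv P) t * poly Q t - poly P t * poly (pderiv Q) t) / (poly Q t * poly Q t)) (at t)"
    unfolding fn by (rule DERIV_divide[OF poly_DERIV poly_DERIV Qt])
  then have dR: "deriv R_real t = (poly (pderiv P) t * poly Q t - poly P t * poly (pderiv Q) t) / (poly Q t * poly Q t)"
    by (rule DERIV_imp_deriv)
  have "complex_of_real (deriv R_real t / (R_real t - R_real x))
     = ((complex_of_real (poly (pderiv P) t) * complex_of_real (poly Q t) - complex_of_real (poly P t) * complex_of_real (poly (pderiv Q) t))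
        / (complex_of_real (poly Q t) * complex_of_real (poly Q t)))
       / (complex_of_real (poly P t) / complex_of_real (poly Q t) - complex_of_real y)"
    by (simp add: dR R_real_def[of t] y_def[symmetric])
  also have "\<dots> = 1 / (T - complex_of_real x) + poly (pderiv l2) T / poly l2 T + poly (pderiv l3) T / poly l3 T
      - complex_of_real (poly (pderiv Q) t) / complex_of_real (poly Q t)"
    by (rule log_derivative_quotient[OF ev dv _ \<kappa>(1) tx nz]) (use Qt in simp)
  finally show ?thesis by (simp add: pterm_def l2_def l3_def T_def)
qed

lemma pterm_integral:
  assumes u: "continuous_on {-1..1} u" and p: "\<And>z. p = Some z \<Longrightarrow> z \<notin> slot"
  shows "continuous_on {-1..1} (\<lambda>t. complex_of_real (u t) * pterm p (complex_of_real t))"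
    "((\<lambda>t. u t * Re (pterm p (complex_of_real t))) has_integral Re (Phi_plus_const 0 u p)) {-1..1}"
proof -
  have *: "continuous_on {-1..1} (\<lambda>t. complex_of_real (u t) * pterm p (complex_of_real t))
      \<and> ((\<lambda>t. complex_of_real (u t) * pterm p (complex_of_real t)) has_integral Phi_plus_const 0 u p) {-1..1}"
  proof (cases p)
    case None
    then show ?thesis by (simp add: Phi_plus_const_def)
  next
    case (Some z)
    then show ?thesis
      using continuous_cauchy_integrand[OF u p[OF Some]] integrable_integral[OF integrable_cauchy_integrand[OF u p[OF Some]]]
      by (simp add: Phi_plus_const_def cauchy_integral_def)
  qed
  then show "continuous_on {-1..1} (\<lambda>t. complex_of_real (u t) * pterm p (complex_of_real t))" by blast
  have "((\<lambda>t. Re (complex_of_real (u t) * pterm p (complex_of_real t))) has_integral Re (Phi_plus_const 0 u p)) {-1..1}"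
    by (rule has_integral_Re) (use * in blast)
  then show "((\<lambda>t. u t * Re (pterm p (complex_of_real t))) has_integral Re (Phi_plus_const 0 u p)) {-1..1}" by simp
qed

text \<open>By \<open>kernel_split\<close> the second principal value is the first plus the Cauchy
  integrals at the other two preimages minus the constant \<open>c0\<close>. Solving for the first,
  which is \<open>Re F\<close> by \<open>plemelj_real_part\<close>, yields the coefficient
  \<open>2 / (lam - 1)\<close>.\<close>

proposition eigen_relation:
  assumes eig: "eigenfunction lam u" and lam: "lam \<noteq> 1"
  obtains C where "\<And>x F. x \<in> {-1<..<1} \<Longrightarrow> (cauchy_integral u \<longlongrightarrow> F) (above x) \<Longrightarrow>
    2 * Re F = 2 / (lam - 1) * (Re (Phi_plus_const 0 u (sec 2 x)) + Re (Phi_plus_const 0 u (sec 3 x))) + C"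
proof -
  have hu: "holder_on {-1..1} u" using eig by (simp add: eigenfunction_def)
  have cu: "continuous_on {-1..1} u" by (rule holder_continuous[OF hu])
  obtain C0 where C0: "\<And>x. x \<in> {-1<..<1} \<Longrightarrow> \<exists>v w. has_pv_integral (\<lambda>t. u t / (t - x)) x v \<and>
        has_pv_integral (\<lambda>t. u t * deriv R_real t / (R_real t - R_real x)) x w \<and> lam * v - w = C0"
    using eig unfolding eigenfunction_def by blast
  define q where "q = (\<lambda>t. u t * (poly (pderiv Q) t / poly Q t))"
  have cq: "continuous_on {-1..1} q" unfolding q_def
    using interval_value(3) by (intro continuous_intros cu) auto
  define c0 where "c0 = integral {-1..1} q"
  have main: "2 * Re F = 2 / (lam - 1) * (Re (Phi_plus_const 0 u (sec 2 x)) + Re (Phi_plus_const 0 u (sec 3 x)))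
     + 2 / (lam - 1) * (C0 - c0)" if x: "x \<in> {-1<..<1}" and F: "(cauchy_integral u \<longlongrightarrow> F) (above x)" for x F
  proof -
    have x': "x \<in> {-1..1}" using x by simp
    obtain v w where vw: "has_pv_integral (\<lambda>t. u t / (t - x)) x v"
        "has_pv_integral (\<lambda>t. u t * deriv R_real t / (R_real t - R_real x)) x w" "lam * v - w = C0"
      using C0[OF x] by blast
    define h where "h = (\<lambda>t. u t * Re (pterm (sec 2 x) (complex_of_real t)) + u t * Re (pterm (sec 3 x) (complex_of_real t)) - q t)"
    note p2 = pterm_integral[OF cu sec_off_slot[OF x', of 2]] and p3 = pterm_integral[OF cu sec_off_slot[OF x', of 3]]
    have h2: "continuous_on {-1..1} (\<lambda>t. u t * Re (pterm (sec 2 x) (complex_of_real t)))"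
      using continuous_on_Re[OF p2(1)] by simp
    have h3: "continuous_on {-1..1} (\<lambda>t. u t * Re (pterm (sec 3 x) (complex_of_real t)))"
      using continuous_on_Re[OF p3(1)] by simp
    have ch: "continuous_on {-1..1} h" unfolding h_def by (intro continuous_intros h2 h3 cq)
    have "(h has_integral (Re (Phi_plus_const 0 u (sec 2 x)) + Re (Phi_plus_const 0 u (sec 3 x)) - c0)) {-1..1}"
      unfolding h_def c0_def
      by (intro has_integral_diff has_integral_add integrable_integral integrable_continuous_interval cq) (rule p2(2) p3(2); simp)+
    then have ih: "integral {-1..1} h = Re (Phi_plus_const 0 u (sec 2 x)) + Re (Phi_plus_const 0 u (sec 3 x)) - c0"
      by (rule integral_unique)
    have "w = v + integral {-1..1} h"
    proof (rule has_pv_integral_add_continuous[OF x ch _ _ _ vw(1,2)])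
      fix e :: real assume e: "0 < e"
      show "(\<lambda>t. u t / (t - x)) integrable_on {-1..x - e}"
        using e x by (intro integrable_continuous_interval continuous_intros continuous_on_subset[OF cu]) auto
      show "(\<lambda>t. u t / (t - x)) integrable_on {x + e..1}"
        using e x by (intro integrable_continuous_interval continuous_intros continuous_on_subset[OF cu]) auto
    next
      fix t assume t: "t \<in> {-1..1}" "t \<noteq> x"
      have "1 / (complex_of_real t - complex_of_real x) = complex_of_real (1 / (t - x))" by simp
      then have "deriv R_real t / (R_real t - R_real x)
         = 1 / (t - x) + Re (pterm (sec 2 x) (complex_of_real t)) + Re (pterm (sec 3 x) (complex_of_real t)) - poly (pderiv Q) t / poly Q t"
        using arg_cong[OF kernel_split[OF x' t], of Re] by (simp only: Re_complex_of_real plus_complex.sel minus_complex.sel)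
      then have "u t * (deriv R_real t / (R_real t - R_real x)) = u t / (t - x) + h t"
        by (simp only: h_def q_def) (simp add: algebra_simps)
      then show "u t * deriv R_real t / (R_real t - R_real x) = u t / (t - x) + h t" by simp
    qed
    moreover have "Re F = v" by (rule plemelj_real_part[OF hu x vw(1) F])
    ultimately have "(lam - 1) * Re F = Re (Phi_plus_const 0 u (sec 2 x)) + Re (Phi_plus_const 0 u (sec 3 x)) + (C0 - c0)"
      using vw(3) ih by (simp add: algebra_simps)
    then have "2 / (lam - 1) * ((lam - 1) * Re F)
       = 2 / (lam - 1) * (Re (Phi_plus_const 0 u (sec 2 x)) + Re (Phi_plus_const 0 u (sec 3 x)) + (C0 - c0))" by simp
    then show ?thesis using lam by (simp only: distrib_left) simp
  qed
  show ?thesis by (rule that[OF main])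
qed

end

section \<open>Antisymmetry at real points\<close>

lemma eps3_eq: "eps3 = Complex (- 1 / 2) (sqrt 3 / 2)"
proof -
  have "complex_of_real (2 * pi / 3) = 2 * complex_of_real pi / 3" by simp
  then have "eps3 = cis (2 * pi / 3)" unfolding eps3_def cis_conv_exp by (simp add: mult.commute)
  then show ?thesis by (simp add: complex_eq_iff cos_120 sin_120)
qed

lemma eps3_square: "eps3\<^sup>2 = Complex (- 1 / 2) (- sqrt 3 / 2)"
  by (simp add: eps3_eq power2_eq_square complex_eq_iff)

lemma eps3_relations: "1 + eps3 + eps3\<^sup>2 = 0" "eps3 * eps3\<^sup>2 = 1" "eps3\<^sup>2 * eps3\<^sup>2 = eps3" "eps3 * eps3 = eps3\<^sup>2"
  unfolding eps3_square by (simp_all add: eps3_eq complex_eq_iff power2_eq_square)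

lemma Kmat_mult:
  fixes X :: "complex^3"
  shows
  "(Kmat lam *v X) $ 1 = (X $ 2 / mu lam + X $ 3 + X $ 1) / csqrt (3 * delta lam + 6)"
  "(Kmat lam *v X) $ 2 = (X $ 2 / mu lam + eps3\<^sup>2 * X $ 3 + eps3 * X $ 1) / csqrt (3 * delta lam + 6)"
  "(Kmat lam *v X) $ 3 = (X $ 2 / mu lam + eps3 * X $ 3 + eps3\<^sup>2 * X $ 1) / csqrt (3 * delta lam + 6)"
  unfolding Kmat_def matrix_vector_mult_def matrix_matrix_mult_def map_matrix_def
  by (simp_all add: sum_3 vector_3 add_divide_distrib divide_inverse algebra_simps)

text \<open>Up to scaling and a permutation of coordinates \<open>Kmat\<close> is the Fourier matrix
  of order three, whose inverse is a third of its conjugate.\<close>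

lemma Kmat_solve:
  fixes X Y :: "complex^3"
  assumes q: "csqrt (3 * delta lam + 6) \<noteq> 0" and m: "mu lam \<noteq> 0" and Y: "Kmat lam *v X = Y"
  shows "X $ 1 = csqrt (3 * delta lam + 6) * (Y $ 1 + eps3\<^sup>2 * Y $ 2 + eps3 * Y $ 3) / 3"
    "X $ 2 = mu lam * csqrt (3 * delta lam + 6) * (Y $ 1 + Y $ 2 + Y $ 3) / 3"
    "X $ 3 = csqrt (3 * delta lam + 6) * (Y $ 1 + eps3 * Y $ 2 + eps3\<^sup>2 * Y $ 3) / 3"
proof -
  define q m e where "q = csqrt (3 * delta lam + 6)" and "m = mu lam" and "e = eps3"
  have nz: "q \<noteq> 0" "m \<noteq> 0" using assms by (simp_all add: q_def m_def)
  have Y1: "q * Y $ 1 = X $ 2 / m + X $ 3 + X $ 1"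
    and Y2: "q * Y $ 2 = X $ 2 / m + e\<^sup>2 * X $ 3 + e * X $ 1"
    and Y3: "q * Y $ 3 = X $ 2 / m + e * X $ 3 + e\<^sup>2 * X $ 1"
    using nz unfolding Y[symmetric] Kmat_mult by (simp_all add: q_def m_def e_def)
  have e: "e\<^sup>2 = - 1 - e" "e * e = - 1 - e"
    using eps3_relations(1,4) unfolding e_def by (simp_all add: algebra_simps eq_neg_iff_add_eq_0)
  have "q * (Y $ 1 + e\<^sup>2 * Y $ 2 + e * Y $ 3) = q * Y $ 1 + e\<^sup>2 * (q * Y $ 2) + e * (q * Y $ 3)"
    by (simp add: algebra_simps)
  also have "\<dots> = 3 * X $ 1 + (1 + e + e\<^sup>2) * (X $ 2 / m) + (1 + e\<^sup>2 * e\<^sup>2 + e * e) * X $ 3 + (e\<^sup>2 * e + e * e\<^sup>2 - 2) * X $ 1"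
    unfolding Y1 Y2 Y3 by (simp add: algebra_simps add_divide_distrib)
  also have "\<dots> = 3 * X $ 1"
    using eps3_relations by (simp add: e_def mult.commute add.commute add.left_commute)
  finally show "X $ 1 = csqrt (3 * delta lam + 6) * (Y $ 1 + eps3\<^sup>2 * Y $ 2 + eps3 * Y $ 3) / 3"
    by (simp add: q_def e_def)
  have "q * (Y $ 1 + e * Y $ 2 + e\<^sup>2 * Y $ 3) = q * Y $ 1 + e * (q * Y $ 2) + e\<^sup>2 * (q * Y $ 3)"
    by (simp add: algebra_simps)
  also have "\<dots> = 3 * X $ 3 + (1 + e + e\<^sup>2) * (X $ 2 / m) + (1 + e\<^sup>2 * e\<^sup>2 + e * e) * X $ 1 + (e\<^sup>2 * e + e * e\<^sup>2 - 2) * X $ 3"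
    unfolding Y1 Y2 Y3 by (simp add: algebra_simps add_divide_distrib)
  also have "\<dots> = 3 * X $ 3"
    using eps3_relations by (simp add: e_def mult.commute add.commute add.left_commute)
  finally show "X $ 3 = csqrt (3 * delta lam + 6) * (Y $ 1 + eps3 * Y $ 2 + eps3\<^sup>2 * Y $ 3) / 3"
    by (simp add: q_def e_def)
  have "q * (Y $ 1 + Y $ 2 + Y $ 3) = q * Y $ 1 + q * Y $ 2 + q * Y $ 3" by (simp add: algebra_simps)
  also have "\<dots> = 3 * (X $ 2 / m) + (1 + e + e\<^sup>2) * (X $ 1 + X $ 3)"
    unfolding Y1 Y2 Y3 by (simp add: algebra_simps add_divide_distrib)
  also have "\<dots> = 3 * (X $ 2 / m)" using eps3_relations(1) by (simp add: e_def)
  finally have "m * (q * (Y $ 1 + Y $ 2 + Y $ 3)) = 3 * X $ 2" using nz by simp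
  then show "X $ 2 = mu lam * csqrt (3 * delta lam + 6) * (Y $ 1 + Y $ 2 + Y $ 3) / 3"
    by (simp add: q_def m_def mult.assoc)
qed

lemma Kmat_inverse:
  fixes Y :: "complex^3"
  assumes q: "csqrt (3 * delta lam + 6) \<noteq> 0" and m: "mu lam \<noteq> 0"
  shows "Kmat lam *v (matrix_inv (Kmat lam) *v Y) = Y"
proof -
  have "X = 0" if "Kmat lam *v X = 0" for X :: "complex^3"
    using Kmat_solve[OF assms that] by (simp add: vec_eq_iff forall_3)
  then have "\<exists>B. B ** Kmat lam = mat 1" unfolding matrix_left_invertible_ker by blast
  then have "invertible (Kmat lam)" by (simp add: invertible_left_inverse)
  then have "Kmat lam ** matrix_inv (Kmat lam) = mat 1"
    unfolding invertible_def matrix_inv_def by (rule someI2_ex) blast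
  then show ?thesis by (simp add: matrix_vector_mul_assoc)
qed

text \<open>A Fourier coefficient of three real numbers: since
  \<open>1 + eps3 + eps3\<^sup>2 = 0\<close>, its squared modulus depends only on their differences,
  and it vanishes only if the three are equal.\<close>

lemma eps3_form_norm:
  fixes w :: "3 \<Rightarrow> real"
  shows "(cmod (complex_of_real (w 1) + eps3\<^sup>2 * complex_of_real (w 2) + eps3 * complex_of_real (w 3)))\<^sup>2
     = (w 1)\<^sup>2 + (w 2)\<^sup>2 + (w 3)\<^sup>2 - (w 1 * w 2 + w 1 * w 3 + w 2 * w 3)"
proof -
  define a b c where "a = w 1" and "b = w 2" and "c = w 3"
  have "(cmod (complex_of_real a + eps3\<^sup>2 * complex_of_real b + eps3 * complex_of_real c))\<^sup>2
      = (a - b / 2 - c / 2)\<^sup>2 + (sqrt 3 * ((c - b) / 2))\<^sup>2"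
    unfolding eps3_square
    unfolding eps3_eq cmod_power2 by (simp add: algebra_simps diff_divide_distrib)
  also have "\<dots> = (a - b / 2 - c / 2)\<^sup>2 + 3 * ((c - b) / 2)\<^sup>2" by (simp only: power_mult_distrib real_sqrt_pow2 zero_le_numeral)
  also have "\<dots> = a\<^sup>2 + b\<^sup>2 + c\<^sup>2 - (a * b + a * c + b * c)" by (simp add: power2_eq_square field_simps)
  finally show ?thesis by (simp only: a_def b_def c_def)
qed

context cubic_change_of_variable
begin

text \<open>At a point with \<open>cnj_point y = y\<close> antisymmetry reads (V2 + r) cnj (V2 - r)
  = |V1|^2, whose real part is |V2|^2 - |k| = |V1|^2. For real values |V1|^2 = |d + 2| N / 3 and
  |V2|^2 = |d - 1| S^2 / 3, while k = ((d + 2) N - (d - 1) S^2) / 3. Comparing the two according to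
  the signs of d + 2 and d - 1 gives the three conclusions.\<close>

lemma antisymmetric_at_fixed_point:
  fixes w :: "3 \<Rightarrow> real" and lam k d :: real
  assumes anti: "antisymmetric lam u" and y: "y \<in> pants" "cnj_point y = y"
    and W: "\<And>s. W lam u y $ s = complex_of_real (w s)" and J: "J0 lam u = complex_of_real k"
    and c: "k = (w 1)\<^sup>2 + (w 2)\<^sup>2 + (w 3)\<^sup>2 - d * (w 1 * w 2 + w 1 * w 3 + w 2 * w 3)"
    and d: "delta lam = complex_of_real d" "d \<noteq> 1" "d \<noteq> -2"
  shows "1 < d \<Longrightarrow> k \<le> 0" "d < -2 \<Longrightarrow> 0 \<le> k" "-2 < d \<Longrightarrow> d < 1 \<Longrightarrow> w 1 = w 2 \<and> w 1 = w 3"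
proof -
  define X where "X = V lam u y"
  define N where "N = (w 1)\<^sup>2 + (w 2)\<^sup>2 + (w 3)\<^sup>2 - (w 1 * w 2 + w 1 * w 3 + w 2 * w 3)"
  define S where "S = w 1 + w 2 + w 3"
  define q where "q = csqrt (3 * delta lam + 6)"
  have q3: "3 * delta lam + 6 = complex_of_real (3 * (d + 2))" by (simp add: d(1))
  have mu2: "(delta lam - 1) / (delta lam + 2) = complex_of_real ((d - 1) / (d + 2))" by (simp add: d(1))
  have q_norm: "(cmod q)\<^sup>2 = 3 * \<bar>d + 2\<bar>" 
  proof -
    have "3 * \<bar>d + 2\<bar> = \<bar>3 * (d + 2)\<bar>" unfolding abs_mult by simp
    then show ?thesis unfolding q_def q3 norm_csqrt norm_of_real by (simp only: real_sqrt_pow2 abs_ge_zero)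
  qed
  have mu_norm: "(cmod (mu lam))\<^sup>2 = \<bar>d - 1\<bar> / \<bar>d + 2\<bar>"
    unfolding mu_def mu2 norm_csqrt norm_of_real by (simp add: abs_divide)
  have q0: "q \<noteq> 0" using q_norm d(3) by auto
  have m0: "mu lam \<noteq> 0" using mu_norm d(2,3) by auto
  have KX: "Kmat lam *v X = W lam u y"
    unfolding X_def V_def using Kmat_inverse q0 m0 by (simp add: q_def)
  note sol = Kmat_solve[OF q0[unfolded q_def] m0 KX, folded q_def, unfolded W]
  have N1: "(cmod (X $ 1))\<^sup>2 = \<bar>d + 2\<bar> * N / 3"
    unfolding sol(1) N_def norm_divide norm_mult power_divide power_mult_distrib eps3_form_norm q_norm by simp
  have S2: "(cmod (X $ 2))\<^sup>2 = \<bar>d - 1\<bar> * S\<^sup>2 / 3"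
  proof -
    have "complex_of_real (w 1) + complex_of_real (w 2) + complex_of_real (w 3) = complex_of_real S" by (simp add: S_def)
    then show ?thesis
      unfolding sol(2) norm_divide norm_mult power_divide power_mult_distrib q_norm mu_norm using d(3) by simp
  qed
  have N0: "N \<ge> 0" and N_zero: "N = 0 \<Longrightarrow> w 1 = w 2 \<and> w 1 = w 3"
  proof -
    have eq: "2 * N = (w 1 - w 2)\<^sup>2 + ((w 1 - w 3)\<^sup>2 + (w 2 - w 3)\<^sup>2)" by (simp add: N_def power2_eq_square algebra_simps)
    have "0 \<le> 2 * N" unfolding eq by simp
    then show "N \<ge> 0" by simp
    assume "N = 0"
    then have "(w 1 - w 2)\<^sup>2 + ((w 1 - w 3)\<^sup>2 + (w 2 - w 3)\<^sup>2) = 0" using eq by simp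
    then show "w 1 = w 2 \<and> w 1 = w 3"
      by (simp add: add_nonneg_eq_0_iff)
  qed
  have cN: "k = ((d + 2) * N - (d - 1) * S\<^sup>2) / 3" by (simp add: c N_def S_def power2_eq_square field_simps)
  define r where "r = \<i> * csqrt (J0 lam u)"
  have r_norm: "(cmod r)\<^sup>2 = \<bar>k\<bar>" unfolding r_def J norm_mult power_mult_distrib norm_csqrt norm_of_real by simp
  \<comment> \<open>If \<open>N = 0\<close>, then V1 = 0 and no equation of moduli is available; in
    that case the three values are equal and the formula for \<open>k\<close> gives the conclusions
    directly.\<close>
  have key: "N = 0 \<or> \<bar>d - 1\<bar> * S\<^sup>2 / 3 - \<bar>k\<bar> = \<bar>d + 2\<bar> * N / 3"
  proof (cases "N = 0")
    case False
    have X1: "X $ 1 \<noteq> 0"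
    proof
      assume "X $ 1 = 0"
      then have "\<bar>d + 2\<bar> * N / 3 = 0" using N1 by simp
      then show False using False d(3) by simp
    qed
    have v: "p_value 1 lam u (cnj_point y) (sphere_quot (X $ 2 + r) (X $ 1))"
      using X1 unfolding y(2) p_value_def Let_def X_def r_def by simp
    have w: "p_value (- 1) lam u y (sphere_quot (X $ 2 - r) (X $ 1))"
      using X1 unfolding p_value_def Let_def X_def r_def by simp
    have "(1::complex) \<in> {1, - 1}" by simp
    from anti[unfolded antisymmetric_def, rule_format, OF y(1) this v w]
    have "Some ((X $ 2 + r) / X $ 1) = sphere_quot 1 (cnj ((X $ 2 - r) / X $ 1))"
      using X1 by (simp add: sphere_quot_def)
    then have "cnj ((X $ 2 - r) / X $ 1) \<noteq> 0" "(X $ 2 + r) / X $ 1 = 1 / cnj ((X $ 2 - r) / X $ 1)"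
      unfolding sphere_quot_def by (auto split: if_splits)
    moreover have "e * z = 1" if "z \<noteq> 0" "e = 1 / z" for e z :: complex using that by simp
    ultimately have "((X $ 2 + r) / X $ 1) * cnj ((X $ 2 - r) / X $ 1) = 1" by blast
    then have "(X $ 2 + r) * cnj (X $ 2 - r) = X $ 1 * cnj (X $ 1)" using X1 by (simp add: field_simps)
    then have "Re ((X $ 2 + r) * cnj (X $ 2 - r)) = Re (X $ 1 * cnj (X $ 1))" by (rule arg_cong)
    then have "(cmod (X $ 2))\<^sup>2 - (cmod r)\<^sup>2 = (cmod (X $ 1))\<^sup>2"
      unfolding cmod_power2 by (simp add: power2_eq_square algebra_simps)
    then show ?thesis using N1 S2 r_norm by simp
  qed simp
  have S0: "0 \<le> S\<^sup>2" by simp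
  show "k \<le> 0" if "1 < d"
  proof (cases "N = 0")
    case True then show ?thesis using cN that by simp
  next
    case False
    then have "(d - 1) * S\<^sup>2 / 3 - \<bar>k\<bar> = (d + 2) * N / 3" using key that by simp
    then have "\<bar>k\<bar> = - k" using cN by (simp add: diff_divide_distrib)
    then show ?thesis by simp
  qed
  show "0 \<le> k" if "d < -2"
  proof (cases "N = 0")
    case True
    then have "k = (1 - d) * S\<^sup>2 / 3" using cN by (simp add: left_diff_distrib)
    moreover have "0 \<le> (1 - d) * S\<^sup>2 / 3" using that by simp
    ultimately show ?thesis by (simp only:)
  next
    case False
    have "\<bar>d - 1\<bar> = 1 - d" "\<bar>d + 2\<bar> = - (d + 2)" using that by simp_all
    then have "(1 - d) * S\<^sup>2 / 3 - \<bar>k\<bar> = - (d + 2) * N / 3" using key False by simp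
    moreover have "k = (1 - d) * S\<^sup>2 / 3 - (- (d + 2) * N / 3)"
      using cN by (simp add: left_diff_distrib distrib_right add_divide_distrib diff_divide_distrib)
    ultimately have "\<bar>k\<bar> = k" by linarith
    then show ?thesis by simp
  qed
  show "w 1 = w 2 \<and> w 1 = w 3" if "-2 < d" "d < 1"
  proof (rule N_zero, rule ccontr)
    assume "N \<noteq> 0"
    have "\<bar>d - 1\<bar> = 1 - d" "\<bar>d + 2\<bar> = d + 2" using that by simp_all
    then have *: "(1 - d) * S\<^sup>2 / 3 - \<bar>k\<bar> = (d + 2) * N / 3" using key \<open>N \<noteq> 0\<close> by simp
    have c': "k = (d + 2) * N / 3 + (1 - d) * S\<^sup>2 / 3" using cN by (simp add: field_simps)
    moreover have "0 \<le> (d + 2) * N / 3" "0 \<le> (1 - d) * S\<^sup>2 / 3" using that N0 by simp_all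
    ultimately have "\<bar>k\<bar> = k" by simp
    then have "(d + 2) * N = 0" using * c' by simp
    then show False using \<open>N \<noteq> 0\<close> that by simp
  qed
qed

end

lemma Some_in_closed_upper [simp]: "Some z \<in> closed_upper \<longleftrightarrow> 0 \<le> Im z"
  and None_in_closed_upper [simp]: "None \<in> closed_upper"
  by (auto simp: closed_upper_def)

section \<open>The quadratic form is constant\<close>

lemma continuous_map_upper_limit:
  fixes h :: "complex option \<Rightarrow> complex"
  assumes "continuous_map (subtopology sphere_top closed_upper) euclidean h" "t \<in> closed_upper"
  shows "((\<lambda>y. h (Some y)) \<longlongrightarrow> h t) (upper_filter t)"
proof -
  have "limitin euclidean h (h t) (atin (subtopology sphere_top closed_upper) t)"
    using assms by (auto simp: continuous_map_atin simp del: limitin_canonical_iff)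
  then have "limitin euclidean h (h t) (atin_within sphere_top t closed_upper)"
    using assms by (simp add: atin_subtopology_within)
  then have "limitin euclidean h (h t) (atin_within sphere_top t (Some ` upper))"
    by (rule limit_within_subset) (auto simp: closed_upper_def)
  then have "limitin euclidean (\<lambda>y. h (Some y)) (h t) (upper_filter t)"
    unfolding atin_within_upper limitin_filtermap .
  then show ?thesis by simp
qed

lemma continuous_map_euclidean_iff:
  "continuous_map X euclidean f \<longleftrightarrow> (\<forall>x\<in>topspace X. (f \<longlongrightarrow> f x) (atin X x))"
  by (simp add: continuous_map_atin)

text \<open>Reflection in the real line gives an entire function, which is bounded because the
  closed half plane with infinity is compact; Liouville's theorem applies.\<close>

lemma half_plane_real_boundary:
  fixes h :: "complex option \<Rightarrow> complex"
  assumes cont: "continuous_map (subtopology sphere_top closed_upper) euclidean h"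
    and holo: "(\<lambda>z. h (Some z)) holomorphic_on upper"
    and real: "\<And>x. Im (h (Some (complex_of_real x))) = 0"
  obtains c where "\<And>t. t \<in> closed_upper \<Longrightarrow> h t = complex_of_real c"
proof -
  define f where "f = (\<lambda>z. h (Some z))"
  have "continuous_map (top_of_set {z. 0 \<le> Im z}) (subtopology sphere_top closed_upper) Some"
    by (auto simp: continuous_map_in_subtopology intro: continuous_map_from_subtopology continuous_map_Some)
  from continuous_map_compose[OF this cont]
  have cf: "continuous_on {z. 0 \<le> Im z} f" by (simp add: f_def o_def)
  define F where "F = (\<lambda>z. if 0 \<le> Im z then f z else cnj (f (cnj z)))"
  have "F holomorphic_on UNIV" unfolding F_def
  proof (rule Schwarz_reflection)
    show "f z \<in> \<real>" if zr: "z \<in> UNIV" "z \<in> \<real>" for z :: complex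
    proof -
      obtain x where "z = complex_of_real x" using zr(2) Reals_cases by blast
      then show ?thesis using real[of x] by (simp add: f_def complex_is_Real_iff)
    qed
  qed (use cf holo in \<open>simp_all add: f_def\<close>)
  moreover have "bounded (range F)"
  proof -
    have "compactin sphere_top closed_upper"
      by (rule closedin_compact_space) (auto simp: closedin_closed_upper)
    then have "compactin (subtopology sphere_top closed_upper) closed_upper" by (simp add: compactin_subtopology)
    then have "compactin euclidean (h ` closed_upper)" by (rule image_compactin[OF _ cont])
    then have "bounded (h ` closed_upper)" using compact_imp_bounded by simp
    then obtain B where B: "\<And>t. t \<in> closed_upper \<Longrightarrow> cmod (h t) \<le> B" unfolding bounded_iff by blast
    have "cmod (F z) \<le> B" for z
      using B[of "Some z"] B[of "Some (cnj z)"] by (auto simp: F_def f_def)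
    then show ?thesis unfolding bounded_iff by blast
  qed
  ultimately have "F constant_on UNIV" by (rule Liouville_theorem)
  then obtain c where c: "\<And>z. F z = c" by (auto simp: constant_on_def)
  have fc: "h (Some z) = c" if "0 \<le> Im z" for z using c[of z] that by (simp add: F_def f_def)
  have c_real: "c = complex_of_real (Re c)" using fc[of 0] real[of 0] by (simp add: complex_eq_iff)
  have "h None = c"
  proof (rule tendsto_unique[OF upper_filter_nontrivial])
    show "((\<lambda>y. h (Some y)) \<longlongrightarrow> h None) (upper_filter None)" by (rule continuous_map_upper_limit[OF cont]) simp
    have "eventually (\<lambda>y. c = h (Some y)) (upper_filter None)"
      using eventually_upper_filter by (rule eventually_mono) (simp add: fc)
    then show "((\<lambda>y. h (Some y)) \<longlongrightarrow> c) (upper_filter None)" by (rule Lim_transform_eventually[OF tendsto_const])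
  qed simp
  then have "h t = complex_of_real (Re c)" if "t \<in> closed_upper" for t
    using that fc c_real by (cases t) auto
  then show ?thesis by (rule that)
qed

lemma filterlim_cnj_below: "filterlim cnj (above x) (below x)"
  unfolding filterlim_at
proof
  have "((\<lambda>z. cnj z) \<longlongrightarrow> cnj (complex_of_real x)) (below x)" by (intro tendsto_intros)
  then show "(cnj \<longlongrightarrow> complex_of_real x) (below x)" by simp
  show "\<forall>\<^sub>F z in below x. cnj z \<in> upper \<and> cnj z \<noteq> complex_of_real x"
    unfolding eventually_at_filter by (rule always_eventually) (auto simp: complex_eq_iff)
qed

lemma upper_filter_real: "upper_filter (Some (complex_of_real x)) = above x"
  by (simp add: upper_filter_def)

lemma above_nontrivial: "above x \<noteq> bot"
  using upper_filter_nontrivial[of "Some (complex_of_real x)"] by (simp add: upper_filter_real)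

lemma below_nontrivial: "below x \<noteq> bot"
proof
  assume "below x = bot"
  then have ev: "\<forall>\<^sub>F z in below x. False" by simp
  have fl: "filterlim cnj (below x) (above x)" unfolding filterlim_at
  proof
    have "((\<lambda>z. cnj z) \<longlongrightarrow> cnj (complex_of_real x)) (above x)" by (intro tendsto_intros)
    then show "(cnj \<longlongrightarrow> complex_of_real x) (above x)" by simp
    show "\<forall>\<^sub>F z in above x. cnj z \<in> {z. Im z < 0} \<and> cnj z \<noteq> complex_of_real x"
      unfolding eventually_at_filter by (rule always_eventually) (auto simp: complex_eq_iff)
  qed
  have "\<forall>\<^sub>F z in above x. False" by (rule eventually_compose_filterlim[OF ev fl])
  then show False using above_nontrivial by (simp add: eventually_False)
qed

section \<open>Boundary values of the Cauchy integral of an eigenfunction\<close>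

locale cubic_eigen = cubic_labelled P Q a b c r g
  for P Q :: "real poly" and a b c :: "nat \<Rightarrow> real option" and r g +
  fixes lam :: real and u :: "real \<Rightarrow> real"
  assumes eig: "eigenfunction lam u" and lam: "lam \<noteq> 1" "lam \<noteq> 3"
begin

lemma holder_u: "holder_on {-1..1} u" using eig by (simp add: eigenfunction_def)
lemma cont_u: "continuous_on {-1..1} u" by (rule holder_continuous[OF holder_u])

lemma cauchy_not_zero:
  assumes "\<And>z. z \<notin> slot \<Longrightarrow> cauchy_integral u z = 0"
  shows False
  using eig cauchy_integral_eq_0_imp[OF cont_u assms] by (auto simp: eigenfunction_def)

definition boundary_value :: "real \<Rightarrow> complex" where "boundary_value x = Lim (above x) (cauchy_integral u)"

lemma boundary_value_limit: "x \<in> {-1..1} \<Longrightarrow> (cauchy_integral u \<longlongrightarrow> boundary_value x) (above x)"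
proof -
  assume "x \<in> {-1..1}"
  then obtain F where F: "(cauchy_integral u \<longlongrightarrow> F) (above x)"
    using eig unfolding eigenfunction_def cauchy_holder_boundary_values_def by blast
  then have "boundary_value x = F" unfolding boundary_value_def by (rule tendsto_Lim[OF above_nontrivial])
  then show ?thesis using F by simp
qed

text \<open>\<open>\<Phi>\<close> without its additive constant, on the closed upper half of the \<open>x\<close>-sphere;
  on the slot it takes the values of the upper bank.\<close>

definition phi :: "complex option \<Rightarrow> complex" where
  "phi p = (case p of None \<Rightarrow> 0 | Some z \<Rightarrow> if z \<in> slot then boundary_value (Re z) else cauchy_integral u z)"

lemma phi_None [simp]: "phi None = 0" by (simp add: phi_def)
lemma phi_off: "z \<notin> slot \<Longrightarrow> phi (Some z) = cauchy_integral u z" by (simp add: phi_def)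
lemma phi_on: "x \<in> {-1..1} \<Longrightarrow> phi (Some (complex_of_real x)) = boundary_value x"
  by (auto simp: phi_def slot_iff)

lemma upper_off_slot: "Im z \<noteq> 0 \<Longrightarrow> z \<notin> slot" by (simp add: slot_iff)

lemma phi_limit:
  assumes "t \<in> closed_upper"
  shows "(cauchy_integral u \<longlongrightarrow> phi t) (upper_filter t)"
proof (cases t)
  case None
  then show ?thesis using tendsto_mono[OF inf_le1 cauchy_integral_at_infinity[OF cont_u]]
    by (simp add: upper_filter_def)
next
  case (Some z)
  show ?thesis
  proof (cases "z \<in> slot")
    case True
    then obtain x where x: "x \<in> {-1..1}" "z = complex_of_real x" by blast
    then show ?thesis using boundary_value_limit[OF x(1)] Some phi_on[OF x(1)] by (simp add: upper_filter_real)
  next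
    case False
    have "continuous_on (- slot) (cauchy_integral u)"
      by (rule holomorphic_on_imp_continuous_on[OF holomorphic_cauchy_integral[OF cont_u]])
    then have "isCont (cauchy_integral u) z"
      using False closed_slot by (simp add: continuous_on_eq_continuous_at open_Compl)
    then have "(cauchy_integral u \<longlongrightarrow> cauchy_integral u z) (at z within upper)"
      unfolding isCont_def by (rule tendsto_within_subset) simp
    then show ?thesis using Some False by (simp add: phi_off upper_filter_def)
  qed
qed

text \<open>The limits of \<open>phi_limit\<close> provide a continuous extension from the open half
  plane, and uniqueness of limits identifies it with \<open>phi\<close>.\<close>

lemma cont_phi: "continuous_map (subtopology sphere_top closed_upper) euclidean phi"
proof -
  define f where "f = (\<lambda>x. cauchy_integral u (the x))"
  have cf: "continuous_map (subtopology sphere_top (Some ` upper)) euclidean f"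
  proof -
    have "limitin euclidean f (f x) (atin_within sphere_top x (Some ` upper))" if x: "x \<in> Some ` upper" for x
    proof -
      obtain y where y: "y \<in> upper" "x = Some y" using x by auto
      have "(cauchy_integral u \<longlongrightarrow> phi x) (upper_filter x)" by (rule phi_limit) (use y in simp)
      then show ?thesis unfolding y(2) atin_within_upper limitin_filtermap
        using y phi_off[OF upper_off_slot[of y]] by (simp add: f_def)
    qed
    then show ?thesis by (auto simp: continuous_map_atin atin_subtopology_within simp del: limitin_canonical_iff)
  qed
  have sub: "Some ` upper \<subseteq> closed_upper" by auto
  have ex: "\<exists>l. limitin euclidean f l (atin_within sphere_top t (Some ` upper))" if "t \<in> closed_upper - Some ` upper" for t
    unfolding atin_within_upper limitin_filtermap using phi_limit[of t] that by (auto simp: f_def)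
  have reg: "regular_space (euclidean :: complex topology)"
    by (rule metrizable_imp_regular_space[OF metrizable_space_euclidean])
  obtain h where h: "continuous_map (subtopology sphere_top closed_upper) euclidean h"
      "\<And>x. x \<in> Some ` upper \<Longrightarrow> h x = f x"
    using continuous_map_extension_pointwise_alt[OF reg sub closed_upper_subset_closure cf ex] by blast
  have "h t = phi t" if t: "t \<in> closed_upper" for t
  proof (rule tendsto_unique[OF upper_filter_nontrivial[OF t]])
    have "eventually (\<lambda>y. h (Some y) = cauchy_integral u y) (upper_filter t)"
      using eventually_upper_filter by (rule eventually_mono) (use h(2) in \<open>simp add: f_def\<close>)
    then show "(cauchy_integral u \<longlongrightarrow> h t) (upper_filter t)"
      by (rule Lim_transform_eventually[OF continuous_map_upper_limit[OF h(1) t]])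
  qed (rule phi_limit[OF t])
  then show ?thesis using h(1) by (rule continuous_map_eq[rotated]) simp
qed

lemma cont_phi_real: "continuous_on UNIV (\<lambda>x. phi (Some (complex_of_real x)))"
  using continuous_map_compose[OF continuous_map_real_line cont_phi] by (simp add: o_def)

lemma phi_real:
  assumes "p \<in> range emb" "\<And>z. p = Some z \<Longrightarrow> z \<notin> slot"
  shows "Im (phi p) = 0"
proof (cases p)
  case (Some z)
  then have "cnj z = z" using assms(1) by (auto simp: Some_in_range_emb complex_eq_iff)
  then have "cnj (cauchy_integral u z) = cauchy_integral u z" using cauchy_integral_cnj[of u z] by simp
  then show ?thesis using phi_off[OF assms(2)[OF Some]] Some by (simp add: complex_eq_iff)
qed simp

text \<open>At the ends of the slot \<open>phi\<close> is a boundary value; it is real there as a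
  limit of the real values outside.\<close>

lemma phi_real_outside: "\<bar>x\<bar> \<ge> 1 \<Longrightarrow> Im (phi (Some (complex_of_real x))) = 0"
proof -
  have out: "Im (phi (Some (complex_of_real x))) = 0" if "\<bar>x\<bar> > 1" for x
    by (rule phi_real) (use that in \<open>auto simp: Some_in_range_emb slot_iff\<close>)
  have ci: "continuous_on S (\<lambda>x. Im (phi (Some (complex_of_real x))))" for S
    by (intro continuous_intros continuous_on_subset[OF cont_phi_real]) simp
  assume "\<bar>x\<bar> \<ge> 1"
  then consider "x \<ge> 1" | "x \<le> -1" by linarith
  then show ?thesis
  proof cases
    case 1
    show ?thesis
      by (rule continuous_constant_on_closure[where S = "{1<..}", OF ci]) (use 1 out in \<open>auto simp: closure_greaterThan\<close>)
  next
    case 2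
    show ?thesis
      by (rule continuous_constant_on_closure[where S = "{..<-1}", OF ci]) (use 2 out in \<open>auto simp: closure_lessThan\<close>)
  qed
qed

definition d :: real where "d = 2 / (lam - 1)"

lemma delta_d: "delta lam = complex_of_real d" by (simp add: delta_def d_def)
lemma d_not_1: "d \<noteq> 1" using lam by (simp add: d_def)

lemma phi_sec: "x \<in> {-1..1} \<Longrightarrow> s \<noteq> 1 \<Longrightarrow> Phi_plus_const \<kappa> u (sec s x) = phi (sec s x) + \<kappa>"
  by (cases "sec s x") (simp_all add: Phi_plus_const_def phi_off sec_off_slot)

lemma phi_sec_real: "x \<in> {-1..1} \<Longrightarrow> s \<noteq> 1 \<Longrightarrow> Im (phi (sec s x)) = 0"
  by (intro phi_real sec_real sec_off_slot)

lemma ex_const: "\<exists>k::real. \<forall>x\<in>{-1<..<1}. 2 * (Re (boundary_value x) + k) = d * ((Re (phi (sec 2 x)) + k) + (Re (phi (sec 3 x)) + k))"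
proof (rule eigen_relation[OF eig lam(1)])
  fix C assume C: "\<And>x F. x \<in> {-1<..<1} \<Longrightarrow> (cauchy_integral u \<longlongrightarrow> F) (above x) \<Longrightarrow>
    2 * Re F = 2 / (lam - 1) * (Re (Phi_plus_const 0 u (sec 2 x)) + Re (Phi_plus_const 0 u (sec 3 x))) + C"
  \<comment> \<open>Adding \<open>k\<close> to \<Phi> adds 2 k on the left and 2 d k on the right,
    so for d \<noteq> 1 the constant \<open>C\<close> can be absorbed.\<close>
  define k where "k = C / (2 * (d - 1))"
  have k: "C + 2 * k = 2 * d * k" using d_not_1 by (simp add: k_def field_simps)
  have "2 * (Re (boundary_value x) + k) = d * ((Re (phi (sec 2 x)) + k) + (Re (phi (sec 3 x)) + k))" if x: "x \<in> {-1<..<1}" for x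
  proof -
    have x': "x \<in> {-1..1}" using x by simp
    have "2 * Re (boundary_value x) = d * (Re (phi (sec 2 x)) + Re (phi (sec 3 x))) + C"
      using C[OF x boundary_value_limit[OF x']] phi_sec[OF x', of 2 0] phi_sec[OF x', of 3 0] by (simp add: d_def)
    then show ?thesis using k by (simp add: algebra_simps)
  qed
  then show ?thesis by blast
qed

definition k :: real where
  "k = (SOME k. \<forall>x\<in>{-1<..<1}. 2 * (Re (boundary_value x) + k) = d * ((Re (phi (sec 2 x)) + k) + (Re (phi (sec 3 x)) + k)))"

lemma cont_sec: "continuous_map (top_of_set {-1..1}) (subtopology sphere_top closed_upper) (sec s)"
proof -
  have "continuous_map euclideanreal sphere_top (\<lambda>t. Some (complex_of_real t))"
    using continuous_map_real_line by (simp add: continuous_map_in_subtopology)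
  from continuous_map_compose[OF this continuous_R]
  have "continuous_map euclideanreal sphere_top (\<lambda>t. R (Some (complex_of_real t)))" by (simp add: o_def)
  then have "continuous_map (top_of_set {-1..1}) (subtopology sphere_top closed_upper) (\<lambda>t. R (Some (complex_of_real t)))"
    using R_in_closed_upper by (auto simp: continuous_map_in_subtopology intro: continuous_map_from_subtopology)
  from continuous_map_compose[OF this cont_g[of s]]
  have "continuous_map (top_of_set {-1..1}) sphere_top (sec s)" by (simp add: o_def)
  moreover have "sec s x \<in> closed_upper" if "x \<in> {-1..1}" for x
    using sec_real[OF that, of s] emb_in_closed_upper by auto
  ultimately show ?thesis by (auto simp: continuous_map_in_subtopology)
qed

lemma cont_phi_sec: "continuous_on {-1..1} (\<lambda>x. phi (sec s x))"
  using continuous_map_compose[OF cont_sec[of s] cont_phi] by (simp add: o_def)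

text \<open>The relation that defines \<open>k\<close> concerns inner points; both sides are
  continuous up to the ends of the slot, which correspond to points of the circle in the disc
  argument.\<close>

lemma slot_relation:
  assumes x: "x \<in> {-1..1}"
  shows "2 * (Re (boundary_value x) + k) = d * ((Re (phi (sec 2 x)) + k) + (Re (phi (sec 3 x)) + k))"
proof -
  have k: "2 * (Re (boundary_value x) + k) = d * ((Re (phi (sec 2 x)) + k) + (Re (phi (sec 3 x)) + k))" if "x \<in> {-1<..<1}" for x
    using someI_ex[OF ex_const] that unfolding k_def by blast
  define E where "E = (\<lambda>x. 2 * (Re (phi (Some (complex_of_real x))) + k) - d * ((Re (phi (sec 2 x)) + k) + (Re (phi (sec 3 x)) + k)))"
  have cl: "closure {-1<..<1} = {-1..1::real}" by simp
  have cE: "continuous_on {-1..1} E" unfolding E_def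
    by (intro continuous_intros cont_phi_sec continuous_on_subset[OF cont_phi_real]) simp
  have "E x = 0"
  proof (rule continuous_constant_on_closure[where S = "{-1<..<1}" and f = E])
    show "continuous_on (closure {-1<..<1}) E" unfolding cl by (rule cE)
    show "x \<in> closure {-1<..<1}" unfolding cl by (rule x)
    fix y :: real assume "y \<in> {-1<..<1}"
    then show "E y = 0" using k[of y] phi_on[of y] by (simp add: E_def)
  qed
  then show ?thesis using phi_on[OF x] by (simp add: E_def)
qed

text \<open>A sheet lies over the upper half plane either above or below the real line; in the latter case
  \<open>\<Phi>\<close> is continued to the boundary by reflection.\<close>

definition ph :: "3 \<Rightarrow> complex option \<Rightarrow> complex" where
  "ph s t = (if pos s then phi (g s t) else cnj (phi (cnjo (g s t)))) + complex_of_real k"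

lemma cont_ph: "continuous_map (subtopology sphere_top closed_upper) euclidean (ph s)"
proof -
  let ?X = "subtopology sphere_top closed_upper"
  have "continuous_map ?X euclidean (\<lambda>t. if pos s then phi (g s t) else cnj (phi (cnjo (g s t))))"
  proof (cases "pos s")
    case True
    have "continuous_map ?X ?X (g s)"
      using cont_g[of s] g_pos True by (auto simp: continuous_map_in_subtopology)
    from continuous_map_compose[OF this cont_phi] show ?thesis using True by (simp add: o_def)
  next
    case False
    have "continuous_map ?X ?X (\<lambda>t. cnjo (g s t))"
      using continuous_map_compose[OF cont_g[of s] continuous_map_sphere_cnj] g_neg False
      by (auto simp: continuous_map_in_subtopology o_def)
    from continuous_map_compose[OF this cont_phi]
    have 1: "continuous_map ?X euclidean (\<lambda>t. phi (cnjo (g s t)))" by (simp add: o_def)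
    have 2: "continuous_map euclidean euclidean cnj" by (simp add: continuous_on_cnj)
    have "continuous_map ?X euclidean (\<lambda>t. cnj (phi (cnjo (g s t))))"
      using continuous_map_compose[OF 1 2] by (simp add: o_def)
    then show ?thesis using False by simp
  qed
  then show ?thesis unfolding ph_def continuous_map_euclidean_iff by (intro ballI tendsto_add tendsto_const) blast
qed

lemma ph_upper: "z \<in> upper \<Longrightarrow> ph s (Some z) = cauchy_integral u (r s z) + complex_of_real k"
proof -
  assume z: "z \<in> upper"
  have "r s z \<notin> slot" "cnj (r s z) \<notin> slot" using r_nonreal[OF z, of s] by (simp_all add: upper_off_slot)
  then show ?thesis by (simp add: ph_def g_Some[OF z] phi_off cauchy_integral_cnj)
qed

lemma holo_ph: "(\<lambda>z. ph s (Some z)) holomorphic_on upper"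
proof -
  have "(cauchy_integral u \<circ> r s) holomorphic_on upper"
    by (rule holomorphic_on_compose_gen[OF holo_r holomorphic_cauchy_integral[OF cont_u]])
      (use r_nonreal upper_off_slot in auto)
  then have "(\<lambda>z. cauchy_integral u (r s z) + complex_of_real k) holomorphic_on upper"
    by (intro holomorphic_intros) (simp add: o_def)
  then show ?thesis by (rule holomorphic_transform) (simp add: ph_upper)
qed

lemma ph_off:
  assumes t: "t \<in> closed_upper" "t \<notin> emb ` Some ` {-1..1}"
  shows "ph s t = Phi_plus_const (complex_of_real k) u (g s t)"
proof (cases "g s t")
  case (Some z)
  then have z: "z \<notin> slot" by (rule off_slot[OF t])
  then have "cnj z \<notin> slot" by (simp add: slot_iff)
  then show ?thesis using Some z by (simp add: ph_def Phi_plus_const_def phi_off cauchy_integral_cnj)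
qed (simp add: ph_def Phi_plus_const_def)

lemma ph_real:
  assumes t: "t \<in> closed_upper" "t \<notin> emb ` Some ` {-1..1}" and real: "g s t \<in> range emb"
  shows "Im (ph s t) = 0"
proof -
  have "cnjo (g s t) = g s t" using real range_emb_iff by blast
  moreover have "Im (phi (g s t)) = 0" by (rule phi_real[OF real]) (rule off_slot[OF t])
  ultimately show ?thesis by (simp add: ph_def)
qed

section \<open>The form \<open>J\<close> on the real line\<close>

definition J :: "complex option \<Rightarrow> complex" where
  "J t = (ph 1 t)\<^sup>2 + (ph 2 t)\<^sup>2 + (ph 3 t)\<^sup>2 - complex_of_real d * (ph 1 t * ph 2 t + ph 1 t * ph 3 t + ph 2 t * ph 3 t)"

lemma ph_slot:
  assumes x: "x \<in> {-1..1}"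
  shows "ph 1 (R (Some (complex_of_real x))) = (if pos 1 then boundary_value x else cnj (boundary_value x)) + complex_of_real k"
    "s \<noteq> 1 \<Longrightarrow> ph s (R (Some (complex_of_real x))) = complex_of_real (Re (phi (sec s x)) + k)"
proof -
  show "ph 1 (R (Some (complex_of_real x))) = (if pos 1 then boundary_value x else cnj (boundary_value x)) + complex_of_real k"
    using sec1[OF x] phi_on[OF x] by (simp add: ph_def)
  assume s: "s \<noteq> 1"
  have "cnjo (sec s x) = sec s x" using sec_real[OF x] range_emb_iff by blast
  then show "ph s (R (Some (complex_of_real x))) = complex_of_real (Re (phi (sec s x)) + k)"
    using phi_sec_real[OF x s] by (simp add: ph_def complex_eq_iff)
qed

text \<open>If w is the value on sheet 1 and A, B are the real values on the other sheets, the jump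
  relation is d (A + B) = w + cnj w. Hence w^2 - d w (A + B) = -|w|^2, and everything left is
  real.\<close>

lemma J_slot:
  assumes x: "x \<in> {-1..1}"
  shows "J (R (Some (complex_of_real x))) = complex_of_real ((Re (phi (sec 2 x)) + k)\<^sup>2 + (Re (phi (sec 3 x)) + k)\<^sup>2
     - d * (Re (phi (sec 2 x)) + k) * (Re (phi (sec 3 x)) + k) - (cmod (boundary_value x + complex_of_real k))\<^sup>2)"
proof -
  define A B where "A = Re (phi (sec 2 x)) + k" and "B = Re (phi (sec 3 x)) + k"
  define w where "w = ph 1 (R (Some (complex_of_real x)))"
  have w: "Re w = Re (boundary_value x) + k" "(cmod w)\<^sup>2 = (cmod (boundary_value x + complex_of_real k))\<^sup>2"
    using ph_slot(1)[OF x] by (simp_all add: w_def cmod_power2)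
  have rel: "2 * Re w = d * (A + B)" using slot_relation[OF x] unfolding w(1) A_def B_def .
  have rel': "complex_of_real d * (complex_of_real A + complex_of_real B) = w + cnj w"
    unfolding complex_add_cnj rel by simp
  have p2: "ph 2 (R (Some (complex_of_real x))) = complex_of_real A"
    unfolding A_def by (rule ph_slot(2)[OF x]) simp
  have p3: "ph 3 (R (Some (complex_of_real x))) = complex_of_real B"
    unfolding B_def by (rule ph_slot(2)[OF x]) simp
  have "J (R (Some (complex_of_real x))) = w\<^sup>2 + (complex_of_real A)\<^sup>2 + (complex_of_real B)\<^sup>2
      - (w * (complex_of_real d * (complex_of_real A + complex_of_real B)) + complex_of_real (d * A * B))"
    unfolding J_def w_def[symmetric] p2 p3 by (simp add: algebra_simps)
  also have "\<dots> = complex_of_real (A\<^sup>2 + B\<^sup>2 - d * A * B) - w * cnj w"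
    unfolding rel' by (simp add: power2_eq_square algebra_simps)
  also have "w * cnj w = complex_of_real ((cmod w)\<^sup>2)" by (simp add: complex_mult_cnj cmod_power2)
  finally show ?thesis unfolding w(2) A_def B_def by simp
qed

lemma J_real: "Im (J (Some (complex_of_real y))) = 0"
proof -
  let ?y = "Some (complex_of_real y)"
  have cu: "?y \<in> closed_upper" by simp
  consider "y \<in> {-1..1}" | "y \<notin> {-1..1}" "Some y \<in> oarc (a 1) (a 2) \<union> oarc (a 3) (a 4)"
    | "y \<notin> {-1..1}" "Some y \<notin> oarc (a 1) (a 2) \<union> oarc (a 3) (a 4)" by blast
  then show ?thesis
  proof cases
    case 1
    then obtain x where x: "x \<in> {-1..1}" "R (emb (Some x)) = emb (Some y)" by (rule interval_image)
    then show ?thesis using J_slot[OF x(1)] by simp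
  next
    case 2
    have off: "?y \<notin> emb ` Some ` {-1..1}" using 2(1) by auto
    obtain i where i: "g i ?y \<in> range emb" "\<And>j k. j \<noteq> i \<Longrightarrow> k \<noteq> i \<Longrightarrow> j \<noteq> k \<Longrightarrow>
       g k ?y = cnjo (g j ?y) \<and> pos j \<noteq> pos k"
      using arc_pair[OF 2(2)] by auto
    have ci: "cnj (ph i ?y) = ph i ?y" using ph_real[OF cu off i(1)] by (simp add: complex_eq_iff)
    \<comment> \<open>The two sections run on opposite sides, so exactly one of the two values is
      defined by reflection.\<close>
    have cj: "cnj (ph j ?y) = ph l ?y" if "j \<noteq> i" "l \<noteq> i" "j \<noteq> l" for j l
      using i(2)[OF that] by (cases "pos j") (simp_all add: ph_def)
    have "cnj (J ?y) = J ?y"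
    proof -
      consider "i = 1" | "i = 2" | "i = 3" using exhaust_3 by blast
      then show ?thesis
      proof cases
        case 1
        have "cnj (ph 1 ?y) = ph 1 ?y" "cnj (ph 2 ?y) = ph 3 ?y" "cnj (ph 3 ?y) = ph 2 ?y" using ci cj 1 by simp_all
        then show ?thesis unfolding J_def by (simp add: algebra_simps)
      next
        case 2
        have "cnj (ph 2 ?y) = ph 2 ?y" "cnj (ph 1 ?y) = ph 3 ?y" "cnj (ph 3 ?y) = ph 1 ?y" using ci cj 2 by simp_all
        then show ?thesis unfolding J_def by (simp add: algebra_simps)
      next
        case 3
        have "cnj (ph 3 ?y) = ph 3 ?y" "cnj (ph 1 ?y) = ph 2 ?y" "cnj (ph 2 ?y) = ph 1 ?y" using ci cj 3 by simp_all
        then show ?thesis unfolding J_def by (simp add: algebra_simps)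
      qed
    qed
    then show ?thesis by (simp add: complex_eq_iff)
  next
    case 3
    have off: "?y \<notin> emb ` Some ` {-1..1}" using 3(1) by auto
    have "Im (ph s ?y) = 0" for s
      using ph_real[OF cu off] real_fibre_value[OF 3(2), of s] by simp
    then show ?thesis by (simp add: J_def power2_eq_square)
  qed
qed

lemma ex_J_const: "\<exists>c. \<forall>t\<in>closed_upper. J t = complex_of_real c"
proof -
  have cont: "continuous_map (subtopology sphere_top closed_upper) euclidean J"
  proof -
    have lim: "(ph s \<longlongrightarrow> ph s t) (atin (subtopology sphere_top closed_upper) t)"
      if "t \<in> topspace (subtopology sphere_top closed_upper)" for s t
      using cont_ph[of s] that unfolding continuous_map_euclidean_iff by blast
    have "(J \<longlongrightarrow> J t) (atin (subtopology sphere_top closed_upper) t)"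
      if "t \<in> topspace (subtopology sphere_top closed_upper)" for t
      unfolding J_def[abs_def] by (intro tendsto_intros lim[OF that])
    then show ?thesis unfolding continuous_map_euclidean_iff by blast
  qed
  have holo: "(\<lambda>z. J (Some z)) holomorphic_on upper"
    unfolding J_def by (intro holomorphic_intros holo_ph)
  show ?thesis
  proof (rule half_plane_real_boundary[OF cont holo J_real])
    fix c assume "\<And>t. t \<in> closed_upper \<Longrightarrow> J t = complex_of_real c"
    then show ?thesis by blast
  qed
qed

definition j0 :: real where "j0 = (SOME c. \<forall>t\<in>closed_upper. J t = complex_of_real c)"

lemma J_const: "t \<in> closed_upper \<Longrightarrow> J t = complex_of_real j0"
  using someI_ex[OF ex_J_const] unfolding j0_def by blast

text \<open>Replacing \<open>k\<close> by \<open>\<kappa>\<close> changes the difference of the two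
  sides of the jump relation by 2 (1 - d)(\<kappa> - k), so d \<noteq> 1 leaves a single constant.
  The fibre without the point itself consists of two distinct points, hence the sum over it has two
  terms.\<close>

lemma Phi_const_eq: "Phi_const lam u = complex_of_real k"
proof -
  have rel: "(let z = Some (complex_of_real x) in
        Lim (above x) (\<lambda>w. Phi_plus_const \<kappa> u (Some w)) + Lim (below x) (\<lambda>w. Phi_plus_const \<kappa> u (Some w)) =
        delta lam * (\<Sum>x'\<in>R -` {R z} - {z}. Phi_plus_const \<kappa> u x')) \<longleftrightarrow> \<kappa> = complex_of_real k"
    if x: "x \<in> {-1<..<1}" for x \<kappa>
  proof -
    have x': "x \<in> {-1..1}" using x by simp
    have "((\<lambda>w. cauchy_integral u w + \<kappa>) \<longlongrightarrow> boundary_value x + \<kappa>) (above x)" by (intro tendsto_intros boundary_value_limit x')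
    then have L1: "Lim (above x) (\<lambda>w. Phi_plus_const \<kappa> u (Some w)) = boundary_value x + \<kappa>"
      unfolding Phi_plus_const_def option.case by (rule tendsto_Lim[OF above_nontrivial])
    have "((\<lambda>w. cnj (cauchy_integral u (cnj w)) + \<kappa>) \<longlongrightarrow> cnj (boundary_value x) + \<kappa>) (below x)"
      by (intro tendsto_intros filterlim_compose[OF boundary_value_limit[OF x'] filterlim_cnj_below])
    then have "((\<lambda>w. cauchy_integral u w + \<kappa>) \<longlongrightarrow> cnj (boundary_value x) + \<kappa>) (below x)" by (simp add: cauchy_integral_cnj)
    then have L2: "Lim (below x) (\<lambda>w. Phi_plus_const \<kappa> u (Some w)) = cnj (boundary_value x) + \<kappa>"
      unfolding Phi_plus_const_def option.case by (rule tendsto_Lim[OF below_nontrivial])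
    have fib: "R -` {R (Some (complex_of_real x))} = {sec 1 x, sec 2 x, sec 3 x}"
      unfolding fibre_eq[OF R_in_closed_upper[OF x']] UNIV_3 by simp
    have ne: "sec 1 x \<noteq> sec 2 x" "sec 1 x \<noteq> sec 3 x" "sec 2 x \<noteq> sec 3 x"
      using inj_sec[OF x'] by (auto dest: injD)
    have "{sec 1 x, sec 2 x, sec 3 x} - {z} = {sec 2 x, sec 3 x}" if "sec 1 x = z" for z
      using ne that by auto
    from this[OF sec1[OF x']]
    have "R -` {R (Some (complex_of_real x))} - {Some (complex_of_real x)} = {sec 2 x, sec 3 x}"
      unfolding fib .
    then have sum: "(\<Sum>x'\<in>R -` {R (Some (complex_of_real x))} - {Some (complex_of_real x)}. Phi_plus_const \<kappa> u x')
       = phi (sec 2 x) + \<kappa> + (phi (sec 3 x) + \<kappa>)"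
      using ne(3) phi_sec[OF x', of 2] phi_sec[OF x', of 3] by simp
    have p: "phi (sec s x) = complex_of_real (Re (phi (sec s x)))" if "s \<noteq> 1" for s
      using phi_sec_real[OF x' that] by (simp add: complex_eq_iff)
    have alg: "S + 2 * \<kappa> = D + 2 * dd * \<kappa> \<longleftrightarrow> 2 * (dd - 1) * (\<kappa> - kk) = 0"
      if "S = D + 2 * dd * kk - 2 * kk" for S D dd kk :: complex
    proof -
      have "(D + 2 * dd * \<kappa>) - (S + 2 * \<kappa>) = 2 * (dd - 1) * (\<kappa> - kk)" unfolding that by (simp add: algebra_simps)
      then show ?thesis by (metis right_minus_eq)
    qed
    have "boundary_value x + \<kappa> + (cnj (boundary_value x) + \<kappa>) = complex_of_real (2 * Re (boundary_value x)) + 2 * \<kappa>"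
      using complex_add_cnj[of "boundary_value x"] by (simp add: algebra_simps)
    moreover have sr: "complex_of_real (2 * Re (boundary_value x)) = complex_of_real (d * (Re (phi (sec 2 x)) + Re (phi (sec 3 x))) + 2 * d * k - 2 * k)"
      using slot_relation[OF x'] by (intro arg_cong[of _ _ complex_of_real]) (simp add: algebra_simps)
    moreover have "delta lam * (phi (sec 2 x) + \<kappa> + (phi (sec 3 x) + \<kappa>))
        = complex_of_real (d * (Re (phi (sec 2 x)) + Re (phi (sec 3 x)))) + 2 * complex_of_real d * \<kappa>"
      unfolding delta_d using p[of 2] p[of 3] by (simp add: algebra_simps)
    moreover have "complex_of_real (2 * Re (boundary_value x)) + 2 * \<kappa>
        = complex_of_real (d * (Re (phi (sec 2 x)) + Re (phi (sec 3 x)))) + 2 * complex_of_real d * \<kappa>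
        \<longleftrightarrow> 2 * (complex_of_real d - 1) * (\<kappa> - complex_of_real k) = 0"
      by (rule alg, subst sr) (simp only: of_real_add of_real_diff of_real_mult of_real_numeral)
    ultimately have "boundary_value x + \<kappa> + (cnj (boundary_value x) + \<kappa>) = delta lam * (phi (sec 2 x) + \<kappa> + (phi (sec 3 x) + \<kappa>))
        \<longleftrightarrow> 2 * (complex_of_real d - 1) * (\<kappa> - complex_of_real k) = 0" by (simp only:)
    also have "\<dots> \<longleftrightarrow> \<kappa> = complex_of_real k"
    proof -
      have "complex_of_real d - 1 \<noteq> 0" using d_not_1 by (metis of_real_1 of_real_eq_iff right_minus_eq)
      then show ?thesis by simp
    qed
    finally show ?thesis unfolding Let_def L1 L2 sum .
  qed
  show ?thesis unfolding Phi_const_def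
  proof (rule the_equality)
    show "Phi_jump_relation lam u (complex_of_real k)"
      unfolding Phi_jump_relation_def using rel[of _ "complex_of_real k"] by blast
  next
    fix \<kappa> assume "Phi_jump_relation lam u \<kappa>"
    then show "\<kappa> = complex_of_real k"
      unfolding Phi_jump_relation_def using rel[of 0 \<kappa>] by (meson greaterThanLessThan_iff neg_less_0_iff_less zero_less_one)
  qed
qed

section \<open>The vector \<open>W\<close> and the constant \<open>J0\<close>\<close>

lemma Phi_eq: "Phi lam u = Phi_plus_const (complex_of_real k) u"
  unfolding Phi_def Phi_const_eq ..

lemma Phi_plus_const_cnjo: "Phi_plus_const (complex_of_real k) u (cnjo p) = cnj (Phi_plus_const (complex_of_real k) u p)"
  by (cases p) (simp_all add: Phi_plus_const_def cauchy_integral_cnj)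

lemma pants_off_interval: "y \<in> pants_interior \<Longrightarrow> y \<notin> emb ` Some ` {-1..1}"
  by (auto simp: pants_interior_def slots_def)

lemma Phi_sheet_upper:
  assumes "y \<in> pants_interior" "y \<in> closed_upper"
  shows "Phi lam u (sheet_inv s y) = ph s y"
  using ph_off[OF assms(2) pants_off_interval[OF assms(1)]] assms(2)
  unfolding sheet_inv_eq[OF assms(1)] Phi_eq by (simp add: gf_def)

lemma Phi_sheet_lower:
  assumes y: "y \<in> pants_interior" "y \<notin> closed_upper"
  shows "Phi lam u (sheet_inv s y) = cnj (ph s (cnjo y))"
proof -
  have cu: "cnjo y \<in> closed_upper" using closed_upper_cases y(2) by blast
  have "ph s (cnjo y) = Phi_plus_const (complex_of_real k) u (g s (cnjo y))"
    by (rule ph_off[OF cu pants_off_interval[OF pants_cnjo[OF y(1)]]])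
  then show ?thesis unfolding sheet_inv_eq[OF y(1)] Phi_eq using y(2) by (simp add: gf_def Phi_plus_const_cnjo)
qed

lemma W_upper: "W lam u (Upper t) $ s = ph s (Some (complex_of_real t))"
proof -
  have "((\<lambda>z. ph s (Some z)) \<longlongrightarrow> ph s (Some (complex_of_real t))) (above t)"
    using continuous_map_upper_limit[OF cont_ph, of "Some (complex_of_real t)" s] by (simp add: upper_filter_real)
  moreover have "eventually (\<lambda>z. ph s (Some z) = Phi lam u (sheet_inv s (Some z))) (above t)"
    using eventually_upper_filter[of "Some (complex_of_real t)"] unfolding upper_filter_real
  proof (rule eventually_mono)
    fix z assume z: "z \<in> upper"
    then have "Some z \<in> pants_interior" using pants_upper by blast
    then show "ph s (Some z) = Phi lam u (sheet_inv s (Some z))" using Phi_sheet_upper[of "Some z" s] z by simp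
  qed
  ultimately have "((\<lambda>z. Phi lam u (sheet_inv s (Some z))) \<longlongrightarrow> ph s (Some (complex_of_real t))) (above t)"
    by (rule Lim_transform_eventually)
  then show ?thesis by (simp add: tendsto_Lim[OF above_nontrivial])
qed

lemma W_lower: "W lam u (Lower t) $ s = cnj (ph s (Some (complex_of_real t)))"
proof -
  have "((\<lambda>z. ph s (Some z)) \<longlongrightarrow> ph s (Some (complex_of_real t))) (above t)"
    using continuous_map_upper_limit[OF cont_ph, of "Some (complex_of_real t)" s] by (simp add: upper_filter_real)
  then have "((\<lambda>z. cnj (ph s (Some (cnj z)))) \<longlongrightarrow> cnj (ph s (Some (complex_of_real t)))) (below t)"
    by (intro tendsto_intros) (rule filterlim_compose[OF _ filterlim_cnj_below])
  moreover have "eventually (\<lambda>z. cnj (ph s (Some (cnj z))) = Phi lam u (sheet_inv s (Some z))) (below t)"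
    unfolding eventually_at_filter
  proof (intro always_eventually allI impI)
    fix z :: complex assume z: "z \<in> {z. Im z < 0}"
    have "Some (cnj z) \<in> pants_interior" using z pants_upper by auto
    then have "Some z \<in> pants_interior" using pants_cnjo[of "Some (cnj z)"] by simp
    then show "cnj (ph s (Some (cnj z))) = Phi lam u (sheet_inv s (Some z))" using Phi_sheet_lower[of "Some z" s] z by simp
  qed
  ultimately have "((\<lambda>z. Phi lam u (sheet_inv s (Some z))) \<longlongrightarrow> cnj (ph s (Some (complex_of_real t)))) (below t)"
    by (rule Lim_transform_eventually)
  then show ?thesis by (simp add: tendsto_Lim[OF below_nontrivial])
qed

lemma Jform_values:
  assumes "(\<forall>s. W lam u y $ s = ph s t) \<or> (\<forall>s. W lam u y $ s = cnj (ph s t))" and t: "t \<in> closed_upper"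
  shows "Jform lam (W lam u y) = complex_of_real j0"
  using assms(1)
proof
  assume "\<forall>s. W lam u y $ s = ph s t"
  then have "Jform lam (W lam u y) = J t" unfolding Jform_def sum_3 delta_d J_def by simp
  then show ?thesis by (simp add: J_const[OF t])
next
  assume "\<forall>s. W lam u y $ s = cnj (ph s t)"
  then have "Jform lam (W lam u y) = cnj (J t)" unfolding Jform_def sum_3 delta_d J_def by simp
  then show ?thesis by (simp add: J_const[OF t])
qed

lemma W_inner: "y \<in> pants_interior \<Longrightarrow> y \<in> closed_upper \<Longrightarrow> W lam u (Inner y) $ s = ph s y"
  by (simp add: Phi_sheet_upper)

lemma J0_eq: "J0 lam u = complex_of_real j0"
proof -
  have all: "Jform lam (W lam u y) = complex_of_real j0" if y: "y \<in> pants" for y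
  proof (cases y)
    case (Inner x)
    then have x: "x \<in> pants_interior" using y by (auto simp: pants_def)
    show ?thesis
    proof (cases "x \<in> closed_upper")
      case True
      then show ?thesis unfolding Inner by (intro Jform_values[OF _ True] disjI1 allI W_inner[OF x])
    next
      case False
      then have "cnjo x \<in> closed_upper" using closed_upper_cases by blast
      then show ?thesis unfolding Inner
        by (intro Jform_values[of _ "cnjo x"] disjI2 allI) (simp_all add: Phi_sheet_lower[OF x False])
    qed
  next
    case (Upper t)
    show ?thesis unfolding Upper by (intro Jform_values[of _ "Some (complex_of_real t)"] disjI1 allI W_upper) simp
  next
    case (Lower t)
    show ?thesis unfolding Lower by (intro Jform_values[of _ "Some (complex_of_real t)"] disjI2 allI W_lower) simp
  qed
  show ?thesis unfolding J0_def
  proof (rule the_equality)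
    show "\<forall>y\<in>pants. Jform lam (W lam u y) = complex_of_real j0" using all by blast
    fix j assume "\<forall>y\<in>pants. Jform lam (W lam u y) = j"
    moreover have "Inner None \<in> pants" using None_pants by (simp add: pants_def)
    ultimately show "j = complex_of_real j0" using all by metis
  qed
qed

end

section \<open>Excluding the remaining values\<close>

lemma carc_bounded:
  assumes "None \<notin> carc x y"
  shows "\<exists>M. \<forall>t>M. Some t \<notin> carc x y"
proof -
  obtain p q where pq: "x = Some p" "y = Some q" using assms by (cases x; cases y) (auto simp: carc_def)
  have "p < q" by (rule ccontr) (use assms in \<open>simp add: pq carc_def\<close>)
  then show ?thesis by (intro exI[of _ q]) (auto simp: pq carc_def)
qed

lemma continuous_on_sphere_Some:
  assumes "continuous_map (top_of_set S) sphere_top (\<lambda>x. Some (h x))"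
  shows "continuous_on S h"
  unfolding continuous_openin_preimage_eq
proof (intro allI impI)
  fix T :: "complex set" assume "open T"
  then have "openin sphere_top (Some ` T)" by simp
  from openin_continuous_map_preimage[OF assms this]
  have "openin (top_of_set S) {x \<in> S. Some (h x) \<in> Some ` T}" by simp
  moreover have "{x \<in> S. Some (h x) \<in> Some ` T} = S \<inter> h -` T" by auto
  ultimately show "openin (top_of_set S) (S \<inter> h -` T)" by simp
qed

lemma connected_compl_slot: "connected (- slot)"
proof (rule connected_complement_bounded_convex)
  show "bounded slot" by (rule compact_imp_bounded[OF compact_slot])
  show "convex slot" by (rule convex_linear_image) (simp_all add: bounded_linear.linear[OF bounded_linear_of_real])
qed simp

text \<open>The Joukowski map (z + 1/z)/2 as a map to the sphere. It carries the open unit disc onto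
  the complement of the slot and folds the unit circle onto the slot by z to Re z.\<close>

definition jk :: "complex \<Rightarrow> complex option" where "jk z = sphere_quot (1 + z\<^sup>2) (2 * z)"

lemma jk_0 [simp]: "jk 0 = None" and jk_nz: "z \<noteq> 0 \<Longrightarrow> jk z = Some ((1 + z\<^sup>2) / (2 * z))"
  by (simp_all add: jk_def sphere_quot_def)

lemma continuous_jk: "continuous_map euclidean sphere_top jk"
proof -
  have "continuous_map sphere_top sphere_top (ratmap [:1, 0, 1:] [:0, 2:])"
  proof (rule continuous_map_ratmap)
    show "poly [:1, 0, 1:] z \<noteq> 0 \<or> poly [:0, 2:] z \<noteq> 0" for z :: complex by (cases "z = 0") auto
  qed simp
  from continuous_map_compose[OF continuous_map_Some this]
  have "continuous_map euclidean sphere_top (ratmap [:1, 0, 1:] [:0, 2:] \<circ> Some)" .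
  moreover have "ratmap [:1, 0, 1:] [:0, 2:] \<circ> Some = jk"
    by (simp add: fun_eq_iff jk_def power2_eq_square mult.commute)
  ultimately show ?thesis by simp
qed

lemma joukowski_split: "z \<noteq> 0 \<Longrightarrow> (1 + z\<^sup>2) / (2 * z) = (z + inverse z) / 2" for z :: complex
proof -
  assume z: "z \<noteq> 0"
  have "(1 + z\<^sup>2) / z = z + inverse z"
    unfolding add_divide_distrib power2_eq_square using z by (simp add: inverse_eq_divide add.commute)
  moreover have "(1 + z\<^sup>2) / (2 * z) = ((1 + z\<^sup>2) / z) / 2" by simp
  ultimately show ?thesis by (simp only:)
qed

lemma Im_joukowski: "z \<noteq> 0 \<Longrightarrow> Im ((1 + z\<^sup>2) / (2 * z)) = Im z * (1 - 1 / (cmod z)\<^sup>2) / 2"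
  unfolding joukowski_split using Im_minus_inverse[of z] by (simp add: right_diff_distrib)

text \<open>In the unit disc 1 - 1/|z|^2 is at most 0, so the map exchanges the two half
  planes.\<close>

lemma jk_lower:
  assumes "Im z \<le> 0" "cmod z \<le> 1"
  shows "jk z \<in> closed_upper"
proof (cases "z = 0")
  case False
  then have "(cmod z)\<^sup>2 \<le> 1" "(cmod z)\<^sup>2 > 0" using assms(2) by (simp_all add: power_le_one)
  then have "1 - 1 / (cmod z)\<^sup>2 \<le> 0" by simp
  then have "0 \<le> Im z * (1 - 1 / (cmod z)\<^sup>2)" using assms(1) by (rule mult_nonpos_nonpos[rotated])
  then show ?thesis using Im_joukowski[OF False] False by (simp add: jk_nz)
qed simp

lemma joukowski_real_abs:
  fixes x :: real
  assumes "x \<noteq> 0"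
  shows "1 \<le> \<bar>(1 + x\<^sup>2) / (2 * x)\<bar>" "\<bar>x\<bar> < 1 \<Longrightarrow> 1 < \<bar>(1 + x\<^sup>2) / (2 * x)\<bar>"
proof -
  have eq: "\<bar>(1 + x\<^sup>2) / (2 * x)\<bar> = (1 + x\<^sup>2) / (2 * \<bar>x\<bar>)" by (simp add: abs_divide abs_mult abs_of_nonneg)
  have sq: "1 + x\<^sup>2 - 2 * \<bar>x\<bar> = (1 - \<bar>x\<bar>)\<^sup>2" by (simp add: power2_eq_square algebra_simps)
  have pos: "2 * \<bar>x\<bar> > 0" using assms by simp
  have "0 \<le> (1 - \<bar>x\<bar>)\<^sup>2" by simp
  then have "2 * \<bar>x\<bar> \<le> 1 + x\<^sup>2" using sq by linarith
  then show "1 \<le> \<bar>(1 + x\<^sup>2) / (2 * x)\<bar>" unfolding eq using pos by simp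
  assume "\<bar>x\<bar> < 1"
  then have "0 < (1 - \<bar>x\<bar>)\<^sup>2" by simp
  then have "2 * \<bar>x\<bar> < 1 + x\<^sup>2" using sq by linarith
  then show "1 < \<bar>(1 + x\<^sup>2) / (2 * x)\<bar>" unfolding eq using pos by simp
qed

lemma joukowski_of_real: "(1 + (complex_of_real x)\<^sup>2) / (2 * complex_of_real x) = complex_of_real ((1 + x\<^sup>2) / (2 * x))"
  by simp

lemma joukowski_off_slot:
  assumes z: "z \<noteq> 0" "cmod z < 1"
  shows "(1 + z\<^sup>2) / (2 * z) \<notin> slot"
proof (cases "Im z = 0")
  case True
  then obtain x where x: "z = complex_of_real x" by (metis complex_is_Real_iff Reals_cases)
  have "x \<noteq> 0" "\<bar>x\<bar> < 1" using z by (simp_all add: x)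
  then have "1 < \<bar>(1 + x\<^sup>2) / (2 * x)\<bar>" by (rule joukowski_real_abs(2))
  then show ?thesis unfolding x joukowski_of_real slot_iff Re_complex_of_real by (metis linorder_not_le)
next
  case False
  have "(cmod z)\<^sup>2 < 1" "(cmod z)\<^sup>2 > 0" using z by (simp_all add: power_less_one_iff)
  then have "1 - 1 / (cmod z)\<^sup>2 \<noteq> 0" by simp
  then have "Im ((1 + z\<^sup>2) / (2 * z)) \<noteq> 0" unfolding Im_joukowski[OF z(1)] using False by simp
  then show ?thesis by (simp add: slot_iff)
qed

lemma jk_circle: "cmod z = 1 \<Longrightarrow> jk z = Some (complex_of_real (Re z))"
proof -
  assume z: "cmod z = 1"
  then have nz: "z \<noteq> 0" by auto
  have "z * cnj z = 1" using complex_norm_square[of z] z by simp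
  then have "inverse z = cnj z" by (rule inverse_unique)
  then show ?thesis unfolding jk_nz[OF nz] joukowski_split[OF nz] by (simp add: complex_add_cnj)
qed

text \<open>\<alpha> is the root of v \<alpha>^2 - 2 \<alpha> + v = 0 in the unit disc, written
  without division by v, because v = 0 has to be allowed as the reciprocal of infinity.\<close>

lemma joukowski_inverse:
  fixes v :: real
  assumes "\<bar>v\<bar> < 1"
  defines "\<alpha> \<equiv> v / (1 + sqrt (1 - v\<^sup>2))"
  shows "\<bar>\<alpha>\<bar> < 1" "\<alpha> = 0 \<longleftrightarrow> v = 0" "v \<noteq> 0 \<Longrightarrow> (1 + \<alpha>\<^sup>2) / (2 * \<alpha>) = 1 / v"
proof -
  define q where "q = sqrt (1 - v\<^sup>2)"
  have v2: "v\<^sup>2 \<le> 1" using assms(1) by (simp add: abs_square_le_1)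
  have q: "q \<ge> 0" "q\<^sup>2 = 1 - v\<^sup>2" using v2 by (simp_all add: q_def)
  have \<alpha>: "\<alpha> = v / (1 + q)" by (simp add: \<alpha>_def q_def)
  have "\<bar>\<alpha>\<bar> = \<bar>v\<bar> / (1 + q)" using q(1) by (simp add: \<alpha> abs_divide)
  also have "\<dots> \<le> \<bar>v\<bar> / 1" using q(1) by (intro divide_left_mono) auto
  finally show "\<bar>\<alpha>\<bar> < 1" using assms(1) by simp
  show "\<alpha> = 0 \<longleftrightarrow> v = 0" using q(1) by (simp add: \<alpha>)
  assume v: "v \<noteq> 0"
  have "v * (1 + \<alpha>\<^sup>2) = 2 * \<alpha>"
  proof -
    have q1: "1 + q \<noteq> 0" using q(1) by simp
    have "(1 + q)\<^sup>2 + v\<^sup>2 = 2 * (1 + q)" using q(2) by (simp add: power2_eq_square algebra_simps)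
    then have "((1 + q)\<^sup>2 + v\<^sup>2) / (1 + q)\<^sup>2 = 2 * (1 + q) / ((1 + q) * (1 + q))" by (simp only: power2_eq_square)
    then have "((1 + q)\<^sup>2 + v\<^sup>2) / (1 + q)\<^sup>2 = 2 / (1 + q)" unfolding mult_divide_mult_cancel_right[OF q1] .
    moreover have "((1 + q)\<^sup>2 + v\<^sup>2) / (1 + q)\<^sup>2 = 1 + \<alpha>\<^sup>2" using q1 by (simp add: \<alpha> power_divide add_divide_distrib)
    ultimately show ?thesis by (simp add: \<alpha>)
  qed
  moreover have "\<alpha> \<noteq> 0" using v q(1) by (simp add: \<alpha>)
  ultimately show "(1 + \<alpha>\<^sup>2) / (2 * \<alpha>) = 1 / v" using v by (simp add: field_simps)
qed

context cubic_eigen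
begin

lemma slots_bounded: "\<exists>M. \<forall>t>M. Some t \<notin> slots"
proof -
  have "None \<notin> slots" using None_pants pants_real[of None] by simp
  then have "None \<notin> carc (a 1) (a 2)" "None \<notin> carc (a 3) (a 4)" by (auto simp: slots_def)
  then obtain M1 M2 where M: "\<And>t. t > M1 \<Longrightarrow> Some t \<notin> carc (a 1) (a 2)" "\<And>t. t > M2 \<Longrightarrow> Some t \<notin> carc (a 3) (a 4)"
    using carc_bounded by metis
  have "\<forall>t>max 1 (max M1 M2). Some t \<notin> slots" using M by (auto simp: slots_def)
  then show ?thesis by blast
qed

text \<open>By the identity theorem \<open>\<Phi>\<^sup>2\<close> would be constant on the connected complement of the slot.\<close>

lemma cauchy_square_not_constant:
  assumes AB: "A < B"
    and v: "\<And>x z. x \<in> {A<..<B} \<Longrightarrow> gr s x = Some z \<Longrightarrow> z \<notin> slot \<and> (cauchy_integral u z + complex_of_real k)\<^sup>2 = m"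
  shows False
proof -
  have gi: "x = x'" if "gr s x = gr s x'" for x x'
    using arg_cong[OF that, of R] by (simp add: R_gr)
  obtain x1 z1 where x1: "x1 \<in> {A<..<B}" "gr s x1 = Some z1"
  proof -
    \<comment> \<open>The section is injective, having \<open>R\<close> as a left inverse, so at
      most one of two points goes to infinity.\<close>
    define p q where "p = (2 * A + B) / 3" and "q = (A + 2 * B) / 3"
    have pq: "p \<in> {A<..<B}" "q \<in> {A<..<B}" "p \<noteq> q" using AB by (simp_all add: p_def q_def)
    have "gr s p \<noteq> None \<or> gr s q \<noteq> None"
    proof (rule ccontr)
      assume "\<not> (gr s p \<noteq> None \<or> gr s q \<noteq> None)"
      then have "gr s p = gr s q" by simp
      then show False using gi[of p q] pq(3) by blast
    qed
    then obtain x where x: "x \<in> {A<..<B}" "gr s x \<noteq> None" using pq(1,2) by blast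
    then obtain z where "gr s x = Some z" by blast
    with x(1) show ?thesis by (rule that)
  qed
  define f where "f = (\<lambda>z. (cauchy_integral u z + complex_of_real k)\<^sup>2 - m)"
  define U where "U = {z. z \<notin> slot \<and> f z = 0}"
  have U: "z \<in> U" if "x \<in> {A<..<B}" "gr s x = Some z" for x z using v[OF that] by (simp add: U_def f_def)
  have lp: "z1 islimpt U" unfolding islimpt_def
  proof (intro allI impI)
    fix T assume T: "z1 \<in> T" "open T"
    then have "openin sphere_top (Some ` T)" by simp
    from openin_continuous_map_preimage[OF cont_gr this]
    have "open {x. gr s x \<in> Some ` T}" by simp
    then have "open ({x. gr s x \<in> Some ` T} \<inter> {A<..<B})" by (intro open_Int) auto
    then obtain e where e: "e > 0" "ball x1 e \<subseteq> {x. gr s x \<in> Some ` T} \<inter> {A<..<B}"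
      using x1 T(1) by (metis (no_types, lifting) Int_iff image_eqI mem_Collect_eq openE)
    have "x1 + e / 2 \<in> ball x1 e" using e(1) by (simp add: dist_real_def)
    then have x2: "gr s (x1 + e / 2) \<in> Some ` T" "x1 + e / 2 \<in> {A<..<B}" using e(2) by blast+
    then obtain z2 where z2: "z2 \<in> T" "gr s (x1 + e / 2) = Some z2" by blast
    have "z2 \<noteq> z1"
    proof
      assume "z2 = z1"
      then have "x1 + e / 2 = x1" using gi[of "x1 + e / 2" x1] z2(2) x1(2) by simp
      then show False using e(1) by simp
    qed
    then show "\<exists>y\<in>U. y \<in> T \<and> y \<noteq> z1" using U[OF x2(2) z2(2)] z2(1) by blast
  qed
  have holf: "f holomorphic_on - slot" unfolding f_def
    by (intro holomorphic_intros holomorphic_cauchy_integral[OF cont_u])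
  have f0: "f w = 0" if "w \<in> - slot" for w
    by (rule analytic_continuation[OF holf _ connected_compl_slot _ _ lp _ that])
      (use U[OF x1] closed_slot in \<open>auto simp: U_def open_Compl\<close>)
  define h where "h = (\<lambda>z. cauchy_integral u z + complex_of_real k)"
  have ch: "continuous_on (- slot) h" unfolding h_def
    by (intro continuous_intros holomorphic_on_imp_continuous_on[OF holomorphic_cauchy_integral[OF cont_u]])
  \<comment> \<open>A continuous function with at most two values on a connected set is constant.
    Its limit at infinity identifies the constant with \<open>k\<close>, and the Cauchy integral
    vanishes.\<close>
  have "h ` (- slot) \<subseteq> {csqrt m, - csqrt m}"
  proof
    fix w assume "w \<in> h ` (- slot)"
    then have "w\<^sup>2 = (csqrt m)\<^sup>2" using f0 by (auto simp: f_def h_def)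
    then show "w \<in> {csqrt m, - csqrt m}" by (simp add: power2_eq_iff del: power2_csqrt)
  qed
  then have "finite (h ` (- slot))" by (rule finite_subset) simp
  then have "h constant_on (- slot)" by (rule continuous_finite_range_constant[OF connected_compl_slot ch])
  then obtain y where y: "\<And>z. z \<notin> slot \<Longrightarrow> h z = y" by (auto simp: constant_on_def)
  then have e: "cauchy_integral u z = y - complex_of_real k" if "z \<notin> slot" for z
    using that by (simp add: h_def eq_diff_eq)
  have "eventually (\<lambda>z. y - complex_of_real k = cauchy_integral u z) at_infinity"
    unfolding eventually_at_infinity
  proof (intro exI[of _ 2] allI impI)
    fix z :: complex assume "2 \<le> cmod z"
    then have "z \<notin> slot" by auto
    then show "y - complex_of_real k = cauchy_integral u z" by (simp add: e)
  qed
  then have "(cauchy_integral u \<longlongrightarrow> y - complex_of_real k) at_infinity"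
    by (rule Lim_transform_eventually[OF tendsto_const])
  then have "y - complex_of_real k = 0"
    by (rule tendsto_unique[OF trivial_limit_at_infinity _ cauchy_integral_at_infinity[OF cont_u]])
  then show False using cauchy_not_zero e by simp
qed

text \<open>The values of section 2 over the interval would form a curve of zeros of \<Phi>, which
  is the case \<open>m = 0\<close> of \<open>cauchy_square_not_constant\<close>.\<close>

lemma sec_not_zero:
  assumes "\<And>x. x \<in> {-1..1} \<Longrightarrow> Re (phi (sec 2 x)) + k = 0"
  shows False
proof (rule cauchy_square_not_constant[of "-1" 1 2 0])
  fix y z assume y: "y \<in> {-1<..<1}" and z: "gr 2 y = Some z"
  then have "y \<in> {-1..1}" by simp
  then obtain x where x: "x \<in> {-1..1}" "R (emb (Some x)) = emb (Some y)" by (rule interval_image)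
  then have sz: "sec 2 x = Some z" using z by simp
  have off: "z \<notin> slot" by (rule sec_off_slot[OF x(1) _ sz]) simp
  have "Im (phi (sec 2 x)) = 0" by (rule phi_sec_real[OF x(1)]) simp
  then have "phi (sec 2 x) + complex_of_real k = 0" using assms[OF x(1)] by (simp add: complex_eq_iff)
  then show "z \<notin> slot \<and> (cauchy_integral u z + complex_of_real k)\<^sup>2 = 0" using off sz by (simp add: phi_off)
qed simp

text \<open>Points of the extended real line off the slots are fixed by conjugation and carry real
  values on all sheets. If the three values equal w, the form is 3 (1 - d) w^2.\<close>

lemma gap_consequences:
  assumes anti: "antisymmetric lam u" and x: "x \<notin> slots" and d2: "d \<noteq> -2"
  shows "1 < d \<Longrightarrow> j0 \<le> 0" "d < -2 \<Longrightarrow> 0 \<le> j0"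
    "-2 < d \<Longrightarrow> d < 1 \<Longrightarrow> (ph 1 (emb x))\<^sup>2 = complex_of_real (j0 / (3 * (1 - d)))"
proof -
  define w where "w = (\<lambda>s. Re (ph s (emb x)))"
  have px: "emb x \<in> pants_interior" using x by (simp add: pants_real)
  have cu: "emb x \<in> closed_upper" by (rule emb_in_closed_upper)
  have ph: "ph s (emb x) = complex_of_real (w s)" for s
    using ph_real[OF cu pants_off_interval[OF px] real_off_arcs(1)[OF slots_off[OF x]], of s]
    by (simp add: w_def complex_eq_iff)
  have pt: "Inner (emb x) \<in> pants" "cnj_point (Inner (emb x)) = Inner (emb x)"
    using px range_emb_iff[of "emb x"] by (simp_all add: pants_def)
  have W: "W lam u (Inner (emb x)) $ s = complex_of_real (w s)" for s
    using W_inner[OF px cu] ph by simp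
  have j: "j0 = (w 1)\<^sup>2 + (w 2)\<^sup>2 + (w 3)\<^sup>2 - d * (w 1 * w 2 + w 1 * w 3 + w 2 * w 3)"
  proof -
    have "complex_of_real j0 = complex_of_real ((w 1)\<^sup>2 + (w 2)\<^sup>2 + (w 3)\<^sup>2 - d * (w 1 * w 2 + w 1 * w 3 + w 2 * w 3))"
      using J_const[OF cu] unfolding J_def ph by simp
    then show ?thesis by (simp only: of_real_eq_iff)
  qed
  note * = antisymmetric_at_fixed_point[OF anti pt W J0_eq j delta_d d_not_1 d2]
  show "1 < d \<Longrightarrow> j0 \<le> 0" "d < -2 \<Longrightarrow> 0 \<le> j0" by (rule *(1), assumption) (rule *(2), assumption)
  assume d: "-2 < d" "d < 1"
  have "w 2 = w 1" "w 3 = w 1" using *(3)[OF d] by simp_all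
  then have "j0 = (3 * (1 - d)) * (w 1)\<^sup>2" unfolding j by (simp add: power2_eq_square algebra_simps)
  then have "(w 1)\<^sup>2 = j0 / (3 * (1 - d))" using d(2) by simp
  then show "(ph 1 (emb x))\<^sup>2 = complex_of_real (j0 / (3 * (1 - d)))" unfolding ph by (metis of_real_power)
qed

lemma middle_case:
  assumes anti: "antisymmetric lam u" and d: "-2 < d" "d < 1"
  shows False
proof -
  obtain M where M: "\<And>t. t > M \<Longrightarrow> Some t \<notin> slots" using slots_bounded by blast
  show False
  \<comment> \<open>Any interval beyond all slots will do; on it the square of the value on sheet 1
    is constant.\<close>
  proof (rule cauchy_square_not_constant[of M "M + 1" 1])
    fix x z assume x: "x \<in> {M<..<M + 1}" and z: "gr 1 x = Some z"
    have xs: "Some x \<notin> slots" using M x by simp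
    have "(ph 1 (emb (Some x)))\<^sup>2 = complex_of_real (j0 / (3 * (1 - d)))"
      by (rule gap_consequences(3)[OF anti xs _ d]) (use d in simp)
    moreover have off: "emb (Some x) \<notin> emb ` Some ` {-1..1}" 
      by (rule pants_off_interval) (use xs pants_real[of "Some x"] in blast)
    moreover have "ph 1 (emb (Some x)) = Phi_plus_const (complex_of_real k) u (g 1 (emb (Some x)))"
      by (rule ph_off[OF emb_in_closed_upper off])
    moreover have "z \<notin> slot" by (rule off_slot[OF emb_in_closed_upper off]) (use z in simp)
    ultimately show "z \<notin> slot \<and> (cauchy_integral u z + complex_of_real k)\<^sup>2 = complex_of_real (j0 / (3 * (1 - d)))"
      using z by (simp add: Phi_plus_const_def)
  qed simp
qed

lemma None_not_slots: "None \<notin> slots"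
  using None_pants pants_real[of None] by simp

lemma slot_quadratic:
  assumes x: "x \<in> {-1..1}"
  shows "j0 = (Re (phi (sec 2 x)) + k)\<^sup>2 + (Re (phi (sec 3 x)) + k)\<^sup>2
     - d * (Re (phi (sec 2 x)) + k) * (Re (phi (sec 3 x)) + k) - (cmod (boundary_value x + complex_of_real k))\<^sup>2"
  using J_slot[OF x] J_const[OF R_in_closed_upper[OF x]] by (metis of_real_eq_iff)

text \<open>For \<open>d < -2\<close> the form \<open>J\<close> is negative definite on the slot.\<close>

lemma negative_case:
  assumes anti: "antisymmetric lam u" and d: "d < -2"
  shows False
proof (rule sec_not_zero)
  fix x :: real assume x: "x \<in> {-1..1}"
  define A B where "A = Re (phi (sec 2 x)) + k" and "B = Re (phi (sec 3 x)) + k"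
  have "0 \<le> j0" by (rule gap_consequences(2)[OF anti None_not_slots]) (use d in simp_all)
  then have q: "0 \<le> A\<^sup>2 + B\<^sup>2 - d * A * B - (cmod (boundary_value x + complex_of_real k))\<^sup>2"
    using slot_quadratic[OF x] by (simp add: A_def B_def)
  have r: "Re (boundary_value x) + k = d * (A + B) / 2" using slot_relation[OF x] by (simp add: A_def B_def)
  have "(cmod (boundary_value x + complex_of_real k))\<^sup>2 = (Re (boundary_value x) + k)\<^sup>2 + (Im (boundary_value x))\<^sup>2" by (simp add: cmod_power2)
  then have "(cmod (boundary_value x + complex_of_real k))\<^sup>2 \<ge> (d * (A + B) / 2)\<^sup>2" unfolding r by simp
  then have "0 \<le> A\<^sup>2 + B\<^sup>2 - d * A * B - (d * (A + B) / 2)\<^sup>2" using q by simp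
  \<comment> \<open>In the coordinates A + B and A - B the form is diagonal. For d < -2 both
    coefficients are negative, so both coordinates vanish.\<close>
  also have "\<dots> = - ((d + 2) * (d - 1) / 4) * (A + B)\<^sup>2 + ((d + 2) / 4) * (A - B)\<^sup>2"
    by (simp add: power2_eq_square field_simps)
  finally have *: "0 \<le> - ((d + 2) * (d - 1) / 4) * (A + B)\<^sup>2 + ((d + 2) / 4) * (A - B)\<^sup>2" .
  have c: "(d + 2) * (d - 1) / 4 > 0" "(d + 2) / 4 < 0" using d by (simp_all add: mult_neg_neg)
  have "0 \<le> (A + B)\<^sup>2" "0 \<le> (A - B)\<^sup>2" by simp_all
  then have "((d + 2) * (d - 1) / 4) * (A + B)\<^sup>2 \<ge> 0" "((d + 2) / 4) * (A - B)\<^sup>2 \<le> 0"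
    using c by (simp_all add: mult_nonpos_nonneg)
  then have "((d + 2) * (d - 1) / 4) * (A + B)\<^sup>2 = 0" "((d + 2) / 4) * (A - B)\<^sup>2 = 0" using * by linarith+
  then have "(A + B)\<^sup>2 = 0" "(A - B)\<^sup>2 = 0" using c by (simp_all only: mult_eq_0_iff) auto
  then have "A + B = 0" "A - B = 0" by simp_all
  then show "Re (phi (sec 2 x)) + k = 0" unfolding A_def[symmetric] by simp
qed

text \<open>For d = -2 the form is the square of the sum of the three values, and on the slot the
  jump relation reduces it to minus the squared imaginary part of the boundary value. This vanishes
  at the end 1, hence on the whole slot. Then \<open>phi\<close> is real on the whole line and
  therefore constant, equal to its value 0 at infinity.\<close>

lemma degenerate_case:
  assumes d: "d = -2"
  shows False
proof -
  have im: "j0 = - (Im (boundary_value x))\<^sup>2" if x: "x \<in> {-1..1}" for x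
  proof -
    define A B where "A = Re (phi (sec 2 x)) + k" and "B = Re (phi (sec 3 x)) + k"
    have r: "Re (boundary_value x) + k = - (A + B)" using slot_relation[OF x] d by (simp add: A_def B_def)
    have "j0 = A\<^sup>2 + B\<^sup>2 - d * A * B - (cmod (boundary_value x + complex_of_real k))\<^sup>2"
      unfolding A_def B_def by (rule slot_quadratic[OF x])
    moreover have "(cmod (boundary_value x + complex_of_real k))\<^sup>2 = (Re (boundary_value x) + k)\<^sup>2 + (Im (boundary_value x))\<^sup>2" by (simp add: cmod_power2)
    ultimately have "j0 = A\<^sup>2 + B\<^sup>2 + 2 * A * B - ((Re (boundary_value x) + k)\<^sup>2 + (Im (boundary_value x))\<^sup>2)"
      using d by simp
    then show ?thesis unfolding r by (simp add: power2_eq_square algebra_simps)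
  qed
  have "Im (boundary_value 1) = 0" using phi_real_outside[of 1] phi_on[of 1] by simp
  then have "j0 = 0" using im[of 1] by simp
  then have im0: "Im (boundary_value x) = 0" if "x \<in> {-1..1}" for x using im[OF that] by simp
  have real: "Im (phi (Some (complex_of_real x))) = 0" for x
  proof (cases "x \<in> {-1..1}")
    case True
    then show ?thesis using im0[OF True] phi_on[OF True] by simp
  qed (auto intro: phi_real_outside)
  have holo: "(\<lambda>z. phi (Some z)) holomorphic_on upper"
  proof (rule holomorphic_transform)
    show "cauchy_integral u holomorphic_on upper"
      by (rule holomorphic_on_subset[OF holomorphic_cauchy_integral[OF cont_u]]) (use upper_off_slot in force)
    show "cauchy_integral u z = phi (Some z)" if "z \<in> upper" for z
      using that by (simp add: phi_off upper_off_slot)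
  qed
  show False
  proof (rule half_plane_real_boundary[OF cont_phi holo real])
    fix c0 assume c0: "\<And>t. t \<in> closed_upper \<Longrightarrow> phi t = complex_of_real c0"
    then have "c0 = 0" using c0[of None] by simp
    then have z: "cauchy_integral u z = 0" if "0 \<le> Im z" "z \<notin> slot" for z
      using c0[of "Some z"] that by (simp add: phi_off)
    have "cauchy_integral u z = 0" if s: "z \<notin> slot" for z
    proof (cases "0 \<le> Im z")
      case False
      then have "cauchy_integral u (cnj z) = 0" using s by (intro z) (simp_all add: slot_iff)
      then show ?thesis by (simp add: cauchy_integral_cnj)
    qed (use z s in blast)
    then show False by (rule cauchy_not_zero)
  qed
qed

section \<open>Transfer to the unit disc\<close>

definition recip_section :: "3 \<Rightarrow> real \<Rightarrow> real" where
  "recip_section s x = (case sec s x of None \<Rightarrow> 0 | Some z \<Rightarrow> 1 / Re z)"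

text \<open>The point of the disc that the Joukowski map sends to \<open>sec s x\<close>. It is
  computed from the reciprocal because the section runs outside the interval \<open>[-1,1]\<close>
  and may pass through infinity.\<close>

definition disc_section :: "3 \<Rightarrow> real \<Rightarrow> real" where "disc_section s x = recip_section s x / (1 + sqrt (1 - (recip_section s x)\<^sup>2))"

lemma recip_section:
  assumes x: "x \<in> {-1..1}" and s: "s \<noteq> 1"
  shows "ratmap [:1:] [:0, 1:] (sec s x) = Some (complex_of_real (recip_section s x))" "\<bar>recip_section s x\<bar> < 1"
    "sec s x = (if recip_section s x = 0 then None else Some (complex_of_real (1 / recip_section s x)))"
proof -
  have "ratmap [:1:] [:0, 1:] (sec s x) = Some (complex_of_real (recip_section s x)) \<and> \<bar>recip_section s x\<bar> < 1 \<and>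
    sec s x = (if recip_section s x = 0 then None else Some (complex_of_real (1 / recip_section s x)))"
  proof (cases "sec s x")
    case None
    then show ?thesis by (simp add: recip_section_def)
  next
    case (Some z)
    have "Some z \<in> range emb" using sec_real[OF x, of s] Some by simp
    then have "Im z = 0" by (simp add: Some_in_range_emb)
    moreover have "z \<notin> slot" by (rule sec_off_slot[OF x s Some])
    ultimately have z: "z = complex_of_real (Re z)" "\<bar>Re z\<bar> > 1" by (auto simp: slot_iff complex_eq_iff)
    have nz: "z \<noteq> 0" "Re z \<noteq> 0" using z(2) by auto
    have v: "recip_section s x = 1 / Re z" using Some by (simp add: recip_section_def)
    have "complex_of_real (1 / Re z) = 1 / z" using z(1) by (metis of_real_1 of_real_divide)
    moreover have "\<bar>1 / Re z\<bar> < 1" using z(2) by (simp add: abs_divide)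
    ultimately show ?thesis using Some nz z(1) by (simp add: v sphere_quot_def)
  qed
  then show "ratmap [:1:] [:0, 1:] (sec s x) = Some (complex_of_real (recip_section s x))" "\<bar>recip_section s x\<bar> < 1"
    "sec s x = (if recip_section s x = 0 then None else Some (complex_of_real (1 / recip_section s x)))" by blast+
qed

lemma continuous_disc_section:
  assumes s: "s \<noteq> 1"
  shows "continuous_on {-1..1} (disc_section s)"
proof -
  have "continuous_map (top_of_set {-1..1}) sphere_top (sec s)"
    using cont_sec[of s] by (simp add: continuous_map_in_subtopology)
  moreover have "continuous_map sphere_top sphere_top (ratmap [:1:] [:0, 1:])"
    by (rule continuous_map_ratmap) simp_all
  ultimately have "continuous_map (top_of_set {-1..1}) sphere_top (ratmap [:1:] [:0, 1:] \<circ> sec s)"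
    by (rule continuous_map_compose)
  then have "continuous_map (top_of_set {-1..1}) sphere_top (\<lambda>x. Some (complex_of_real (recip_section s x)))"
    by (rule continuous_map_eq) (simp add: recip_section(1)[OF _ s])
  then have "continuous_on {-1..1} (\<lambda>x. complex_of_real (recip_section s x))" by (rule continuous_on_sphere_Some)
  then have c: "continuous_on {-1..1} (recip_section s)" using continuous_on_Re by fastforce
  have "1 + sqrt (1 - (recip_section s x)\<^sup>2) \<noteq> 0" if "x \<in> {-1..1}" for x
  proof -
    have "(recip_section s x)\<^sup>2 \<le> 1" using recip_section(2)[OF that s] by (simp add: abs_square_le_1)
    then have "0 \<le> sqrt (1 - (recip_section s x)\<^sup>2)" by simp
    then show ?thesis by linarith
  qed
  then show ?thesis unfolding disc_section_def by (intro continuous_intros c) blast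
qed

lemma jk_disc_section:
  assumes x: "x \<in> {-1..1}" and s: "s \<noteq> 1"
  shows "\<bar>disc_section s x\<bar> < 1" "jk (complex_of_real (disc_section s x)) = sec s x"
proof -
  note ji = joukowski_inverse[OF recip_section(2)[OF x s], folded disc_section_def]
  show "\<bar>disc_section s x\<bar> < 1" by (rule ji(1))
  show "jk (complex_of_real (disc_section s x)) = sec s x"
  proof (cases "recip_section s x = 0")
    case True
    then show ?thesis using ji(2) recip_section(3)[OF x s] by simp
  next
    case False
    then have "complex_of_real (disc_section s x) \<noteq> 0" using ji(2) by simp
    then show ?thesis unfolding jk_nz[OF \<open>complex_of_real (disc_section s x) \<noteq> 0\<close>] joukowski_of_real ji(3)[OF False]
      using recip_section(3)[OF x s] False by simp
  qed
qed

text \<open>The Joukowski map recovers the section value, \<open>R\<close> recovers R x, and sheet 1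
  recovers x; distinctness of the three values over one point then gives s = t.\<close>

lemma disc_section_eqD:
  assumes x: "x \<in> {-1..1}" "y \<in> {-1..1}" and s: "s \<noteq> 1" "t \<noteq> 1" and eq: "disc_section s x = disc_section t y"
  shows "x = y \<and> s = t"
proof -
  have st: "sec s x = sec t y" using jk_disc_section(2)[OF x(1) s(1)] jk_disc_section(2)[OF x(2) s(2)] eq by simp
  then have Req: "R (Some (complex_of_real x)) = R (Some (complex_of_real y))"
    using R_g[OF R_in_closed_upper[OF x(1)], of s] R_g[OF R_in_closed_upper[OF x(2)], of t] by simp
  have "sec 1 x = sec 1 y" unfolding Req ..
  then have "Some (complex_of_real x) = Some (complex_of_real y)" unfolding sec1[OF x(1)] sec1[OF x(2)] .
  then have xy: "x = y" by simp
  have "s = t" by (rule injD[OF inj_sec[OF x(1)]]) (use st xy in simp)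
  with xy show ?thesis by (rule conjI)
qed

text \<open>On the slot \<open>phi\<close> holds the values of the upper bank, and the Joukowski map
  carries the lower half disc to the upper half plane. On the upper half disc the values are
  therefore taken by reflection, which matters on the circle.\<close>

definition disc_function :: "complex \<Rightarrow> complex" where
  "disc_function z = (if Im z \<le> 0 then phi (jk z) else cnj (phi (jk (cnj z)))) + complex_of_real k"

lemma phi_jk_real: "\<bar>x\<bar> \<le> 1 \<Longrightarrow> Im (phi (jk (complex_of_real x))) = 0"
proof (cases "x = 0")
  case False
  then have "complex_of_real x \<noteq> 0" by simp
  then show ?thesis unfolding jk_nz[OF \<open>complex_of_real x \<noteq> 0\<close>] joukowski_of_real
    by (intro phi_real_outside joukowski_real_abs(1) False)
qed simp

lemma continuous_disc_function: "continuous_on (cball 0 1) disc_function"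
proof -
  define L where "L = {z \<in> cball 0 1. Im z \<le> (0::real)}"
  have "continuous_map (top_of_set L) (subtopology sphere_top closed_upper) jk"
    using jk_lower by (auto simp: continuous_map_in_subtopology L_def intro: continuous_map_from_subtopology continuous_jk)
  from continuous_map_compose[OF this cont_phi]
  have c1: "continuous_on L (\<lambda>z. phi (jk z))" by (simp add: o_def)
  have c2: "continuous_on {z \<in> cball 0 1. 0 \<le> Im z} (\<lambda>z. cnj (phi (jk (cnj z))))"
    by (intro continuous_on_cnj continuous_on_compose2[OF c1] continuous_on_id) (auto simp: L_def)
  have "continuous_on (cball 0 1) (\<lambda>z. if Im z \<le> 0 then phi (jk z) else cnj (phi (jk (cnj z))))"
  proof (rule continuous_on_cases_le[OF c1[unfolded L_def] c2])
    show "continuous_on (cball 0 1) Im" by (intro continuous_intros)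
    fix z :: complex assume z: "z \<in> cball 0 1" "Im z = 0"
    then have x: "z = complex_of_real (Re z)" "\<bar>Re z\<bar> \<le> 1" by (auto simp: complex_eq_iff cmod_eq_Re)
    have cz: "cnj z = z" using z(2) by (simp add: complex_eq_iff)
    have "Im (phi (jk z)) = 0" using phi_jk_real[OF x(2)] x(1) by simp
    then show "phi (jk z) = cnj (phi (jk (cnj z)))" unfolding cz by (simp add: complex_eq_iff)
  qed
  then show ?thesis unfolding disc_function_def by (intro continuous_intros)
qed

text \<open>The centre corresponds to infinity; the singularity there is removable because the
  function is continuous.\<close>

lemma holomorphic_disc_function: "disc_function holomorphic_on ball 0 1"
proof (rule no_isolated_singularity[where K = "{0}"])
  show "continuous_on (ball 0 1) disc_function" by (rule continuous_on_subset[OF continuous_disc_function]) auto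
  have im: "(\<lambda>z. (1 + z\<^sup>2) / (2 * z)) ` (ball 0 1 - {0}) \<subseteq> - slot"
  proof (rule image_subsetI)
    fix z :: complex assume "z \<in> ball 0 1 - {0}"
    then show "(1 + z\<^sup>2) / (2 * z) \<in> - slot" unfolding Compl_iff by (intro joukowski_off_slot) auto
  qed
  have "(\<lambda>z::complex. (1 + z\<^sup>2) / (2 * z)) holomorphic_on (ball 0 1 - {0})"
    by (intro holomorphic_intros) auto
  then have "(cauchy_integral u \<circ> (\<lambda>z. (1 + z\<^sup>2) / (2 * z))) holomorphic_on (ball 0 1 - {0})"
    by (rule holomorphic_on_compose_gen[OF _ holomorphic_cauchy_integral[OF cont_u] im])
  then have "(\<lambda>z. cauchy_integral u ((1 + z\<^sup>2) / (2 * z)) + complex_of_real k) holomorphic_on (ball 0 1 - {0})"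
    by (intro holomorphic_intros) (simp add: o_def)
  then show "disc_function holomorphic_on (ball 0 1 - {0})"
  proof (rule holomorphic_transform)
    fix z :: complex assume z: "z \<in> ball 0 1 - {0}"
    then have nz: "z \<noteq> 0" "cnj z \<noteq> 0" by auto
    have 1: "phi (jk z) = cauchy_integral u ((1 + z\<^sup>2) / (2 * z))"
      unfolding jk_nz[OF nz(1)] by (intro phi_off joukowski_off_slot) (use z in auto)
    have 2: "phi (jk (cnj z)) = cauchy_integral u ((1 + (cnj z)\<^sup>2) / (2 * cnj z))"
      unfolding jk_nz[OF nz(2)] by (intro phi_off joukowski_off_slot) (use z in auto)
    have "(1 + (cnj z)\<^sup>2) / (2 * cnj z) = cnj ((1 + z\<^sup>2) / (2 * z))" by simp
    then show "cauchy_integral u ((1 + z\<^sup>2) / (2 * z)) + complex_of_real k = disc_function z"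
      unfolding disc_function_def 1 2 by (simp only: cauchy_integral_cnj complex_cnj_cnj if_cancel)
  qed
qed auto

lemma disc_function_section:
  assumes "x \<in> {-1..1}" "s \<noteq> 1"
  shows "disc_function (complex_of_real (disc_section s x)) = phi (sec s x) + complex_of_real k"
  unfolding disc_function_def using jk_disc_section(2)[OF assms] by simp

lemma disc_function_circle:
  assumes z: "cmod z = 1"
  shows "Re z \<in> {-1..1}" "Re (disc_function z) = Re (boundary_value (Re z)) + k" "cmod (disc_function z) = cmod (boundary_value (Re z) + complex_of_real k)"
proof -
  show x: "Re z \<in> {-1..1}" using abs_Re_le_cmod[of z] z by (simp add: abs_le_iff)
  have "jk z = Some (complex_of_real (Re z))" "jk (cnj z) = Some (complex_of_real (Re z))"
    using jk_circle[of z] jk_circle[of "cnj z"] z by simp_all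
  then have "disc_function z = (if Im z \<le> 0 then boundary_value (Re z) else cnj (boundary_value (Re z))) + complex_of_real k"
    unfolding disc_function_def using phi_on[OF x] by simp
  then show "Re (disc_function z) = Re (boundary_value (Re z)) + k" "cmod (disc_function z) = cmod (boundary_value (Re z) + complex_of_real k)"
    by (simp_all add: cmod_def)
qed

text \<open>Antisymmetry enters only as J \<le> 0, which is the inequality for the form in
  \<open>disc_vanishing\<close>; the jump relation is the other boundary condition there.\<close>

lemma disc_case:
  assumes anti: "antisymmetric lam u" and d: "1 < d" "d \<le> 2"
  shows False
proof (rule sec_not_zero)
  have j: "j0 \<le> 0" by (rule gap_consequences(1)[OF anti None_not_slots]) (use d in simp_all)
  have ne: "(2::3) \<noteq> 1" "(3::3) \<noteq> 1" "(2::3) \<noteq> 3" by simp_all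
  have zero: "disc_function z = 0" if "z \<in> ball 0 1" for z
  proof (rule disc_vanishing[OF holomorphic_disc_function continuous_disc_function _ _ _ _ _ _ _ _ _ _ d that, where \<alpha> = "disc_section 2" and \<beta> = "disc_section 3"])
    show "Im (disc_function (complex_of_real x)) = 0" if "\<bar>x\<bar> < 1" for x
      using phi_jk_real[of x] that by (simp add: disc_function_def)
    show "continuous_on {-1..1} (disc_section 2)" "continuous_on {-1..1} (disc_section 3)" by (intro continuous_disc_section ne)+
    show "inj_on (disc_section 2) {-1..1}"
      by (rule inj_onI) (rule conjunct1[OF disc_section_eqD[OF _ _ ne(1) ne(1)]])
    show "inj_on (disc_section 3) {-1..1}"
      by (rule inj_onI) (rule conjunct1[OF disc_section_eqD[OF _ _ ne(2) ne(2)]])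
    show "\<bar>disc_section 2 x\<bar> < 1" "\<bar>disc_section 3 x\<bar> < 1" if "x \<in> {-1..1}" for x by (intro jk_disc_section(1) that ne)+
    show "disc_section 2 ` {-1..1} \<inter> disc_section 3 ` {-1..1} = {}"
    proof (rule ccontr)
      assume "disc_section 2 ` {-1..1} \<inter> disc_section 3 ` {-1..1} \<noteq> {}"
      then obtain x y where xy: "x \<in> {-1..1}" "y \<in> {-1..1}" "disc_section 2 x = disc_section 3 y" by blast
      from disc_section_eqD[OF xy(1,2) ne(1,2) xy(3)] ne(3) show False by blast
    qed
    fix z :: complex assume z: "cmod z = 1"
    note x = disc_function_circle(1)[OF z]
    have A: "Re (disc_function (complex_of_real (disc_section 2 (Re z)))) = Re (phi (sec 2 (Re z))) + k"
      using disc_function_section[OF x ne(1)] by simp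
    have B: "Re (disc_function (complex_of_real (disc_section 3 (Re z)))) = Re (phi (sec 3 (Re z))) + k"
      using disc_function_section[OF x ne(2)] by simp
    show "2 * Re (disc_function z) = d * (Re (disc_function (complex_of_real (disc_section 2 (Re z)))) + Re (disc_function (complex_of_real (disc_section 3 (Re z)))))"
      unfolding A B disc_function_circle(2)[OF z] by (rule slot_relation[OF x])
    show "(Re (disc_function (complex_of_real (disc_section 2 (Re z)))))\<^sup>2 + (Re (disc_function (complex_of_real (disc_section 3 (Re z)))))\<^sup>2
         - d * Re (disc_function (complex_of_real (disc_section 2 (Re z)))) * Re (disc_function (complex_of_real (disc_section 3 (Re z)))) - (cmod (disc_function z))\<^sup>2 \<le> 0"
      unfolding A B disc_function_circle(3)[OF z] using slot_quadratic[OF x] j by simp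
  qed
  fix x :: real assume x: "x \<in> {-1..1}"
  have "complex_of_real (disc_section 2 x) \<in> ball 0 1" using jk_disc_section(1)[OF x ne(1)] by simp
  then have "phi (sec 2 x) + complex_of_real k = 0" using zero disc_function_section[OF x ne(1)] by simp
  then show "Re (phi (sec 2 x)) + k = 0" by (simp add: complex_eq_iff)
qed

theorem antisymmetric_spectrum:
  assumes anti: "antisymmetric lam u"
  shows "lam \<in> {1<..<2}"
proof -
  consider "d < -2" | "d = -2" | "-2 < d" "d < 1" | "d = 1" | "1 < d" "d \<le> 2" | "2 < d" by linarith
  then have d2: "2 < d"
    using negative_case[OF anti] degenerate_case middle_case[OF anti] d_not_1 disc_case[OF anti] by cases auto
  have "lam - 1 > 0"
  proof (rule ccontr)
    assume "\<not> lam - 1 > 0"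
    then have "d \<le> 0" by (simp add: d_def divide_nonneg_nonpos)
    then show False using d2 by simp
  qed
  moreover have "2 * (lam - 1) < 2" using d2 \<open>lam - 1 > 0\<close> by (simp add: d_def pos_less_divide_eq)
  ultimately show ?thesis by simp
qed

end

theorem mainTheorem2:
  fixes P Q :: "real poly" and a b c :: "nat \<Rightarrow> real option"
    and lam :: real and u :: "real \<Rightarrow> real"
  assumes "cubic_change_of_variable.standing_assumptions P Q a b c"
    and "cubic_change_of_variable.eigenfunction P Q lam u"
    and "lam \<noteq> 1 \<Longrightarrow> lam \<noteq> 3 \<Longrightarrow> cubic_change_of_variable.antisymmetric P Q a b c lam u"
  shows "lam \<in> {1..<2} \<union> {3}"
proof (cases "lam = 1 \<or> lam = 3")
  case False
  interpret cubic_setting P Q a b c by (rule cubic_setting.intro) (rule assms(1))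
  obtain r g where rg: "cubic_ext P Q a b c r g" "good_labelling 1 2 3 g"
    using ex_labelled by blast
  have "cubic_eigen P Q a b c r g lam u"
    using rg assms(2) False
    by (simp add: cubic_eigen_def cubic_eigen_axioms_def cubic_labelled_def cubic_labelled_axioms_def)
  then interpret E: cubic_eigen P Q a b c r g lam u .
  have "lam \<in> {1<..<2}" using assms(3) False by (intro E.antisymmetric_spectrum) blast
  then show ?thesis by auto
qed auto

end
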